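(* For all $\mu_1,\mu_2\in\overline{\mathcal M}$, $\Xi\in C(\mathbb T^n)$, $P\in\mathbb R^n$ and $T>0$, $$H_{\Xi,T}(\mu_1,\mu_2,P)=\frac{|P|^2}{2}-D^T_P(\mu_1,\mu_2,\Xi).$$ In particular, for every $\mu\in\overline{\mathcal M}$, $H_{\Xi,T}(\mu,\mu,P)=\frac{|P|^2}{2}-D^T_P(\mu,\mu,\Xi)$.
   Context: $\mathbb T^n=\mathbb R^n/\mathbb Z^n$ is the flat torus and $\overline{\mathcal M}$ is the set of Borel probability measures on $\mathbb T^n$ with the weak-* topology. For $T>0$, $\overline{\mathcal M}_T(\mu_1,\mu_2)$ is the set of weak-* continuous curves $\hat\mu=(\mu_{(t)})_{t\in[0,T]}$ in $\overline{\mathcal M}$ with $\mu_{(0)}=\mu_1$, $\mu_{(T)}=\mu_2$. For such a curve and $P\in\mathbb R^n$, $$F(\hat\mu,P,T)=\frac1T\inf_{\phi}\int_0^T\!\!\int_{\mathbb T^n}\Big[\frac{\partial\phi}{\partial t}+\frac12|\nabla_x\phi+P|^2\Big]d\mu_{(t)}\,dt\in[-\infty,\infty),$$ the infimum being over $\phi\in C^1_0(\mathbb T^n\times(0,T))$ ($C^1$ functions compactly supported in $\mathbb T^n\times(0,T)$), and $$H_{\Xi,T}(\mu_1,\mu_2,P)=\sup_{\hat\mu\in\overline{\mathcal M}_T(\mu_1,\mu_2)}\Big[\frac1T\int_0^T\!\!\int_{\mathbb T^n}\Xi\,d\mu_{(t)}\,dt+F(\hat\mu,P,T)\Big].$$ For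 $x,y\in\mathbb T^n$, $$A^\Xi_P(y,x,T)=\inf\Big\{\frac1T\int_0^T\Big(\frac{|\dot x(s)-P|^2}{2}-\Xi(x(s))\Big)ds\ :\ x(0)=y,\ x(T)=x\Big\},$$ the infimum being over (absolutely continuous) curves $x(\cdot):[0,T]\to\mathbb T^n$, and $$D^T_P(\mu_1,\mu_2,\Xi)=\min_\sigma\int_{\mathbb T^n\times\mathbb T^n}A^\Xi_P(x,y,T)\,d\sigma(x,y),$$ the minimum being over Borel probability measures $\sigma$ on $\mathbb T^n\times\mathbb T^n$ with first marginal $\mu_1$ and second marginal $\mu_2$. *)

theory Defs
  imports "HOL-Probability.Probability"
begin

section \<open>The flat torus\<close>

quotient_type 'n torus = "real ^ ('n::finite)" / "\<lambda>x y. \<forall>i. x $ i - y $ i \<in> \<int>"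
  morphisms rep_torus proj_torus
proof (rule equivpI)
  show "reflp (\<lambda>(x::real^'n) y. \<forall>i. x $ i - y $ i \<in> \<int>)"
    by (simp add: reflp_def)
  show "symp (\<lambda>(x::real^'n) y. \<forall>i. x $ i - y $ i \<in> \<int>)"
    unfolding symp_def by (metis Ints_minus minus_diff_eq)
  show "transp (\<lambda>(x::real^'n) y. \<forall>i. x $ i - y $ i \<in> \<int>)"
  proof (rule transpI, rule allI)
    fix x y z :: "real^'n" and i
    assume "\<forall>i. x $ i - y $ i \<in> \<int>" "\<forall>i. y $ i - z $ i \<in> \<int>"
    then have "(x $ i - y $ i) + (y $ i - z $ i) \<in> \<int>" by (intro Ints_add) auto
    then show "x $ i - z $ i \<in> \<int>" by simp
  qed
qed

text \<open>The quotient topology.\<close>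

instantiation torus :: (finite) topological_space
begin

definition open_torus :: "'a torus set \<Rightarrow> bool" where
  "open_torus U \<longleftrightarrow> open (proj_torus -` U)"

instance
proof
  show "open (UNIV :: 'a torus set)"
    by (simp add: open_torus_def)
  show "open (S \<inter> T)" if "open S" "open T" for S T :: "'a torus set"
    using that by (simp add: open_torus_def open_Int)
  show "open (\<Union>K)" if "\<forall>S\<in>K. open S" for K :: "'a torus set set"
    using that by (auto simp: open_torus_def vimage_Union)
qed

end

instantiation torus :: (finite) ab_group_add
begin

lift_definition zero_torus :: "'a torus" is 0 .

lift_definition plus_torus :: "'a torus \<Rightarrow> 'a torus \<Rightarrow> 'a torus" is "(+)"
  by (metis (no_types, lifting) Ints_add add_diff_add vector_add_component)

lift_definition uminus_torus :: "'a torus \<Rightarrow> 'a torus" is uminus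
  by (metis (no_types, lifting) Ints_minus minus_diff_minus vector_uminus_component)

definition minus_torus :: "'a torus \<Rightarrow> 'a torus \<Rightarrow> 'a torus" where
  "minus_torus p q = p + - q"

instance
proof
  fix a b c :: "'a torus"
  show "a + b + c = a + (b + c)" by transfer (simp add: algebra_simps)
  show "a + b = b + a" by transfer (simp add: algebra_simps)
  show "0 + a = a" by transfer simp
  show "- a + a = 0" by transfer simp
  show "a - b = a + - b" by (rule minus_torus_def)
qed

end


section \<open>Probability measures and weak-* continuous curves\<close>

definition torus_probs :: "'n::finite torus measure set" where
  "torus_probs = {\<mu>. sets \<mu> = sets borel \<and> prob_space \<mu>}"

definition weak_star :: "'n::finite torus measure topology" where
  "weak_star = topology_generated_by
     {{\<mu> \<in> torus_probs. (\<integral>q. f q \<partial>\<mu>) \<in> U} | (f :: 'n torus \<Rightarrow> real) U.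
        continuous_on UNIV f \<and> open U}"

text \<open>Only the values of a curve on \<open>{0..T}\<close> matter below.\<close>

definition measure_curves ::
  "real \<Rightarrow> 'n::finite torus measure \<Rightarrow> 'n torus measure \<Rightarrow> (real \<Rightarrow> 'n torus measure) set" where
  "measure_curves T \<mu>1 \<mu>2 =
     {\<mu>. continuous_map (top_of_set {0..T}) weak_star \<mu> \<and> \<mu> 0 = \<mu>1 \<and> \<mu> T = \<mu>2}"


section \<open>The functionals F and H\<close>

text \<open>A compactly supported function on the open cylinder is represented by its extension by
  zero to all times; being \<open>C\<^sup>1\<close> is expressed on the universal cover.\<close>

definition test_functions :: "real \<Rightarrow> ('n::finite torus \<times> real \<Rightarrow> real) set" where
  "test_functions T = {\<phi>.
     (\<exists>D :: (real ^ 'n) \<times> real \<Rightarrow> ((real ^ 'n) \<times> real) \<Rightarrow>\<^sub>L real.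
        (\<forall>z. ((\<lambda>(x, t). \<phi> (proj_torus x, t)) has_derivative blinfun_apply (D z)) (at z)) \<and>
        continuous_on UNIV D) \<and>
     (\<exists>K. compact K \<and> K \<subseteq> UNIV \<times> {0<..<T} \<and> (\<forall>z. z \<notin> K \<longrightarrow> \<phi> z = 0))}"

definition time_deriv :: "('n::finite torus \<times> real \<Rightarrow> real) \<Rightarrow> 'n torus \<Rightarrow> real \<Rightarrow> real" where
  "time_deriv \<phi> q t = deriv (\<lambda>\<tau>. \<phi> (q, \<tau>)) t"

definition space_grad :: "('n::finite torus \<times> real \<Rightarrow> real) \<Rightarrow> 'n torus \<Rightarrow> real \<Rightarrow> real ^ 'n" where
  "space_grad \<phi> q t = (\<chi> i. deriv (\<lambda>h. \<phi> (q + proj_torus (h *\<^sub>R axis i 1), t)) 0)"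

definition F_functional :: "(real \<Rightarrow> 'n::finite torus measure) \<Rightarrow> real ^ 'n \<Rightarrow> real \<Rightarrow> ereal" where
  "F_functional \<mu> P T = ereal (1 / T) *
     (INF \<phi> \<in> test_functions T.
        ereal (LINT t:{0..T}|lborel.
          (\<integral>q. time_deriv \<phi> q t + (norm (space_grad \<phi> q t + P))\<^sup>2 / 2 \<partial>\<mu> t)))"

definition H_functional ::
  "('n::finite torus \<Rightarrow> real) \<Rightarrow> real \<Rightarrow> 'n torus measure \<Rightarrow> 'n torus measure \<Rightarrow> real ^ 'n \<Rightarrow> ereal"
  where
  "H_functional \<Xi> T \<mu>1 \<mu>2 P =
     (SUP \<mu> \<in> measure_curves T \<mu>1 \<mu>2.
        ereal (1 / T * (LINT t:{0..T}|lborel. (\<integral>q. \<Xi> q \<partial>\<mu> t))) + F_functional \<mu> P T)"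


section \<open>The action and the transport cost\<close>

text \<open>The Lebesgue integral of an extended-real function, as the difference of the integrals of
  its positive and negative parts. Unlike for the Bochner integral, the value is \<open>\<infinity>\<close> (not \<open>0\<close>)
  when only the positive part has infinite integral; this occurs for absolutely continuous
  curves whose velocity is not square integrable.\<close>

definition ext_integral :: "'a measure \<Rightarrow> ('a \<Rightarrow> ereal) \<Rightarrow> ereal" where
  "ext_integral M f =
     enn2ereal (\<integral>\<^sup>+ x. e2ennreal (f x) \<partial>M) - enn2ereal (\<integral>\<^sup>+ x. e2ennreal (- f x) \<partial>M)"

definition abs_continuous_on :: "real \<Rightarrow> real \<Rightarrow> (real \<Rightarrow> 'a::metric_space) \<Rightarrow> bool" where
  "abs_continuous_on a b g \<longleftrightarrow>
     (\<forall>\<epsilon>>0. \<exists>\<delta>>0. \<forall>(m::nat) u v.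
        (\<forall>i<m. a \<le> u i \<and> u i \<le> v i \<and> v i \<le> b) \<longrightarrow>
        disjoint_family_on (\<lambda>i. {u i<..<v i}) {..<m} \<longrightarrow>
        (\<Sum>i<m. v i - u i) < \<delta> \<longrightarrow>
        (\<Sum>i<m. dist (g (u i)) (g (v i))) < \<epsilon>)"

text \<open>An absolutely continuous curve on the torus, together with an absolutely continuous lift
  to the universal cover; the velocity of the curve is the derivative of the lift (it exists
  almost everywhere and does not depend on the lift).\<close>

definition ac_curve_lift :: "real \<Rightarrow> (real \<Rightarrow> 'n::finite torus) \<Rightarrow> (real \<Rightarrow> real ^ 'n) \<Rightarrow> bool" where
  "ac_curve_lift T x \<gamma> \<longleftrightarrow>
     abs_continuous_on 0 T \<gamma> \<and> (\<forall>s\<in>{0..T}. x s = proj_torus (\<gamma> s))"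

definition lagrangian_action ::
  "('n::finite torus \<Rightarrow> real) \<Rightarrow> real ^ 'n \<Rightarrow> real \<Rightarrow> (real \<Rightarrow> 'n torus) \<Rightarrow> (real \<Rightarrow> real ^ 'n) \<Rightarrow> ereal"
  where
  "lagrangian_action \<Xi> P T x \<gamma> = ereal (1 / T) *
     ext_integral (restrict_space lborel {0..T})
       (\<lambda>s. ereal ((norm (vector_derivative \<gamma> (at s within {0..T}) - P))\<^sup>2 / 2 - \<Xi> (x s)))"

definition A_cost ::
  "('n::finite torus \<Rightarrow> real) \<Rightarrow> real ^ 'n \<Rightarrow> 'n torus \<Rightarrow> 'n torus \<Rightarrow> real \<Rightarrow> ereal" where
  "A_cost \<Xi> P y z T =
     Inf {lagrangian_action \<Xi> P T x \<gamma> | x \<gamma>. ac_curve_lift T x \<gamma> \<and> x 0 = y \<and> x T = z}"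

definition couplings ::
  "'n::finite torus measure \<Rightarrow> 'n torus measure \<Rightarrow> ('n torus \<times> 'n torus) measure set" where
  "couplings \<mu>1 \<mu>2 =
     {\<sigma>. sets \<sigma> = sets borel \<and> prob_space \<sigma> \<and> distr \<sigma> borel fst = \<mu>1 \<and> distr \<sigma> borel snd = \<mu>2}"

text \<open>\<open>LEAST\<close> denotes a minimum: it is specified only if the infimum over couplings is
  attained, so any statement about the value of \<open>D_cost\<close> includes attainment.\<close>

definition D_cost ::
  "real \<Rightarrow> real ^ 'n::finite \<Rightarrow> 'n torus measure \<Rightarrow> 'n torus measure \<Rightarrow> ('n torus \<Rightarrow> real) \<Rightarrow> ereal"
  where
  "D_cost T P \<mu>1 \<mu>2 \<Xi> =
     (LEAST c. \<exists>\<sigma> \<in> couplings \<mu>1 \<mu>2. c = ext_integral \<sigma> (\<lambda>(x, y). A_cost \<Xi> P x y T))"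

end

theory Submission
  imports Defs
begin

text \<open>For a minimal coupling \<open>\<sigma>\<close>, transporting mass along measurably chosen near-optimal paths
  gives a curve of measures; along each path the chain rule and
  \<open>w \<bullet> (a - w) + |w|\<^sup>2 / 2 \<le> |a|\<^sup>2 / 2\<close> bound the functional in \<open>F\<close> from below by the kinetic
  part of the action, uniformly in the test function. This yields \<open>H \<ge> |P|\<^sup>2 / 2 - D\<close>.

  For the converse, Kantorovich duality provides potentials with \<open>U2 z - U1 y \<le> A y z\<close>. The value
  function of the control problem with initial cost \<open>T * U1\<close> is a subsolution of the Hamilton--Jacobi
  equation and lies above \<open>T * U2\<close> at time \<open>T\<close>. Mollified and cut off near the two endpoints it
  is an admissible test function, and inserting it into \<open>F\<close> bounds \<open>H\<close> by the dual value. Only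
  one-sided bounds at the endpoints are needed, and these follow from the constant curves.\<close>

section \<open>The torus as a compact metric space\<close>

text \<open>The term |P|^2 / 2 is a Legendre shift: the transform of v |-> |v - P|^2 / 2 is p |-> |p
  + P|^2 / 2 - |P|^2 / 2, and F contains only the first summand. Velocities in the action are
  derivatives of absolutely continuous lifts, so the classical theory of such functions
  (differentiability almost everywhere, fundamental theorem) is developed; it serves to replace an
  arbitrary curve by a polygon, and everything afterwards works with curves of bounded speed.
  \<open>D_cost\<close> is a \<open>LEAST\<close>, so an optimal coupling has to be produced: it is
  a weak limit of optimal finite plans, and their dual potentials certify its optimality. The
  obstacle in the upper bound is that the value function is merely continuous, while a test function
  is C^1 and vanishes near times 0 and T. Mollification costs an error governed by the modulus of
  continuity of \<Xi>. A cutoff \<eta> adds \<eta>' times the value function; \<eta>' consists of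
  two ramps of unit mass close to the endpoints, and this is how the integrals of U1 and U2 against
  the two end measures arise.\<close>

lemma proj_torus_eq_iff: "proj_torus x = proj_torus y \<longleftrightarrow> (\<forall>i. x $ i - y $ i \<in> \<int>)"
  by (rule torus.abs_eq_iff)

lemma proj_torus_add: "proj_torus (x + y) = proj_torus x + proj_torus y"
  by (simp add: plus_torus.abs_eq)

lemma proj_rep_torus [simp]: "proj_torus (rep_torus q) = q"
  by (simp add: Quotient3_abs_rep[OF Quotient3_torus])

lemma cis_2pi_eq_iff: "cis (2 * pi * a) = cis (2 * pi * b) \<longleftrightarrow> a - b \<in> \<int>"
proof
  assume "cis (2 * pi * a) = cis (2 * pi * b)"
  then have "exp (\<i> * complex_of_real (2 * pi * a)) = exp (\<i> * complex_of_real (2 * pi * b))"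
    by (simp only: cis_conv_exp)
  then obtain n :: int where "\<i> * complex_of_real (2 * pi * a) = \<i> * complex_of_real (2 * pi * b) + of_int (2 * n) * pi * \<i>"
    by (auto simp: exp_eq)
  then have "\<i> * complex_of_real (2 * pi * a) = \<i> * complex_of_real (2 * pi * b + 2 * pi * n)"
    by (simp add: algebra_simps)
  then have "2 * pi * a = 2 * pi * b + 2 * pi * n"
    using complex_i_not_zero mult_cancel_left of_real_eq_iff by blast
  then have "2 * pi * (a - b) = 2 * pi * n" by (simp add: algebra_simps)
  then have "a - b = n" by simp
  then show "a - b \<in> \<int>" by simp
next
  assume "a - b \<in> \<int>"
  then obtain n :: int where "a = b + n" by (auto elim!: Ints_cases simp: algebra_simps)
  then have "cis (2 * pi * a) = cis (2 * pi * b) * cis (2 * pi * n)"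
    by (simp add: cis_mult algebra_simps)
  then show "cis (2 * pi * a) = cis (2 * pi * b)" by (simp add: cis_multiple_2pi)
qed

text \<open>The torus as a product of circles in C^n. The chordal distance along this map will be
  the metric: separation and the triangle inequality are inherited, and only the agreement with the
  quotient topology has to be checked.\<close>

lift_definition torus_emb :: "'n::finite torus \<Rightarrow> complex ^ 'n" is "\<lambda>x. \<chi> i. cis (2 * pi * x $ i)"
  by (simp add: vec_eq_iff cis_2pi_eq_iff)

lemma torus_emb_proj: "torus_emb (proj_torus x) = (\<chi> i. cis (2 * pi * x $ i))"
  by (rule torus_emb.abs_eq)

lemma inj_torus_emb: "inj torus_emb"
  unfolding inj_def by transfer (simp add: vec_eq_iff cis_2pi_eq_iff)

lemma continuous_on_emb_proj: "continuous_on S (\<lambda>x :: real ^ 'n::finite. torus_emb (proj_torus x))"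
  unfolding torus_emb_proj by (intro continuous_intros)

lemma continuous_on_proj_torus: "continuous_on S proj_torus"
  by (rule continuous_on_subset[of UNIV])
    (auto simp: continuous_on_open_vimage open_torus_def)

lemma open_torus_iff: "open U \<longleftrightarrow> open (proj_torus -` U)"
  by (rule open_torus_def)

lemma closed_torus_iff: "closed U \<longleftrightarrow> closed (proj_torus -` U)"
  by (simp add: closed_def open_torus_iff vimage_Compl)

lemma proj_torus_frac: "proj_torus (\<chi> i. frac (x $ i)) = proj_torus x"
  by (simp add: proj_torus_eq_iff frac_def)

lemma proj_torus_unit_cube: "proj_torus ` cbox 0 1 = UNIV"
proof -
  have "q \<in> proj_torus ` cbox 0 1" for q :: "'a torus"
  proof
    show "q = proj_torus (\<chi> i. frac (rep_torus q $ i))" by (simp add: proj_torus_frac)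
    show "(\<chi> i. frac (rep_torus q $ i)) \<in> cbox 0 1"
      by (simp add: mem_box_cart less_imp_le[OF frac_lt_1])
  qed
  then show ?thesis by auto
qed

lemma compact_torus: "compact (UNIV :: 'n::finite torus set)"
  unfolding proj_torus_unit_cube[symmetric]
  by (intro compact_continuous_image continuous_on_proj_torus compact_cbox)

text \<open>The part of the unit cube lying over the complement of an open U has a compact image,
  which therefore keeps a positive distance from \<open>torus_emb x\<close>. The converse is
  continuity of the lifted embedding. Together they show that the chordal metric induces the
  quotient topology.\<close>

lemma open_torus_emb:
  fixes U :: "'n::finite torus set"
  shows "open U \<longleftrightarrow> (\<forall>x\<in>U. \<exists>e>0. \<forall>y. dist (torus_emb x) (torus_emb y) < e \<longrightarrow> y \<in> U)"
proof (intro iffI ballI)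
  fix x assume U: "open U" and x: "x \<in> U"
  let ?K = "cbox 0 1 \<inter> proj_torus -` (- U)"
  have "compact ((\<lambda>x. torus_emb (proj_torus x)) ` ?K)"
    using U by (intro compact_continuous_image continuous_on_emb_proj compact_Int_closed compact_cbox)
      (simp add: closed_torus_iff[symmetric] closed_Compl)
  moreover have "torus_emb x \<notin> (\<lambda>x. torus_emb (proj_torus x)) ` ?K"
    using x injD[OF inj_torus_emb] by (auto simp: image_iff)
  ultimately obtain e where e: "e > 0" "\<forall>y\<in>(\<lambda>x. torus_emb (proj_torus x)) ` ?K. e \<le> dist (torus_emb x) y"
    using separate_point_closed compact_imp_closed by metis
  have "y \<in> U" if "dist (torus_emb x) (torus_emb y) < e" for y
  proof (rule ccontr)
    assume "y \<notin> U"
    moreover obtain z where "z \<in> cbox 0 1" "y = proj_torus z" using proj_torus_unit_cube by blast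
    ultimately have "torus_emb y \<in> (\<lambda>x. torus_emb (proj_torus x)) ` ?K" by auto
    then show False using e that by force
  qed
  then show "\<exists>e>0. \<forall>y. dist (torus_emb x) (torus_emb y) < e \<longrightarrow> y \<in> U" using e by blast
next
  assume *: "\<forall>x\<in>U. \<exists>e>0. \<forall>y. dist (torus_emb x) (torus_emb y) < e \<longrightarrow> y \<in> U"
  show "open U" unfolding open_torus_iff
  proof (rule Topological_Spaces.openI)
    fix x assume "x \<in> proj_torus -` U"
    then obtain e where e: "e > 0" "\<And>y. dist (torus_emb (proj_torus x)) (torus_emb y) < e \<Longrightarrow> y \<in> U"
      using * by auto
    let ?V = "(\<lambda>y. torus_emb (proj_torus y)) -` ball (torus_emb (proj_torus x)) e"
    have "open ?V" by (intro open_vimage open_ball continuous_on_emb_proj)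
    moreover have "x \<in> ?V" "?V \<subseteq> proj_torus -` U" using e by auto
    ultimately show "\<exists>T. open T \<and> x \<in> T \<and> T \<subseteq> proj_torus -` U" by blast
  qed
qed

instantiation torus :: (finite) metric_space
begin

definition dist_torus :: "'a torus \<Rightarrow> 'a torus \<Rightarrow> real" where
  "dist_torus x y = dist (torus_emb x) (torus_emb y)"

definition uniformity_torus :: "('a torus \<times> 'a torus) filter" where
  "uniformity_torus = (INF e\<in>{0<..}. principal {(x, y). dist x y < e})"

instance
proof
  show uni: "uniformity = (INF e\<in>{0<..}. principal {(x, y :: 'a torus). dist x y < e})"
    by (rule uniformity_torus_def)
  show "dist x y = 0 \<longleftrightarrow> x = y" for x y :: "'a torus"
    using injD[OF inj_torus_emb] by (auto simp: dist_torus_def)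
  show "dist x y \<le> dist x z + dist y z" for x y z :: "'a torus"
    by (simp add: dist_torus_def dist_triangle2)
  show "open U \<longleftrightarrow> (\<forall>x\<in>U. \<forall>\<^sub>F (x', y) in uniformity. x' = x \<longrightarrow> y \<in> U)" for U :: "'a torus set"
  proof -
    have *: "eventually Q uniformity \<longleftrightarrow> (\<exists>e>0. \<forall>x y. dist x y < e \<longrightarrow> Q (x, y))"
      for Q :: "'a torus \<times> 'a torus \<Rightarrow> bool"
      unfolding uni
    proof (subst eventually_INF_base, goal_cases)
      case (2 a b)
      then show ?case by (intro bexI[of _ "min a b"]) auto
    qed (auto simp: subset_eq eventually_principal)
    show ?thesis unfolding open_torus_emb * by (simp add: dist_torus_def) 
  qed
qed

end

lemma dist_cis_le: "dist (cis a) (cis b) \<le> \<bar>a - b\<bar>"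
proof -
  have "norm (cis t - 1) \<le> \<bar>t\<bar>" for t :: real
    using iexp_approx1[of t 0] by (simp add: cis_conv_exp)
  then have "norm (cis (a - b) - 1) \<le> \<bar>a - b\<bar>" by blast
  moreover have "cis a - cis b = cis b * (cis (a - b) - 1)" by (simp add: cis_mult algebra_simps)
  ultimately show ?thesis by (simp add: dist_norm norm_mult)
qed

lemma dist_proj_torus_le: "dist (proj_torus x) (proj_torus y) \<le> 2 * pi * dist x y"
proof -
  have "dist (torus_emb (proj_torus x)) (torus_emb (proj_torus y)) = L2_set (\<lambda>i. dist (cis (2 * pi * x $ i)) (cis (2 * pi * y $ i))) UNIV"
    by (simp add: torus_emb_proj dist_vec_def)
  also have "\<dots> \<le> L2_set (\<lambda>i. 2 * pi * dist (x $ i) (y $ i)) UNIV"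
  proof (rule L2_set_mono)
    show "dist (cis (2 * pi * x $ i)) (cis (2 * pi * y $ i)) \<le> 2 * pi * dist (x $ i) (y $ i)" for i
      using dist_cis_le[of "2 * pi * x $ i" "2 * pi * y $ i"]
      by (simp add: dist_real_def abs_mult flip: right_diff_distrib)
  qed simp
  also have "\<dots> = 2 * pi * dist x y" by (simp add: dist_vec_def L2_set_right_distrib)
  finally show ?thesis by (simp add: dist_torus_def)
qed

text \<open>\<open>rep_torus\<close> is an arbitrary choice of representative. Passing to fractional
  parts makes the section canonical, and this is what renders it Borel.\<close>

definition torus_sec :: "'n::finite torus \<Rightarrow> real ^ 'n" where
  "torus_sec q = (\<chi> i. frac (rep_torus q $ i))"

lemma proj_torus_sec [simp]: "proj_torus (torus_sec q) = q"
  by (simp add: torus_sec_def proj_torus_frac)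

lemma torus_sec_bounds: "0 \<le> torus_sec q $ i" "torus_sec q $ i < 1"
  by (simp_all add: torus_sec_def frac_lt_1)

lemma torus_sec_proj: "torus_sec (proj_torus x) = (\<chi> i. frac (x $ i))"
proof -
  have "rep_torus (proj_torus x) $ i - x $ i \<in> \<int>" for i
    using proj_torus_eq_iff[of "rep_torus (proj_torus x)" x] by simp
  then have "frac (rep_torus (proj_torus x) $ i) = frac (x $ i)" for i
    by (metis frac_add_int_left diff_add_cancel)
  then show ?thesis by (simp add: torus_sec_def)
qed

text \<open>For 0 \<le> c < 1 a sublevel set of a coordinate is the projection of a compact slab of
  the unit cube, hence closed; with c < 1 the slab avoids the face at 1, where \<open>frac\<close>
  jumps. For the other c the set is empty or everything.\<close>

lemma torus_sec_measurable [measurable]: "torus_sec \<in> borel_measurable borel"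
proof (rule borel_measurable_euclidean_space[THEN iffD2, rule_format])
  fix b :: "real ^ 'a" assume "b \<in> Basis"
  then obtain i where b: "b = axis i 1" by (auto simp: Basis_vec_def)
  have "closed {q. torus_sec q $ i \<le> c}" if "c < 1" "0 \<le> c" for c
  proof -
    have "{q. torus_sec q $ i \<le> c} = proj_torus ` (cbox 0 1 \<inter> {x. x $ i \<le> c})"
    proof (intro equalityI subsetI)
      fix q assume "q \<in> {q. torus_sec q $ i \<le> c}"
      then show "q \<in> proj_torus ` (cbox 0 1 \<inter> {x. x $ i \<le> c})"
        by (intro image_eqI[of _ _ "torus_sec q"])
          (auto simp: mem_box_cart torus_sec_bounds less_imp_le[OF torus_sec_bounds(2)])
    next
      fix q assume "q \<in> proj_torus ` (cbox 0 1 \<inter> {x. x $ i \<le> c})"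
      then obtain x where x: "q = proj_torus x" "x \<in> cbox 0 1" "x $ i \<le> c" by auto
      then have "frac (x $ i) = x $ i" using that by (intro frac_eq[THEN iffD2]) (auto simp: mem_box_cart)
      then show "q \<in> {q. torus_sec q $ i \<le> c}" using x by (simp add: torus_sec_proj)
    qed
    moreover have "compact (cbox 0 1 \<inter> {x :: real ^ 'a. x $ i \<le> c})"
      by (intro compact_Int_closed compact_cbox closed_halfspace_component_le_cart)
    ultimately show ?thesis
      by (simp add: compact_imp_closed compact_continuous_image continuous_on_proj_torus)
  qed
  then have "{q. torus_sec q $ i \<le> c} \<in> sets borel" for c
  proof (cases "c < 0 \<or> c \<ge> 1")
    case True
    then show ?thesis
    proof
      assume "c < 0"
      then have "\<not> torus_sec q $ i \<le> c" for q :: "'a torus" using torus_sec_bounds(1)[of q i] by linarith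
      then show ?thesis by simp
    next
      assume "1 \<le> c"
      then have "torus_sec q $ i \<le> c" for q :: "'a torus" using torus_sec_bounds(2)[of q i] by linarith
      then show ?thesis by simp
    qed
  qed (auto intro!: borel_closed)
  then have "(\<lambda>q. torus_sec q $ i) \<in> borel_measurable borel"
    by (subst borel_measurable_iff_le) simp
  then show "(\<lambda>q. torus_sec q \<bullet> b) \<in> borel_measurable borel"
    by (simp add: b inner_axis)
qed

section \<open>Finite Borel measures are determined by continuous functions\<close>

lemma finite_borel_measure_eqI:
  fixes M N :: "'a::metric_space measure"
  assumes M: "finite_measure M" "sets M = sets borel" and N: "finite_measure N" "sets N = sets borel"
    and eq: "\<And>f :: 'a \<Rightarrow> real. continuous_on UNIV f \<Longrightarrow> bounded (range f) \<Longrightarrow> (\<integral>x. f x \<partial>M) = (\<integral>x. f x \<partial>N)"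
  shows "M = N"
proof -
  interpret M: finite_measure M by fact
  interpret N: finite_measure N by fact
  \<comment> \<open>These continuous functions decrease to the indicator of C. Closed sets form an
    intersection-stable generator, so agreement on them suffices.\<close>
  have lim: "(\<lambda>k. \<integral>x. max 0 (1 - real k * infdist x C) \<partial>L) \<longlonglongrightarrow> measure L C"
    if C: "closed C" "C \<noteq> {}" and L: "finite_measure L" "sets L = sets borel" for C :: "'a set" and L
  proof -
    interpret L: finite_measure L by fact
    have [measurable_cong]: "sets L = sets borel" by fact
    have [measurable]: "C \<in> sets borel" using C by simp
    have [measurable]: "(\<lambda>x. infdist x C) \<in> borel_measurable borel"
      by (intro borel_measurable_continuous_onI continuous_intros)
    have "(\<lambda>k. \<integral>x. max 0 (1 - real k * infdist x C) \<partial>L) \<longlonglongrightarrow> (\<integral>x. indicator C x \<partial>L)"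
    proof (rule integral_dominated_convergence[where w = "\<lambda>_. 1"])
      show "AE x in L. (\<lambda>k. max 0 (1 - real k * infdist x C)) \<longlonglongrightarrow> indicator C x"
      proof (rule AE_I2)
        fix x
        show "(\<lambda>k. max 0 (1 - real k * infdist x C)) \<longlonglongrightarrow> indicator C x"
        proof (cases "x \<in> C")
          case False
          then have pos: "infdist x C > 0" using C by (simp add: infdist_pos_not_in_closed)
          have "eventually (\<lambda>k. real k > 1 / infdist x C) sequentially"
            by (rule eventually_gt_at_top[THEN filterlim_real_sequentially[unfolded filterlim_def, THEN filter_leD, unfolded eventually_filtermap]])
          then have "eventually (\<lambda>k. max 0 (1 - real k * infdist x C) = indicator C x) sequentially"
            by eventually_elim (use False pos in \<open>auto simp: field_simps\<close>)
          then show ?thesis by (rule tendsto_eventually)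
        qed auto
      qed
      show "AE x in L. norm (max 0 (1 - real k * infdist x C)) \<le> 1" for k
        by (rule AE_I2) (auto simp: infdist_nonneg)
    qed (auto simp: L.integrable_const)
    then show ?thesis using L(2) by (simp add: sets_eq_imp_space_eq[OF L(2)])
  qed
  have closed: "emeasure M C = emeasure N C" if C: "closed C" for C
  proof (cases "C = {}")
    case False
    have eq': "(\<integral>x. max 0 (1 - real k * infdist x C) \<partial>M) = (\<integral>x. max 0 (1 - real k * infdist x C) \<partial>N)" for k
    proof (rule eq)
      show "continuous_on UNIV (\<lambda>x. max 0 (1 - real k * infdist x C))" by (intro continuous_intros)
      show "bounded (range (\<lambda>x. max 0 (1 - real k * infdist x C)))"
        by (rule boundedI[of _ 1]) (auto simp: infdist_nonneg)
    qed
    have "measure M C = measure N C"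
      using LIMSEQ_unique lim[OF C False M] lim[OF C False N] unfolding eq' by blast
    then show ?thesis by (simp add: M.emeasure_eq_measure N.emeasure_eq_measure)
  qed simp
  show ?thesis
  proof (rule measure_eqI_generator_eq[where E = "Collect closed" and \<Omega> = UNIV and A = "\<lambda>_. UNIV"])
    show "Int_stable (Collect closed :: 'a set set)" by (auto simp: Int_stable_def)
    show "sets M = sigma_sets UNIV (Collect closed)" "sets N = sigma_sets UNIV (Collect closed)"
      using M(2) N(2) by (simp_all add: borel_eq_closed)
  qed (use closed in auto)
qed

section \<open>Absolutely continuous functions\<close>

text \<open>Real induction: the supremum of the points where \<open>g + w\<close> has not fallen
  below its initial value is again such a point, because \<open>g\<close> is continuous and
  \<open>w\<close>, which may jump, jumps upwards only. The step hypothesis then forces this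
  supremum to be d.\<close>

lemma grow_right:
  fixes g w :: "real \<Rightarrow> real"
  assumes cd: "c \<le> d" and g: "continuous_on {c..d} g" and w: "mono_on {c..d} w"
    and step: "\<And>x. c \<le> x \<Longrightarrow> x < d \<Longrightarrow> \<exists>y. x < y \<and> y \<le> d \<and> g x + w x \<le> g y + w y"
  shows "g c + w c \<le> g d + w d"
proof -
  define S where "S = {x \<in> {c..d}. g c + w c \<le> g x + w x}"
  have cS: "c \<in> S" using cd by (simp add: S_def)
  have bdd: "bdd_above S" by (auto simp: S_def intro!: bdd_aboveI[of _ d])
  define s where "s = Sup S"
  have s: "c \<le> s" "s \<le> d"
    using cS bdd by (auto simp: s_def S_def intro!: cSup_upper cSup_least)
  obtain X where X: "\<And>n. X n \<in> S" "X \<longlonglongrightarrow> s"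
    using closure_contains_Sup[OF _ bdd] cS unfolding s_def closure_sequential by blast
  have Xs: "X n \<le> s" for n using X(1) bdd by (simp add: s_def cSup_upper)
  have "(\<lambda>n. g (X n)) \<longlonglongrightarrow> g s"
    using X s by (intro continuous_on_tendsto_compose[OF g X(2)]) (auto simp: S_def)
  then have "(\<lambda>n. g (X n) + w s) \<longlonglongrightarrow> g s + w s" by (intro tendsto_intros)
  moreover have "g c + w c \<le> g (X n) + w s" for n
  proof -
    have "w (X n) \<le> w s" using X(1)[of n] Xs[of n] s by (intro mono_onD[OF w]) (auto simp: S_def)
    then show ?thesis using X(1)[of n] by (simp add: S_def)
  qed
  ultimately have gs: "g c + w c \<le> g s + w s" by (meson LIMSEQ_le_const)
  have "s = d"
  proof (rule ccontr)
    assume "s \<noteq> d"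
    then obtain y where y: "s < y" "y \<le> d" "g s + w s \<le> g y + w y" using step s by force
    then have "y \<in> S" using gs s by (simp add: S_def)
    then show False using y bdd by (simp add: s_def) (meson cSup_upper not_le)
  qed
  then show ?thesis using gs by simp
qed

text \<open>The reflection x |-> - x, with a change of sign of both functions, turns steps to the
  left into steps to the right.\<close>

lemma grow_left:
  fixes g w :: "real \<Rightarrow> real"
  assumes cd: "c \<le> d" and g: "continuous_on {c..d} g" and w: "mono_on {c..d} w"
    and step: "\<And>x. c < x \<Longrightarrow> x \<le> d \<Longrightarrow> \<exists>y. c \<le> y \<and> y < x \<and> g y + w y \<le> g x + w x"
  shows "g c + w c \<le> g d + w d"
proof -
  have "(\<lambda>x. - g (- x)) (- d) + (\<lambda>x. - w (- x)) (- d) \<le> (\<lambda>x. - g (- x)) (- c) + (\<lambda>x. - w (- x)) (- c)"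
  proof (rule grow_right[where g = "\<lambda>x. - g (- x)" and w = "\<lambda>x. - w (- x)"])
    show "continuous_on {- d..- c} (\<lambda>x. - g (- x))"
      by (intro continuous_intros continuous_on_compose2[OF g]) auto
    show "mono_on {- d..- c} (\<lambda>x. - w (- x))"
      using w by (auto simp: mono_on_def)
    show "\<exists>y>x. y \<le> - c \<and> - g (- x) + - w (- x) \<le> - g (- y) + - w (- y)"
      if x: "- d \<le> x" "x < - c" for x
    proof -
      obtain y where "c \<le> y \<and> y < - x \<and> g y + w y \<le> g (- x) + w (- x)"
        using step[of "- x"] x by auto
      then show ?thesis by (intro exI[of _ "- y"]) auto
    qed
  qed (use cd in simp)
  then show ?thesis by simp
qed

text \<open>Absolute continuity is formulated for families indexed by an initial segment of the
  naturals; the applications use subsets of a grid and tagged intervals of a partition as index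
  sets.\<close>

lemma ac_less:
  assumes "abs_continuous_on a b g" "e > 0"
  obtains d where "d > 0"
    "\<And>(I :: 'i set) u v. finite I \<Longrightarrow> (\<And>i. i \<in> I \<Longrightarrow> a \<le> u i \<and> u i \<le> v i \<and> v i \<le> b) \<Longrightarrow>
        disjoint_family_on (\<lambda>i. {u i<..<v i}) I \<Longrightarrow> (\<Sum>i\<in>I. v i - u i) < d \<Longrightarrow>
        (\<Sum>i\<in>I. dist (g (u i)) (g (v i))) < e"
proof -
  obtain d where d: "d > 0" "\<And>(m::nat) u v. (\<forall>i<m. a \<le> u i \<and> u i \<le> v i \<and> v i \<le> b) \<Longrightarrow>
        disjoint_family_on (\<lambda>i. {u i<..<v i}) {..<m} \<Longrightarrow>
        (\<Sum>i<m. v i - u i) < d \<Longrightarrow> (\<Sum>i<m. dist (g (u i)) (g (v i))) < e"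
    using assms(1)[unfolded abs_continuous_on_def, rule_format, OF assms(2)] by blast
  show thesis
  proof (rule that[OF d(1)])
    fix I :: "'i set" and u v :: "'i \<Rightarrow> real"
    assume I: "finite I" and uv: "\<And>i. i \<in> I \<Longrightarrow> a \<le> u i \<and> u i \<le> v i \<and> v i \<le> b"
      and dis: "disjoint_family_on (\<lambda>i. {u i<..<v i}) I" and lt: "(\<Sum>i\<in>I. v i - u i) < d"
    obtain h where h: "bij_betw h {..<card I} I"
      using ex_bij_betw_nat_finite[OF I] by (auto simp: atLeast0LessThan)
    have re: "(\<Sum>i\<in>I. F i) = (\<Sum>n<card I. F (h n))" for F :: "'i \<Rightarrow> real"
      using sum.reindex_bij_betw[OF h, of F] by simp
    have "(\<Sum>n<card I. dist (g (u (h n))) (g (v (h n)))) < e"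
    proof (rule d(2))
      show "\<forall>i<card I. a \<le> u (h i) \<and> u (h i) \<le> v (h i) \<and> v (h i) \<le> b"
        using uv bij_betwE[OF h] by simp
      show "disjoint_family_on (\<lambda>i. {u (h i)<..<v (h i)}) {..<card I}"
        unfolding disjoint_family_on_def
      proof (intro ballI impI)
        fix m n assume mn: "m \<in> {..<card I}" "n \<in> {..<card I}" "m \<noteq> n"
        then have "h m \<noteq> h n" "h m \<in> I" "h n \<in> I"
          using h by (auto simp: bij_betw_def inj_on_def)
        then show "{u (h m)<..<v (h m)} \<inter> {u (h n)<..<v (h n)} = {}"
          using dis by (simp add: disjoint_family_on_def)
      qed
      show "(\<Sum>i<card I. v (h i) - u (h i)) < d" using lt re[of "\<lambda>i. v i - u i"] by simp
    qed
    then show "(\<Sum>i\<in>I. dist (g (u i)) (g (v i))) < e" using re[of "\<lambda>i. dist (g (u i)) (g (v i))"] by simp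
  qed
qed

lemma sum_lengths_le_measure:
  fixes u v :: "'i \<Rightarrow> real"
  assumes "finite I" "\<And>i. i \<in> I \<Longrightarrow> u i \<le> v i" "disjoint_family_on (\<lambda>i. {u i<..<v i}) I"
    "\<And>i. i \<in> I \<Longrightarrow> {u i<..<v i} \<subseteq> W" "W \<in> lmeasurable"
  shows "(\<Sum>i\<in>I. v i - u i) \<le> measure lebesgue W"
proof -
  have "(\<Sum>i\<in>I. v i - u i) = (\<Sum>i\<in>I. measure lebesgue {u i<..<v i})"
    using assms(2) by (intro sum.cong) auto
  also have "\<dots> = measure lebesgue (\<Union>i\<in>I. {u i<..<v i})"
    by (rule measure_finite_Union[symmetric]) (use assms in \<open>auto simp: emeasure_lborel_Ioo\<close>)
  also have "\<dots> \<le> measure lebesgue W"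
    using assms by (intro measure_mono_fmeasurable) auto
  finally show ?thesis .
qed

text \<open>This condition lies between two Dini conditions: it follows from a positive upper Dini
  derivative on the chosen side and implies a nonnegative one. The flag \<open>r\<close> selects the
  right-hand side.\<close>

definition slope_up :: "bool \<Rightarrow> (real \<Rightarrow> real) \<Rightarrow> real \<Rightarrow> bool" where
  "slope_up r g x \<longleftrightarrow> (\<forall>e>0. \<exists>h>0. h < e \<and> (if r then g x \<le> g (x + h) else g (x - h) \<le> g x))"

text \<open>The correction \<open>w x\<close> is the largest total increment of \<open>g\<close> over finite disjoint families of
  intervals inside \<open>W \<inter> {a..x}\<close>; it is small by absolute continuity and pays for the decrease of
  \<open>g\<close> wherever the slope condition may fail.\<close>

lemma ac_monotone_cells:
  fixes g :: "real \<Rightarrow> real"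
  assumes ac: "abs_continuous_on a b g" and g: "continuous_on {a..b} g" and "e > 0"
  obtains \<delta> where "\<delta> > 0"
    "\<And>W. open W \<Longrightarrow> W \<in> lmeasurable \<Longrightarrow> measure lebesgue W < \<delta> \<Longrightarrow>
      \<exists>w. mono_on {a..b} w \<and> (\<forall>x. 0 \<le> w x \<and> w x \<le> e) \<and>
        (\<forall>c d K r. a \<le> c \<longrightarrow> c \<le> d \<longrightarrow> d \<le> b \<longrightarrow> {c..d} \<subseteq> K \<union> W \<longrightarrow> (\<forall>x\<in>K. slope_up r g x) \<longrightarrow>
           g c + w c \<le> g d + w d)"
proof -
  obtain \<delta> where \<delta>: "\<delta> > 0" 
    "\<And>(I :: nat set) u v. finite I \<Longrightarrow> (\<And>i. i \<in> I \<Longrightarrow> a \<le> u i \<and> u i \<le> v i \<and> v i \<le> b) \<Longrightarrow>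
        disjoint_family_on (\<lambda>i. {u i<..<v i}) I \<Longrightarrow> (\<Sum>i\<in>I. v i - u i) < \<delta> \<Longrightarrow>
        (\<Sum>i\<in>I. dist (g (u i)) (g (v i))) < e"
    using ac_less[OF ac \<open>e > 0\<close>] by blast
  show thesis
  proof (rule that[OF \<delta>(1)])
    fix W :: "real set" assume W: "open W" "W \<in> lmeasurable" "measure lebesgue W < \<delta>"
    define fam where "fam x m u v \<longleftrightarrow> (\<forall>i<m. a \<le> u i \<and> u i \<le> v i \<and> v i \<le> x \<and> {u i<..<v i} \<subseteq> W) \<and>
        disjoint_family_on (\<lambda>i. {u i<..<v i}) {..<m}" for x and m :: nat and u v :: "nat \<Rightarrow> real"
    \<comment> \<open>Cutting at b keeps every family inside {a..b}, so the bounds on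
      \<open>w\<close> hold for all real x.\<close>
    define A where "A x = {\<Sum>i<m. dist (g (u i)) (g (v i)) | m u v. fam (min x b) m u v}" for x
    define w where "w x = Sup (A x)" for x
    have A_le: "s \<le> e" if s: "s \<in> A x" for s x
    proof -
      obtain m u v where f: "fam (min x b) m u v" "s = (\<Sum>i<m. dist (g (u i)) (g (v i)))"
        using s by (auto simp: A_def)
      have "(\<Sum>i<m. v i - u i) \<le> measure lebesgue W"
        using f W by (intro sum_lengths_le_measure) (auto simp: fam_def)
      then show ?thesis using f W by (intro less_imp_le) (auto simp: fam_def intro!: \<delta>(2))
    qed
    have A0: "0 \<in> A x" for x
    proof -
      have "fam (min x b) 0 undefined undefined" by (simp add: fam_def disjoint_family_on_def)
      then show ?thesis unfolding A_def by (intro CollectI exI[of _ 0] exI) auto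
    qed
    have bdd: "bdd_above (A x)" for x using A_le by (auto intro!: bdd_aboveI[of _ e])
    have w0: "0 \<le> w x" "w x \<le> e" for x
      unfolding w_def using cSup_upper[OF A0 bdd] cSup_least[of "A x" e] A0[of x] A_le by blast+
    have A_mono: "A x \<subseteq> A y" if "x \<le> y" for x y
    proof -
      have "fam (min y b) m u v" if "fam (min x b) m u v" for m u v
        using that \<open>x \<le> y\<close> unfolding fam_def by (meson min.mono order.refl order_trans)
      then show ?thesis unfolding A_def by blast
    qed
    have mono: "w x \<le> w y" if "x \<le> y" for x y
      unfolding w_def by (rule cSup_subset_mono) (use A0 bdd A_mono[OF that] in auto)
    have append: "w x + dist (g x) (g y) \<le> w y" if xy: "a \<le> x" "x < y" "y \<le> b" "{x<..<y} \<subseteq> W" for x y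
    proof -
      have "s + dist (g x) (g y) \<le> w y" if s: "s \<in> A x" for s
      proof -
        obtain m u v where f: "fam x m u v" "s = (\<Sum>i<m. dist (g (u i)) (g (v i)))"
          using s min_absorb1[of x b] xy by (auto simp: A_def)
        have "fam (min y b) (Suc m) (u(m := x)) (v(m := y))"
          unfolding fam_def
        proof (intro conjI allI impI)
          fix i assume "i < Suc m"
          show "a \<le> (u(m := x)) i" "(u(m := x)) i \<le> (v(m := y)) i" "(v(m := y)) i \<le> min y b"
            "{(u(m := x)) i<..<(v(m := y)) i} \<subseteq> W"
            using f(1) xy \<open>i < Suc m\<close> by (auto simp: fam_def less_Suc_eq intro: order_trans)
        next
          show "disjoint_family_on (\<lambda>i. {(u(m := x)) i<..<(v(m := y)) i}) {..<Suc m}"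
            unfolding disjoint_family_on_def
          proof (intro ballI impI)
            fix i j assume ij: "i \<in> {..<Suc m}" "j \<in> {..<Suc m}" "i \<noteq> j"
            have vx: "v k \<le> x" if "k < m" for k using f(1) that by (simp add: fam_def)
            consider "i < m" "j < m" | "i = m" "j < m" | "i < m" "j = m" using ij by fastforce
            then show "{(u(m := x)) i<..<(v(m := y)) i} \<inter> {(u(m := x)) j<..<(v(m := y)) j} = {}"
            proof cases
              case 1 then show ?thesis using f(1) ij by (simp add: fam_def disjoint_family_on_def)
            next
              case 2 then show ?thesis using vx[of j] by auto
            next
              case 3 then show ?thesis using vx[of i] by auto
            qed
          qed
        qed
        then have "(\<Sum>i<Suc m. dist (g ((u(m := x)) i)) (g ((v(m := y)) i))) \<in> A y"
          unfolding A_def by blast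
        moreover have "(\<Sum>i<Suc m. dist (g ((u(m := x)) i)) (g ((v(m := y)) i))) = s + dist (g x) (g y)"
          by (simp add: f(2))
        ultimately show ?thesis unfolding w_def using bdd by (metis cSup_upper)
      qed
      then have "w x \<le> w y - dist (g x) (g y)"
        unfolding w_def[of x] using A0 by (intro cSup_least) (auto simp: algebra_simps)
      then show ?thesis by simp
    qed
    \<comment> \<open>At a point of W, moving along a short interval inside W raises
      \<open>w\<close> by at least the change of \<open>g\<close>; at any other point the slope
      condition supplies the step and monotonicity of \<open>w\<close> does the rest.\<close>
    have main: "g c + w c \<le> g d + w d"
      if cd: "a \<le> c" "c \<le> d" "d \<le> b" "{c..d} \<subseteq> K \<union> W" "\<forall>x\<in>K. slope_up r g x" for c d K r
    proof (cases r)
      case True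
      show ?thesis
      proof (rule grow_right)
        fix x assume x: "c \<le> x" "x < d"
        show "\<exists>y. x < y \<and> y \<le> d \<and> g x + w x \<le> g y + w y"
        proof (cases "x \<in> W")
          case True
          then obtain e where e: "e > 0" "ball x e \<subseteq> W" using W(1) openE by blast
          define y where "y = min d (x + e)"
          have y: "x < y" "y \<le> d" "{x<..<y} \<subseteq> W" using e x by (auto simp: y_def dist_real_def subset_eq)
          then have "w x + dist (g x) (g y) \<le> w y" using x cd by (intro append) auto
          then have "g x + w x \<le> g y + w y" by (simp add: dist_real_def)
          then show ?thesis using y by blast
        next
          case False
          then have "slope_up True g x" using subsetD[OF cd(4), of x] cd(5) x True \<open>r\<close> by auto
          then obtain h where h: "h > 0" "h < d - x" "g x \<le> g (x + h)"
            unfolding slope_up_def using x by (metis diff_gt_0_iff_gt)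
          have "w x \<le> w (x + h)" using h by (intro mono) auto
          then show ?thesis using h by (intro exI[of _ "x + h"]) auto
        qed
      qed (use cd mono continuous_on_subset[OF g] in \<open>auto intro: mono_onI\<close>)
    next
      case False
      show ?thesis
      proof (rule grow_left)
        fix x assume x: "c < x" "x \<le> d"
        show "\<exists>y. c \<le> y \<and> y < x \<and> g y + w y \<le> g x + w x"
        proof (cases "x \<in> W")
          case True
          then obtain e where e: "e > 0" "ball x e \<subseteq> W" using W(1) openE by blast
          define y where "y = max c (x - e)"
          have y: "y < x" "c \<le> y" "{y<..<x} \<subseteq> W" using e x by (auto simp: y_def dist_real_def subset_eq)
          then have "w y + dist (g y) (g x) \<le> w x" using x cd by (intro append) auto
          then have "g y + w y \<le> g x + w x" by (simp add: dist_real_def)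
          then show ?thesis using y by blast
        next
          case False
          then have "slope_up False g x" using subsetD[OF cd(4), of x] cd(5) x \<open>\<not> r\<close> by auto
          then obtain h where h: "h > 0" "h < x - c" "g (x - h) \<le> g x"
            unfolding slope_up_def using x by (metis diff_gt_0_iff_gt)
          have "w (x - h) \<le> w x" using h by (intro mono) auto
          then show ?thesis using h by (intro exI[of _ "x - h"]) auto
        qed
      qed (use cd mono continuous_on_subset[OF g] in \<open>auto intro: mono_onI\<close>)
    qed
    show "\<exists>w. mono_on {a..b} w \<and> (\<forall>x. 0 \<le> w x \<and> w x \<le> e) \<and>
        (\<forall>c d K r. a \<le> c \<longrightarrow> c \<le> d \<longrightarrow> d \<le> b \<longrightarrow> {c..d} \<subseteq> K \<union> W \<longrightarrow> (\<forall>x\<in>K. slope_up r g x) \<longrightarrow>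
           g c + w c \<le> g d + w d)"
      using w0 mono main by (intro exI[of _ w] conjI mono_onI) blast+
  qed
qed

text \<open>With a mesh below the distance from K to the complement of V, every cell that meets K
  stays inside V. All cells belong to one uniform partition of {a..b}, so increments of monotone
  functions over them can later be summed by telescoping.\<close>

lemma compact_grid_cover:
  fixes K V :: "real set"
  assumes K: "compact K" "K \<subseteq> {a..b}" and V: "open V" "K \<subseteq> V" and ab: "a < b"
  obtains N :: nat and J and t :: "nat \<Rightarrow> real" where "J \<subseteq> {..<N}"
    "\<And>i. i \<in> J \<Longrightarrow> {t i..t (Suc i)} \<subseteq> V" "measure lebesgue K \<le> (\<Sum>i\<in>J. t (Suc i) - t i)"
    "t 0 = a" "t N = b" "\<And>i. t i < t (Suc i)"
proof -
  obtain e where e: "e > 0" "(\<Union>x\<in>K. ball x e) \<subseteq> V"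
    using compact_subset_open_imp_ball_epsilon_subset[OF K(1) V] by metis
  obtain N :: nat where N': "max 1 ((b - a) / e) < N"
    using reals_Archimedean2 by blast
  then have N: "N > 0" "b - a < N * e" using e(1) by (auto simp: pos_divide_less_eq)
  define \<tau> where "\<tau> = (b - a) / N"
  have N\<tau>: "N * \<tau> = b - a" using N by (simp add: \<tau>_def)
  have \<tau>: "\<tau> > 0" "\<tau> < e"
    using N ab by (simp_all add: \<tau>_def pos_divide_less_eq mult.commute)
  define t where "t = (\<lambda>i::nat. a + i * ((b - a) / N))"
  have t: "t (Suc i) - t i = \<tau>" for i unfolding t_def \<tau>_def[symmetric] by (simp add: algebra_simps)
  define J where "J = {i. i < N \<and> {t i..t (Suc i)} \<inter> K \<noteq> {}}"
  have "K \<subseteq> (\<Union>i\<in>J. {t i..t (Suc i)})"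
  proof
    fix x assume x: "x \<in> K"
    then have xab: "a \<le> x" "x \<le> b" using K by auto
    define j where "j = nat \<lfloor>(x - a) / \<tau>\<rfloor>"
    have j: "real j \<le> (x - a) / \<tau>" "(x - a) / \<tau> < real j + 1"
      using xab \<tau> by (auto simp: j_def) 
    have tj: "t j \<le> x" "x \<le> t (Suc j)" using j \<tau>(1) unfolding t_def \<tau>_def[symmetric] by (auto simp: field_simps)
    show "x \<in> (\<Union>i\<in>J. {t i..t (Suc i)})"
    proof (cases "j < N")
      case True
      then show ?thesis using tj x unfolding J_def UN_iff by (intro bexI[of _ j]) auto
    next
      case False
      \<comment> \<open>Only x = b leads to an index beyond the last cell; it belongs to the last
        cell as its right end.\<close>
      then have "t N \<le> t j" using \<tau> unfolding t_def \<tau>_def[symmetric] by simp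
      then have "x = t N" using xab tj N by (auto simp: t_def)
      then have "t (N - 1) \<le> x \<and> x \<le> t (Suc (N - 1))" using t[of "N - 1"] \<tau> N by simp
      then show ?thesis using x N unfolding J_def UN_iff by (intro bexI[of _ "N - 1"]) auto
    qed
  qed
  moreover have "finite J" by (simp add: J_def)
  ultimately have "measure lebesgue K \<le> measure lebesgue (\<Union>i\<in>J. {t i..t (Suc i)})"
    using K(1) by (intro measure_mono_fmeasurable fmeasurable.finite_UN) (auto simp: lmeasurable_compact fmeasurableD)
  also have "\<dots> \<le> (\<Sum>i\<in>J. measure lebesgue {t i..t (Suc i)})"
    using \<open>finite J\<close> by (intro measure_UNION_le) auto
  also have "\<dots> = (\<Sum>i\<in>J. t (Suc i) - t i)"
  proof (intro sum.cong refl)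
    fix i
    have "t i \<le> t (Suc i)" using t[of i] \<tau>(1) by linarith
    then show "measure lebesgue {t i..t (Suc i)} = t (Suc i) - t i" by simp
  qed
  finally have m: "measure lebesgue K \<le> (\<Sum>i\<in>J. t (Suc i) - t i)" .
  show thesis
  proof (rule that[OF _ _ m])
    fix i assume "i \<in> J"
    then obtain y where y: "y \<in> K" "t i \<le> y" "y \<le> t (Suc i)" by (auto simp: J_def)
    then show "{t i..t (Suc i)} \<subseteq> V" using e(2) t[of i] \<tau> by (force simp: dist_real_def)
  next
    show "t i < t (Suc i)" for i using t[of i] \<tau>(1) by linarith
    show "t N = b" using N\<tau> unfolding t_def \<tau>_def[symmetric] by simp
  qed (auto simp: J_def t_def)
qed

lemma abs_continuous_on_subset:
  assumes "abs_continuous_on a b g" "a \<le> c" "d \<le> b"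
  shows "abs_continuous_on c d g"
  unfolding abs_continuous_on_def
proof (intro allI impI)
  fix e :: real assume "e > 0"
  then obtain \<delta> where \<delta>: "\<delta> > 0" "\<And>(m::nat) u v. (\<forall>i<m. a \<le> u i \<and> u i \<le> v i \<and> v i \<le> b) \<Longrightarrow>
        disjoint_family_on (\<lambda>i. {u i<..<v i}) {..<m} \<Longrightarrow>
        (\<Sum>i<m. v i - u i) < \<delta> \<Longrightarrow> (\<Sum>i<m. dist (g (u i)) (g (v i))) < e"
    using assms(1)[unfolded abs_continuous_on_def, rule_format, of e] by blast
  show "\<exists>\<delta>>0. \<forall>(m::nat) u v. (\<forall>i<m. c \<le> u i \<and> u i \<le> v i \<and> v i \<le> d) \<longrightarrow>
        disjoint_family_on (\<lambda>i. {u i<..<v i}) {..<m} \<longrightarrow>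
        (\<Sum>i<m. v i - u i) < \<delta> \<longrightarrow> (\<Sum>i<m. dist (g (u i)) (g (v i))) < e"
    using \<delta> assms(2,3) by (intro exI[of _ \<delta>] conjI allI impI \<delta>(2)) (auto intro: order_trans)
qed

text \<open>One comparison criterion for all cases that occur: coordinates of a curve, linear
  corrections of a function, and Lipschitz curves, the last with M = 0.\<close>

lemma abs_continuous_on_dominated:
  fixes g :: "real \<Rightarrow> 'a::metric_space" and h :: "real \<Rightarrow> 'b::metric_space"
  assumes g: "abs_continuous_on a b g" and M: "M \<ge> 0" "L \<ge> 0"
    and le: "\<And>u v. a \<le> u \<Longrightarrow> u \<le> v \<Longrightarrow> v \<le> b \<Longrightarrow> dist (h u) (h v) \<le> M * dist (g u) (g v) + L * (v - u)"
  shows "abs_continuous_on a b h"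
  unfolding abs_continuous_on_def
proof (intro allI impI)
  fix e :: real assume e: "e > 0"
  define e' where "e' = e / (2 * (M + 1))"
  have e': "e' > 0" "M * e' \<le> e / 2" using e M by (auto simp: e'_def field_simps)
  obtain \<delta> where \<delta>: "\<delta> > 0" "\<And>(m::nat) u v. (\<forall>i<m. a \<le> u i \<and> u i \<le> v i \<and> v i \<le> b) \<Longrightarrow>
        disjoint_family_on (\<lambda>i. {u i<..<v i}) {..<m} \<Longrightarrow>
        (\<Sum>i<m. v i - u i) < \<delta> \<Longrightarrow> (\<Sum>i<m. dist (g (u i)) (g (v i))) < e'"
    using g[unfolded abs_continuous_on_def, rule_format, OF e'(1)] by blast
  define \<delta>' where "\<delta>' = min \<delta> (e / (2 * (L + 1)))"
  have \<delta>': "\<delta>' > 0" using \<delta> e M by (auto simp: \<delta>'_def)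
  have L\<delta>: "L * x < e / 2" if "x < \<delta>'" "0 \<le> x" for x
  proof -
    have "(L + 1) * x < e / 2" using that M e by (auto simp: \<delta>'_def field_simps)
    then show ?thesis using that by (simp add: algebra_simps)
  qed
  show "\<exists>\<delta>>0. \<forall>(m::nat) u v. (\<forall>i<m. a \<le> u i \<and> u i \<le> v i \<and> v i \<le> b) \<longrightarrow>
        disjoint_family_on (\<lambda>i. {u i<..<v i}) {..<m} \<longrightarrow>
        (\<Sum>i<m. v i - u i) < \<delta> \<longrightarrow> (\<Sum>i<m. dist (h (u i)) (h (v i))) < e"
  proof (intro exI[of _ \<delta>'] conjI allI impI \<delta>')
    fix m :: nat and u v
    assume uv: "\<forall>i<m. a \<le> u i \<and> u i \<le> v i \<and> v i \<le> b" "disjoint_family_on (\<lambda>i. {u i<..<v i}) {..<m}"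
      "(\<Sum>i<m. v i - u i) < \<delta>'"
    have "(\<Sum>i<m. dist (h (u i)) (h (v i))) \<le> (\<Sum>i<m. M * dist (g (u i)) (g (v i)) + L * (v i - u i))"
      using uv by (intro sum_mono le) auto
    also have "\<dots> = M * (\<Sum>i<m. dist (g (u i)) (g (v i))) + L * (\<Sum>i<m. v i - u i)"
      by (simp add: sum.distrib sum_distrib_left)
    also have "\<dots> \<le> M * e' + L * (\<Sum>i<m. v i - u i)"
      using \<delta>(2)[OF uv(1,2)] uv(3) M by (intro add_right_mono mult_left_mono) (auto simp: \<delta>'_def)
    also have "\<dots> < e" using e'(2) L\<delta>[OF uv(3)] uv(1) by (force intro: sum_nonneg)
    finally show "(\<Sum>i<m. dist (h (u i)) (h (v i))) < e" .
  qed
qed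

text \<open>The points where an upper Dini derivative of \<open>f\<close> is essentially at least \<open>q\<close>: from the right for
  \<open>r = True\<close>, from the left for \<open>r = False\<close>. The strict inequality makes the set Borel.\<close>

definition slope_set :: "(real \<Rightarrow> real) \<Rightarrow> bool \<Rightarrow> real \<Rightarrow> real set" where
  "slope_set f r q = {x. \<forall>n::nat. \<exists>h>0. h < 1 / real (Suc n) \<and>
     (if r then q * h < f (x + h) - f x else q * h < f x - f (x - h))}"

text \<open>For a fixed h the condition is open in x, and the union over the small h remains open;
  the countable intersection over n makes the set a G_delta.\<close>

lemma slope_set_borel:
  assumes "continuous_on UNIV f"
  shows "slope_set f r q \<in> sets borel"
proof -
  have c: "continuous_on UNIV (\<lambda>x. f (x + h) - f x)" "continuous_on UNIV (\<lambda>x. f x - f (x - h))" for h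
    by (intro continuous_intros continuous_on_compose2[OF assms]; simp)+
  have o: "open {x. if r then q * h < f (x + h) - f x else q * h < f x - f (x - h)}" for h
    using c[of h] by (cases r) (auto intro!: open_Collect_less continuous_intros)
  define B where "B n = (\<Union>h\<in>{0<..<1 / real (Suc n)}.
    {x. if r then q * h < f (x + h) - f x else q * h < f x - f (x - h)})" for n
  have "open (B n)" for n unfolding B_def by (intro open_UN ballI o)
  then have "(\<Inter>n. B n) \<in> sets borel" by (intro sets.countable_INT'') auto
  moreover have "slope_set f r q = (\<Inter>n. B n)"
    unfolding slope_set_def B_def by (auto simp: Bex_def simp del: if_split) blast+
  ultimately show ?thesis by simp
qed

lemma slope_set_slope_up:
  assumes "x \<in> slope_set f r q"
  shows "slope_up r (\<lambda>x. f x - q * x) x"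
  unfolding slope_up_def
proof (intro allI impI)
  fix e :: real assume "e > 0"
  then obtain n where n: "1 / real (Suc n) < e" using reals_Archimedean[of e] by (auto simp: inverse_eq_divide)
  obtain h where "h > 0" "h < 1 / real (Suc n)" "if r then q * h < f (x + h) - f x else q * h < f x - f (x - h)"
    using assms by (auto simp: slope_set_def)
  then show "\<exists>h>0. h < e \<and> (if r then f x - q * x \<le> f (x + h) - q * (x + h) else f (x - h) - q * (x - h) \<le> f x - q * x)"
    using n by (intro exI[of _ h]) (auto simp: algebra_simps)
qed

text \<open>Inner regularity: a set of finite measure exceeds some closed subset by arbitrarily
  little, and closed subsets of a bounded set are compact.\<close>

lemma negligible_if_compact_subsets_null:
  fixes E :: "real set"
  assumes E: "E \<in> sets borel" "E \<subseteq> {a..b}" and K: "\<And>K. compact K \<Longrightarrow> K \<subseteq> E \<Longrightarrow> measure lebesgue K = 0"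
  shows "negligible E"
proof -
  have El: "E \<in> lmeasurable"
    using E by (intro bounded_set_imp_lmeasurable bounded_subset[OF bounded_closed_interval]) auto
  have "measure lebesgue E \<le> e" if "e > 0" for e
  proof -
    obtain T where T: "closed T" "T \<subseteq> E" "E - T \<in> lmeasurable" "measure lebesgue (E - T) < e"
      using sets_lebesgue_inner_closed[OF fmeasurableD[OF El] \<open>e > 0\<close>] emeasure_eq_measure2
      by (metis ennreal_less_iff measure_nonneg)
    have "compact T" using T E(2) bounded_closed_interval bounded_subset compact_eq_bounded_closed by metis
    have "measure lebesgue E \<le> measure lebesgue T + measure lebesgue (E - T)"
      using measure_Un_le[of T lebesgue "E - T"] T \<open>compact T\<close>
      by (simp add: Un_absorb1 fmeasurableD lmeasurable_compact)
    then show ?thesis using K[OF \<open>compact T\<close> T(2)] T(4) by simp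
  qed
  then have "measure lebesgue E \<le> 0" by (rule field_le_epsilon) simp
  then have "measure lebesgue E = 0" using measure_nonneg[of lebesgue E] by linarith
  then show ?thesis using El by (simp add: negligible_iff_measure)
qed

lemma sum_increments_le:
  fixes w :: "real \<Rightarrow> real"
  assumes w: "mono_on {a..b} w" "\<And>x. 0 \<le> w x \<and> w x \<le> e" and J: "J \<subseteq> {..<N}"
    and t: "\<And>i. i \<le> N \<Longrightarrow> t i \<in> {a..b}" "\<And>i. t i < t (Suc i)"
  shows "(\<Sum>i\<in>J. w (t (Suc i)) - w (t i)) \<le> e"
proof -
  have "(\<Sum>i\<in>J. w (t (Suc i)) - w (t i)) \<le> (\<Sum>i<N. w (t (Suc i)) - w (t i))"
  proof (rule sum_mono2)
    fix i assume "i \<in> {..<N} - J"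
    then show "0 \<le> w (t (Suc i)) - w (t i)"
      using mono_onD[OF w(1), of "t i" "t (Suc i)"] t less_imp_le[OF t(2)] by auto
  qed (use J in auto)
  also have "\<dots> = w (t N) - w (t 0)" by (rule sum_lessThan_telescope)
  also have "\<dots> \<le> e" using w(2)[of "t N"] w(2)[of "t 0"] by linarith
  finally show ?thesis .
qed

lemma grid_in_interval:
  assumes "t (0::nat) = a" "t N = b" "\<And>i. t i < t (Suc i)" "i \<le> N"
  shows "t i \<in> {a..b :: real}"
proof -
  have "mono t" using assms(3) by (simp add: mono_iff_le_Suc less_imp_le)
  then show ?thesis using assms monoD[of t 0 i] monoD[of t i N] by auto
qed

text \<open>The open neighbourhood V of K is chosen so that V - K has tiny measure. On a cell inside
  V the slope condition takes care of the points of K, and the points of V - K are paid for by a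
  monotone correction whose total increase is at most e. Hence over the cells f rises at rate at
  least q, and at rate at most p if \<open>low\<close> is set, up to an error e. The flag allows one
  proof to serve both the oscillation and the infinite-slope argument.\<close>

lemma ac_cells_compact:
  fixes f :: "real \<Rightarrow> real"
  assumes ac: "abs_continuous_on a b f" and f: "continuous_on {a..b} f" and ab: "a < b" and e: "e > 0"
    and K: "compact K" "K \<subseteq> {a<..<b}" 
    and up: "\<And>x. x \<in> K \<Longrightarrow> slope_up r (\<lambda>x. f x - q * x) x" "\<And>x. x \<in> K \<Longrightarrow> slope_up r' (\<lambda>x. p * x - f x) x \<or> \<not> low"
  obtains J N t where "J \<subseteq> {..<N}" "t (0::nat) = a" "t N = b" "\<And>i. t i < t (Suc i)"
    "measure lebesgue K \<le> (\<Sum>i\<in>J. t (Suc i) - t i)"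
    "(\<Sum>i\<in>J. q * (t (Suc i) - t i) - (f (t (Suc i)) - f (t i))) \<le> e"
    "low \<Longrightarrow> (\<Sum>i\<in>J. (f (t (Suc i)) - f (t i)) - p * (t (Suc i) - t i)) \<le> e"
proof -
  have ac1: "abs_continuous_on a b (\<lambda>x. f x - q * x)"
  proof (rule abs_continuous_on_dominated[OF ac, where M = 1 and L = "\<bar>q\<bar>"])
    fix u v :: real assume "u \<le> v"
    have "dist (f u - q * u) (f v - q * v) \<le> \<bar>f u - f v\<bar> + \<bar>q * (u - v)\<bar>" by (simp add: dist_real_def algebra_simps)
    then show "dist (f u - q * u) (f v - q * v) \<le> 1 * dist (f u) (f v) + \<bar>q\<bar> * (v - u)"
      using \<open>u \<le> v\<close> by (simp add: dist_real_def abs_mult)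
  qed auto
  have ac2: "abs_continuous_on a b (\<lambda>x. p * x - f x)"
  proof (rule abs_continuous_on_dominated[OF ac, where M = 1 and L = "\<bar>p\<bar>"])
    fix u v :: real assume "u \<le> v"
    have "dist (p * u - f u) (p * v - f v) \<le> \<bar>f u - f v\<bar> + \<bar>p * (u - v)\<bar>" by (simp add: dist_real_def algebra_simps)
    then show "dist (p * u - f u) (p * v - f v) \<le> 1 * dist (f u) (f v) + \<bar>p\<bar> * (v - u)"
      using \<open>u \<le> v\<close> by (simp add: dist_real_def abs_mult)
  qed auto
  have c1: "continuous_on {a..b} (\<lambda>x. f x - q * x)" "continuous_on {a..b} (\<lambda>x. p * x - f x)"
    by (intro continuous_intros f)+
  obtain d1 where d1: "d1 > 0" "\<And>W. open W \<Longrightarrow> W \<in> lmeasurable \<Longrightarrow> measure lebesgue W < d1 \<Longrightarrow>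
      \<exists>w. mono_on {a..b} w \<and> (\<forall>x. 0 \<le> w x \<and> w x \<le> e) \<and>
        (\<forall>c d K r. a \<le> c \<longrightarrow> c \<le> d \<longrightarrow> d \<le> b \<longrightarrow> {c..d} \<subseteq> K \<union> W \<longrightarrow> (\<forall>x\<in>K. slope_up r (\<lambda>x. f x - q * x) x) \<longrightarrow>
           (f c - q * c) + w c \<le> (f d - q * d) + w d)"
    using ac_monotone_cells[OF ac1 c1(1) e] by blast
  obtain d2 where d2: "d2 > 0" "\<And>W. open W \<Longrightarrow> W \<in> lmeasurable \<Longrightarrow> measure lebesgue W < d2 \<Longrightarrow>
      \<exists>w. mono_on {a..b} w \<and> (\<forall>x. 0 \<le> w x \<and> w x \<le> e) \<and>
        (\<forall>c d K r. a \<le> c \<longrightarrow> c \<le> d \<longrightarrow> d \<le> b \<longrightarrow> {c..d} \<subseteq> K \<union> W \<longrightarrow> (\<forall>x\<in>K. slope_up r (\<lambda>x. p * x - f x) x) \<longrightarrow>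
           (p * c - f c) + w c \<le> (p * d - f d) + w d)"
    using ac_monotone_cells[OF ac2 c1(2) e] by blast
  have Kl: "K \<in> lmeasurable" using K by (simp add: lmeasurable_compact)
  obtain V0 where V0: "open V0" "K \<subseteq> V0" "V0 - K \<in> lmeasurable" "emeasure lebesgue (V0 - K) < ennreal (min d1 d2)"
    using sets_lebesgue_outer_open[OF fmeasurableD[OF Kl], of "min d1 d2"] d1 d2 by auto
  then have V0m: "measure lebesgue (V0 - K) < min d1 d2"
    using d1 d2 by (simp add: emeasure_eq_measure2 ennreal_less_iff)
  define V where "V = V0 \<inter> {a<..<b}"
  define W where "W = V - K"
  have V: "open V" "K \<subseteq> V" "V \<subseteq> {a<..<b}"
    using V0 K by (auto simp: V_def)
  have W: "open W" using V K by (auto simp: W_def intro!: open_Diff compact_imp_closed)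
  have W0: "W \<subseteq> V0 - K" by (auto simp: W_def V_def)
  have W1: "W \<in> sets lebesgue" using W by (simp add: borel_open)
  have Wl: "W \<in> lmeasurable" by (rule fmeasurableI2[OF V0(3) W0 W1])
  have Wm: "measure lebesgue W < d1" "measure lebesgue W < d2"
    using measure_mono_fmeasurable[OF W0 W1 V0(3)] V0m by auto
  obtain w1 where w1: "mono_on {a..b} w1" "\<And>x. 0 \<le> w1 x \<and> w1 x \<le> e"
    "\<And>c d K r. a \<le> c \<Longrightarrow> c \<le> d \<Longrightarrow> d \<le> b \<Longrightarrow> {c..d} \<subseteq> K \<union> W \<Longrightarrow> (\<forall>x\<in>K. slope_up r (\<lambda>x. f x - q * x) x) \<Longrightarrow>
           (f c - q * c) + w1 c \<le> (f d - q * d) + w1 d"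
    using d1(2)[OF W Wl Wm(1)] by blast
  obtain w2 where w2: "mono_on {a..b} w2" "\<And>x. 0 \<le> w2 x \<and> w2 x \<le> e"
    "\<And>c d K r. a \<le> c \<Longrightarrow> c \<le> d \<Longrightarrow> d \<le> b \<Longrightarrow> {c..d} \<subseteq> K \<union> W \<Longrightarrow> (\<forall>x\<in>K. slope_up r (\<lambda>x. p * x - f x) x) \<Longrightarrow>
           (p * c - f c) + w2 c \<le> (p * d - f d) + w2 d"
    using d2(2)[OF W Wl Wm(2)] by blast
  have Kab: "K \<subseteq> {a..b}" using K(2) by auto
  obtain N :: nat and J and t :: "nat \<Rightarrow> real" where t: "J \<subseteq> {..<N}"
    "\<And>i. i \<in> J \<Longrightarrow> {t i..t (Suc i)} \<subseteq> V" "measure lebesgue K \<le> (\<Sum>i\<in>J. t (Suc i) - t i)"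
    "t 0 = a" "t N = b" "\<And>i. t i < t (Suc i)"
    by (rule compact_grid_cover[OF K(1) Kab V(1,2) ab], rule that)
  have tab: "t i \<in> {a..b}" if "i \<le> N" for i using grid_in_interval[of t a N b] t that by blast
  have cell: "a \<le> t i" "t i \<le> t (Suc i)" "t (Suc i) \<le> b" "{t i..t (Suc i)} \<subseteq> K \<union> W" if "i \<in> J" for i
    using tab[of i] tab[of "Suc i"] t(1) t(2)[OF that] less_imp_le[OF t(6)] that by (auto simp: W_def)
  show thesis
  proof (rule that[OF t(1,4,5,6,3)])
    have "(\<Sum>i\<in>J. q * (t (Suc i) - t i) - (f (t (Suc i)) - f (t i))) \<le> (\<Sum>i\<in>J. w1 (t (Suc i)) - w1 (t i))"
    proof (rule sum_mono)
      fix i assume "i \<in> J"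
      note c = cell[of i, OF \<open>i \<in> J\<close>]
      have "(f (t i) - q * t i) + w1 (t i) \<le> (f (t (Suc i)) - q * t (Suc i)) + w1 (t (Suc i))"
        using w1(3)[of "t i" "t (Suc i)" K r, OF c] up(1) by blast
      then show "q * (t (Suc i) - t i) - (f (t (Suc i)) - f (t i)) \<le> w1 (t (Suc i)) - w1 (t i)"
        by (simp add: algebra_simps)
    qed
    also have "\<dots> \<le> e" by (rule sum_increments_le[of a b w1 e J N t, OF w1(1,2) t(1) tab t(6)])
    finally show "(\<Sum>i\<in>J. q * (t (Suc i) - t i) - (f (t (Suc i)) - f (t i))) \<le> e" .
  next
    assume low
    have "(\<Sum>i\<in>J. (f (t (Suc i)) - f (t i)) - p * (t (Suc i) - t i)) \<le> (\<Sum>i\<in>J. w2 (t (Suc i)) - w2 (t i))"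
    proof (rule sum_mono)
      fix i assume "i \<in> J"
      note c = cell[of i, OF \<open>i \<in> J\<close>]
      have "(p * t i - f (t i)) + w2 (t i) \<le> (p * t (Suc i) - f (t (Suc i))) + w2 (t (Suc i))"
        using w2(3)[of "t i" "t (Suc i)" K r', OF c] up(2) \<open>low\<close> by blast
      then show "(f (t (Suc i)) - f (t i)) - p * (t (Suc i) - t i) \<le> w2 (t (Suc i)) - w2 (t i)"
        by (simp add: algebra_simps)
    qed
    also have "\<dots> \<le> e" by (rule sum_increments_le[of a b w2 e J N t, OF w2(1,2) t(1) tab t(6)])
    finally show "(\<Sum>i\<in>J. (f (t (Suc i)) - f (t i)) - p * (t (Suc i) - t i)) \<le> e" .
  qed
qed

text \<open>On cells covering a compact part K of this set, f would rise both at rate at least q and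
  at rate at most p, up to e. This gives (q - p) times the measure of K at most e, for every
  e.\<close>

lemma ac_null_oscillation:
  fixes f :: "real \<Rightarrow> real"
  assumes ac: "abs_continuous_on a b f" and f: "continuous_on UNIV f" and ab: "a < b" and pq: "p < q"
  shows "negligible ({a<..<b} \<inter> slope_set f r q \<inter> slope_set (\<lambda>x. - f x) r' (- p))"
proof (rule negligible_if_compact_subsets_null[where a = a and b = b])
  show "{a<..<b} \<inter> slope_set f r q \<inter> slope_set (\<lambda>x. - f x) r' (- p) \<in> sets borel"
    by (intro sets.Int slope_set_borel f continuous_intros) auto
  fix K assume K: "compact K" "K \<subseteq> {a<..<b} \<inter> slope_set f r q \<inter> slope_set (\<lambda>x. - f x) r' (- p)"
  have "(q - p) * measure lebesgue K \<le> 0 + e" if e: "e > 0" for e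
  proof -
    have fc: "continuous_on {a..b} f" using continuous_on_subset[OF f] by auto
    have K': "K \<subseteq> {a<..<b}" using K by auto
    have low: "slope_up r' (\<lambda>x. p * x - f x) x \<or> \<not> True" if "x \<in> K" for x
      using slope_set_slope_up[of x "\<lambda>x. - f x" r' "- p"] K that by auto
    obtain J :: "nat set" and N and t :: "nat \<Rightarrow> real" where J: "J \<subseteq> {..<N}"
      "measure lebesgue K \<le> (\<Sum>i\<in>J. t (Suc i) - t i)"
      "(\<Sum>i\<in>J. q * (t (Suc i) - t i) - (f (t (Suc i)) - f (t i))) \<le> e / 2"
      "True \<Longrightarrow> (\<Sum>i\<in>J. (f (t (Suc i)) - f (t i)) - p * (t (Suc i) - t i)) \<le> e / 2"
    proof (rule ac_cells_compact[OF ac fc ab _ K(1) K', of "e / 2" r q r' p True])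
      show "slope_up r (\<lambda>x. f x - q * x) x" if "x \<in> K" for x
        using slope_set_slope_up[of x f r q] K(2) that by blast
    qed (use e low in auto)
    have "(q - p) * measure lebesgue K \<le> (q - p) * (\<Sum>i\<in>J. t (Suc i) - t i)"
      using J pq by (intro mult_left_mono) auto
    also have "\<dots> = (\<Sum>i\<in>J. q * (t (Suc i) - t i) - (f (t (Suc i)) - f (t i))) + (\<Sum>i\<in>J. (f (t (Suc i)) - f (t i)) - p * (t (Suc i) - t i))"
      by (simp add: sum_distrib_left sum.distrib[symmetric] algebra_simps)
    finally show ?thesis using J by simp
  qed
  then have "(q - p) * measure lebesgue K \<le> 0" by (rule field_le_epsilon)
  then show "measure lebesgue K = 0"
    using pq by (simp add: mult_le_0_iff) (metis antisym measure_nonneg not_le)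
qed auto

lemma slope_set_antimono: "p \<le> q \<Longrightarrow> slope_set f r q \<subseteq> slope_set f r p"
  unfolding slope_set_def
  by (auto; meson mult_right_mono less_imp_le order.strict_trans1 order_le_less_trans)

text \<open>On an interval so short that f varies by less than 1, a compact part K of the set
  satisfies n |K| \<le> 2 for every n: one unit comes from the variation, the other from the error
  allowed in the choice of cells.\<close>

lemma ac_null_infinite_slope:
  fixes f :: "real \<Rightarrow> real"
  assumes ac: "abs_continuous_on a b f" and f: "continuous_on UNIV f" and ab: "a < b"
  shows "negligible ({a<..<b} \<inter> (\<Inter>n::nat. slope_set f r n))"
proof -
  obtain \<delta> where \<delta>: "\<delta> > 0" 
    "\<And>(I :: nat set) u v. finite I \<Longrightarrow> (\<And>i. i \<in> I \<Longrightarrow> a \<le> u i \<and> u i \<le> v i \<and> v i \<le> b) \<Longrightarrow>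
        disjoint_family_on (\<lambda>i. {u i<..<v i}) I \<Longrightarrow> (\<Sum>i\<in>I. v i - u i) < \<delta> \<Longrightarrow>
        (\<Sum>i\<in>I. dist (f (u i)) (f (v i))) < 1"
    using ac_less[OF ac zero_less_one] by blast
  have local: "negligible ({c<..<d} \<inter> (\<Inter>n::nat. slope_set f r n))" if cd: "a \<le> c" "c < d" "d \<le> b" "d - c < \<delta>" for c d
  proof (rule negligible_if_compact_subsets_null[where a = a and b = b])
    show "{c<..<d} \<inter> (\<Inter>n::nat. slope_set f r n) \<in> sets borel"
      by (intro sets.Int sets.countable_INT' slope_set_borel f) (auto intro!: slope_set_borel f)
    fix K assume K: "compact K" "K \<subseteq> {c<..<d} \<inter> (\<Inter>n::nat. slope_set f r n)"
    have fc: "continuous_on {c..d} f" using continuous_on_subset[OF f] by auto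
    have K': "K \<subseteq> {c<..<d}" using K by auto
    have n: "real n * measure lebesgue K \<le> 2" for n
    proof -
      obtain J :: "nat set" and N and t :: "nat \<Rightarrow> real" where J: "J \<subseteq> {..<N}" "t 0 = c" "t N = d" "\<And>i. t i < t (Suc i)"
        "measure lebesgue K \<le> (\<Sum>i\<in>J. t (Suc i) - t i)"
        "(\<Sum>i\<in>J. real n * (t (Suc i) - t i) - (f (t (Suc i)) - f (t i))) \<le> 1"
      proof (rule ac_cells_compact[OF abs_continuous_on_subset[OF ac cd(1,3)] fc cd(2) zero_less_one K(1) K', of r "real n" r 0 False])
        show "slope_up r (\<lambda>x. f x - real n * x) x" if "x \<in> K" for x
          using slope_set_slope_up[of x f r "real n"] K(2) that by blast
      qed auto
      have tcd: "t i \<in> {c..d}" if "i \<le> N" for i using grid_in_interval[of t c N d] J that by blast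
      have "finite J" using J(1) finite_subset by blast
      have "mono t" using J(4) by (simp add: mono_iff_le_Suc less_imp_le)
      have "(\<Sum>i\<in>J. dist (f (t i)) (f (t (Suc i)))) < 1"
      proof (rule \<delta>(2)[OF \<open>finite J\<close>])
        show "a \<le> t i \<and> t i \<le> t (Suc i) \<and> t (Suc i) \<le> b" if "i \<in> J" for i
          using tcd[of i] tcd[of "Suc i"] that J(1) cd less_imp_le[OF J(4)] by auto
        show "disjoint_family_on (\<lambda>i. {t i<..<t (Suc i)}) J"
          unfolding disjoint_family_on_def
        proof (intro ballI impI)
          fix m n :: nat assume "m \<noteq> n"
          then consider "Suc m \<le> n" | "Suc n \<le> m" by linarith
          then show "{t m<..<t (Suc m)} \<inter> {t n<..<t (Suc n)} = {}"
            by cases (use monoD[OF \<open>mono t\<close>] in \<open>fastforce+\<close>)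
        qed
        have "(\<Sum>i\<in>J. t (Suc i) - t i) \<le> (\<Sum>i<N. t (Suc i) - t i)"
          using J(1) less_imp_le[OF J(4)] by (intro sum_mono2) auto
        also have "\<dots> = d - c" using J(2,3) by (simp add: sum_lessThan_telescope)
        finally show "(\<Sum>i\<in>J. t (Suc i) - t i) < \<delta>" using cd by simp
      qed
      moreover have "(\<Sum>i\<in>J. f (t (Suc i)) - f (t i)) \<le> (\<Sum>i\<in>J. dist (f (t i)) (f (t (Suc i))))"
        by (intro sum_mono) (simp add: dist_real_def)
      moreover have "real n * measure lebesgue K \<le> real n * (\<Sum>i\<in>J. t (Suc i) - t i)"
        using J by (intro mult_left_mono) auto
      moreover have "real n * (\<Sum>i\<in>J. t (Suc i) - t i) = (\<Sum>i\<in>J. real n * (t (Suc i) - t i) - (f (t (Suc i)) - f (t i))) + (\<Sum>i\<in>J. f (t (Suc i)) - f (t i))"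
        by (simp add: sum_distrib_left sum.distrib[symmetric])
      ultimately show ?thesis using J(6) by linarith
    qed
    show "measure lebesgue K = 0"
    proof (rule ccontr)
      assume "measure lebesgue K \<noteq> 0"
      then have pos: "measure lebesgue K > 0" using measure_nonneg[of lebesgue K] by linarith
      then obtain n :: nat where "2 / measure lebesgue K < n" using reals_Archimedean2 by blast
      then show False using n[of n] pos by (simp add: field_simps)
    qed
  qed (use cd in auto)
  \<comment> \<open>Intervals of length at most \<delta> / 2 with rational centres: countably many
    of them cover {a<..<b}.\<close>
  define I where "I c = {max a (c - \<delta> / 4)<..<min b (c + \<delta> / 4)}" for c
  have "negligible (I c \<inter> (\<Inter>n::nat. slope_set f r n))" for c
  proof (cases "max a (c - \<delta> / 4) < min b (c + \<delta> / 4)")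
    case True
    then show ?thesis unfolding I_def using \<delta>(1) by (intro local) (auto simp: max_def min_def)
  qed (auto simp: I_def)
  then have "negligible (\<Union>c\<in>\<rat>. I c \<inter> (\<Inter>n::nat. slope_set f r n))"
    by (intro negligible_countable_Union countable_image countable_rat) auto
  moreover have "{a<..<b} \<inter> (\<Inter>n::nat. slope_set f r n) \<subseteq> (\<Union>c\<in>\<rat>. I c \<inter> (\<Inter>n::nat. slope_set f r n))"
  proof
    fix x assume x: "x \<in> {a<..<b} \<inter> (\<Inter>n::nat. slope_set f r n)"
    obtain c where "c \<in> \<rat>" "x - \<delta> / 4 < c" "c < x + \<delta> / 4"
      using Rats_dense_in_real[of "x - \<delta> / 4" "x + \<delta> / 4"] \<delta>(1) by auto
    then have "x \<in> I c" using x by (auto simp: I_def)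
    then show "x \<in> (\<Union>c\<in>\<rat>. I c \<inter> (\<Inter>n::nat. slope_set f r n))" using x \<open>c \<in> \<rat>\<close> by blast
  qed
  ultimately show ?thesis by (rule negligible_subset)
qed

lemma slope_frequently:
  assumes "\<not> eventually (\<lambda>y. (f y - f x) / (y - x) \<le> q) (at (x :: real))"
  shows "x \<in> slope_set f True q \<or> x \<in> slope_set f False q"
proof (rule ccontr)
  assume "\<not> (x \<in> slope_set f True q \<or> x \<in> slope_set f False q)"
  then have neg: "x \<notin> slope_set f True q" "x \<notin> slope_set f False q" by auto
  obtain n :: nat where n: "\<And>h. h > 0 \<Longrightarrow> h < 1 / real (Suc n) \<Longrightarrow> f (x + h) - f x \<le> q * h"
    using neg(1) unfolding slope_set_def by (simp del: of_nat_Suc) (meson linorder_not_less)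
  obtain m :: nat where m: "\<And>h. h > 0 \<Longrightarrow> h < 1 / real (Suc m) \<Longrightarrow> f x - f (x - h) \<le> q * h"
    using neg(2) unfolding slope_set_def by (simp del: of_nat_Suc) (meson linorder_not_less)
  have "eventually (\<lambda>y. (f y - f x) / (y - x) \<le> q) (at x)"
    unfolding eventually_at
  proof (intro exI[of _ "min (1 / real (Suc n)) (1 / real (Suc m))"] conjI ballI impI)
    fix y assume y: "y \<noteq> x \<and> dist y x < min (1 / real (Suc n)) (1 / real (Suc m))"
    show "(f y - f x) / (y - x) \<le> q"
    proof (cases "y > x")
      case True
      then show ?thesis using n[of "y - x"] y by (simp add: dist_real_def pos_divide_le_eq)
    next
      case False
      then have "y < x" using y by simp
      then show ?thesis using m[of "x - y"] y by (simp add: dist_real_def neg_divide_le_eq) (simp add: algebra_simps)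
    qed
  qed auto
  then show False using assms by blast
qed

text \<open>If the upper limit of the difference quotients exceeded the lower one, rationals p < q
  would fit strictly between, and a bad pair of slope sets would contain x; the flags r and r'
  record from which side each limit is approached. So the limit exists in the extended reals, and
  the second hypothesis excludes infinite values.\<close>

lemma differentiable_if_no_bad_slopes:
  fixes f :: "real \<Rightarrow> real"
  assumes osc: "\<And>p q r r'. p \<in> \<rat> \<Longrightarrow> q \<in> \<rat> \<Longrightarrow> p < q \<Longrightarrow> x \<notin> slope_set f r q \<inter> slope_set (\<lambda>x. - f x) r' (- p)"
    and inf: "\<And>r. x \<notin> (\<Inter>n::nat. slope_set f r n)" "\<And>r. x \<notin> (\<Inter>n::nat. slope_set (\<lambda>x. - f x) r n)"
  shows "\<exists>D. (f has_real_derivative D) (at x)"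
proof -
  define s where "s y = (f y - f x) / (y - x)" for y
  define u where "u = Limsup (at x) (\<lambda>y. ereal (s y))"
  define l where "l = Liminf (at x) (\<lambda>y. ereal (s y))"
  have up: "x \<in> slope_set f True q \<or> x \<in> slope_set f False q" if "ereal q < u" for q
  proof (rule slope_frequently, rule notI)
    assume "\<forall>\<^sub>F y in at x. (f y - f x) / (y - x) \<le> q"
    then have "u \<le> ereal q" unfolding u_def s_def by (intro Limsup_bounded) simp
    then show False using that by simp
  qed
  have low: "x \<in> slope_set (\<lambda>x. - f x) True (- p) \<or> x \<in> slope_set (\<lambda>x. - f x) False (- p)" if "l < ereal p" for p
  proof (rule slope_frequently, rule notI)
    assume *: "\<forall>\<^sub>F y in at x. (- f y - - f x) / (y - x) \<le> - p"
    have "\<forall>\<^sub>F y in at x. ereal p \<le> ereal (s y)"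
      using * 
    proof eventually_elim
      case (elim y)
      have "(- f y - - f x) / (y - x) = - s y" unfolding s_def by (metis minus_diff_eq minus_divide_left minus_diff_minus)
      then show ?case using elim by simp
    qed
    then have "ereal p \<le> l" unfolding l_def by (intro Liminf_bounded)
    then show False using that by simp
  qed
  have lu: "l \<le> u" unfolding l_def u_def by (rule Liminf_le_Limsup) simp
  have "\<not> l < u"
  proof
    assume "l < u"
    then obtain p0 where p0: "l < ereal p0" "ereal p0 < u" using ereal_dense2 by blast
    then obtain q0 where q0: "ereal p0 < ereal q0" "ereal q0 < u" using ereal_dense2 by blast
    obtain p where p: "p \<in> \<rat>" "p0 < p" "p < q0" using Rats_dense_in_real q0 by auto
    obtain q where q: "q \<in> \<rat>" "p < q" "q < q0" using Rats_dense_in_real p by blast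
    have "l < ereal p" using p0 p by (meson less_ereal.simps(1) order.strict_trans)
    moreover have "ereal q < u" using q0 q by (meson less_ereal.simps(1) order.strict_trans)
    ultimately show False using up[of q] low[of p] osc[OF p(1) q(1,2)] by blast
  qed
  then have ul: "u = l" using lu by simp
  have anti: "x \<in> slope_set g r q \<Longrightarrow> p \<le> q \<Longrightarrow> x \<in> slope_set g r p" for g r p q
    using slope_set_antimono by blast
  have "u \<noteq> \<infinity>"
  proof
    assume "u = \<infinity>"
    then have a: "x \<in> slope_set f True q \<or> x \<in> slope_set f False q" for q using up[of q] by simp
    obtain n m :: nat where "x \<notin> slope_set f True n" "x \<notin> slope_set f False m" using inf(1) by blast
    then show False using a[of "max n m"] anti by (metis max.cobounded1 max.cobounded2 of_nat_max)
  qed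
  moreover have "u \<noteq> - \<infinity>"
  proof
    assume "u = - \<infinity>"
    then have a: "x \<in> slope_set (\<lambda>x. - f x) True q \<or> x \<in> slope_set (\<lambda>x. - f x) False q" for q
      using low[of "- q"] ul by simp
    obtain n m :: nat where "x \<notin> slope_set (\<lambda>x. - f x) True n" "x \<notin> slope_set (\<lambda>x. - f x) False m" using inf(2) by blast
    then show False using a[of "max n m"] anti by (metis max.cobounded1 max.cobounded2 of_nat_max)
  qed
  ultimately obtain D where D: "u = ereal D" by (cases u) auto
  have "((\<lambda>y. ereal (s y)) \<longlongrightarrow> ereal D) (at x)"
    by (subst tendsto_iff_Liminf_eq_Limsup) (use D ul in \<open>auto simp: u_def l_def\<close>)
  then have "(s \<longlongrightarrow> D) (at x)" by simp
  then show ?thesis unfolding has_field_derivative_iff s_def by blast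
qed

section \<open>Differentiability almost everywhere and the fundamental theorem\<close>

lemma ac_imp_continuous_on:
  assumes "abs_continuous_on a b g"
  shows "continuous_on {a..b} g"
  unfolding continuous_on_iff
proof (intro ballI allI impI)
  fix x e :: real assume x: "x \<in> {a..b}" and "e > 0"
  then obtain d where d: "d > 0" "\<And>(m::nat) u v. (\<forall>i<m. a \<le> u i \<and> u i \<le> v i \<and> v i \<le> b) \<Longrightarrow>
        disjoint_family_on (\<lambda>i. {u i<..<v i}) {..<m} \<Longrightarrow>
        (\<Sum>i<m. v i - u i) < d \<Longrightarrow> (\<Sum>i<m. dist (g (u i)) (g (v i))) < e"
    using assms[unfolded abs_continuous_on_def, rule_format, of e] by blast
  have one: "dist (g u) (g v) < e" if "a \<le> u" "u \<le> v" "v \<le> b" "v - u < d" for u v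
    using d(2)[of 1 "\<lambda>_. u" "\<lambda>_. v"] that by (simp add: disjoint_family_on_def)
  show "\<exists>d>0. \<forall>x'\<in>{a..b}. dist x' x < d \<longrightarrow> dist (g x') (g x) < e"
  proof (intro exI[of _ d] conjI ballI impI d(1))
    fix y assume "y \<in> {a..b}" "dist y x < d"
    then show "dist (g y) (g x) < e"
      using one[of x y] one[of y x] x by (cases "x \<le> y") (auto simp: dist_real_def dist_commute)
  qed
qed

text \<open>The bad points lie in a countable union of null sets: oscillation sets indexed by
  rational p < q and a choice of two sides, and sets of infinite slope for f and - f.\<close>

theorem ac_differentiable_ae:
  fixes f :: "real \<Rightarrow> real"
  assumes ac: "abs_continuous_on a b f" and ab: "a < b"
  shows "negligible {x \<in> {a<..<b}. \<not> (\<exists>D. (f has_real_derivative D) (at x))}"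
proof -
  \<comment> \<open>Measurability of the slope sets is proved for functions continuous on the whole
    line, so f is continued by its end values.\<close>
  define g where "g x = f (max a (min b x))" for x
  have gf: "g x = f x" if "x \<in> {a..b}" for x using that by (simp add: g_def)
  have gc: "continuous_on UNIV g" unfolding g_def
    by (rule continuous_on_compose2[OF ac_imp_continuous_on[OF ac]]) (use ab in \<open>auto intro!: continuous_intros\<close>)
  have gac: "abs_continuous_on a b g"
    by (rule abs_continuous_on_dominated[OF ac, where M = 1 and L = 0]) (auto simp: gf)
  have mgc: "continuous_on UNIV (\<lambda>x. - g x)" by (intro continuous_intros gc)
  have mgac: "abs_continuous_on a b (\<lambda>x. - g x)"
    by (rule abs_continuous_on_dominated[OF gac, where M = 1 and L = 0]) (auto simp: dist_real_def)
  define O1 where "O1 = (\<Union>(p, q, r, r')\<in>{(p, q, r, r'). p \<in> \<rat> \<and> q \<in> \<rat> \<and> p < q}. 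
     {a<..<b} \<inter> slope_set g r q \<inter> slope_set (\<lambda>x. - g x) r' (- p))"
  define O2 where "O2 = (\<Union>r. ({a<..<b} \<inter> (\<Inter>n::nat. slope_set g r n)) \<union> ({a<..<b} \<inter> (\<Inter>n::nat. slope_set (\<lambda>x. - g x) r n)))"
  have "countable {(p::real, q::real, r::bool, r'::bool). p \<in> \<rat> \<and> q \<in> \<rat> \<and> p < q}"
    by (rule countable_subset[of _ "\<rat> \<times> \<rat> \<times> UNIV \<times> UNIV"])
      (auto intro!: countable_SIGMA countable_rat)
  then have "negligible O1" unfolding O1_def
    by (intro negligible_countable_Union countable_image) (auto intro: ac_null_oscillation[OF gac gc ab])
  moreover have "negligible O2" unfolding O2_def
    using ac_null_infinite_slope[OF gac gc ab] ac_null_infinite_slope[OF mgac mgc ab]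
    by (intro negligible_countable_Union countable_image countable_finite) auto
  ultimately have "negligible (O1 \<union> O2)" by (rule negligible_Un)
  moreover have "{x \<in> {a<..<b}. \<not> (\<exists>D. (f has_real_derivative D) (at x))} \<subseteq> O1 \<union> O2"
  proof (intro subsetI, rule ccontr)
    fix x assume x: "x \<in> {x \<in> {a<..<b}. \<not> (\<exists>D. (f has_real_derivative D) (at x))}" "x \<notin> O1 \<union> O2"
    have "\<exists>D. (g has_real_derivative D) (at x)"
    proof (rule differentiable_if_no_bad_slopes)
      show "x \<notin> slope_set g r q \<inter> slope_set (\<lambda>x. - g x) r' (- p)" if "p \<in> \<rat>" "q \<in> \<rat>" "p < q" for p q r r'
        using x that unfolding O1_def by blast
      show "x \<notin> (\<Inter>n::nat. slope_set g r n)" "x \<notin> (\<Inter>n::nat. slope_set (\<lambda>x. - g x) r n)" for r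
        using x unfolding O2_def by blast+
    qed
    then obtain D where "(g has_real_derivative D) (at x)" by blast
    then have "(f has_real_derivative D) (at x)"
      by (rule has_field_derivative_transform_within_open[of _ _ _ "{a<..<b}"]) (use x gf in auto)
    then show False using x by blast
  qed
  ultimately show ?thesis by (rule negligible_subset)
qed

text \<open>A gauge argument. Tags at good points contribute at most e / 2 times the length by
  differentiability. Tags in the null set M are confined to an open set of measure below \<delta>,
  so by absolute continuity their increments add up to less than e / 2 times b - a.\<close>

theorem ac_fundamental_theorem:
  fixes f :: "real \<Rightarrow> real"
  assumes ac: "abs_continuous_on a b f" and ab: "a < b"
    and N: "negligible N" and g: "\<And>x. x \<in> {a<..<b} - N \<Longrightarrow> (f has_real_derivative g x) (at x)"
  shows "(g has_integral f b - f a) {a..b}"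
proof -
  define M where "M = N \<union> {a, b}"
  have M: "negligible M" using N unfolding M_def by (intro negligible_Un) auto
  \<comment> \<open>Vanishing on M, which contains both endpoints, leaves only the increments of f
    to be estimated for intervals tagged there.\<close>
  define g0 where "g0 x = (if x \<in> M then 0 else g x)" for x
  have "(g0 has_integral f b - f a) {a..b}"
    unfolding has_integral_factor_content_real
  proof (intro allI impI)
    fix e :: real assume e: "e > 0"
    define e1 where "e1 = e / 2"
    define e2 where "e2 = e / 2 * (b - a)"
    have e1: "e1 > 0" and e2: "e2 > 0" using e ab by (auto simp: e1_def e2_def)
    obtain \<delta> where \<delta>: "\<delta> > 0" 
      "\<And>(I :: (real \<times> real set) set) u v. finite I \<Longrightarrow> (\<And>i. i \<in> I \<Longrightarrow> a \<le> u i \<and> u i \<le> v i \<and> v i \<le> b) \<Longrightarrow>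
        disjoint_family_on (\<lambda>i. {u i<..<v i}) I \<Longrightarrow> (\<Sum>i\<in>I. v i - u i) < \<delta> \<Longrightarrow>
        (\<Sum>i\<in>I. dist (f (u i)) (f (v i))) < e2"
      using ac_less[OF ac e2] by blast
    obtain U where U: "open U" "M \<subseteq> U" "U - M \<in> lmeasurable" "emeasure lebesgue (U - M) < ennreal \<delta>"
      using sets_lebesgue_outer_open[OF negligible_imp_sets[OF M] \<delta>(1)] by blast
    have Ul: "U \<in> lmeasurable" and Um: "measure lebesgue U < \<delta>"
    proof -
      have Mm: "M \<in> lmeasurable" "measure lebesgue M = 0" using M by (simp_all add: negligible_iff_measure)
      have eq: "U = (U - M) \<union> M" using U(2) by blast
      show "U \<in> lmeasurable" by (subst eq) (intro fmeasurable.Un U Mm)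
      have "measure lebesgue U \<le> measure lebesgue (U - M) + measure lebesgue M"
        by (subst eq) (intro measure_Un_le fmeasurableD U Mm)
      moreover have "measure lebesgue (U - M) < \<delta>"
        using U(3,4) \<delta>(1) by (simp add: emeasure_eq_measure2 ennreal_less_iff)
      ultimately show "measure lebesgue U < \<delta>" using Mm by simp
    qed
    have "\<exists>r>0. \<forall>y. \<bar>y - x\<bar> < r \<longrightarrow> \<bar>f y - f x - g x * (y - x)\<bar> \<le> e1 * \<bar>y - x\<bar>" if x: "x \<in> {a..b} - M" for x
    proof -
      have "(f has_derivative (\<lambda>h. g x * h)) (at x)"
        using g[of x] x by (auto simp: M_def has_field_derivative_def)
      then show ?thesis using e1 unfolding has_derivative_at_alt by (auto simp: abs_mult)
    qed
    then obtain r where r: "\<And>x. x \<in> {a..b} - M \<Longrightarrow> r x > 0" 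
      "\<And>x y. x \<in> {a..b} - M \<Longrightarrow> \<bar>y - x\<bar> < r x \<Longrightarrow> \<bar>f y - f x - g x * (y - x)\<bar> \<le> e1 * \<bar>y - x\<bar>"
      by metis
    define G where "G x = (if x \<in> M then U else if x \<in> {a..b} then ball x (r x) else ball x 1)" for x
    have gauge: "gauge G" unfolding gauge_def G_def using U r(1) by auto
    show "\<exists>d. gauge d \<and> (\<forall>p. p tagged_division_of {a..b} \<and> d fine p \<longrightarrow>
        norm ((\<Sum>(x, k)\<in>p. measure lborel k *\<^sub>R g0 x) - (f b - f a)) \<le> e * measure lborel {a..b})"
    proof (intro exI[of _ G] conjI gauge allI impI)
      fix p assume p: "p tagged_division_of {a..b} \<and> G fine p"
      then have td: "p tagged_division_of {a..b}" and fine: "G fine p" by auto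
      have fin: "finite p" using td by blast
      define lo where "lo xk = Inf (snd xk)" for xk :: "real \<times> real set"
      define hi where "hi xk = Sup (snd xk)" for xk :: "real \<times> real set"
      have k: "fst xk \<in> {lo xk..hi xk} \<and> snd xk = {lo xk..hi xk} \<and> a \<le> lo xk \<and> lo xk \<le> hi xk \<and> hi xk \<le> b \<and> {lo xk..hi xk} \<subseteq> G (fst xk)"
        if "xk \<in> p" for xk
      proof -
        obtain x K where xk: "xk = (x, K)" by force
        have "x \<in> K" "K \<subseteq> {a..b}" "\<exists>c d. K = cbox c d" "K \<subseteq> G x"
          using tagged_division_ofD[OF td] fine that xk by (auto simp: fine_def)
        then obtain c d where K: "K = {c..d}" "x \<in> {c..d}" by auto
        then have "lo xk = c" "hi xk = d" by (auto simp: lo_def hi_def xk)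
        then show ?thesis using K xk \<open>K \<subseteq> {a..b}\<close> \<open>K \<subseteq> G x\<close> by auto
      qed
      have disj: "{lo xk<..<hi xk} \<inter> {lo yk<..<hi yk} = {}" if "xk \<in> p" "yk \<in> p" "xk \<noteq> yk" for xk yk
        using tagged_division_ofD(5)[OF td, of "fst xk" "snd xk" "fst yk" "snd yk"] k[OF that(1)] k[OF that(2)] that
        by (metis interior_atLeastAtMost_real prod.collapse)
      have tel: "(\<Sum>xk\<in>p. f (hi xk) - f (lo xk)) = f b - f a"
        using additive_tagged_division_1[OF less_imp_le[OF ab] td, of f] by (simp add: lo_def hi_def case_prod_beta)
      have len: "(\<Sum>xk\<in>p. hi xk - lo xk) = b - a"
        using additive_tagged_division_1[OF less_imp_le[OF ab] td, of "\<lambda>x. x"] by (simp add: lo_def hi_def case_prod_beta)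
      have content: "measure lborel (snd xk) = hi xk - lo xk" if "xk \<in> p" for xk using k[OF that] by simp
      define p1 where "p1 = {xk \<in> p. fst xk \<in> M}"
      define p2 where "p2 = {xk \<in> p. fst xk \<notin> M}"
      have pp: "p = p1 \<union> p2" "p1 \<inter> p2 = {}" "finite p1" "finite p2" using fin by (auto simp: p1_def p2_def)
      have "(\<Sum>xk\<in>p1. dist (f (lo xk)) (f (hi xk))) < e2"
      proof (rule \<delta>(2)[OF pp(3)])
        show "disjoint_family_on (\<lambda>i. {lo i<..<hi i}) p1"
          unfolding disjoint_family_on_def using disj by (auto simp: p1_def)
        then have "(\<Sum>i\<in>p1. hi i - lo i) \<le> measure lebesgue U"
        proof (intro sum_lengths_le_measure[OF pp(3) _ _ _ Ul])
          show "{lo i<..<hi i} \<subseteq> U" if "i \<in> p1" for i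
            using k[of i] that by (auto simp: p1_def G_def)
        qed (use k in \<open>auto simp: p1_def\<close>)
        then show "(\<Sum>i\<in>p1. hi i - lo i) < \<delta>" using Um by simp
      qed (use k in \<open>auto simp: p1_def\<close>)
      moreover have "\<bar>\<Sum>xk\<in>p1. f (hi xk) - f (lo xk)\<bar> \<le> (\<Sum>xk\<in>p1. dist (f (lo xk)) (f (hi xk)))"
        by (rule order_trans[OF sum_abs]) (simp add: dist_real_def abs_minus_commute)
      ultimately have b1: "\<bar>\<Sum>xk\<in>p1. f (hi xk) - f (lo xk)\<bar> \<le> e2" by linarith
      have "\<bar>\<Sum>xk\<in>p2. measure lborel (snd xk) * g0 (fst xk) - (f (hi xk) - f (lo xk))\<bar> \<le> (\<Sum>xk\<in>p2. e1 * (hi xk - lo xk))"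
      proof (rule order_trans[OF sum_abs], rule sum_mono)
        fix xk assume "xk \<in> p2"
        then have xk: "xk \<in> p" "fst xk \<notin> M" by (auto simp: p2_def)
        define x where "x = fst xk"
        have kk: "lo xk \<le> x" "x \<le> hi xk" "a \<le> lo xk" "hi xk \<le> b" "{lo xk..hi xk} \<subseteq> ball x (r x)"
          using k[OF xk(1)] xk(2) by (auto simp: x_def G_def split: if_splits)
        have xM: "x \<in> {a..b} - M" using kk xk(2) by (auto simp: x_def)
        have "hi xk \<in> ball x (r x)" "lo xk \<in> ball x (r x)"
          using subsetD[OF kk(5), of "hi xk"] subsetD[OF kk(5), of "lo xk"] kk(1,2) by auto
        then have near: "\<bar>hi xk - x\<bar> < r x" "\<bar>lo xk - x\<bar> < r x" by (auto simp: dist_real_def)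
        have "\<bar>f (hi xk) - f x - g x * (hi xk - x)\<bar> \<le> e1 * \<bar>hi xk - x\<bar>"
          "\<bar>f (lo xk) - f x - g x * (lo xk - x)\<bar> \<le> e1 * \<bar>lo xk - x\<bar>"
          using r(2)[OF xM near(1)] r(2)[OF xM near(2)] by auto
        then have "\<bar>(hi xk - lo xk) * g x - (f (hi xk) - f (lo xk))\<bar> \<le> e1 * (hi xk - lo xk)"
          using kk(1,2) by (simp add: algebra_simps)
        then show "\<bar>measure lborel (snd xk) * g0 (fst xk) - (f (hi xk) - f (lo xk))\<bar> \<le> e1 * (hi xk - lo xk)"
          using content[OF xk(1)] xk(2) by (simp add: g0_def x_def)
      qed
      also have "\<dots> \<le> (\<Sum>xk\<in>p. e1 * (hi xk - lo xk))"
        using k e1 pp fin by (intro sum_mono2) auto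
      also have "\<dots> = e1 * (b - a)" by (simp add: len flip: sum_distrib_left)
      finally have b2: "\<bar>\<Sum>xk\<in>p2. measure lborel (snd xk) * g0 (fst xk) - (f (hi xk) - f (lo xk))\<bar> \<le> e1 * (b - a)" .
      have "(\<Sum>(x, k)\<in>p. measure lborel k *\<^sub>R g0 x) - (f b - f a) = (\<Sum>xk\<in>p. measure lborel (snd xk) * g0 (fst xk) - (f (hi xk) - f (lo xk)))"
        by (simp add: sum_subtractf tel case_prod_beta flip: tel)
      also have "\<dots> = (\<Sum>xk\<in>p1. measure lborel (snd xk) * g0 (fst xk) - (f (hi xk) - f (lo xk))) + (\<Sum>xk\<in>p2. measure lborel (snd xk) * g0 (fst xk) - (f (hi xk) - f (lo xk)))"
        using pp by (simp add: sum.union_disjoint)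
      also have "(\<Sum>xk\<in>p1. measure lborel (snd xk) * g0 (fst xk) - (f (hi xk) - f (lo xk))) = (\<Sum>xk\<in>p1. - (f (hi xk) - f (lo xk)))"
        by (intro sum.cong) (auto simp: p1_def g0_def)
      finally have "\<bar>(\<Sum>(x, k)\<in>p. measure lborel k *\<^sub>R g0 x) - (f b - f a)\<bar> \<le> e2 + e1 * (b - a)"
        using b1 b2 unfolding sum_negf by linarith
      also have "\<dots> = e * measure lborel {a..b}" using ab by (simp add: e1_def e2_def algebra_simps)
      finally show "norm ((\<Sum>(x, k)\<in>p. measure lborel k *\<^sub>R g0 x) - (f b - f a)) \<le> e * measure lborel {a..b}" by simp
    qed
  qed
  then show ?thesis
    by (rule has_integral_spike[OF M, rotated]) (auto simp: g0_def)
qed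

section \<open>Curves of bounded speed\<close>

text \<open>The one-dimensional theorems are applied to each coordinate, the exceptional sets being
  united over the finite basis. At interior times the derivative within {0..T} is the two-sided
  one.\<close>

theorem ac_vector_derivative:
  fixes \<gamma> :: "real \<Rightarrow> 'a::euclidean_space"
  assumes ac: "abs_continuous_on 0 T \<gamma>" and T: "T > 0"
  obtains N where "negligible N"
    "\<And>s. s \<in> {0<..<T} - N \<Longrightarrow> (\<gamma> has_vector_derivative vector_derivative \<gamma> (at s within {0..T})) (at s)"
    "\<And>c d. 0 \<le> c \<Longrightarrow> c \<le> d \<Longrightarrow> d \<le> T \<Longrightarrow>
       ((\<lambda>s. vector_derivative \<gamma> (at s within {0..T})) has_integral \<gamma> d - \<gamma> c) {c..d}"
proof -
  have acb: "abs_continuous_on 0 T (\<lambda>s. \<gamma> s \<bullet> b)" if "b \<in> Basis" for b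
  proof (rule abs_continuous_on_dominated[OF ac, where M = 1 and L = 0])
    fix u v :: real
    have "\<bar>(\<gamma> u - \<gamma> v) \<bullet> b\<bar> \<le> norm (\<gamma> u - \<gamma> v)" using that by (rule Basis_le_norm)
    then show "dist (\<gamma> u \<bullet> b) (\<gamma> v \<bullet> b) \<le> 1 * dist (\<gamma> u) (\<gamma> v) + 0 * (v - u)"
      by (simp add: dist_norm inner_diff_left)
  qed auto
  define N where "N = (\<Union>b\<in>Basis. {x \<in> {0<..<T}. \<not> (\<exists>D. ((\<lambda>s. \<gamma> s \<bullet> b) has_real_derivative D) (at x))})"
  have N: "negligible N" unfolding N_def
    by (intro negligible_Union finite_imageI finite_Basis) (use ac_differentiable_ae[OF acb T] in blast)
  have der: "(\<gamma> has_vector_derivative vector_derivative \<gamma> (at s within {0..T})) (at s)"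
    if s: "s \<in> {0<..<T} - N" for s
  proof -
    have "\<forall>b\<in>Basis. \<exists>D. ((\<lambda>s. \<gamma> s \<bullet> b) has_real_derivative D) (at s)"
      using s unfolding N_def by blast
    then obtain D where D: "\<And>b. b \<in> Basis \<Longrightarrow> ((\<lambda>s. \<gamma> s \<bullet> b) has_real_derivative D b) (at s)" by metis
    have "(\<gamma> has_vector_derivative (\<Sum>b\<in>Basis. D b *\<^sub>R b)) (at s)"
      unfolding has_vector_derivative_def
    proof (subst has_derivative_componentwise_within, intro ballI)
      fix b :: 'a assume b: "b \<in> Basis"
      have "(\<lambda>x. x *\<^sub>R (\<Sum>b\<in>Basis. D b *\<^sub>R b) \<bullet> b) = (\<lambda>x. D b * x)"
        using b by (simp add: inner_sum_left inner_Basis if_distrib sum.delta' mult.commute cong: if_cong)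
      then show "((\<lambda>x. \<gamma> x \<bullet> b) has_derivative (\<lambda>x. x *\<^sub>R (\<Sum>b\<in>Basis. D b *\<^sub>R b) \<bullet> b)) (at s)"
        using D[OF b] by (simp add: has_field_derivative_def)
    qed
    moreover have "at s within {0..T} = at s" using s by (intro at_within_interior) auto
    ultimately show ?thesis by (simp add: vector_derivative_at)
  qed
  show thesis
  proof (rule that[OF N der])
    fix c d :: real assume cd: "0 \<le> c" "c \<le> d" "d \<le> T"
    show "((\<lambda>s. vector_derivative \<gamma> (at s within {0..T})) has_integral \<gamma> d - \<gamma> c) {c..d}"
    proof (cases "c = d")
      case False
      show ?thesis
        unfolding has_integral_componentwise_iff[where f = "\<lambda>s. vector_derivative \<gamma> (at s within {0..T})"] inner_diff_left
      proof
        fix b :: 'a assume b: "b \<in> Basis"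
        show "((\<lambda>x. vector_derivative \<gamma> (at x within {0..T}) \<bullet> b) has_integral \<gamma> d \<bullet> b - \<gamma> c \<bullet> b) {c..d}"
        proof (rule ac_fundamental_theorem[OF abs_continuous_on_subset[OF acb[OF b]] _ N])
          fix x assume "x \<in> {c<..<d} - N"
          then have "(\<gamma> has_vector_derivative vector_derivative \<gamma> (at x within {0..T})) (at x)"
            using cd by (intro der) auto
          then show "((\<lambda>s. \<gamma> s \<bullet> b) has_real_derivative vector_derivative \<gamma> (at x within {0..T}) \<bullet> b) (at x)"
            unfolding has_real_derivative_iff_has_vector_derivative
            by (rule bounded_linear.has_vector_derivative[OF bounded_linear_inner_left])
        qed (use cd False in auto)
      qed
    qed (simp add: has_integral_refl)
  qed
qed

text \<open>The velocity is carried along explicitly, since \<open>vector_derivative\<close> has no useful value at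
  the corners of a polygon.\<close>

definition nice_curve :: "real \<Rightarrow> real \<Rightarrow> (real \<Rightarrow> 'a::euclidean_space) \<Rightarrow> (real \<Rightarrow> 'a) \<Rightarrow> bool" where
  "nice_curve R t \<gamma> v \<longleftrightarrow> v \<in> borel_measurable borel \<and> (\<forall>s. norm (v s) \<le> R) \<and> continuous_on {0..t} \<gamma> \<and>
     (\<exists>S. finite S \<and> (\<forall>s\<in>{0<..<t} - S. (\<gamma> has_vector_derivative v s) (at s)))"

text \<open>The factor 1 / t is left out, so that the action is additive under concatenation and can
  serve as the cost in dynamic programming at all times t.\<close>

definition action :: "('a::euclidean_space \<Rightarrow> real) \<Rightarrow> 'a \<Rightarrow> real \<Rightarrow> (real \<Rightarrow> 'a) \<Rightarrow> (real \<Rightarrow> 'a) \<Rightarrow> real" where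
  "action X P t \<gamma> v = integral {0..t} (\<lambda>s. (norm (v s - P))\<^sup>2 / 2 - X (\<gamma> s))"

lemma nice_curveD:
  assumes "nice_curve R t \<gamma> v"
  shows "v \<in> borel_measurable borel" "norm (v s) \<le> R" "continuous_on {0..t} \<gamma>" "0 \<le> R"
proof -
  show "v \<in> borel_measurable borel" "norm (v s) \<le> R" "continuous_on {0..t} \<gamma>"
    using assms by (auto simp: nice_curve_def)
  then show "0 \<le> R" using norm_ge_zero order_trans by blast
qed

lemma nice_curve_mono: "nice_curve R t \<gamma> v \<Longrightarrow> R \<le> R' \<Longrightarrow> nice_curve R' t \<gamma> v"
  unfolding nice_curve_def using order_trans by blast

lemma nice_curve_has_integral:
  assumes n: "nice_curve R t \<gamma> v" and "0 \<le> c" "c \<le> d" "d \<le> t"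
  shows "(v has_integral \<gamma> d - \<gamma> c) {c..d}"
proof -
  obtain S where "finite S" "\<forall>s\<in>{0<..<t} - S. (\<gamma> has_vector_derivative v s) (at s)"
    using n by (auto simp: nice_curve_def)
  then show ?thesis
    using assms continuous_on_subset[OF nice_curveD(3)[OF n], of "{c..d}"]
    by (intro fundamental_theorem_of_calculus_interior_strong[of S]) auto
qed

lemma nice_curve_lipschitz:
  assumes n: "nice_curve R t \<gamma> v" and "0 \<le> c" "c \<le> d" "d \<le> t"
  shows "norm (\<gamma> d - \<gamma> c) \<le> R * (d - c)"
  using has_integral_bound_real[OF nice_curveD(4)[OF n] finite.emptyI nice_curve_has_integral[OF assms]]
    nice_curveD(2)[OF n] assms by auto

lemma nice_curve_ac: 
  assumes n: "nice_curve R t \<gamma> v"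
  shows "abs_continuous_on 0 t \<gamma>"
proof (rule abs_continuous_on_dominated[where g = "\<lambda>_. 0 :: real" and M = 0 and L = R])
  show "abs_continuous_on 0 t (\<lambda>_. 0 :: real)" unfolding abs_continuous_on_def by (auto intro: exI[of _ 1])
  show "dist (\<gamma> u) (\<gamma> v) \<le> 0 * dist 0 (0 :: real) + R * (v - u)" if "0 \<le> u" "u \<le> v" "v \<le> t" for u v
    using nice_curve_lipschitz[OF n that] by (simp add: dist_norm norm_minus_commute)
qed (use nice_curveD(4)[OF n] in auto)

section \<open>Integrability of the action and operations on curves\<close>

lemma bounded_borel_integrable_on:
  fixes f :: "real \<Rightarrow> 'b::euclidean_space"
  assumes f: "f \<in> borel_measurable borel" and B: "\<And>s. norm (f s) \<le> B"
  shows "set_integrable lborel {a..b} f" "f integrable_on {a..b}"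
proof -
  show "set_integrable lborel {a..b} f"
    unfolding set_integrable_def
  proof (rule Bochner_Integration.integrable_bound)
    show "integrable lborel (\<lambda>s. indicator {a..b} s *\<^sub>R B)"
      using borel_integrable_compact[of "{a..b}" "\<lambda>_. B"] by (simp add: set_integrable_def)
    show "(\<lambda>s. indicator {a..b} s *\<^sub>R f s) \<in> borel_measurable lborel" using f by measurable
    show "AE s in lborel. norm (indicator {a..b} s *\<^sub>R f s) \<le> norm (indicator {a..b} s *\<^sub>R B)"
      using B by (intro AE_I2) (auto split: split_indicator intro: order_trans[OF _ abs_ge_self])
  qed
  then show "f integrable_on {a..b}" by (rule set_borel_integral_eq_integral(1))
qed

lemma kinetic_borel_bounded:
  assumes n: "nice_curve R t \<gamma> v"
  shows "(\<lambda>s. (norm (v s - P))\<^sup>2 / 2) \<in> borel_measurable borel"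
    "norm ((norm (v s - P))\<^sup>2 / 2) \<le> (R + norm P)\<^sup>2 / 2"
proof -
  have [measurable]: "v \<in> borel_measurable borel" by (rule nice_curveD(1)[OF n])
  show "(\<lambda>s. (norm (v s - P))\<^sup>2 / 2) \<in> borel_measurable borel" by measurable
  have "norm (v s - P) \<le> R + norm P" using nice_curveD(2)[OF n, of s] norm_triangle_ineq4[of "v s" P] by linarith
  then show "norm ((norm (v s - P))\<^sup>2 / 2) \<le> (R + norm P)\<^sup>2 / 2" by (simp add: power_mono)
qed

lemma action_integrable:
  assumes n: "nice_curve R t \<gamma> v" and X: "continuous_on UNIV X" and ab: "0 \<le> a" "b \<le> t"
  shows "(\<lambda>s. (norm (v s - P))\<^sup>2 / 2) integrable_on {a..b}" "(\<lambda>s. X (\<gamma> s)) integrable_on {a..b}"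
    "(\<lambda>s. (norm (v s - P))\<^sup>2 / 2 - X (\<gamma> s)) integrable_on {a..b}"
proof -
  show 1: "(\<lambda>s. (norm (v s - P))\<^sup>2 / 2) integrable_on {a..b}"
    by (rule bounded_borel_integrable_on(2)[OF kinetic_borel_bounded[OF n]])
  show 2: "(\<lambda>s. X (\<gamma> s)) integrable_on {a..b}"
    using nice_curveD(3)[OF n] ab
    by (intro integrable_continuous_real continuous_on_compose2[OF X] continuous_on_subset[OF nice_curveD(3)[OF n]]) auto
  show "(\<lambda>s. (norm (v s - P))\<^sup>2 / 2 - X (\<gamma> s)) integrable_on {a..b}"
    by (intro integrable_diff 1 2)
qed

lemma nice_curve_const: "nice_curve 0 t (\<lambda>s. x) (\<lambda>s. 0)"
  by (auto simp: nice_curve_def intro!: exI[of _ "{}"])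

lemma nice_curve_subinterval:
  assumes n: "nice_curve R t \<gamma> v" and "t' \<le> t"
  shows "nice_curve R t' \<gamma> v"
proof -
  obtain S where "finite S" "\<forall>s\<in>{0<..<t} - S. (\<gamma> has_vector_derivative v s) (at s)"
    using n by (auto simp: nice_curve_def)
  then show ?thesis
    using assms continuous_on_subset[of "{0..t}" \<gamma> "{0..t'}"] by (auto simp: nice_curve_def intro!: exI[of _ S])
qed

lemma nice_curve_shift:
  assumes n: "nice_curve R t \<gamma> v"
  shows "nice_curve R t (\<lambda>s. \<gamma> s + a) v"
proof -
  obtain S where S: "finite S" "\<forall>s\<in>{0<..<t} - S. (\<gamma> has_vector_derivative v s) (at s)"
    using n by (auto simp: nice_curve_def)
  have "((\<lambda>s. \<gamma> s + a) has_vector_derivative v s) (at s)" if "s \<in> {0<..<t} - S" for s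
    using has_vector_derivative_add[OF S(2)[rule_format, OF that] has_vector_derivative_const[of a]] by simp
  then show ?thesis
    using n S(1) by (auto simp: nice_curve_def intro!: continuous_intros)
qed

lemma nice_curve_add_linear:
  assumes n: "nice_curve R t \<gamma> v"
  shows "nice_curve (R + norm w) t (\<lambda>s. \<gamma> s + a + s *\<^sub>R w) (\<lambda>s. v s + w)"
proof -
  obtain S where S: "finite S" "\<forall>s\<in>{0<..<t} - S. (\<gamma> has_vector_derivative v s) (at s)"
    using n by (auto simp: nice_curve_def)
  have "((\<lambda>s. \<gamma> s + a + s *\<^sub>R w) has_vector_derivative v s + w) (at s)" if "s \<in> {0<..<t} - S" for s
    using S(2)[rule_format, OF that] by (auto intro!: derivative_eq_intros)
  moreover have "norm (v s + w) \<le> R + norm w" for s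
    using nice_curveD(2)[OF n, of s] norm_triangle_ineq[of "v s" w] by linarith
  moreover have "(\<lambda>s. v s + w) \<in> borel_measurable borel" using nice_curveD(1)[OF n] by measurable
  ultimately show ?thesis
    using n S(1) by (auto simp: nice_curve_def intro!: continuous_intros)
qed

text \<open>Appending one straight segment is the only way in which curves are prolonged, both when
  polygons are built and in the dynamic programming step for the value function.\<close>

lemma nice_curve_concat:
  assumes n: "nice_curve R t \<gamma> v" and w: "norm w \<le> R" and th: "0 \<le> t" "0 \<le> h" and X: "continuous_on UNIV X"
  defines "\<gamma>' \<equiv> \<lambda>s. if s \<le> t then \<gamma> s else \<gamma> t + (s - t) *\<^sub>R w" and "v' \<equiv> \<lambda>s. if s \<le> t then v s else w"
  shows "nice_curve R (t + h) \<gamma>' v'" "\<gamma>' (t + h) = \<gamma> t + h *\<^sub>R w"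
    "action X P (t + h) \<gamma>' v' = action X P t \<gamma> v + integral {0..h} (\<lambda>s. (norm (w - P))\<^sup>2 / 2 - X (\<gamma> t + s *\<^sub>R w))"
proof -
  obtain S where S: "finite S" "\<forall>s\<in>{0<..<t} - S. (\<gamma> has_vector_derivative v s) (at s)"
    using n by (auto simp: nice_curve_def)
  have "(\<gamma>' has_vector_derivative v' s) (at s)" if s: "s \<in> {0<..<t + h} - insert t S" for s
  proof (cases "s < t")
    case True
    then have "(\<gamma> has_vector_derivative v' s) (at s)" using S(2) s by (auto simp: v'_def)
    then show ?thesis
      by (rule has_vector_derivative_transform_within_open[of _ _ _ "{..<t}"]) (use True in \<open>auto simp: \<gamma>'_def\<close>)
  next
    case False
    then have "s > t" using s by auto
    have "((\<lambda>s. \<gamma> t + (s - t) *\<^sub>R w) has_vector_derivative w) (at s)"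
      by (auto intro!: derivative_eq_intros)
    then have "(\<gamma>' has_vector_derivative w) (at s)"
      by (rule has_vector_derivative_transform_within_open[of _ _ _ "{t<..}"]) (use \<open>s > t\<close> in \<open>auto simp: \<gamma>'_def\<close>)
    then show ?thesis using \<open>s > t\<close> by (simp add: v'_def)
  qed
  moreover have "continuous_on {0..t + h} \<gamma>'"
  proof -
    have "continuous_on ({0..t} \<union> {t..t + h}) \<gamma>'"
      unfolding \<gamma>'_def
      by (rule continuous_on_cases) (use nice_curveD(3)[OF n] in \<open>auto intro!: continuous_intros\<close>)
    moreover have "{0..t} \<union> {t..t + h} = {0..t + h}" using th by auto
    ultimately show ?thesis by simp
  qed
  moreover have "v' \<in> borel_measurable borel" unfolding v'_def using nice_curveD(1)[OF n] by measurable
  moreover have "norm (v' s) \<le> R" for s using nice_curveD(2)[OF n] w by (simp add: v'_def)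
  ultimately show n': "nice_curve R (t + h) \<gamma>' v'"
    unfolding nice_curve_def using S(1) by (intro conjI allI exI[of _ "insert t S"]) auto
  show "\<gamma>' (t + h) = \<gamma> t + h *\<^sub>R w" using th by (auto simp: \<gamma>'_def)
  let ?F = "\<lambda>s. (norm (v' s - P))\<^sup>2 / 2 - X (\<gamma>' s)"
  have "action X P (t + h) \<gamma>' v' = integral {0..t} ?F + integral {t..t + h} ?F"
    unfolding action_def by (rule Henstock_Kurzweil_Integration.integral_combine[symmetric])
      (use th in \<open>auto intro: action_integrable[OF n' X]\<close>)
  moreover have "integral {0..t} ?F = action X P t \<gamma> v"
    unfolding action_def by (rule integral_cong) (auto simp: v'_def \<gamma>'_def)
  moreover have "integral {t..t + h} ?F = integral {0..h} (\<lambda>s. (norm (w - P))\<^sup>2 / 2 - X (\<gamma> t + s *\<^sub>R w))"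
  proof -
    have "integral {t..t + h} ?F = integral {t..t + h} (\<lambda>s. (norm (w - P))\<^sup>2 / 2 - X (\<gamma> t + (s - t) *\<^sub>R w))"
      by (rule integral_spike[of "{t}"]) (auto simp: v'_def \<gamma>'_def)
    also have "\<dots> = integral {0..h} (\<lambda>s. (norm (w - P))\<^sup>2 / 2 - X (\<gamma> t + s *\<^sub>R w))"
      using integral_shift_Icc_real[of 0 h "\<lambda>s. (norm (w - P))\<^sup>2 / 2 - X (\<gamma> t + (s - t) *\<^sub>R w)" t]
      by (simp add: add.commute o_def) 
    finally show ?thesis .
  qed
  ultimately show "action X P (t + h) \<gamma>' v' = action X P t \<gamma> v + integral {0..h} (\<lambda>s. (norm (w - P))\<^sup>2 / 2 - X (\<gamma> t + s *\<^sub>R w))"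
    by simp
qed

text \<open>The tangent plane of |.|^2 / 2 at w lies below the graph. This convexity inequality
  yields Jensen's inequality for polygons as well as the Legendre inequality along paths.\<close>

lemma inner_tangent_le:
  fixes a w :: "'a::real_inner"
  shows "(norm w)\<^sup>2 / 2 + w \<bullet> (a - w) \<le> (norm a)\<^sup>2 / 2"
proof -
  have "0 \<le> (norm (a - w))\<^sup>2" by simp
  also have "\<dots> = (norm a)\<^sup>2 + (norm w)\<^sup>2 - 2 * (a \<bullet> w)"
    by (simp add: power2_norm_eq_inner algebra_simps inner_commute)
  finally show ?thesis by (simp add: algebra_simps power2_norm_eq_inner inner_commute)
qed

text \<open>By Jensen's inequality, replacing a curve by an inscribed polygon does not increase its kinetic
  energy.\<close>

theorem polygon_approximation:
  fixes \<gamma> g :: "real \<Rightarrow> 'a::euclidean_space"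
  assumes T: "T > 0" and c: "continuous_on {0..T} \<gamma>" and X: "continuous_on UNIV X"
    and g: "\<And>c d. 0 \<le> c \<Longrightarrow> c \<le> d \<Longrightarrow> d \<le> T \<Longrightarrow> (g has_integral \<gamma> d - \<gamma> c) {c..d}"
    and E: "(\<lambda>s. (norm (g s - P))\<^sup>2 / 2 - X (\<gamma> s)) integrable_on {0..T}" and e: "e > 0"
  obtains R \<gamma>' v where "nice_curve R T \<gamma>' v" "\<gamma>' 0 = \<gamma> 0" "\<gamma>' T = \<gamma> T"
    "action X P T \<gamma>' v \<le> integral {0..T} (\<lambda>s. (norm (g s - P))\<^sup>2 / 2 - X (\<gamma> s)) + e"
proof -
  let ?F = "\<lambda>s. (norm (g s - P))\<^sup>2 / 2 - X (\<gamma> s)"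
  define e' where "e' = e / T"
  have e': "e' > 0" using e T by (simp add: e'_def)
  \<comment> \<open>A chord may leave the range of \<gamma>, but both stay in a ball, on which X is
    uniformly continuous.\<close>
  have "compact (\<gamma> ` {0..T})" by (intro compact_continuous_image c) auto
  then obtain B where B: "\<And>s. s \<in> {0..T} \<Longrightarrow> norm (\<gamma> s) \<le> B" using compact_imp_bounded bounded_iff by (metis image_eqI)
  have "uniformly_continuous_on (cball 0 B) X"
    by (intro compact_uniformly_continuous continuous_on_subset[OF X]) auto
  then obtain d1 where d1: "d1 > 0" "\<And>x y. x \<in> cball 0 B \<Longrightarrow> y \<in> cball 0 B \<Longrightarrow> dist x y < d1 \<Longrightarrow> dist (X x) (X y) < e'"
    using e' unfolding uniformly_continuous_on_def by metis
  have "uniformly_continuous_on {0..T} \<gamma>" by (intro compact_uniformly_continuous c) auto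
  then obtain d2 where d2: "d2 > 0" "\<And>s s'. s \<in> {0..T} \<Longrightarrow> s' \<in> {0..T} \<Longrightarrow> dist s s' < d2 \<Longrightarrow> dist (\<gamma> s) (\<gamma> s') < d1 / 2"
    using d1(1) unfolding uniformly_continuous_on_def by (metis half_gt_zero)
  obtain N :: nat where N': "max 1 (T / d2) < N" using reals_Archimedean2 by blast
  then have N: "N > 0" "T < N * d2" using d2(1) by (auto simp: pos_divide_less_eq)
  define \<tau> where "\<tau> = T / N"
  have \<tau>: "\<tau> > 0" "\<tau> < d2" "N * \<tau> = T" using N T by (auto simp: \<tau>_def pos_divide_less_eq mult.commute)
  \<comment> \<open>An error of e' = e / T per unit time is stable under the induction over the
    cells.\<close>
  have "\<exists>R \<gamma>' v. nice_curve R (k * \<tau>) \<gamma>' v \<and> \<gamma>' 0 = \<gamma> 0 \<and> \<gamma>' (k * \<tau>) = \<gamma> (k * \<tau>) \<and>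
      action X P (k * \<tau>) \<gamma>' v \<le> integral {0..k * \<tau>} ?F + e' * (k * \<tau>)" if "k \<le> N" for k :: nat
    using that
  proof (induction k)
    case 0
    then show ?case using nice_curve_const[of 0 "\<gamma> 0"] by (intro exI[of _ 0] exI[of _ "\<lambda>s. \<gamma> 0"] exI[of _ "\<lambda>s. 0"]) (simp add: action_def)
  next
    case (Suc k)
    define t where "t = k * \<tau>"
    have t: "0 \<le> t" "t + \<tau> = Suc k * \<tau>" using \<tau> by (auto simp: t_def algebra_simps)
    have tT: "t + \<tau> \<le> T" using Suc.prems \<tau> unfolding t(2) \<tau>(3)[symmetric] by (intro mult_right_mono) auto
    obtain R \<gamma>' v where IH: "nice_curve R t \<gamma>' v" "\<gamma>' 0 = \<gamma> 0" "\<gamma>' t = \<gamma> t" "action X P t \<gamma>' v \<le> integral {0..t} ?F + e' * t"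
      using Suc unfolding t_def by auto
    define w where "w = (\<gamma> (t + \<tau>) - \<gamma> t) /\<^sub>R \<tau>"
    define R' where "R' = max R (norm w)"
    have nR': "nice_curve R' t \<gamma>' v" using IH(1) by (rule nice_curve_mono) (simp add: R'_def)
    note con = nice_curve_concat[OF nR' _ t(1) less_imp_le[OF \<tau>(1)] X, of w, unfolded IH(3)]
    have wR: "norm w \<le> R'" by (simp add: R'_def)
    have Fint: "?F integrable_on {t..t + \<tau>}" using E t tT by (intro integrable_on_subinterval[OF E]) auto
    have seg: "integral {0..\<tau>} (\<lambda>s. (norm (w - P))\<^sup>2 / 2 - X (\<gamma> t + s *\<^sub>R w)) \<le> integral {t..t + \<tau>} ?F + e' * \<tau>"
    proof -
      have "(g has_integral \<tau> *\<^sub>R w) {t..t + \<tau>}" using g[of t "t + \<tau>"] t tT \<tau> by (simp add: w_def)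
      then have "((\<lambda>s. g s - w) has_integral \<tau> *\<^sub>R w - \<tau> *\<^sub>R w) {t..t + \<tau>}"
        using \<tau>(1) has_integral_const_real[of w t "t + \<tau>"] by (intro has_integral_diff) auto
      \<comment> \<open>On one cell w is the mean of g, so this linear term integrates to zero.
        Adding it turns the constant kinetic energy of the chord into the tangent of |.|^2 / 2 below
        that of g: Jensen's inequality in integrated form.\<close>
      then have z: "((\<lambda>s. (w - P) \<bullet> (g s - w)) has_integral 0) {t..t + \<tau>}"
        using has_integral_linear[OF _ bounded_linear_inner_right[of "w - P"], of "\<lambda>s. g s - w" 0 "{t..t + \<tau>}"] by (simp add: o_def)
      have Xi: "(\<lambda>s. X (\<gamma> s)) integrable_on {t..t + \<tau>}"
        using t tT by (intro integrable_continuous_real continuous_on_compose2[OF X] continuous_on_subset[OF c]) auto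
      have Xs: "(\<lambda>s. X (\<gamma> t + (s - t) *\<^sub>R w)) integrable_on {t..t + \<tau>}"
        by (intro integrable_continuous_real continuous_on_compose2[OF X] continuous_intros) auto
      have "integral {0..\<tau>} (\<lambda>s. (norm (w - P))\<^sup>2 / 2 - X (\<gamma> t + s *\<^sub>R w)) = integral {t..t + \<tau>} (\<lambda>s. (norm (w - P))\<^sup>2 / 2 - X (\<gamma> t + (s - t) *\<^sub>R w))"
        using integral_shift_Icc_real[of 0 \<tau> "\<lambda>s. (norm (w - P))\<^sup>2 / 2 - X (\<gamma> t + (s - t) *\<^sub>R w)" t]
        by (simp add: add.commute o_def)
      also have "\<dots> = integral {t..t + \<tau>} (\<lambda>s. ((norm (w - P))\<^sup>2 / 2 - X (\<gamma> t + (s - t) *\<^sub>R w)) + (w - P) \<bullet> (g s - w))"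
        by (subst integral_add[OF integrable_diff[OF _ Xs] has_integral_integrable[OF z]]) (auto simp: integral_unique[OF z])
      also have "\<dots> \<le> integral {t..t + \<tau>} (\<lambda>s. ?F s + e')"
      proof (rule integral_le)
        show "(\<lambda>s. ((norm (w - P))\<^sup>2 / 2 - X (\<gamma> t + (s - t) *\<^sub>R w)) + (w - P) \<bullet> (g s - w)) integrable_on {t..t + \<tau>}"
          using z Xs by (intro integrable_add integrable_diff) (auto intro: has_integral_integrable)
        show "(\<lambda>s. ?F s + e') integrable_on {t..t + \<tau>}" by (intro integrable_add Fint) auto
        fix s assume s: "s \<in> {t..t + \<tau>}"
        have "(norm (w - P))\<^sup>2 / 2 + (w - P) \<bullet> (g s - w) \<le> (norm (g s - P))\<^sup>2 / 2"
          using inner_tangent_le[of "w - P" "g s - P"] by simp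
        moreover have "dist (X (\<gamma> t + (s - t) *\<^sub>R w)) (X (\<gamma> s)) < e'"
        proof (rule d1(2))
          define \<theta> where "\<theta> = (s - t) / \<tau>"
          have \<theta>: "0 \<le> \<theta>" "\<theta> \<le> 1" using s \<tau> by (auto simp: \<theta>_def pos_divide_le_eq)
          have eq: "\<gamma> t + (s - t) *\<^sub>R w = (1 - \<theta>) *\<^sub>R \<gamma> t + \<theta> *\<^sub>R \<gamma> (t + \<tau>)"
            by (simp add: w_def \<theta>_def divide_inverse algebra_simps)
          have in01: "t \<in> {0..T}" "t + \<tau> \<in> {0..T}" "s \<in> {0..T}" using s t tT \<tau> by auto
          show "\<gamma> t + (s - t) *\<^sub>R w \<in> cball 0 B" unfolding eq
            using B in01 \<theta> by (intro convexD_alt[OF convex_cball]) auto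
          show "\<gamma> s \<in> cball 0 B" using B in01 by auto
          have "dist (\<gamma> t) (\<gamma> (t + \<tau>)) < d1 / 2" "dist (\<gamma> t) (\<gamma> s) < d1 / 2"
            using d2(2) in01 s \<tau> by (auto simp: dist_real_def)
          moreover have "dist (\<gamma> t) (\<gamma> t + (s - t) *\<^sub>R w) = \<theta> * dist (\<gamma> t) (\<gamma> (t + \<tau>))"
          proof -
            have "\<gamma> t + (s - t) *\<^sub>R w - \<gamma> t = \<theta> *\<^sub>R (\<gamma> (t + \<tau>) - \<gamma> t)" unfolding eq by (simp add: algebra_simps)
            then show ?thesis using \<theta> by (metis abs_of_nonneg dist_commute dist_norm norm_scaleR)
          qed
          moreover have "\<theta> * dist (\<gamma> t) (\<gamma> (t + \<tau>)) \<le> dist (\<gamma> t) (\<gamma> (t + \<tau>))" using \<theta> by (intro mult_left_le_one_le) auto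
          ultimately show "dist (\<gamma> t + (s - t) *\<^sub>R w) (\<gamma> s) < d1"
            using dist_triangle3[of "\<gamma> t + (s - t) *\<^sub>R w" "\<gamma> s" "\<gamma> t"] by linarith
        qed
        ultimately show "((norm (w - P))\<^sup>2 / 2 - X (\<gamma> t + (s - t) *\<^sub>R w)) + (w - P) \<bullet> (g s - w) \<le> ?F s + e'"
          by (simp add: dist_real_def abs_less_iff)
      qed
      also have "\<dots> = integral {t..t + \<tau>} ?F + e' * \<tau>"
        using \<tau>(1) by (subst integral_add[OF Fint]) (auto simp: mult.commute)
      finally show ?thesis .
    qed
    have "integral {0..t} ?F + integral {t..t + \<tau>} ?F = integral {0..t + \<tau>} ?F"
      using t tT \<tau> by (intro Henstock_Kurzweil_Integration.integral_combine integrable_on_subinterval[OF E]) auto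
    then have "action X P (t + \<tau>) (\<lambda>s. if s \<le> t then \<gamma>' s else \<gamma> t + (s - t) *\<^sub>R w) (\<lambda>s. if s \<le> t then v s else w)
        \<le> integral {0..t + \<tau>} ?F + e' * (t + \<tau>)"
      using con(3)[OF wR, of P] seg IH(4) by (simp add: algebra_simps)
    moreover have "\<gamma> t + \<tau> *\<^sub>R w = \<gamma> (t + \<tau>)" using \<tau> by (simp add: w_def)
    ultimately show ?case
      using con(1,2)[OF wR] t(1) IH(2) unfolding t(2)[symmetric]
      by (intro exI[of _ R'] exI[of _ "\<lambda>s. if s \<le> t then \<gamma>' s else \<gamma> t + (s - t) *\<^sub>R w"]
        exI[of _ "\<lambda>s. if s \<le> t then v s else w"]) simp
  qed
  from this[of N] show thesis
    using that e' T unfolding \<tau>(3) e'_def by auto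
qed

section \<open>The transport cost\<close>

text \<open>A gauge integral gives Lebesgue measurability of the integrand, whereas the action is an
  integral with respect to \<open>lborel\<close>. The velocity is replaced coordinate by coordinate
  by a Borel function equal to it almost everywhere.\<close>

lemma borel_version_of_has_integral:
  fixes g :: "real \<Rightarrow> 'a::euclidean_space"
  assumes "(g has_integral I) \<Omega>"
  obtains G where "G \<in> borel_measurable borel" "AE s in lborel. indicator \<Omega> s *\<^sub>R g s = G s"
proof -
  have "\<exists>h\<in>borel_measurable lborel. AE s in lborel. indicator \<Omega> s *\<^sub>R g s \<bullet> b = h s" for b
  proof (rule completion_ex_borel_measurable_real)
    show "(\<lambda>s. indicator \<Omega> s *\<^sub>R g s \<bullet> b) \<in> borel_measurable lebesgue"
      using has_integral_implies_lebesgue_measurable[OF assms] by measurable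
  qed
  then obtain h where h: "\<And>b. h b \<in> borel_measurable lborel" "\<And>b. AE s in lborel. indicator \<Omega> s *\<^sub>R g s \<bullet> b = h b s"
    by metis
  show thesis
  proof (rule that[of "\<lambda>s. \<Sum>b\<in>Basis. h b s *\<^sub>R b"])
    show "(\<lambda>s. \<Sum>b\<in>Basis. h b s *\<^sub>R b) \<in> borel_measurable borel"
      using h(1) by (intro borel_measurable_sum borel_measurable_scaleR) auto
    have "AE s in lborel. \<forall>b\<in>Basis. indicator \<Omega> s *\<^sub>R g s \<bullet> b = h b s"
      using h(2) by (intro AE_ball_countable[THEN iffD2] countable_finite finite_Basis) auto
    then show "AE s in lborel. indicator \<Omega> s *\<^sub>R g s = (\<Sum>b\<in>Basis. h b s *\<^sub>R b)"
    proof eventually_elim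
      case (elim s)
      have "indicator \<Omega> s *\<^sub>R g s = (\<Sum>b\<in>Basis. (indicator \<Omega> s *\<^sub>R g s \<bullet> b) *\<^sub>R b)"
        by (rule euclidean_representation[symmetric])
      then show ?case using elim by simp
    qed
  qed
qed

section \<open>Evaluation of the extended integral\<close>

lemma ext_integral_cong_AE:
  assumes "AE x in M. f x = g x"
  shows "ext_integral M f = ext_integral M g"
proof -
  have "(\<integral>\<^sup>+ x. e2ennreal (f x) \<partial>M) = (\<integral>\<^sup>+ x. e2ennreal (g x) \<partial>M)"
    by (rule nn_integral_cong_AE) (use assms in eventually_elim, simp)
  moreover have "(\<integral>\<^sup>+ x. e2ennreal (- f x) \<partial>M) = (\<integral>\<^sup>+ x. e2ennreal (- g x) \<partial>M)"
    by (rule nn_integral_cong_AE) (use assms in eventually_elim, simp)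
  ultimately show ?thesis by (simp add: ext_integral_def)
qed

lemma e2ennreal_ereal: "e2ennreal (ereal r) = ennreal r"
  by (simp add: ennreal.abs_eq[symmetric] e2ennreal_def ennreal_def)

lemma ext_integral_real:
  assumes "integrable M f"
  shows "ext_integral M (\<lambda>x. ereal (f x)) = ereal (\<integral>x. f x \<partial>M)"
proof -
  have fin: "(\<integral>\<^sup>+ x. ennreal (f x) \<partial>M) \<noteq> \<infinity>" "(\<integral>\<^sup>+ x. ennreal (- f x) \<partial>M) \<noteq> \<infinity>"
    using assms by (auto simp: real_integrable_def)
  have "enn2ereal x = ereal (enn2real x)" if "x \<noteq> \<infinity>" for x
    using that by (cases x) auto
  then show ?thesis
    using fin by (simp add: ext_integral_def e2ennreal_ereal real_lebesgue_integral_def[OF assms])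
qed

lemma ext_integral_infinite:
  assumes f: "f \<in> borel_measurable M" and neg: "(\<integral>\<^sup>+ x. ennreal (- f x) \<partial>M) < \<infinity>" and n: "\<not> integrable M f"
  shows "ext_integral M (\<lambda>x. ereal (f x)) = \<infinity>"
proof -
  have "(\<integral>\<^sup>+ x. ennreal (f x) \<partial>M) = \<infinity>" using f neg n by (auto simp: real_integrable_def)
  then show ?thesis using neg by (cases "\<integral>\<^sup>+ x. ennreal (- f x) \<partial>M") (auto simp: ext_integral_def e2ennreal_ereal)
qed

lemma torus_continuous_bounded:
  fixes f :: "'n::finite torus \<Rightarrow> real"
  assumes "continuous_on UNIV f"
  obtains B where "B > 0" "\<And>x. \<bar>f x\<bar> \<le> B"
proof -
  have "bounded (range f)" using compact_continuous_image[OF assms compact_torus] by (rule compact_imp_bounded)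
  then show thesis using that by (auto simp: bounded_pos)
qed

lemma torus_lift_continuous:
  assumes "continuous_on UNIV \<Xi>"
  shows "continuous_on S (\<lambda>x. \<Xi> (proj_torus x))"
  by (rule continuous_on_compose2[OF assms continuous_on_proj_torus]) auto

lemma torus_lift_uniformly_continuous:
  fixes \<Xi> :: "'n::finite torus \<Rightarrow> real"
  assumes "continuous_on UNIV \<Xi>" "e > 0"
  obtains d where "d > 0" "\<And>x y. dist x y < d \<Longrightarrow> \<bar>\<Xi> (proj_torus x) - \<Xi> (proj_torus y)\<bar> < e"
proof -
  obtain d where d: "d > 0" "\<And>x y. dist x y < d \<Longrightarrow> dist (\<Xi> x) (\<Xi> y) < e"
    using compact_uniformly_continuous[OF assms(1) compact_torus] assms(2)
    unfolding uniformly_continuous_on_def by (metis UNIV_I)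
  show thesis
  proof (rule that[of "d / (2 * pi)"])
    fix x y :: "real ^ 'n" assume "dist x y < d / (2 * pi)"
    then have "2 * pi * dist x y < d" by (simp add: pos_less_divide_eq mult.commute)
    then have "dist (proj_torus x) (proj_torus y) < d" using dist_proj_torus_le[of x y] by linarith
    then show "\<bar>\<Xi> (proj_torus x) - \<Xi> (proj_torus y)\<bar> < e" using d(2) by (simp add: dist_real_def)
  qed (use d in simp)
qed

lemma set_integrable_restrict_iff:
  fixes f :: "real \<Rightarrow> real"
  shows "integrable (restrict_space lborel {0..T}) f \<longleftrightarrow> set_integrable lborel {0..T} f"
  unfolding set_integrable_def by (rule integrable_restrict_space) simp

lemma integral_restrict_eq:
  fixes f :: "real \<Rightarrow> real"
  assumes "set_integrable lborel {0..T} f"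
  shows "(\<integral>s. f s \<partial>restrict_space lborel {0..T}) = integral {0..T} f"
proof -
  have "(\<integral>s. f s \<partial>restrict_space lborel {0..T}) = (LINT s:{0..T}|lborel. f s)"
    unfolding set_lebesgue_integral_def by (rule integral_restrict_space) simp
  then show ?thesis using set_borel_integral_eq_integral(2)[OF assms] by simp
qed

lemma action_set_integrable:
  assumes n: "nice_curve R T \<gamma> v" and X: "continuous_on UNIV X"
  shows "set_integrable lborel {0..T} (\<lambda>s. (norm (v s - P))\<^sup>2 / 2 - X (\<gamma> s))"
proof (rule set_integral_diff(1))
  show "set_integrable lborel {0..T} (\<lambda>s. (norm (v s - P))\<^sup>2 / 2)"
    by (rule bounded_borel_integrable_on(1)[OF kinetic_borel_bounded[OF n]])
  show "set_integrable lborel {0..T} (\<lambda>s. X (\<gamma> s))"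
    using continuous_on_compose2[OF X nice_curveD(3)[OF n]] by (intro borel_integrable_atLeastAtMost') auto
qed

text \<open>The prescribed velocity can differ from \<open>vector_derivative\<close> only at the
  finitely many corners and the two endpoints, a null set.\<close>

lemma lagrangian_action_nice_curve:
  fixes \<Xi> :: "'n::finite torus \<Rightarrow> real"
  assumes n: "nice_curve R T \<gamma> v" and T: "T > 0" and \<Xi>: "continuous_on UNIV \<Xi>"
    and x: "\<And>s. s \<in> {0..T} \<Longrightarrow> x s = proj_torus (\<gamma> s)"
  shows "lagrangian_action \<Xi> P T x \<gamma> = ereal (action (\<lambda>x. \<Xi> (proj_torus x)) P T \<gamma> v / T)"
proof -
  let ?f = "\<lambda>s. (norm (v s - P))\<^sup>2 / 2 - \<Xi> (proj_torus (\<gamma> s))"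
  obtain S where S: "finite S" "\<forall>s\<in>{0<..<T} - S. (\<gamma> has_vector_derivative v s) (at s)"
    using n by (auto simp: nice_curve_def)
  have "AE s in lborel. s \<notin> insert 0 (insert T S)"
    by (rule AE_not_in) (intro finite_imp_null_set_lborel, use S in auto)
  then have "AE s in lborel. s \<in> {0..T} \<longrightarrow> 
     ereal ((norm (vector_derivative \<gamma> (at s within {0..T}) - P))\<^sup>2 / 2 - \<Xi> (x s)) = ereal (?f s)"
  proof eventually_elim
    case (elim s)
    show ?case
    proof
      assume s: "s \<in> {0..T}"
      then have s': "s \<in> {0<..<T} - S" using elim by auto
      then have "at s within {0..T} = at s" by (intro at_within_interior) auto
      then have "vector_derivative \<gamma> (at s within {0..T}) = v s" using S(2) s' by (simp add: vector_derivative_at)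
      then show "ereal ((norm (vector_derivative \<gamma> (at s within {0..T}) - P))\<^sup>2 / 2 - \<Xi> (x s)) = ereal (?f s)"
        using x[OF s] by simp
    qed
  qed
  then have "AE s in restrict_space lborel {0..T}. 
     ereal ((norm (vector_derivative \<gamma> (at s within {0..T}) - P))\<^sup>2 / 2 - \<Xi> (x s)) = ereal (?f s)"
    by (subst AE_restrict_space_iff) auto
  then have "ext_integral (restrict_space lborel {0..T}) (\<lambda>s. ereal ((norm (vector_derivative \<gamma> (at s within {0..T}) - P))\<^sup>2 / 2 - \<Xi> (x s)))
    = ext_integral (restrict_space lborel {0..T}) (\<lambda>s. ereal (?f s))"
    by (rule ext_integral_cong_AE)
  also have "\<dots> = ereal (integral {0..T} ?f)"
    using action_set_integrable[OF n torus_lift_continuous[OF \<Xi>]]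
    by (subst ext_integral_real) (auto simp: set_integrable_restrict_iff integral_restrict_eq)
  finally show ?thesis by (simp add: lagrangian_action_def action_def)
qed

lemma nice_segment:
  "nice_curve (norm w) T (\<lambda>s. y + s *\<^sub>R w) (\<lambda>s. w)"
  using nice_curve_add_linear[OF nice_curve_const[of T y], of w 0] by simp

text \<open>The bridge from absolutely continuous curves to curves of bounded speed. If the
  Lagrangian is not integrable along the curve, the action is \<infinity>, because its negative part
  is bounded by a bound of \<Xi>, and the straight segment between the endpoints will do. Otherwise
  an inscribed polygon is fine enough.\<close>

lemma lagrangian_action_approx:
  fixes \<Xi> :: "'n::finite torus \<Rightarrow> real"
  assumes ac: "ac_curve_lift T x \<gamma>" and T: "T > 0" and \<Xi>: "continuous_on UNIV \<Xi>" and e: "e > 0"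
  obtains R \<gamma>' v where "nice_curve R T \<gamma>' v" "\<gamma>' 0 = \<gamma> 0" "\<gamma>' T = \<gamma> T"
    "ereal (action (\<lambda>x. \<Xi> (proj_torus x)) P T \<gamma>' v / T) \<le> lagrangian_action \<Xi> P T x \<gamma> + ereal e"
proof -
  let ?X = "\<lambda>x. \<Xi> (proj_torus x)"
  let ?M = "restrict_space lborel {0..T}"
  have acg: "abs_continuous_on 0 T \<gamma>" and x: "\<And>s. s \<in> {0..T} \<Longrightarrow> x s = proj_torus (\<gamma> s)"
    using ac by (auto simp: ac_curve_lift_def)
  define g where "g s = vector_derivative \<gamma> (at s within {0..T})" for s
  obtain N where g: "\<And>c d. 0 \<le> c \<Longrightarrow> c \<le> d \<Longrightarrow> d \<le> T \<Longrightarrow> (g has_integral \<gamma> d - \<gamma> c) {c..d}"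
    using ac_vector_derivative[OF acg T] unfolding g_def by metis
  obtain G where G: "G \<in> borel_measurable borel" "AE s in lborel. indicator {0..T} s *\<^sub>R g s = G s"
    using borel_version_of_has_integral[OF g[of 0 T]] T by auto
  obtain N' where N': "{s. indicator {0..T} s *\<^sub>R g s \<noteq> G s} \<subseteq> N'" "N' \<in> null_sets lborel"
    using G(2) unfolding eventually_ae_filter by auto
  have negl: "negligible N'" using N'(2) by (simp add: negligible_iff_null_sets null_sets_completionI)
  have gG: "g s = G s" if "s \<in> {0..T} - N'" for s
  proof -
    have "indicator {0..T} s *\<^sub>R g s = G s" using that N'(1) by blast
    then show ?thesis using that by simp
  qed
  have Gint: "(G has_integral \<gamma> d - \<gamma> c) {c..d}" if "0 \<le> c" "c \<le> d" "d \<le> T" for c d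
    by (rule has_integral_spike[OF negl _ g[OF that]]) (use gG that in auto)
  define h where "h s = (norm (G s - P))\<^sup>2 / 2 - ?X (\<gamma> s)" for s
  have cX: "continuous_on {0..T} (\<lambda>s. ?X (\<gamma> s))"
    by (rule continuous_on_compose2[OF torus_lift_continuous[OF \<Xi>] ac_imp_continuous_on[OF acg]]) auto
  have hM: "h \<in> borel_measurable ?M"
  proof -
    have "(\<lambda>s. ?X (\<gamma> s)) \<in> borel_measurable (restrict_space borel {0..T})"
      by (rule borel_measurable_continuous_on_restrict[OF cX])
    then have "(\<lambda>s. ?X (\<gamma> s)) \<in> borel_measurable ?M"
      by (simp cong: measurable_cong_sets sets_restrict_space_cong)
    moreover have "(\<lambda>s. (norm (G s - P))\<^sup>2 / 2) \<in> borel_measurable ?M"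
    proof (rule measurable_restrict_space1)
      have [measurable]: "G \<in> borel_measurable borel" by (rule G(1))
      show "(\<lambda>s. (norm (G s - P))\<^sup>2 / 2) \<in> borel_measurable lborel" by measurable
    qed
    ultimately show ?thesis unfolding h_def by (intro borel_measurable_diff)
  qed
  have "AE s in lborel. s \<in> {0..T} \<longrightarrow> ereal ((norm (vector_derivative \<gamma> (at s within {0..T}) - P))\<^sup>2 / 2 - \<Xi> (x s)) = ereal (h s)"
    using G(2)
  proof eventually_elim
    case (elim s)
    then show ?case using x by (auto simp: h_def g_def)
  qed
  then have "AE s in ?M. ereal ((norm (vector_derivative \<gamma> (at s within {0..T}) - P))\<^sup>2 / 2 - \<Xi> (x s)) = ereal (h s)"
    by (subst AE_restrict_space_iff) auto
  then have L: "lagrangian_action \<Xi> P T x \<gamma> = ereal (1 / T) * ext_integral ?M (\<lambda>s. ereal (h s))"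
    unfolding lagrangian_action_def by (simp only: ext_integral_cong_AE)
  show thesis
  proof (cases "integrable ?M h")
    case False
    obtain B where B: "B > 0" "\<And>x. \<bar>\<Xi> x\<bar> \<le> B" using torus_continuous_bounded[OF \<Xi>] by blast
    have "(\<integral>\<^sup>+ s. ennreal (- h s) \<partial>?M) \<le> (\<integral>\<^sup>+ s. ennreal B \<partial>?M)"
    proof (intro nn_integral_mono ennreal_leI)
      fix s
      have "0 \<le> (norm (G s - P))\<^sup>2 / 2" by simp
      then show "- h s \<le> B" using B(2)[of "proj_torus (\<gamma> s)"] unfolding h_def by linarith
    qed
    also have "\<dots> < \<infinity>" using T by (simp add: emeasure_restrict_space ennreal_mult_less_top)
    finally have "ext_integral ?M (\<lambda>s. ereal (h s)) = \<infinity>" by (intro ext_integral_infinite[OF hM] False)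
    then have inf: "lagrangian_action \<Xi> P T x \<gamma> = \<infinity>" using T by (simp add: L)
    show ?thesis
    proof (rule that[OF nice_segment[of "(\<gamma> T - \<gamma> 0) /\<^sub>R T" T "\<gamma> 0"]])
    qed (use T inf in auto)
  next
    case True
    then have si: "set_integrable lborel {0..T} h" by (simp add: set_integrable_restrict_iff)
    have Lr: "lagrangian_action \<Xi> P T x \<gamma> = ereal (integral {0..T} h / T)"
      using True si by (simp add: L ext_integral_real integral_restrict_eq)
    have hi: "(\<lambda>s. (norm (G s - P))\<^sup>2 / 2 - ?X (\<gamma> s)) integrable_on {0..T}"
      using set_borel_integral_eq_integral(1)[OF si] by (simp add: h_def[abs_def])
    have eT: "e * T > 0" using e T by simp
    obtain R \<gamma>' v where nc: "nice_curve R T \<gamma>' v" "\<gamma>' 0 = \<gamma> 0" "\<gamma>' T = \<gamma> T"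
      "action ?X P T \<gamma>' v \<le> integral {0..T} (\<lambda>s. (norm (G s - P))\<^sup>2 / 2 - ?X (\<gamma> s)) + e * T"
      by (rule polygon_approximation[where X = ?X and g = G and P = P and \<gamma> = \<gamma> and T = T and e = "e * T",
        OF T ac_imp_continuous_on[OF acg] torus_lift_continuous[OF \<Xi>] Gint _ eT]) (use hi in auto)
    have "action ?X P T \<gamma>' v / T \<le> (integral {0..T} h + e * T) / T"
      using nc(4) T by (intro divide_right_mono) (auto simp: h_def[abs_def])
    also have "\<dots> = integral {0..T} h / T + e" using T by (simp add: add_divide_distrib)
    finally show ?thesis using that[OF nc(1-3)] by (simp add: Lr)
  qed
qed

lemma action_lower_bound:
  assumes n: "nice_curve R T \<gamma> v" and T: "T > 0" and X: "continuous_on UNIV X" "\<And>x. \<bar>X x\<bar> \<le> B"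
  shows "integral {0..T} (\<lambda>s. (norm (v s - P))\<^sup>2 / 2) \<le> action X P T \<gamma> v + B * T" "- B * T \<le> action X P T \<gamma> v"
proof -
  note i = action_integrable(1)[OF n X(1) order_refl order_refl, of P] action_integrable(2)[OF n X(1) order_refl order_refl]
  have "integral {0..T} (\<lambda>s. X (\<gamma> s)) \<le> integral {0..T} (\<lambda>s. B)"
    using X(2) by (intro integral_le i) (auto simp: abs_le_iff)
  then show 1: "integral {0..T} (\<lambda>s. (norm (v s - P))\<^sup>2 / 2) \<le> action X P T \<gamma> v + B * T"
    using T by (simp add: action_def integral_diff[OF i(1,2)] mult.commute)
  have "0 \<le> integral {0..T} (\<lambda>s. (norm (v s - P))\<^sup>2 / 2)" by (intro integral_nonneg i) auto
  then show "- B * T \<le> action X P T \<gamma> v" using 1 by simp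
qed

section \<open>Bounds, near-minimisers and continuity of the cost\<close>

lemma A_cost_le_action:
  fixes \<Xi> :: "'n::finite torus \<Rightarrow> real"
  assumes n: "nice_curve R T \<gamma> v" and T: "T > 0" and \<Xi>: "continuous_on UNIV \<Xi>"
  shows "A_cost \<Xi> P (proj_torus (\<gamma> 0)) (proj_torus (\<gamma> T)) T \<le> ereal (action (\<lambda>x. \<Xi> (proj_torus x)) P T \<gamma> v / T)"
proof -
  have "ac_curve_lift T (\<lambda>s. proj_torus (\<gamma> s)) \<gamma>" using nice_curve_ac[OF n] by (simp add: ac_curve_lift_def)
  then show ?thesis
    unfolding A_cost_def lagrangian_action_nice_curve[OF n T \<Xi> refl, symmetric] by (intro Inf_lower) blast
qed

lemma nice_segment_action_le:
  assumes T: "T > 0" and X: "continuous_on UNIV X" "\<And>x. \<bar>X x\<bar> \<le> B"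
  shows "action X P T (\<lambda>s. y + s *\<^sub>R w) (\<lambda>s. w) \<le> ((norm (w - P))\<^sup>2 / 2 + B) * T"
proof -
  have "action X P T (\<lambda>s. y + s *\<^sub>R w) (\<lambda>s. w) \<le> integral {0..T} (\<lambda>s. (norm (w - P))\<^sup>2 / 2 + B)"
    unfolding action_def
  proof (rule integral_le)
    show "(\<lambda>s. (norm (w - P))\<^sup>2 / 2 - X (y + s *\<^sub>R w)) integrable_on {0..T}"
      by (rule action_integrable(3)[OF nice_segment X(1)]) auto
    show "(norm (w - P))\<^sup>2 / 2 - X (y + s *\<^sub>R w) \<le> (norm (w - P))\<^sup>2 / 2 + B" for s
      using X(2)[of "y + s *\<^sub>R w"] by linarith
  qed auto
  then show ?thesis using T by (simp add: mult.commute)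
qed

lemma norm_torus_sec_diff: "norm (torus_sec p - torus_sec q) \<le> CARD('n)" for p q :: "'n::finite torus"
proof -
  have "norm (torus_sec p - torus_sec q) \<le> (\<Sum>i\<in>UNIV. \<bar>(torus_sec p - torus_sec q) $ i\<bar>)" by (rule norm_le_l1_cart)
  also have "\<dots> \<le> (\<Sum>i\<in>(UNIV :: 'n set). 1)"
  proof (rule sum_mono)
    fix i
    show "\<bar>(torus_sec p - torus_sec q) $ i\<bar> \<le> 1"
      using torus_sec_bounds[of p i] torus_sec_bounds[of q i] by simp
  qed
  finally show ?thesis by simp
qed

text \<open>From below the action is bounded by - B, with B a bound of \<Xi>. From above one uses
  the straight segment between the representatives in the unit cube, whose speed is at most
  \<open>CARD('n) / T\<close>. Hence the cost is a real number.\<close>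

lemma A_cost_bounds:
  fixes \<Xi> :: "'n::finite torus \<Rightarrow> real"
  assumes T: "T > 0" and \<Xi>: "continuous_on UNIV \<Xi>"
  obtains K where "K > 0" "\<And>y z. ereal (- K) \<le> A_cost \<Xi> P y z T" "\<And>y z. A_cost \<Xi> P y z T \<le> ereal K"
proof -
  obtain B where B: "B > 0" "\<And>x. \<bar>\<Xi> x\<bar> \<le> B" using torus_continuous_bounded[OF \<Xi>] by blast
  define K where "K = (CARD('n) / T + norm P)\<^sup>2 / 2 + B"
  have "K > 0" using B by (simp add: K_def add_nonneg_pos)
  moreover have "ereal (- K) \<le> A_cost \<Xi> P y z T" for y z
  proof -
    have "ereal (- B) \<le> lagrangian_action \<Xi> P T x \<gamma>" if ac: "ac_curve_lift T x \<gamma>" for x \<gamma>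
    proof (rule ereal_le_epsilon2)
      fix e :: real assume e: "e > 0"
      obtain R \<gamma>' v where nc: "nice_curve R T \<gamma>' v"
        "ereal (action (\<lambda>x. \<Xi> (proj_torus x)) P T \<gamma>' v / T) \<le> lagrangian_action \<Xi> P T x \<gamma> + ereal e"
        by (rule lagrangian_action_approx[OF ac T \<Xi> e, of P])
      have "- B \<le> action (\<lambda>x. \<Xi> (proj_torus x)) P T \<gamma>' v / T"
        using action_lower_bound(2)[OF nc(1) T torus_lift_continuous[OF \<Xi>] B(2), of P] T by (simp add: pos_le_divide_eq)
      then show "ereal (- B) \<le> lagrangian_action \<Xi> P T x \<gamma> + ereal e" using nc(2) order_trans by (metis ereal_less_eq(3))
    qed
    then have "ereal (- B) \<le> A_cost \<Xi> P y z T" unfolding A_cost_def by (intro Inf_greatest) auto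
    moreover have "- K \<le> - B" by (simp add: K_def)
    ultimately show ?thesis by (metis ereal_less_eq(3) order_trans)
  qed
  moreover have "A_cost \<Xi> P y z T \<le> ereal K" for y z
  proof -
    define w where "w = (torus_sec z - torus_sec y) /\<^sub>R T"
    have w: "norm w \<le> CARD('n) / T"
      using norm_torus_sec_diff[of z y] T by (simp add: w_def divide_inverse mult.commute mult_left_mono)
    have "A_cost \<Xi> P y z T \<le> ereal (action (\<lambda>x. \<Xi> (proj_torus x)) P T (\<lambda>s. torus_sec y + s *\<^sub>R w) (\<lambda>s. w) / T)"
      using A_cost_le_action[OF nice_segment[of w T "torus_sec y"] T \<Xi>, of P] T by (simp add: w_def)
    also have "action (\<lambda>x. \<Xi> (proj_torus x)) P T (\<lambda>s. torus_sec y + s *\<^sub>R w) (\<lambda>s. w) / T \<le> (norm (w - P))\<^sup>2 / 2 + B"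
      using nice_segment_action_le[OF T torus_lift_continuous[OF \<Xi>] B(2), of P "torus_sec y" w] T by (simp add: pos_divide_le_eq)
    also have "\<dots> \<le> K"
    proof -
      have "norm (w - P) \<le> CARD('n) / T + norm P" using w norm_triangle_ineq4[of w P] by linarith
      then show ?thesis by (simp add: K_def power_mono)
    qed
    finally show ?thesis by simp
  qed
  ultimately show thesis by (rule that)
qed

text \<open>A near-minimiser comes with a lift starting somewhere over the initial point.
  Translating it by the vector k, which projects to 0, makes the lift start at the prescribed y and
  leaves the action unchanged.\<close>

lemma A_cost_approx:
  fixes \<Xi> :: "'n::finite torus \<Rightarrow> real"
  assumes T: "T > 0" and \<Xi>: "continuous_on UNIV \<Xi>" and e: "e > 0"
  obtains R \<gamma> v where "nice_curve R T \<gamma> v" "\<gamma> 0 = y" "proj_torus (\<gamma> T) = z"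
    "action (\<lambda>x. \<Xi> (proj_torus x)) P T \<gamma> v / T \<le> real_of_ereal (A_cost \<Xi> P (proj_torus y) z T) + e"
proof -
  obtain K where K: "ereal (- K) \<le> A_cost \<Xi> P (proj_torus y) z T" "A_cost \<Xi> P (proj_torus y) z T \<le> ereal K"
    using A_cost_bounds[OF T \<Xi>] by metis
  then obtain a where a: "A_cost \<Xi> P (proj_torus y) z T = ereal a" by (cases "A_cost \<Xi> P (proj_torus y) z T") auto
  then have "A_cost \<Xi> P (proj_torus y) z T < ereal (a + e / 2)" using e by simp
  then obtain x \<gamma> where x: "ac_curve_lift T x \<gamma>" "x 0 = proj_torus y" "x T = z" "lagrangian_action \<Xi> P T x \<gamma> < ereal (a + e / 2)"
    unfolding A_cost_def Inf_less_iff by blast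
  obtain R \<gamma>' v where nc: "nice_curve R T \<gamma>' v" "\<gamma>' 0 = \<gamma> 0" "\<gamma>' T = \<gamma> T"
    "ereal (action (\<lambda>x. \<Xi> (proj_torus x)) P T \<gamma>' v / T) \<le> lagrangian_action \<Xi> P T x \<gamma> + ereal (e / 2)"
    using lagrangian_action_approx[OF x(1) T \<Xi>, of "e / 2"] e by (metis half_gt_zero)
  have "lagrangian_action \<Xi> P T x \<gamma> + ereal (e / 2) \<le> ereal (a + e / 2) + ereal (e / 2)"
    using x(4) by (intro add_right_mono) auto
  with nc(4) have "ereal (action (\<lambda>x. \<Xi> (proj_torus x)) P T \<gamma>' v / T) \<le> ereal (a + e / 2) + ereal (e / 2)" by (rule order_trans)
  then have le: "action (\<lambda>x. \<Xi> (proj_torus x)) P T \<gamma>' v / T \<le> a + e" by simp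
  define k where "k = y - \<gamma>' 0"
  have "proj_torus (\<gamma>' 0) = proj_torus y" "proj_torus (\<gamma>' T) = z"
    using x T nc(2,3) by (auto simp: ac_curve_lift_def)
  note end_pts = this
  moreover have "proj_torus (\<gamma>' 0 + k) = proj_torus y" by (simp add: k_def)
  ultimately have "proj_torus k = 0" by (simp add: proj_torus_add)
  then have per: "proj_torus (u + k) = proj_torus u" for u by (simp add: proj_torus_add)
  show thesis
  proof (rule that[OF nice_curve_shift[OF nc(1), of k]])
    show "\<gamma>' 0 + k = y" by (simp add: k_def)
    show "proj_torus (\<gamma>' T + k) = z" using end_pts(2) by (simp add: per)
    show "action (\<lambda>x. \<Xi> (proj_torus x)) P T (\<lambda>s. \<gamma>' s + k) v / T \<le> real_of_ereal (A_cost \<Xi> P (proj_torus y) z T) + e"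
      using le by (simp add: action_def per a)
  qed
qed

text \<open>Adding the affine path from a to b moves the endpoints by a and b. The cross term u . w
  in the kinetic energy is absorbed by \<eta> (1 + |u|^2) / 2, so d depends on the curve only
  through the bound K on its action and not on its speed R. This makes the modulus of continuity of
  the cost uniform.\<close>

lemma nice_curve_perturb:
  fixes \<Xi> :: "'n::finite torus \<Rightarrow> real"
  assumes T: "T > 0" and \<Xi>: "continuous_on UNIV \<Xi>" and e: "e > 0"
  obtains d where "d > 0" "\<And>R (\<gamma> :: real \<Rightarrow> real ^ 'n) v a b. nice_curve R T \<gamma> v \<Longrightarrow> action (\<lambda>x. \<Xi> (proj_torus x)) P T \<gamma> v \<le> K \<Longrightarrow>
    norm a < d \<Longrightarrow> norm b < d \<Longrightarrow>
    action (\<lambda>x. \<Xi> (proj_torus x)) P T (\<lambda>s. \<gamma> s + a + s *\<^sub>R ((b - a) /\<^sub>R T)) (\<lambda>s. v s + (b - a) /\<^sub>R T)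
      \<le> action (\<lambda>x. \<Xi> (proj_torus x)) P T \<gamma> v + e"
proof -
  let ?X = "\<lambda>x. \<Xi> (proj_torus x)"
  obtain B where B: "B > 0" "\<And>x. \<bar>\<Xi> x\<bar> \<le> B" using torus_continuous_bounded[OF \<Xi>] by blast
  \<comment> \<open>The kinetic energy is at most \<bar>K\<bar> + B * T, and the constant part
    \<eta> of the pointwise error integrates to \<eta> * T. So the kinetic error is at most \<eta> *
    C \<le> e / 2, and the change of \<Xi> along the curve takes the other half.\<close>
  define C where "C = T + \<bar>K\<bar> + B * T + 1"
  have C: "C > 0" using T B by (simp add: C_def add_nonneg_pos add_pos_pos)
  obtain d1 where d1: "d1 > 0" "\<And>x y. dist x y < d1 \<Longrightarrow> \<bar>?X x - ?X y\<bar> < e / (2 * T)"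
    using torus_lift_uniformly_continuous[OF \<Xi>, of "e / (2 * T)"] e T by (metis divide_pos_pos mult_pos_pos zero_less_numeral)
  define \<eta> where "\<eta> = min 1 (e / (2 * C))"
  have \<eta>: "\<eta> > 0" "\<eta> \<le> 1" using e C by (auto simp: \<eta>_def)
  have "\<eta> * C \<le> e / (2 * C) * C" unfolding \<eta>_def using C by (intro mult_right_mono) auto
  then have \<eta>C: "\<eta> * C \<le> e / 2" using C by simp
  define d where "d = min d1 (\<eta> * T / 2)"
  have d: "d > 0" "d \<le> d1" "d \<le> \<eta> * T / 2" using d1 \<eta> T by (auto simp: d_def)
  show thesis
  proof (rule that[OF d(1)])
    fix R and \<gamma> v :: "real \<Rightarrow> real ^ 'n" and a b :: "real ^ 'n"
    assume n: "nice_curve R T \<gamma> v" and K: "action ?X P T \<gamma> v \<le> K" and ab: "norm a < d" "norm b < d"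
    define w where "w = (b - a) /\<^sub>R T"
    have "norm (b - a) \<le> \<eta> * T" using ab d norm_triangle_ineq4[of b a] by linarith
    moreover have "norm w = norm (b - a) / T" using T by (simp add: w_def divide_inverse mult.commute)
    ultimately have w: "norm w \<le> \<eta>" using T by (simp add: pos_divide_le_eq)
    note i = action_integrable(1)[OF n torus_lift_continuous[OF \<Xi>] order_refl order_refl, of P]
      action_integrable(2)[OF n torus_lift_continuous[OF \<Xi>] order_refl order_refl]
      action_integrable(3)[OF n torus_lift_continuous[OF \<Xi>] order_refl order_refl, of P]
    note n' = nice_curve_add_linear[OF n, of w a]
    have kin: "integral {0..T} (\<lambda>s. (norm (v s - P))\<^sup>2 / 2) \<le> \<bar>K\<bar> + B * T"
      using action_lower_bound(1)[OF n T torus_lift_continuous[OF \<Xi>] B(2), of P] K by linarith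
    have ptw: "(norm (v s + w - P))\<^sup>2 / 2 - ?X (\<gamma> s + a + s *\<^sub>R w)
        \<le> ((norm (v s - P))\<^sup>2 / 2 - ?X (\<gamma> s)) + (\<eta> * ((norm (v s - P))\<^sup>2 / 2) + (\<eta> + e / (2 * T)))"
      if s: "s \<in> {0..T}" for s
    proof -
      let ?u = "v s - P"
      have "v s + w - P = ?u + w" by simp
      then have "(norm (v s + w - P))\<^sup>2 = (norm ?u)\<^sup>2 + 2 * (?u \<bullet> w) + (norm w)\<^sup>2"
        by (simp only: power2_norm_eq_inner) (simp add: inner_add_left inner_add_right inner_commute)
      moreover have "?u \<bullet> w \<le> norm ?u * norm w" by (rule norm_cauchy_schwarz)
      moreover have "norm ?u * norm w \<le> (1 + (norm ?u)\<^sup>2) / 2 * \<eta>"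
      proof (intro mult_mono w)
        have "0 \<le> (norm ?u - 1)\<^sup>2" by simp
        then show "norm ?u \<le> (1 + (norm ?u)\<^sup>2) / 2" by (simp add: power2_eq_square algebra_simps)
      qed auto
      moreover have "(norm w)\<^sup>2 \<le> \<eta>"
      proof -
        have "norm w * norm w \<le> \<eta> * 1" using w \<eta> by (intro mult_mono) auto
        then show ?thesis by (simp add: power2_eq_square)
      qed
      moreover have "(1 + (norm ?u)\<^sup>2) / 2 * \<eta> = \<eta> / 2 + \<eta> * ((norm ?u)\<^sup>2 / 2)" by (simp add: field_simps)
      moreover have "\<bar>?X (\<gamma> s + a + s *\<^sub>R w) - ?X (\<gamma> s)\<bar> < e / (2 * T)"
      proof (rule d1(2))
        have eq: "a + s *\<^sub>R w = (1 - s / T) *\<^sub>R a + (s / T) *\<^sub>R b"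
          using T by (simp add: w_def algebra_simps divide_inverse)
        have "a + s *\<^sub>R w \<in> ball 0 d" unfolding eq
          using ab s T by (intro convexD_alt[OF convex_ball]) auto
        then have "norm (a + s *\<^sub>R w) < d1" using d by (simp only: mem_ball_0)
        then show "dist (\<gamma> s + a + s *\<^sub>R w) (\<gamma> s) < d1" by (simp add: dist_norm add.assoc)
      qed
      ultimately show ?thesis unfolding abs_less_iff by argo
    qed
    have "action ?X P T (\<lambda>s. \<gamma> s + a + s *\<^sub>R w) (\<lambda>s. v s + w)
      \<le> integral {0..T} (\<lambda>s. ((norm (v s - P))\<^sup>2 / 2 - ?X (\<gamma> s)) + (\<eta> * ((norm (v s - P))\<^sup>2 / 2) + (\<eta> + e / (2 * T))))"
      unfolding action_def
    proof (rule integral_le[OF action_integrable(3)[OF n' torus_lift_continuous[OF \<Xi>]]])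
      show "(\<lambda>s. ((norm (v s - P))\<^sup>2 / 2 - ?X (\<gamma> s)) + (\<eta> * ((norm (v s - P))\<^sup>2 / 2) + (\<eta> + e / (2 * T)))) integrable_on {0..T}"
        by (intro integrable_add i integrable_on_mult_right) auto
    qed (use ptw in auto)
    also have "\<dots> = action ?X P T \<gamma> v + (\<eta> * integral {0..T} (\<lambda>s. (norm (v s - P))\<^sup>2 / 2) + (\<eta> * T + e / 2))"
    proof -
      have c: "(\<lambda>s::real. \<eta> + e / (2 * T)) integrable_on {0..T}" by auto
      have m: "(\<lambda>s. \<eta> * ((norm (v s - P))\<^sup>2 / 2)) integrable_on {0..T}" by (intro integrable_on_mult_right i)
      have "integral {0..T} (\<lambda>s::real. \<eta> + e / (2 * T)) = \<eta> * T + e / 2" using T by (simp add: field_simps)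
      moreover have "integral {0..T} (\<lambda>s. \<eta> * ((norm (v s - P))\<^sup>2 / 2)) = \<eta> * integral {0..T} (\<lambda>s. (norm (v s - P))\<^sup>2 / 2)"
        by (rule integral_mult_right)
      ultimately show ?thesis
        unfolding action_def integral_add[OF i(3) integrable_add[OF m c]] integral_add[OF m c] by simp
    qed
    also have "\<eta> * integral {0..T} (\<lambda>s. (norm (v s - P))\<^sup>2 / 2) + (\<eta> * T + e / 2) \<le> e"
    proof -
      have "\<eta> * integral {0..T} (\<lambda>s. (norm (v s - P))\<^sup>2 / 2) \<le> \<eta> * (\<bar>K\<bar> + B * T)"
        using kin \<eta> by (intro mult_left_mono) auto
      moreover have "\<eta> * (\<bar>K\<bar> + B * T) + \<eta> * T \<le> \<eta> * C" using \<eta> unfolding C_def by (simp add: algebra_simps)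
      ultimately show ?thesis using \<eta>C by linarith
    qed
    finally show "action ?X P T (\<lambda>s. \<gamma> s + a + s *\<^sub>R ((b - a) /\<^sub>R T)) (\<lambda>s. v s + (b - a) /\<^sub>R T) \<le> action ?X P T \<gamma> v + e"
      by (simp add: w_def)
  qed
qed

text \<open>The preimage of the image is the union of all lattice translates of U.\<close>

lemma open_proj_image:
  fixes U :: "(real ^ 'n::finite) set"
  assumes "open U"
  shows "open (proj_torus ` U)"
proof -
  have "proj_torus -` (proj_torus ` U) = (\<Union>k\<in>{k. proj_torus k = 0}. (\<lambda>x. k + x) ` U)" (is "?L = ?R")
  proof (intro equalityI subsetI)
    fix x assume "x \<in> ?L"
    then obtain u where u: "u \<in> U" "proj_torus x = proj_torus u" by auto
    have "proj_torus (x - u) + proj_torus u = 0 + proj_torus u" using u(2) by (simp flip: proj_torus_add)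
    then have "proj_torus (x - u) = 0" by simp
    then show "x \<in> ?R" using u(1) by (intro UN_I[of "x - u"]) (auto simp: image_iff intro!: bexI[of _ u])
  qed (auto simp: proj_torus_add)
  then show ?thesis unfolding open_torus_iff using assms by (auto intro!: open_translation)
qed

lemma dist_torus_translation: "dist (p + c) (q + c) = dist p (q :: 'n::finite torus)"
proof -
  have "dist (cis (a + b)) (cis (a' + b)) = dist (cis a) (cis a')" for a a' b
  proof -
    have "cis (a + b) - cis (a' + b) = (cis a - cis a') * cis b" by (simp add: cis_mult algebra_simps)
    then show ?thesis by (simp add: dist_norm norm_mult)
  qed
  then have "dist (torus_emb (proj_torus (x + c))) (torus_emb (proj_torus (y + c))) = dist (torus_emb (proj_torus x)) (torus_emb (proj_torus y))"
    for x y c :: "real ^ 'n"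
    by (simp add: torus_emb_proj dist_vec_def distrib_left)
  from this[of "rep_torus p" "rep_torus c" "rep_torus q"] show ?thesis
    by (simp add: dist_torus_def proj_torus_add)
qed

text \<open>Openness of the projection at 0, spread by translation invariance of the metric, gives
  one \<eta> for all points. Closeness on the torus thereby becomes a small displacement in the
  cover.\<close>

lemma torus_near:
  assumes "d > 0"
  obtains \<eta> where "\<eta> > 0" "\<And>p q :: 'n::finite torus. dist p q < \<eta> \<Longrightarrow> \<exists>a. norm a < d \<and> q = p + proj_torus a"
proof -
  have "open (proj_torus ` ball (0 :: real ^ 'n) d)" by (intro open_proj_image open_ball)
  moreover have "(0 :: 'n torus) \<in> proj_torus ` ball 0 d" using assms
    by (intro image_eqI[of _ _ 0]) (auto simp: zero_torus.abs_eq)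
  ultimately obtain \<eta> where \<eta>: "\<eta> > 0" "ball (0 :: 'n torus) \<eta> \<subseteq> proj_torus ` ball 0 d" by (meson openE)
  show thesis
  proof (rule that[OF \<eta>(1)])
    fix p q :: "'n torus" assume "dist p q < \<eta>"
    then have "dist (0 + p) ((q - p) + p) < \<eta>" by simp
    then have "q - p \<in> ball 0 \<eta>" unfolding dist_torus_translation by simp
    then obtain a where "norm a < d" "q - p = proj_torus a" using \<eta>(2) by auto
    then show "\<exists>a. norm a < d \<and> q = p + proj_torus a" by (metis diff_add_cancel add.commute)
  qed
qed

definition A_real :: "('n::finite torus \<Rightarrow> real) \<Rightarrow> real ^ 'n \<Rightarrow> real \<Rightarrow> 'n torus \<Rightarrow> 'n torus \<Rightarrow> real" where
  "A_real \<Xi> P T y z = real_of_ereal (A_cost \<Xi> P y z T)"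

lemma A_cost_eq_A_real:
  assumes "T > 0" "continuous_on UNIV \<Xi>"
  shows "A_cost \<Xi> P y z T = ereal (A_real \<Xi> P T y z)"
proof -
  obtain K where "ereal (- K) \<le> A_cost \<Xi> P y z T" "A_cost \<Xi> P y z T \<le> ereal K"
    using A_cost_bounds[OF assms] by metis
  then show ?thesis by (cases "A_cost \<Xi> P y z T") (auto simp: A_real_def)
qed

text \<open>Bending a near-minimiser to neighbouring endpoints bounds the neighbouring cost from
  above, with an \<eta> that is the same everywhere. Exchanging the two pairs of endpoints gives the
  reverse bound, so the cost is even uniformly continuous.\<close>

lemma A_real_continuous:
  fixes \<Xi> :: "'n::finite torus \<Rightarrow> real"
  assumes T: "T > 0" and \<Xi>: "continuous_on UNIV \<Xi>"
  shows "continuous_on UNIV (\<lambda>(y, z). A_real \<Xi> P T y z)"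
proof -
  let ?X = "\<lambda>x. \<Xi> (proj_torus x)"
  obtain K where K: "K > 0" "\<And>y z. A_cost \<Xi> P y z T \<le> ereal K"
    using A_cost_bounds[OF T \<Xi>] by metis
  have "\<exists>\<eta>>0. \<forall>y z y' z'. dist y y' < \<eta> \<longrightarrow> dist z z' < \<eta> \<longrightarrow> A_real \<Xi> P T y' z' < A_real \<Xi> P T y z + e" if e: "e > 0" for e
  proof -
    obtain d where d: "d > 0" "\<And>R \<gamma> v a b. nice_curve R T \<gamma> v \<Longrightarrow> action ?X P T \<gamma> v \<le> (K + e) * T \<Longrightarrow>
      norm a < d \<Longrightarrow> norm b < d \<Longrightarrow>
      action ?X P T (\<lambda>s. \<gamma> s + a + s *\<^sub>R ((b - a) /\<^sub>R T)) (\<lambda>s. v s + (b - a) /\<^sub>R T) \<le> action ?X P T \<gamma> v + e / 3 * T"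
      using nice_curve_perturb[OF T \<Xi>, of "e / 3 * T" P "(K + e) * T"] e T by (auto simp: mult_pos_pos)
    obtain \<eta> where \<eta>: "\<eta> > 0" "\<And>p q :: 'n torus. dist p q < \<eta> \<Longrightarrow> \<exists>a. norm a < d \<and> q = p + proj_torus a"
      using torus_near[OF d(1)] by blast
    have "A_real \<Xi> P T y' z' < A_real \<Xi> P T y z + e" if near: "dist y y' < \<eta>" "dist z z' < \<eta>" for y z y' z'
    proof -
      obtain a b where ab: "norm a < d" "y' = y + proj_torus a" "norm b < d" "z' = z + proj_torus b"
        using \<eta>(2) near by meson
      obtain R \<gamma> v where n: "nice_curve R T \<gamma> v" "\<gamma> 0 = torus_sec y" "proj_torus (\<gamma> T) = z"
        "action ?X P T \<gamma> v / T \<le> A_real \<Xi> P T y z + e / 3"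
        using A_cost_approx[OF T \<Xi>, of "e / 3" "torus_sec y" z P] e by (auto simp: A_real_def)
      have "A_real \<Xi> P T y z \<le> K" using K(2)[of y z] by (simp add: A_cost_eq_A_real[OF T \<Xi>])
      then have "action ?X P T \<gamma> v / T \<le> K + e" using n(4) e by linarith
      then have "action ?X P T \<gamma> v \<le> (K + e) * T" using T by (simp add: pos_divide_le_eq)
      note p = d(2)[OF n(1) this ab(1,3)]
      have "A_real \<Xi> P T y' z' \<le> action ?X P T (\<lambda>s. \<gamma> s + a + s *\<^sub>R ((b - a) /\<^sub>R T)) (\<lambda>s. v s + (b - a) /\<^sub>R T) / T"
        using A_cost_le_action[OF nice_curve_add_linear[OF n(1), where a = a and w = "(b - a) /\<^sub>R T"] T \<Xi>, of P] T n(2,3) ab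
        by (simp add: A_cost_eq_A_real[OF T \<Xi>] proj_torus_add algebra_simps)
      also have "\<dots> \<le> (action ?X P T \<gamma> v + e / 3 * T) / T" using p T by (intro divide_right_mono) auto
      also have "\<dots> = action ?X P T \<gamma> v / T + e / 3" using T by (simp add: add_divide_distrib)
      finally show ?thesis using n(4) e by linarith
    qed
    then show ?thesis using \<eta>(1) by blast
  qed note near = this
  have "uniformly_continuous_on UNIV (\<lambda>(y, z). A_real \<Xi> P T y z)"
    unfolding uniformly_continuous_on_def
  proof (intro allI impI)
    fix e :: real assume "e > 0"
    then obtain \<eta> where \<eta>: "\<eta> > 0" "\<And>y z y' z'. dist y y' < \<eta> \<Longrightarrow> dist z z' < \<eta> \<Longrightarrow> A_real \<Xi> P T y' z' < A_real \<Xi> P T y z + e"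
      using near by metis
    show "\<exists>d>0. \<forall>x\<in>UNIV. \<forall>x'\<in>UNIV. dist x' x < d \<longrightarrow>
      dist ((\<lambda>(y, z). A_real \<Xi> P T y z) x') ((\<lambda>(y, z). A_real \<Xi> P T y z) x) < e"
    proof (intro exI[of _ \<eta>] conjI ballI impI \<eta>(1))
      fix x x' :: "'n torus \<times> 'n torus" assume d: "dist x' x < \<eta>"
      have "dist (fst x') (fst x) < \<eta>" "dist (snd x') (snd x) < \<eta>"
        using d dist_fst_le[of x' x] dist_snd_le[of x' x] by linarith+
      then show "dist ((\<lambda>(y, z). A_real \<Xi> P T y z) x') ((\<lambda>(y, z). A_real \<Xi> P T y z) x) < e"
        using \<eta>(2)[of "fst x" "fst x'" "snd x" "snd x'"] \<eta>(2)[of "fst x'" "fst x" "snd x'" "snd x"]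
        by (auto simp: case_prod_beta dist_real_def dist_commute abs_less_iff)
    qed
  qed
  then show ?thesis by (rule uniformly_continuous_imp_continuous)
qed

section \<open>A square-filling curve on the torus\<close>

text \<open>The auxiliary function of Schoenberg's curve: equal to 0 on [0, 1/3], to 1 on [2/3, 1],
  and of period 2. The truncated cosine provides the periodicity.\<close>

definition plateau :: "real \<Rightarrow> real" where
  "plateau x = max 0 (min 1 (1 / 2 - cos (pi * x)))"

text \<open>Schoenberg's construction: the binary digits of the \<open>i\<close>-th coordinate are read off the ternary
  digits of \<open>t\<close> at the positions \<open>prod_encode (i, k)\<close>.\<close>

definition schoenberg :: "nat \<Rightarrow> real \<Rightarrow> real" where
  "schoenberg i t = (\<Sum>k. (1 / 2) ^ Suc k * plateau (3 ^ prod_encode (i, k) * t))"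

lemma continuous_on_schoenberg: "continuous_on UNIV (schoenberg i)"
proof -
  have "uniform_limit UNIV (\<lambda>n t. \<Sum>k<n. (1 / 2) ^ Suc k * plateau (3 ^ prod_encode (i, k) * t))
    (\<lambda>t. \<Sum>k. (1 / 2) ^ Suc k * plateau (3 ^ prod_encode (i, k) * t)) sequentially"
  proof (rule Weierstrass_m_test)
    show "summable (\<lambda>k. (1 / 2 :: real) ^ Suc k)" by (simp add: summable_geometric)
    show "norm ((1 / 2) ^ Suc k * plateau (3 ^ prod_encode (i, k) * t)) \<le> (1 / 2) ^ Suc k" for k t
      by (auto simp: plateau_def abs_mult intro!: mult_left_le)
  qed
  then show ?thesis unfolding schoenberg_def[abs_def]
    by (rule uniform_limit_theorem[rotated])
      (auto simp: plateau_def intro!: always_eventually continuous_intros)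
qed

lemma plateau_shift: "plateau (2 * real m + r) = plateau r"
proof -
  have "cos (pi * (2 * real m + r)) = cos (pi * r + 2 * real m * pi)" by (simp add: algebra_simps)
  also have "\<dots> = cos (pi * r)" by (simp add: cos_add)
  finally show ?thesis by (simp add: plateau_def)
qed

lemma plateau_0: "0 \<le> r \<Longrightarrow> r \<le> 1 / 3 \<Longrightarrow> plateau r = 0"
proof -
  assume r: "0 \<le> r" "r \<le> 1 / 3"
  then have "cos (pi / 3) \<le> cos (pi * r)" by (intro cos_monotone_0_pi_le) auto
  then show ?thesis by (simp add: plateau_def cos_60)
qed

lemma plateau_1: "2 / 3 \<le> r \<Longrightarrow> r \<le> 1 \<Longrightarrow> plateau r = 1"
proof -
  assume r: "2 / 3 \<le> r" "r \<le> 1"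
  have "pi * (2 / 3) \<le> pi * r" using r by (intro mult_left_mono) auto
  then have "cos (pi * r) \<le> cos (2 * pi / 3)" using r by (intro cos_monotone_0_pi_le) auto
  also have "cos (2 * pi / 3) = - 1 / 2" using cos_120 by simp
  finally show ?thesis by (simp add: plateau_def)
qed

text \<open>For a 0-1 sequence \<open>a\<close> this is a point of the Cantor set. Since its ternary
  digits are even, multiplication by a power of 3 yields an even integer plus the shifted point, and
  the period 2 of \<open>plateau\<close> removes the integer.\<close>

definition ternary :: "(nat \<Rightarrow> nat) \<Rightarrow> real" where
  "ternary a = (\<Sum>l. 2 * real (a l) / 3 ^ Suc l)"

lemma ternary_summable:
  assumes "\<And>l. a l \<le> (1 :: nat)"
  shows "summable (\<lambda>l. 2 * real (a l) / 3 ^ Suc l)"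
proof (rule summable_comparison_test')
  show "summable (\<lambda>l. 2 / 3 * (1 / 3 :: real) ^ l)" by (intro summable_mult summable_geometric) simp
  show "norm (2 * real (a l) / 3 ^ Suc l) \<le> 2 / 3 * (1 / 3) ^ l" for l
    using assms[of l] by (simp add: field_simps)
qed

lemma ternary_bounds:
  assumes a: "\<And>l. a l \<le> (1 :: nat)"
  shows "0 \<le> ternary a" "ternary a \<le> 1"
proof -
  show "0 \<le> ternary a" unfolding ternary_def by (intro suminf_nonneg ternary_summable a) auto
  have "ternary a \<le> (\<Sum>l. 2 / 3 * (1 / 3 :: real) ^ l)" unfolding ternary_def
  proof (rule suminf_le)
    show "2 * real (a l) / 3 ^ Suc l \<le> 2 / 3 * (1 / 3) ^ l" for l using a[of l] by (simp add: field_simps)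
    show "summable (\<lambda>l. 2 / 3 * (1 / 3 :: real) ^ l)" by (intro summable_mult summable_geometric) simp
  qed (rule ternary_summable[OF a])
  also have "\<dots> = 1" by (subst suminf_mult) (simp_all add: suminf_geometric summable_geometric)
  finally show "ternary a \<le> 1" .
qed

lemma ternary_step:
  assumes a: "\<And>l. a l \<le> (1 :: nat)"
  shows "3 * ternary a = 2 * real (a 0) + ternary (\<lambda>l. a (Suc l))"
proof -
  have "ternary a = (\<Sum>l. 2 * real (a (Suc l)) / 3 ^ Suc (Suc l)) + 2 * real (a 0) / 3"
    unfolding ternary_def by (subst suminf_split_head[OF ternary_summable[OF a]]) simp
  moreover have "(\<Sum>l. 2 * real (a (Suc l)) / 3 ^ Suc (Suc l)) = ternary (\<lambda>l. a (Suc l)) / 3"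
    unfolding ternary_def using suminf_divide[OF ternary_summable[of "\<lambda>l. a (Suc l)"], of 3] a by (simp add: mult.commute)
  ultimately show ?thesis by simp
qed

lemma ternary_power:
  assumes a: "\<And>l. a l \<le> (1 :: nat)"
  shows "\<exists>m::nat. 3 ^ l * ternary a = 2 * real m + ternary (\<lambda>j. a (j + l))"
proof (induction l)
  case (Suc l)
  then obtain m :: nat where m: "3 ^ l * ternary a = 2 * real m + ternary (\<lambda>j. a (j + l))" by blast
  have "3 ^ Suc l * ternary a = 3 * (2 * real m + ternary (\<lambda>j. a (j + l)))" by (simp flip: m)
  also have "\<dots> = 2 * real (3 * m + a l) + ternary (\<lambda>j. a (j + Suc l))"
    using ternary_step[of "\<lambda>j. a (j + l)"] a by simp
  finally show ?case by blast
qed (auto intro: exI[of _ 0])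

text \<open>After the shift by l digits the leading digit decides whether the remainder lies in
  [0, 1/3] or in [2/3, 1].\<close>

lemma plateau_ternary:
  assumes a: "\<And>l. a l \<le> (1 :: nat)"
  shows "plateau (3 ^ l * ternary a) = real (a l)"
proof -
  obtain m :: nat where m: "3 ^ l * ternary a = 2 * real m + ternary (\<lambda>j. a (j + l))" using ternary_power[of a, OF a] by blast
  have s: "3 * ternary (\<lambda>j. a (j + l)) = 2 * real (a l) + ternary (\<lambda>j. a (Suc j + l))"
    using ternary_step[of "\<lambda>j. a (j + l)"] a by simp
  have b: "0 \<le> ternary (\<lambda>j. a (Suc j + l))" "ternary (\<lambda>j. a (Suc j + l)) \<le> 1" by (intro ternary_bounds a)+
  have "a l = 0 \<or> a l = 1" using a[of l] by linarith
  then have "plateau (ternary (\<lambda>j. a (j + l))) = real (a l)"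
  proof
    assume "a l = 0"
    then show ?thesis using s b by (subst plateau_0) auto
  next
    assume "a l = 1"
    then show ?thesis using s b by (subst plateau_1) auto
  qed
  then show ?thesis by (simp add: m plateau_shift)
qed

definition bdigit :: "real \<Rightarrow> nat \<Rightarrow> nat" where
  "bdigit x k = nat (\<lfloor>2 ^ Suc k * x\<rfloor> - 2 * \<lfloor>2 ^ k * x\<rfloor>)"

lemma bdigit_eq: "real (bdigit x k) = real_of_int (\<lfloor>2 ^ Suc k * x\<rfloor> - 2 * \<lfloor>2 ^ k * x\<rfloor>)" "bdigit x k \<le> 1"
proof -
  define y where "y = 2 ^ k * x"
  have f: "2 ^ Suc k * x = 2 * y" by (simp add: y_def)
  have "2 * \<lfloor>y\<rfloor> \<le> \<lfloor>2 * y\<rfloor>" "\<lfloor>2 * y\<rfloor> \<le> 2 * \<lfloor>y\<rfloor> + 1" by linarith+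
  then show "real (bdigit x k) = real_of_int (\<lfloor>2 ^ Suc k * x\<rfloor> - 2 * \<lfloor>2 ^ k * x\<rfloor>)" "bdigit x k \<le> 1"
    unfolding bdigit_def f y_def[symmetric] by auto
qed

text \<open>The partial sums telescope to \<lfloor>2 ^ n * x\<rfloor> / 2 ^ n, which lies below x by
  less than 2^(-n).\<close>

lemma bdigit_sums:
  assumes x: "0 \<le> x" "x < 1"
  shows "(\<lambda>k. (1 / 2) ^ Suc k * real (bdigit x k)) sums x"
proof -
  have part: "(\<Sum>k<n. (1 / 2) ^ Suc k * real (bdigit x k)) = real_of_int \<lfloor>2 ^ n * x\<rfloor> / 2 ^ n" for n
  proof (induction n)
    case 0
    have "\<lfloor>x\<rfloor> = 0" using x by linarith
    then show ?case by simp
  next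
    case (Suc n)
    then show ?case by (simp add: bdigit_eq(1) field_simps)
  qed
  have "(\<lambda>n. real_of_int \<lfloor>2 ^ n * x\<rfloor> / 2 ^ n) \<longlonglongrightarrow> x"
  proof (rule tendsto_sandwich[where f = "\<lambda>n. x - (1 / 2) ^ n" and h = "\<lambda>n. x"])
    have "(\<lambda>n. x - (1 / 2) ^ n) \<longlonglongrightarrow> x - 0" by (intro tendsto_intros LIMSEQ_power_zero) simp
    then show "(\<lambda>n. x - (1 / 2) ^ n) \<longlonglongrightarrow> x" by simp
    show "\<forall>\<^sub>F n in sequentially. x - (1 / 2) ^ n \<le> real_of_int \<lfloor>2 ^ n * x\<rfloor> / 2 ^ n"
    proof (intro always_eventually allI)
      fix n
      have "2 ^ n * x - 1 \<le> real_of_int \<lfloor>2 ^ n * x\<rfloor>" by linarith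
      then have "(2 ^ n * x - 1) / 2 ^ n \<le> real_of_int \<lfloor>2 ^ n * x\<rfloor> / 2 ^ n" by (intro divide_right_mono) auto
      then show "x - (1 / 2) ^ n \<le> real_of_int \<lfloor>2 ^ n * x\<rfloor> / 2 ^ n"
        by (simp add: diff_divide_distrib power_one_over)
    qed
    show "\<forall>\<^sub>F n in sequentially. real_of_int \<lfloor>2 ^ n * x\<rfloor> / 2 ^ n \<le> x"
    proof (intro always_eventually allI)
      fix n
      have "real_of_int \<lfloor>2 ^ n * x\<rfloor> \<le> 2 ^ n * x" by linarith
      then show "real_of_int \<lfloor>2 ^ n * x\<rfloor> / 2 ^ n \<le> x" by (simp add: divide_le_eq mult.commute)
    qed
  qed auto
  then show ?thesis unfolding sums_def part .
qed

text \<open>The binary digits of all coordinates are interleaved into a single 0-1 sequence through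
  \<open>prod_decode\<close>, and the Cantor point with that sequence hits all coordinates
  simultaneously.\<close>

theorem schoenberg_surj:
  assumes x: "\<And>i. 0 \<le> x i \<and> x i < 1"
  shows "\<exists>t\<in>{0..1}. \<forall>i. schoenberg i t = x i"
proof -
  define a where "a l = bdigit (x (fst (prod_decode l))) (snd (prod_decode l))" for l
  have a: "a l \<le> 1" for l unfolding a_def by (rule bdigit_eq(2))
  have "schoenberg i (ternary a) = x i" for i
  proof -
    have "schoenberg i (ternary a) = (\<Sum>k. (1 / 2) ^ Suc k * real (bdigit (x i) k))"
      unfolding schoenberg_def plateau_ternary[of a, OF a] by (simp add: a_def)
    also have "\<dots> = x i" using bdigit_sums[of "x i"] x by (simp add: sums_unique[symmetric])
    finally show ?thesis .
  qed
  then show ?thesis using ternary_bounds[of a, OF a] by (intro bexI[of _ "ternary a"]) auto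
qed

lemma torus_square_curve:
  obtains h :: "real \<Rightarrow> 'n::finite torus \<times> 'n torus" where "continuous_on UNIV h" "h ` {0..1} = UNIV"
proof -
  obtain e :: "'n \<Rightarrow> nat" where e: "inj e" using finite_imp_inj_to_nat_seg[of "UNIV :: 'n set"] by auto
  define h :: "real \<Rightarrow> 'n torus \<times> 'n torus" where
    "h t = (proj_torus (\<chi> i. schoenberg (2 * e i) t), proj_torus (\<chi> i. schoenberg (2 * e i + 1) t))" for t
  have "continuous_on UNIV h" unfolding h_def
    by (intro continuous_on_Pair continuous_on_compose2[OF continuous_on_proj_torus] continuous_on_vec_lambda continuous_on_schoenberg) auto
  moreover have "(p, q) \<in> h ` {0..1}" for p q :: "'n torus"
  proof -
    \<comment> \<open>Even indices carry the coordinates of the first factor and odd indices those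
      of the second. Indices that belong to no coordinate get 0, so that every entry lies in [0,
      1).\<close>
    define x where "x j = (if even j then if \<exists>i. e i = j div 2 then torus_sec p $ inv e (j div 2) else 0
      else if \<exists>i. e i = j div 2 then torus_sec q $ inv e (j div 2) else 0)" for j
    have "0 \<le> x j \<and> x j < 1" for j by (simp add: x_def torus_sec_bounds)
    from schoenberg_surj[of x, OF this] obtain t where t: "t \<in> {0..1}" "\<And>j. schoenberg j t = x j" by blast
    have "x (2 * e i) = torus_sec p $ i" "x (2 * e i + 1) = torus_sec q $ i" for i
      by (auto simp: x_def inv_f_f[OF e])
    then have "h t = (proj_torus (torus_sec p), proj_torus (torus_sec q))" by (simp add: h_def t(2))
    then show ?thesis using t(1) by (auto simp: image_iff intro!: bexI[of _ t])
  qed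
  ultimately show thesis using that[of h] by (metis UNIV_eq_I surj_pair)
qed

section \<open>Kantorovich duality\<close>

text \<open>Plans extended by 0 outside I \<times> I form a closed subset of a product of compact
  intervals, nonempty because of the product plan. Entries of any feasible plan are at most 1, as
  the rows sum to \<alpha> i \<le> 1, so restricting to the unit intervals loses no
  competitor.\<close>

lemma finite_transport_minimizer:
  fixes C :: "'i \<Rightarrow> 'i \<Rightarrow> real"
  assumes I: "finite I" and \<alpha>: "\<And>i. i \<in> I \<Longrightarrow> 0 \<le> \<alpha> i" "sum \<alpha> I = 1" and \<beta>: "\<And>i. i \<in> I \<Longrightarrow> 0 \<le> \<beta> i" "sum \<beta> I = 1"
  defines "W \<equiv> {w. (\<forall>i\<in>I. \<forall>j\<in>I. 0 \<le> w (i, j)) \<and> (\<forall>i\<in>I. (\<Sum>j\<in>I. w (i, j)) = \<alpha> i) \<and> (\<forall>j\<in>I. (\<Sum>i\<in>I. w (i, j)) = \<beta> j)}"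
  obtains w where "w \<in> W" "\<And>w'. w' \<in> W \<Longrightarrow> (\<Sum>i\<in>I. \<Sum>j\<in>I. w (i, j) * C i j) \<le> (\<Sum>i\<in>I. \<Sum>j\<in>I. w' (i, j) * C i j)"
proof -
  define K :: "('i \<times> 'i \<Rightarrow> real) set" where "K = PiE UNIV (\<lambda>p. if p \<in> I \<times> I then {0..1} else {0})"
  have "compactin (product_topology (\<lambda>_. euclidean) UNIV) K"
    unfolding K_def by (subst compactin_PiE) auto
  then have K: "compact K" by (simp add: euclidean_product_topology)
  have ev: "continuous_on UNIV (\<lambda>w :: 'i \<times> 'i \<Rightarrow> real. w p)" for p by (rule continuous_on_product_coordinates)
  have cs: "continuous_on UNIV (\<lambda>w :: 'i \<times> 'i \<Rightarrow> real. \<Sum>j\<in>J. w (f j) * c j)" for J and f :: "'i \<Rightarrow> 'i \<times> 'i" and c :: "'i \<Rightarrow> real"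
    by (intro continuous_intros ev)
  have cl1: "closed {w :: 'i \<times> 'i \<Rightarrow> real. (\<Sum>j\<in>I. w (f j)) = a}" for f a
    by (intro closed_Collect_eq continuous_intros ev)
  have "closed ((\<Inter>i\<in>I. {w :: 'i \<times> 'i \<Rightarrow> real. (\<Sum>j\<in>I. w (i, j)) = \<alpha> i}) \<inter> (\<Inter>j\<in>I. {w. (\<Sum>i\<in>I. w (i, j)) = \<beta> j}))"
    by (intro closed_Int closed_INT ballI cl1)
  also have "(\<Inter>i\<in>I. {w :: 'i \<times> 'i \<Rightarrow> real. (\<Sum>j\<in>I. w (i, j)) = \<alpha> i}) \<inter> (\<Inter>j\<in>I. {w. (\<Sum>i\<in>I. w (i, j)) = \<beta> j})
    = {w. (\<forall>i\<in>I. (\<Sum>j\<in>I. w (i, j)) = \<alpha> i) \<and> (\<forall>j\<in>I. (\<Sum>i\<in>I. w (i, j)) = \<beta> j)}"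
    by auto
  finally have cl: "closed {w. (\<forall>i\<in>I. (\<Sum>j\<in>I. w (i, j)) = \<alpha> i) \<and> (\<forall>j\<in>I. (\<Sum>i\<in>I. w (i, j)) = \<beta> j)}" .
  define W0 where "W0 = K \<inter> {w. (\<forall>i\<in>I. (\<Sum>j\<in>I. w (i, j)) = \<alpha> i) \<and> (\<forall>j\<in>I. (\<Sum>i\<in>I. w (i, j)) = \<beta> j)}"
  have W0: "compact W0" unfolding W0_def by (intro compact_Int_closed K cl)
  define w0 where "w0 p = (if p \<in> I \<times> I then \<alpha> (fst p) * \<beta> (snd p) else 0)" for p
  have \<alpha>1: "\<alpha> i \<le> 1" if "i \<in> I" for i using member_le_sum[of i I \<alpha>] that \<alpha> I by auto
  have \<beta>1: "\<beta> i \<le> 1" if "i \<in> I" for i using member_le_sum[of i I \<beta>] that \<beta> I by auto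
  have "w0 \<in> K"
    unfolding K_def PiE_UNIV_domain Pi_iff
  proof
    fix p
    show "w0 p \<in> (if p \<in> I \<times> I then {0..1} else {0})"
    proof (cases "p \<in> I \<times> I")
      case True
      then have I': "fst p \<in> I" "snd p \<in> I" by (auto simp: mem_Times_iff)
      note \<alpha>(1)[OF I'(1)] \<alpha>1[OF I'(1)] \<beta>(1)[OF I'(2)] \<beta>1[OF I'(2)]
      then show ?thesis using True by (simp add: w0_def mult_le_one)
    qed (simp add: w0_def)
  qed
  moreover have "(\<Sum>j\<in>I. w0 (i, j)) = \<alpha> i" if "i \<in> I" for i
    using that \<beta>(2) by (simp add: w0_def flip: sum_distrib_left)
  moreover have "(\<Sum>i\<in>I. w0 (i, j)) = \<beta> j" if "j \<in> I" for j
    using that \<alpha>(2) by (simp add: w0_def flip: sum_distrib_right)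
  ultimately have "w0 \<in> W0" unfolding W0_def by blast
  then have ne: "W0 \<noteq> {}" by auto
  have "continuous_on W0 (\<lambda>w. \<Sum>i\<in>I. \<Sum>j\<in>I. w (i, j) * C i j)"
    by (intro continuous_on_sum continuous_on_subset[OF cs]) auto
  then obtain w where w: "w \<in> W0" "\<And>w'. w' \<in> W0 \<Longrightarrow> (\<Sum>i\<in>I. \<Sum>j\<in>I. w (i, j) * C i j) \<le> (\<Sum>i\<in>I. \<Sum>j\<in>I. w' (i, j) * C i j)"
    using continuous_attains_inf[OF W0 ne] by blast
  show thesis
  proof (rule that[of w])
    have "w (i, j) \<in> {0..1}" if "i \<in> I" "j \<in> I" for i j
    proof -
      have "w (i, j) \<in> (if (i, j) \<in> I \<times> I then {0..1} else {0})"
        using w(1) unfolding W0_def K_def by (auto simp: PiE_iff)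
      then show ?thesis using that by simp
    qed
    then show "w \<in> W" using w(1) by (auto simp: W_def W0_def)
    fix w' assume w': "w' \<in> W"
    define w'' where "w'' p = (if p \<in> I \<times> I then w' p else 0)" for p
    have "w' (i, j) \<le> 1" if "i \<in> I" "j \<in> I" for i j
    proof -
      have "w' (i, j) \<le> (\<Sum>j\<in>I. w' (i, j))" using w' that I by (intro member_le_sum) (auto simp: W_def)
      then show ?thesis using w' that \<alpha>1[of i] by (auto simp: W_def)
    qed
    then have "w'' \<in> W0" using w' unfolding W0_def K_def by (auto simp: w''_def W_def PiE_iff)
    then have "(\<Sum>i\<in>I. \<Sum>j\<in>I. w (i, j) * C i j) \<le> (\<Sum>i\<in>I. \<Sum>j\<in>I. w'' (i, j) * C i j)" by (rule w(2))
    also have "\<dots> = (\<Sum>i\<in>I. \<Sum>j\<in>I. w' (i, j) * C i j)" by (intro sum.cong refl) (simp add: w''_def)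
    finally show "(\<Sum>i\<in>I. \<Sum>j\<in>I. w (i, j) * C i j) \<le> (\<Sum>i\<in>I. \<Sum>j\<in>I. w' (i, j) * C i j)" .
  qed
qed

text \<open>Each step of the walk moves mass \<epsilon> from the position s (m+1) to the one with
  the row of s m and the column of s (m+1). Columns are unchanged step by step; the changes of the
  rows telescope, and vanish because the walk is closed. Optimality says that the new plan is not
  cheaper.\<close>

lemma transport_closed_walk:
  fixes C :: "'i \<Rightarrow> 'i \<Rightarrow> real" and s :: "nat \<Rightarrow> 'i \<times> 'i" and \<alpha> \<beta> :: "'i \<Rightarrow> real"
  assumes I: "finite I"
  defines "W \<equiv> {w. (\<forall>i\<in>I. \<forall>j\<in>I. 0 \<le> w (i, j)) \<and> (\<forall>i\<in>I. (\<Sum>j\<in>I. w (i, j)) = \<alpha> i) \<and> (\<forall>j\<in>I. (\<Sum>i\<in>I. w (i, j)) = \<beta> j)}"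
  assumes w: "w \<in> W" "\<And>w'. w' \<in> W \<Longrightarrow> (\<Sum>i\<in>I. \<Sum>j\<in>I. w (i, j) * C i j) \<le> (\<Sum>i\<in>I. \<Sum>j\<in>I. w' (i, j) * C i j)"
    and s: "\<And>m. m \<le> k \<Longrightarrow> s m \<in> I \<times> I \<and> w (s m) > 0" "s 0 = s k"
  shows "0 \<le> (\<Sum>m<k. C (fst (s m)) (snd (s (Suc m))) - C (fst (s (Suc m))) (snd (s (Suc m))))"
proof (cases "k = 0")
  case False
  \<comment> \<open>A position can be debited up to k times, hence the smallest mass met on the walk
    is divided by k.\<close>
  define \<epsilon> where "\<epsilon> = Min ((\<lambda>m. w (s m)) ` {..k}) / k"
  have mp: "Min ((\<lambda>m. w (s m)) ` {..k}) > 0" using s(1) by (subst Min_gr_iff) auto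
  then have \<epsilon>: "\<epsilon> > 0" using False by (simp add: \<epsilon>_def)
  define \<Delta> where "\<Delta> p = (\<Sum>m<k. of_bool (p = (fst (s m), snd (s (Suc m)))) - of_bool (p = s (Suc m)) :: real)" for p
  define w' where "w' p = w p + \<epsilon> * \<Delta> p" for p
  have sI: "fst (s m) \<in> I" "snd (s m) \<in> I" if "m \<le> k" for m using s(1)[OF that] by (auto simp: mem_Times_iff)
  have row: "(\<Sum>j\<in>I. \<Delta> (i, j)) = 0" for i
  proof -
    have "(\<Sum>j\<in>I. \<Delta> (i, j)) = (\<Sum>m<k. \<Sum>j\<in>I. of_bool ((i, j) = (fst (s m), snd (s (Suc m)))) - of_bool ((i, j) = s (Suc m)))"
      unfolding \<Delta>_def by (rule sum.swap)
    also have "\<dots> = (\<Sum>m<k. of_bool (i = fst (s m)) - of_bool (i = fst (s (Suc m))))"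
    proof (intro sum.cong refl)
      fix m assume m: "m \<in> {..<k}"
      have a: "(\<Sum>j\<in>I. of_bool ((i, j) = (fst (s m), snd (s (Suc m)))) :: real) = of_bool (i = fst (s m))"
        using m sI(2)[of "Suc m"] I by (simp add: of_bool_def if_distrib sum.If_cases Int_def) (auto simp: card_1_singleton_iff)
      have b: "(\<Sum>j\<in>I. of_bool ((i, j) = s (Suc m)) :: real) = of_bool (i = fst (s (Suc m)))"
        using m sI(2)[of "Suc m"] I by (cases "s (Suc m)") (simp add: of_bool_def if_distrib sum.If_cases Int_def, auto simp: card_1_singleton_iff)
      show "(\<Sum>j\<in>I. of_bool ((i, j) = (fst (s m), snd (s (Suc m)))) - of_bool ((i, j) = s (Suc m)) :: real) = of_bool (i = fst (s m)) - of_bool (i = fst (s (Suc m)))"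
        unfolding sum_subtractf a b ..
    qed
    also have "\<dots> = of_bool (i = fst (s 0)) - of_bool (i = fst (s k))" by (rule sum_lessThan_telescope')
    finally show ?thesis by (simp add: s(2))
  qed
  have col: "(\<Sum>i\<in>I. \<Delta> (i, j)) = 0" for j
  proof -
    have "(\<Sum>i\<in>I. \<Delta> (i, j)) = (\<Sum>m<k. \<Sum>i\<in>I. of_bool ((i, j) = (fst (s m), snd (s (Suc m)))) - of_bool ((i, j) = s (Suc m)))"
      unfolding \<Delta>_def by (rule sum.swap)
    also have "\<dots> = (\<Sum>m<k. of_bool (j = snd (s (Suc m))) - of_bool (j = snd (s (Suc m))))"
    proof (intro sum.cong refl)
      fix m assume m: "m \<in> {..<k}"
      have a: "(\<Sum>i\<in>I. of_bool ((i, j) = (fst (s m), snd (s (Suc m)))) :: real) = of_bool (j = snd (s (Suc m)))"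
        using m sI(1)[of m] I by (simp add: of_bool_def if_distrib sum.If_cases Int_def) (auto simp: card_1_singleton_iff)
      have b: "(\<Sum>i\<in>I. of_bool ((i, j) = s (Suc m)) :: real) = of_bool (j = snd (s (Suc m)))"
        using m sI(1)[of "Suc m"] I by (cases "s (Suc m)") (simp add: of_bool_def if_distrib sum.If_cases Int_def, auto simp: card_1_singleton_iff)
      show "(\<Sum>i\<in>I. of_bool ((i, j) = (fst (s m), snd (s (Suc m)))) - of_bool ((i, j) = s (Suc m)) :: real) = of_bool (j = snd (s (Suc m))) - of_bool (j = snd (s (Suc m)))"
        unfolding sum_subtractf a b ..
    qed
    finally show ?thesis by simp
  qed
  have "w' \<in> W"
  proof -
    have "0 \<le> w' (i, j)" if ij: "i \<in> I" "j \<in> I" for i j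
    proof (cases "\<exists>m<k. (i, j) = s (Suc m)")
      case True
      then obtain m where m: "m < k" "(i, j) = s (Suc m)" by blast
      have "- real k \<le> \<Delta> (i, j)"
      proof -
        have "(\<Sum>m<k. - 1 :: real) \<le> \<Delta> (i, j)" unfolding \<Delta>_def by (intro sum_mono) auto
        then show ?thesis by simp
      qed
      then have "\<epsilon> * (- real k) \<le> \<epsilon> * \<Delta> (i, j)" using \<epsilon> by (intro mult_left_mono) auto
      moreover have "\<epsilon> * real k = Min ((\<lambda>m. w (s m)) ` {..k})" using False by (simp add: \<epsilon>_def)
      moreover have "Min ((\<lambda>m. w (s m)) ` {..k}) \<le> w (i, j)" unfolding m(2) using m(1) by (intro Min_le) auto
      ultimately show ?thesis unfolding w'_def by linarith
    next
      case False
      then have "0 \<le> \<Delta> (i, j)" unfolding \<Delta>_def by (intro sum_nonneg) auto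
      then show ?thesis using w(1) ij \<epsilon> by (auto simp: w'_def W_def)
    qed
    moreover have "(\<Sum>j\<in>I. w' (i, j)) = (\<Sum>j\<in>I. w (i, j))" "(\<Sum>j\<in>I. w' (j, i)) = (\<Sum>j\<in>I. w (j, i))" for i
      by (simp_all add: w'_def sum.distrib row col flip: sum_distrib_left)
    ultimately show ?thesis using w(1) by (auto simp: W_def)
  qed
  from w(2)[OF this] have "0 \<le> (\<Sum>i\<in>I. \<Sum>j\<in>I. (\<epsilon> * \<Delta> (i, j)) * C i j)"
    by (simp add: w'_def distrib_right sum.distrib)
  also have "\<dots> = \<epsilon> * (\<Sum>p\<in>I \<times> I. \<Delta> p * C (fst p) (snd p))"
    by (simp add: sum.cartesian_product sum_distrib_left mult.assoc case_prod_beta)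
  finally have "0 \<le> (\<Sum>p\<in>I \<times> I. \<Delta> p * C (fst p) (snd p))" using \<epsilon> by (simp add: zero_le_mult_iff)
  also have "(\<Sum>p\<in>I \<times> I. \<Delta> p * C (fst p) (snd p)) =
      (\<Sum>m<k. \<Sum>p\<in>I \<times> I. (of_bool (p = (fst (s m), snd (s (Suc m)))) - of_bool (p = s (Suc m))) * C (fst p) (snd p))"
    unfolding \<Delta>_def sum_distrib_right by (rule sum.swap)
  also have "\<dots> = (\<Sum>m<k. C (fst (s m)) (snd (s (Suc m))) - C (fst (s (Suc m))) (snd (s (Suc m))))"
  proof (intro sum.cong refl)
    fix m assume m: "m \<in> {..<k}"
    have a: "(\<Sum>p\<in>I \<times> I. of_bool (p = q) * C (fst p) (snd p)) = C (fst q) (snd q)" if "q \<in> I \<times> I" for q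
    proof -
      have "(\<Sum>p\<in>I \<times> I. of_bool (p = q) * C (fst p) (snd p)) = (\<Sum>p\<in>I \<times> I. if p = q then C (fst p) (snd p) else 0)"
        by (intro sum.cong) auto
      then show ?thesis using that I by (simp add: sum.delta)
    qed
    show "(\<Sum>p\<in>I \<times> I. (of_bool (p = (fst (s m), snd (s (Suc m)))) - of_bool (p = s (Suc m))) * C (fst p) (snd p))
      = C (fst (s m)) (snd (s (Suc m))) - C (fst (s (Suc m))) (snd (s (Suc m)))"
      unfolding left_diff_distrib sum_subtractf using a[of "(fst (s m), snd (s (Suc m)))"] a[of "s (Suc m)"] m sI[of m] sI[of "Suc m"]
      by (simp add: mem_Times_iff)
  qed
  finally show ?thesis .
qed simp

text \<open>An optimal plan is cyclically monotone on its support, because mass can be moved around a closed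
  walk; the potentials are infima of costs over walks.\<close>

theorem finite_kantorovich_duality:
  fixes C :: "'i \<Rightarrow> 'i \<Rightarrow> real"
  assumes I: "finite I" and \<alpha>: "\<And>i. i \<in> I \<Longrightarrow> 0 \<le> \<alpha> i" "sum \<alpha> I = 1" and \<beta>: "\<And>i. i \<in> I \<Longrightarrow> 0 \<le> \<beta> i" "sum \<beta> I = 1"
  obtains w u1 u2 where "\<And>i j. i \<in> I \<Longrightarrow> j \<in> I \<Longrightarrow> 0 \<le> w (i, j)"
    "\<And>i. i \<in> I \<Longrightarrow> (\<Sum>j\<in>I. w (i, j)) = \<alpha> i" "\<And>j. j \<in> I \<Longrightarrow> (\<Sum>i\<in>I. w (i, j)) = \<beta> j"
    "\<And>i j. i \<in> I \<Longrightarrow> j \<in> I \<Longrightarrow> u2 j - u1 i \<le> C i j"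
    "(\<Sum>i\<in>I. \<Sum>j\<in>I. w (i, j) * C i j) = (\<Sum>j\<in>I. \<beta> j * u2 j) - (\<Sum>i\<in>I. \<alpha> i * u1 i)"
proof -
  obtain w where w: "w \<in> {w. (\<forall>i\<in>I. \<forall>j\<in>I. 0 \<le> w (i, j)) \<and> (\<forall>i\<in>I. (\<Sum>j\<in>I. w (i, j)) = \<alpha> i) \<and> (\<forall>j\<in>I. (\<Sum>i\<in>I. w (i, j)) = \<beta> j)}"
    "\<And>w'. w' \<in> {w. (\<forall>i\<in>I. \<forall>j\<in>I. 0 \<le> w (i, j)) \<and> (\<forall>i\<in>I. (\<Sum>j\<in>I. w (i, j)) = \<alpha> i) \<and> (\<forall>j\<in>I. (\<Sum>i\<in>I. w (i, j)) = \<beta> j)}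
      \<Longrightarrow> (\<Sum>i\<in>I. \<Sum>j\<in>I. w (i, j) * C i j) \<le> (\<Sum>i\<in>I. \<Sum>j\<in>I. w' (i, j) * C i j)"
    by (rule finite_transport_minimizer[OF I \<alpha> \<beta>, of C], simp, simp, rule that)
  have wW: "\<And>i j. i \<in> I \<Longrightarrow> j \<in> I \<Longrightarrow> 0 \<le> w (i, j)" "\<And>i. i \<in> I \<Longrightarrow> (\<Sum>j\<in>I. w (i, j)) = \<alpha> i" "\<And>j. j \<in> I \<Longrightarrow> (\<Sum>i\<in>I. w (i, j)) = \<beta> j"
    using w(1) by auto
  define S where "S = {p \<in> I \<times> I. w p > 0}"
  have finS: "finite S" using I by (auto simp: S_def)
  have "\<exists>p. p \<in> S"
  proof (rule ccontr)
    assume "\<nexists>p. p \<in> S"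
    then have "w (i, j) = 0" if "i \<in> I" "j \<in> I" for i j using wW(1)[OF that] that unfolding S_def by force
    then have "\<alpha> i = 0" if "i \<in> I" for i using wW(2)[OF that] that by simp
    then show False using \<alpha>(2) by simp
  qed
  then obtain s0 where s0: "s0 \<in> S" ..
  define l where "l p q = C (fst p) (snd q) - C (fst q) (snd q)" for p q :: "'i \<times> 'i"
  have walk: "0 \<le> (\<Sum>m<k. l (\<sigma> m) (\<sigma> (Suc m)))" if "\<And>m. m \<le> k \<Longrightarrow> \<sigma> m \<in> S" "\<sigma> 0 = \<sigma> k" for k \<sigma>
    unfolding l_def using transport_closed_walk[OF I w, of k \<sigma>] that by (auto simp: S_def)
  \<comment> \<open>Costs of walks inside the support from the base point s0 to q, where a step from
    p to q is charged C (fst p) (snd q) - C (fst q) (snd q). Closing such a walk at s0 gives the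
    lower bound for these costs.\<close>
  define A where "A q = {(\<Sum>m<k. l (\<sigma> m) (\<sigma> (Suc m))) | k \<sigma>. (\<forall>m\<le>k. \<sigma> m \<in> S) \<and> \<sigma> 0 = s0 \<and> \<sigma> k = q}" for q
  define p where "p q = Inf (A q)" for q
  have extend: "a + l q q' \<in> A q'" if a: "a \<in> A q" and q: "q' \<in> S" for a q q'
  proof -
    obtain k \<sigma> where k: "a = (\<Sum>m<k. l (\<sigma> m) (\<sigma> (Suc m)))" "\<forall>m\<le>k. \<sigma> m \<in> S" "\<sigma> 0 = s0" "\<sigma> k = q"
      using a by (auto simp: A_def)
    define \<sigma>' where "\<sigma>' = \<sigma>(Suc k := q')"
    have "a + l q q' = (\<Sum>m<Suc k. l (\<sigma>' m) (\<sigma>' (Suc m)))"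
      using k by (simp add: \<sigma>'_def)
    moreover have "(\<forall>m\<le>Suc k. \<sigma>' m \<in> S) \<and> \<sigma>' 0 = s0 \<and> \<sigma>' (Suc k) = q'"
      using k q by (auto simp: \<sigma>'_def le_Suc_eq)
    ultimately show ?thesis unfolding A_def by blast
  qed
  have A0: "0 \<in> A s0" unfolding A_def using s0 by (intro CollectI exI[of _ 0] exI[of _ "\<lambda>_. s0"]) auto
  have ne: "A q \<noteq> {}" if "q \<in> S" for q using extend[OF A0 that] by auto
  have closed: "0 \<le> a" if a: "a \<in> A s0" for a
  proof -
    obtain k \<sigma> where k: "a = (\<Sum>m<k. l (\<sigma> m) (\<sigma> (Suc m)))" "\<forall>m\<le>k. \<sigma> m \<in> S" "\<sigma> 0 = s0" "\<sigma> k = s0"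
      using a by (auto simp: A_def)
    then show ?thesis using walk[of k \<sigma>] by simp
  qed
  have bdd: "bdd_below (A q)" for q
  proof (rule bdd_belowI[of _ "- l q s0"])
    fix a assume "a \<in> A q"
    from closed[OF extend[OF this s0]] show "- l q s0 \<le> a" by simp
  qed
  have p: "p q' \<le> p q + l q q'" if "q \<in> S" "q' \<in> S" for q q'
  proof -
    have "p q' - l q q' \<le> a" if "a \<in> A q" for a
      using cInf_lower[OF extend[OF that \<open>q' \<in> S\<close>] bdd] by (simp add: p_def)
    then have "p q' - l q q' \<le> p q" unfolding p_def[of q] by (intro cInf_greatest ne that)
    then show ?thesis by simp
  qed
  \<comment> \<open>\<open>u2\<close> is the C-transform of the walk potential p, and
    \<open>u1\<close> is the least function compatible with \<open>u2\<close>. On the support both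
    constraints are tight, with u1 i = p (i, j).\<close>
  define u2 where "u2 j = Min ((\<lambda>q. p q + C (fst q) j) ` S)" for j
  define u1 where "u1 i = Max ((\<lambda>j. u2 j - C i j) ` I)" for i
  have le: "u2 j - u1 i \<le> C i j" if "i \<in> I" "j \<in> I" for i j
  proof -
    have "u2 j - C i j \<le> u1 i" unfolding u1_def using that I by (intro Max_ge) auto
    then show ?thesis by simp
  qed
  have eq: "u2 j - u1 i = C i j" if ij: "(i, j) \<in> S" for i j
  proof -
    have I': "i \<in> I" "j \<in> I" using ij by (auto simp: S_def)
    have "p (i, j) + C i j \<le> u2 j"
      unfolding u2_def
    proof (rule Min.boundedI)
      fix a assume "a \<in> (\<lambda>q. p q + C (fst q) j) ` S"
      then obtain q where q: "q \<in> S" "a = p q + C (fst q) j" by auto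
      then show "p (i, j) + C i j \<le> a" using p[OF q(1) ij] by (simp add: l_def)
    qed (use finS s0 in auto)
    moreover have "u1 i \<le> p (i, j)"
      unfolding u1_def
    proof (rule Max.boundedI)
      fix a assume "a \<in> (\<lambda>j. u2 j - C i j) ` I"
      then obtain j' where j': "j' \<in> I" "a = u2 j' - C i j'" by auto
      have "u2 j' \<le> p (i, j) + C i j'" unfolding u2_def using finS ij by (intro Min_le) (auto simp: image_iff intro!: bexI[of _ "(i, j)"])
      then show "a \<le> p (i, j)" using j' by simp
    qed (use I I' in auto)
    ultimately show ?thesis using le[OF I'] by simp
  qed
  show thesis
  proof (rule that[OF wW le])
    have "(\<Sum>i\<in>I. \<Sum>j\<in>I. w (i, j) * C i j) = (\<Sum>i\<in>I. \<Sum>j\<in>I. w (i, j) * u2 j - w (i, j) * u1 i)"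
    proof (intro sum.cong refl)
      fix i j assume ij: "i \<in> I" "j \<in> I"
      show "w (i, j) * C i j = w (i, j) * u2 j - w (i, j) * u1 i"
      proof (cases "w (i, j) > 0")
        case True
        then have "(i, j) \<in> S" using ij by (simp add: S_def)
        from eq[OF this] show ?thesis by (simp flip: right_diff_distrib)
      next
        case False
        then have "w (i, j) = 0" using wW(1)[OF ij] by simp
        then show ?thesis by simp
      qed
    qed
    also have "\<dots> = (\<Sum>i\<in>I. \<Sum>j\<in>I. w (i, j) * u2 j) - (\<Sum>i\<in>I. (\<Sum>j\<in>I. w (i, j)) * u1 i)"
      by (simp add: sum_subtractf sum_distrib_right)
    also have "(\<Sum>i\<in>I. \<Sum>j\<in>I. w (i, j) * u2 j) = (\<Sum>j\<in>I. (\<Sum>i\<in>I. w (i, j)) * u2 j)"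
      by (subst sum.swap) (simp add: sum_distrib_right)
    also have "\<dots> = (\<Sum>j\<in>I. \<beta> j * u2 j)" by (intro sum.cong) (simp_all add: wW)
    also have "(\<Sum>i\<in>I. (\<Sum>j\<in>I. w (i, j)) * u1 i) = (\<Sum>i\<in>I. \<alpha> i * u1 i)" by (intro sum.cong) (simp_all add: wW)
    finally show "(\<Sum>i\<in>I. \<Sum>j\<in>I. w (i, j) * C i j) = (\<Sum>j\<in>I. \<beta> j * u2 j) - (\<Sum>i\<in>I. \<alpha> i * u1 i)" .
  qed
qed

section \<open>Discretisation of measures and extension of potentials\<close>

lemma fine_partition:
  assumes X: "compact (UNIV :: 'a::metric_space set)" and d: "d > 0"
  obtains m :: nat and r :: "nat \<Rightarrow> 'a::metric_space" and idx :: "'a::metric_space \<Rightarrow> nat"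
  where "idx \<in> measurable borel (count_space UNIV)" "\<And>x. idx x < m" "\<And>x. dist x (r (idx x)) < d"
proof -
  obtain F :: "'a set" where F: "finite F" "UNIV \<subseteq> (\<Union>x\<in>F. ball x d)"
    by (rule compactE_image[OF X, of UNIV "\<lambda>x. ball x d"]) (use d in \<open>auto intro: centre_in_ball[THEN iffD2]\<close>)
  obtain r where r: "F = r ` {i::nat. i < card F}"
    using finite_imp_nat_seg_image_inj_on[OF F(1)] by (metis card_Collect_less_nat card_image)
  have ex: "\<exists>i<card F. dist x (r i) < d" for x
    using F(2) by (subst (asm) r) (auto simp: dist_commute subset_eq)
  \<comment> \<open>Taking the first ball of the finite cover that contains x makes the assignment
    Borel.\<close>
  define idx where "idx x = (LEAST i. i < card F \<and> dist x (r i) < d)" for x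
  have idx: "idx x < card F \<and> dist x (r (idx x)) < d" for x
    unfolding idx_def using ex[of x] by (rule LeastI_ex)
  have "idx \<in> measurable borel (count_space UNIV)"
    unfolding idx_def[abs_def]
  proof (rule measurable_Least)
    fix i
    have "open {x. dist x (r i) < d}" by (intro open_Collect_less continuous_intros)
    then have "Measurable.pred borel (\<lambda>x. dist x (r i) < d)" by (simp add: pred_def)
    then show "Measurable.pred borel (\<lambda>x. i < card F \<and> dist x (r i) < d)" by simp
  qed
  then show thesis using that idx by blast
qed

lemma integral_finite_range:
  fixes f :: "nat \<Rightarrow> real"
  assumes \<mu>: "prob_space \<mu>" "sets \<mu> = sets borel" and idx: "idx \<in> measurable borel (count_space UNIV)" "\<And>x. idx x < m"
  shows "(\<integral>x. f (idx x) \<partial>\<mu>) = (\<Sum>i<m. measure \<mu> {x. idx x = i} * f i)"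
    "(\<Sum>i<m. measure \<mu> {x. idx x = i}) = 1"
    "integrable \<mu> (\<lambda>x. f (idx x))"
proof -
  interpret prob_space \<mu> by fact
  have [measurable_cong]: "sets \<mu> = sets borel" by fact
  have sp: "space \<mu> = UNIV" using sets_eq_imp_space_eq[OF \<mu>(2)] by simp
  have [measurable]: "idx \<in> measurable \<mu> (count_space UNIV)" using idx(1) by simp
  have S: "{x. idx x = i} \<in> sets \<mu>" for i
  proof -
    have "idx -` {i} \<inter> space \<mu> \<in> sets \<mu>" by measurable
    then show ?thesis by (simp add: sp vimage_def)
  qed
  have int: "integrable \<mu> (\<lambda>x. indicator {x. idx x = i} x * g i)" for i and g :: "nat \<Rightarrow> real"
    using S[of i] by (intro integrable_mult_left integrable_real_indicator) (auto simp: emeasure_eq_measure)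
  have eq: "g (idx x) = (\<Sum>i<m. indicator {x. idx x = i} x * g i)" for g :: "nat \<Rightarrow> real" and x
  proof -
    have "(\<Sum>i<m. indicator {x. idx x = i} x * g i) = (\<Sum>i<m. if i = idx x then g i else 0)"
      by (intro sum.cong) (auto simp: indicator_def)
    then show ?thesis using idx(2)[of x] by (simp add: sum.delta)
  qed
  have main: "(\<integral>x. g (idx x) \<partial>\<mu>) = (\<Sum>i<m. measure \<mu> {x. idx x = i} * g i)" for g :: "nat \<Rightarrow> real"
    unfolding eq[of g] using S by (subst Bochner_Integration.integral_sum[OF int]) (simp add: sp)
  show "(\<integral>x. f (idx x) \<partial>\<mu>) = (\<Sum>i<m. measure \<mu> {x. idx x = i} * f i)" by (rule main)
  show "(\<Sum>i<m. measure \<mu> {x. idx x = i}) = 1" using main[of "\<lambda>_. 1"] by (simp add: prob_space)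
  show "integrable \<mu> (\<lambda>x. f (idx x))" unfolding eq[of f] by (intro Bochner_Integration.integrable_sum int)
qed

lemma compact_continuous_integrable:
  fixes f :: "'a::metric_space \<Rightarrow> real"
  assumes X: "compact (UNIV :: 'a set)" and f: "continuous_on UNIV f" and \<mu>: "prob_space \<mu>" "sets \<mu> = sets borel"
  shows "integrable \<mu> f"
proof -
  interpret prob_space \<mu> by fact
  have "bounded (range f)" using compact_continuous_image[OF f X] by (rule compact_imp_bounded)
  then obtain B where "\<And>x. norm (f x) \<le> B" by (auto simp: bounded_iff)
  moreover have "f \<in> borel_measurable \<mu>" using borel_measurable_continuous_onI[OF f] \<mu>(2) by (simp cong: measurable_cong_sets)
  ultimately show ?thesis by (intro integrable_const_bound[of _ B]) auto
qed

lemma abs_integral_diff_le: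
  fixes f g :: "'a \<Rightarrow> real"
  assumes \<mu>: "prob_space \<mu>" and "integrable \<mu> f" "integrable \<mu> g" and le: "\<And>x. \<bar>f x - g x\<bar> \<le> e"
  shows "\<bar>(\<integral>x. f x \<partial>\<mu>) - (\<integral>x. g x \<partial>\<mu>)\<bar> \<le> e"
proof -
  interpret prob_space \<mu> by fact
  have "\<bar>(\<integral>x. f x \<partial>\<mu>) - (\<integral>x. g x \<partial>\<mu>)\<bar> = \<bar>\<integral>x. f x - g x \<partial>\<mu>\<bar>" using assms by simp
  also have "\<dots> \<le> (\<integral>x. \<bar>f x - g x\<bar> \<partial>\<mu>)" by (rule integral_abs_bound)
  also have "\<dots> \<le> (\<integral>x. e \<partial>\<mu>)" using assms by (intro integral_mono) auto
  also have "\<dots> = e" by (simp add: prob_space)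
  finally show ?thesis .
qed

lemma cSup_perturb:
  fixes F G :: "'i \<Rightarrow> real"
  assumes "I \<noteq> {}" "bdd_above (F ` I)" "bdd_above (G ` I)" "\<And>i. i \<in> I \<Longrightarrow> \<bar>F i - G i\<bar> \<le> e"
  shows "\<bar>(SUP i\<in>I. F i) - (SUP i\<in>I. G i)\<bar> \<le> e"
proof -
  have "(SUP i\<in>I. F i) \<le> (SUP i\<in>I. G i) + e"
  proof (rule cSUP_least[OF assms(1)])
    fix i assume i: "i \<in> I"
    show "F i \<le> (SUP i\<in>I. G i) + e" using cSUP_upper[OF i assms(3)] assms(4)[OF i] by linarith
  qed
  moreover have "(SUP i\<in>I. G i) \<le> (SUP i\<in>I. F i) + e"
  proof (rule cSUP_least[OF assms(1)])
    fix i assume i: "i \<in> I"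
    show "G i \<le> (SUP i\<in>I. F i) + e" using cSUP_upper[OF i assms(2)] assms(4)[OF i] by linarith
  qed
  ultimately show ?thesis by linarith
qed

text \<open>Potentials at the sample points are extended to the whole space by two c-transforms, U2
  y = min over i of u1 i + c (r i, y) and U1 x = sup over y of U2 y - c (x, y). The dual constraint
  then holds everywhere, and both functions inherit the modulus of continuity of c whatever u1 is.
  The clause quantified over \<open>a\<close> says, for a = u2 j, that the dual value does not drop
  at the sample points.\<close>

lemma c_transform:
  fixes c :: "'a::metric_space \<times> 'a \<Rightarrow> real" and m :: nat and r :: "nat \<Rightarrow> 'a"
  assumes X: "compact (UNIV :: 'a set)" and c: "continuous_on UNIV c" and m: "0 < m"
  obtains U1 U2 where "\<And>x y. U2 y - U1 x \<le> c (x, y)" "continuous_on UNIV U1" "continuous_on UNIV U2"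
    "\<And>i. i < m \<Longrightarrow> U1 (r i) \<le> u1 i"
    "\<forall>j a. (\<forall>i<m. a \<le> u1 i + c (r i, r j)) \<longrightarrow> a \<le> U2 (r j)"
    "\<forall>x x' e. (\<forall>y. \<bar>c (x, y) - c (x', y)\<bar> \<le> e) \<longrightarrow> \<bar>U1 x - U1 x'\<bar> \<le> e"
    "\<forall>y y' e. (\<forall>x. \<bar>c (x, y) - c (x, y')\<bar> \<le> e) \<longrightarrow> \<bar>U2 y - U2 y'\<bar> \<le> e"
proof -
  have XX: "compact (UNIV :: ('a \<times> 'a) set)" using compact_Times[OF X X] by simp
  have "bounded (range c)" using compact_continuous_image[OF c XX] by (rule compact_imp_bounded)
  then obtain B where B: "\<And>p. \<bar>c p\<bar> \<le> B" by (auto simp: bounded_iff)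
  \<comment> \<open>The minimum is written as a negated supremum, so that
    \<open>cSup_perturb\<close> covers both transforms.\<close>
  define V where "V y = (SUP i\<in>{..<m}. - u1 i - c (r i, y))" for y
  define U2 where "U2 y = - V y" for y
  have bV: "bdd_above ((\<lambda>i. - u1 i - c (r i, y)) ` {..<m})" for y by (intro bdd_above_finite finite_imageI finite_lessThan)
  have V2: "\<bar>U2 y - U2 y'\<bar> \<le> e" if "\<And>x. \<bar>c (x, y) - c (x, y')\<bar> \<le> e" for y y' e
  proof -
    have "\<bar>V y - V y'\<bar> \<le> e" unfolding V_def
    proof (rule cSup_perturb[OF _ bV bV])
      show "\<bar>(- u1 i - c (r i, y)) - (- u1 i - c (r i, y'))\<bar> \<le> e" for i
        using that[of "r i"] by (simp add: abs_minus_commute)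
    qed (use m in auto)
    then show ?thesis by (simp add: U2_def abs_minus_commute)
  qed
  have U2le: "U2 y \<le> u1 i + c (r i, y)" if "i < m" for i y
  proof -
    have "- u1 i - c (r i, y) \<le> V y" unfolding V_def using that by (intro cSUP_upper bV) auto
    then show ?thesis by (simp add: U2_def)
  qed
  have U2ge: "a \<le> U2 y" if "\<And>i. i < m \<Longrightarrow> a \<le> u1 i + c (r i, y)" for a y
  proof -
    have "V y \<le> - a" unfolding V_def using m that by (intro cSUP_least) force+
    then show ?thesis by (simp add: U2_def)
  qed
  define U1 where "U1 x = (SUP y. U2 y - c (x, y))" for x
  have bU: "bdd_above (range (\<lambda>y. U2 y - c (x, y)))" for x
  proof (rule bdd_aboveI2)
    fix y
    show "U2 y - c (x, y) \<le> u1 0 + B + B" using U2le[OF m, of y] B[of "(r 0, y)"] B[of "(x, y)"] by linarith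
  qed
  have V1: "\<bar>U1 x - U1 x'\<bar> \<le> e" if "\<And>y. \<bar>c (x, y) - c (x', y)\<bar> \<le> e" for x x' e
    unfolding U1_def
  proof (rule cSup_perturb[OF _ bU bU])
    show "\<bar>(U2 y - c (x, y)) - (U2 y - c (x', y))\<bar> \<le> e" for y using that[of y] by (simp add: abs_minus_commute)
  qed simp
  have uc: "\<exists>d>0. \<forall>p q. dist p q < d \<longrightarrow> \<bar>c p - c q\<bar> < e" if "e > 0" for e
    using compact_uniformly_continuous[OF c XX] that unfolding uniformly_continuous_on_def by (metis UNIV_I dist_real_def)
  have cont: "continuous_on UNIV U" if U: "\<And>x x' e. (\<And>y. \<bar>c (f x y) - c (f x' y)\<bar> \<le> e) \<Longrightarrow> \<bar>U x - U x'\<bar> \<le> e"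
    and f: "\<And>x x' y. dist (f x y) (f x' y) \<le> dist x x'" for U :: "'a \<Rightarrow> real" and f :: "'a \<Rightarrow> 'a \<Rightarrow> 'a \<times> 'a"
    unfolding continuous_on_iff
  proof (intro ballI allI impI)
    fix x and e :: real assume "e > 0"
    then obtain d where d: "d > 0" "\<forall>p q. dist p q < d \<longrightarrow> \<bar>c p - c q\<bar> < e / 2" using uc[of "e / 2"] by auto
    show "\<exists>d>0. \<forall>x'\<in>UNIV. dist x' x < d \<longrightarrow> dist (U x') (U x) < e"
    proof (intro exI[of _ d] conjI ballI impI d(1))
      fix x' assume "dist x' x < d"
      then have "\<bar>c (f x' y) - c (f x y)\<bar> \<le> e / 2" for y using d(2) f[of x' y x] by (meson le_less_trans less_imp_le)
      from U[OF this] show "dist (U x') (U x) < e" using \<open>e > 0\<close> by (simp add: dist_real_def)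
    qed
  qed
  show thesis
  proof (rule that[of U2 U1])
    show "continuous_on UNIV U1" by (rule cont[of "\<lambda>x y. (x, y)"]) (use V1 in \<open>auto simp: dist_Pair_Pair\<close>)
    show "continuous_on UNIV U2" by (rule cont[of "\<lambda>x y. (y, x)"]) (use V2 in \<open>auto simp: dist_Pair_Pair\<close>)
    show "U2 y - U1 x \<le> c (x, y)" for x y
      using cSUP_upper[OF UNIV_I bU, of y x] by (simp add: U1_def)
    show "U1 (r i) \<le> u1 i" if "i < m" for i
      unfolding U1_def using U2le[OF that] by (intro cSUP_least) (auto simp: algebra_simps)
    show "\<forall>j a. (\<forall>i<m. a \<le> u1 i + c (r i, r j)) \<longrightarrow> a \<le> U2 (r j)" using U2ge by blast
    show "\<forall>x x' e. (\<forall>y. \<bar>c (x, y) - c (x', y)\<bar> \<le> e) \<longrightarrow> \<bar>U1 x - U1 x'\<bar> \<le> e" using V1 by blast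
    show "\<forall>y y' e. (\<forall>x. \<bar>c (x, y) - c (x, y')\<bar> \<le> e) \<longrightarrow> \<bar>U2 y - U2 y'\<bar> \<le> e" using V2 by blast
  qed
qed

text \<open>Finite plans are pulled back to the real line along a space-filling curve, so that Helly's selection
  theorem can take the place of Prokhorov's theorem on the product space.\<close>

lemma finite_plan_distribution:
  fixes t :: "nat \<Rightarrow> nat \<Rightarrow> real"
  assumes w: "\<And>i j. i < m \<Longrightarrow> j < m \<Longrightarrow> 0 \<le> w (i, j)" "(\<Sum>i<m. \<Sum>j<m. w (i, j)) = 1" and t: "\<And>i j. t i j \<in> {0..1}"
  obtains \<nu> where "real_distribution \<nu>" "measure \<nu> {- 1<..1} = 1"
    "\<And>g :: real \<Rightarrow> real. continuous_on UNIV g \<Longrightarrow> (\<integral>x. g x \<partial>\<nu>) = (\<Sum>i<m. \<Sum>j<m. w (i, j) * g (t i j))"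
proof -
  define M where "M = point_measure ({..<m} \<times> {..<m}) (\<lambda>p. ennreal (w p))"
  define \<nu> where "\<nu> = distr M borel (\<lambda>(i, j). t i j)"
  have meas: "(\<lambda>(i, j). t i j) \<in> measurable M borel" by (auto simp: M_def)
  have sp: "space M = {..<m} \<times> {..<m}" by (simp add: M_def space_point_measure)
  have M: "prob_space M"
  proof (rule prob_spaceI)
    have "emeasure M (space M) = (\<Sum>p\<in>{..<m} \<times> {..<m}. ennreal (w p))"
      unfolding sp unfolding M_def by (rule emeasure_point_measure_finite) auto
    also have "\<dots> = ennreal (\<Sum>p\<in>{..<m} \<times> {..<m}. w p)" using w(1) by (intro sum_ennreal) auto
    also have "(\<Sum>p\<in>{..<m} \<times> {..<m}. w p) = 1" using w(2) by (simp add: sum.cartesian_product)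
    finally show "emeasure M (space M) = 1" by simp
  qed
  interpret M: prob_space M by fact
  interpret \<nu>: prob_space \<nu> unfolding \<nu>_def by (rule M.prob_space_distr[OF meas])
  show thesis
  proof (rule that[of \<nu>])
    show "real_distribution \<nu>" by unfold_locales (simp add: \<nu>_def)
    have "measure \<nu> {- 1<..1} = measure M ((\<lambda>(i, j). t i j) -` {- 1<..1} \<inter> space M)"
      unfolding \<nu>_def by (rule measure_distr[OF meas]) simp
    also have "(\<lambda>(i, j). t i j) -` {- 1<..1} \<inter> space M = space M"
    proof -
      have "- 1 < t i j \<and> t i j \<le> 1" for i j using t[of i j] by auto
      then show ?thesis by auto
    qed
    finally show "measure \<nu> {- 1<..1} = 1" by (simp add: M.prob_space)
    fix g :: "real \<Rightarrow> real" assume g: "continuous_on UNIV g"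
    have "(\<integral>x. g x \<partial>\<nu>) = (\<integral>p. g (case p of (i, j) \<Rightarrow> t i j) \<partial>M)"
      unfolding \<nu>_def by (rule integral_distr[OF meas]) (simp add: borel_measurable_continuous_onI[OF g])
    also have "\<dots> = (\<integral>p. g (case p of (i, j) \<Rightarrow> t i j) \<partial>point_measure ({..<m} \<times> {..<m}) w)" by (simp add: M_def)
    also have "\<dots> = (\<Sum>p\<in>{..<m} \<times> {..<m}. w p *\<^sub>R g (case p of (i, j) \<Rightarrow> t i j))"
      by (rule lebesgue_integral_point_measure_finite) (use w(1) in auto)
    also have "\<dots> = (\<Sum>i<m. \<Sum>j<m. w (i, j) * g (t i j))" by (simp add: sum.cartesian_product case_prod_beta)
    finally show "(\<integral>x. g x \<partial>\<nu>) = (\<Sum>i<m. \<Sum>j<m. w (i, j) * g (t i j))" .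
  qed
qed

text \<open>Both measures are discretised at scale 1 / (n + 1), and the optimal finite plans,
  carried to the interval through h, have a weakly convergent subsequence; pushing its limit forward
  by h gives \<sigma>. No limit of the potentials is taken: for each e the extended potentials of
  one sufficiently fine discretisation almost attain the cost of \<sigma>, which is enough to
  certify that \<sigma> is optimal.\<close>

theorem kantorovich_duality:
  fixes c :: "'a::metric_space \<times> 'a \<Rightarrow> real" and h :: "real \<Rightarrow> 'a \<times> 'a"
  assumes X: "compact (UNIV :: 'a set)" and h: "continuous_on UNIV h" "h ` {0..1} = UNIV" and c: "continuous_on UNIV c"
    and \<mu>1: "prob_space \<mu>1" "sets \<mu>1 = sets borel" and \<mu>2: "prob_space \<mu>2" "sets \<mu>2 = sets borel"
  obtains \<sigma> where "prob_space \<sigma>" "sets \<sigma> = sets borel" "distr \<sigma> borel fst = \<mu>1" "distr \<sigma> borel snd = \<mu>2"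
    "\<And>e. e > 0 \<Longrightarrow> \<exists>U1 U2. continuous_on UNIV U1 \<and> continuous_on UNIV U2 \<and> (\<forall>x y. U2 y - U1 x \<le> c (x, y)) \<and>
       (\<integral>p. c p \<partial>\<sigma>) - e \<le> (\<integral>y. U2 y \<partial>\<mu>2) - (\<integral>x. U1 x \<partial>\<mu>1)"
proof -
  have XX: "compact (UNIV :: ('a \<times> 'a) set)" using compact_Times[OF X X] by simp
  \<comment> \<open>A solved discretisation together with the law \<nu> of its plan on the parameter
    interval. The number of cells, the sample points and the potentials vary with n and are
    therefore hidden under quantifiers.\<close>
  define good where "good n \<nu> \<longleftrightarrow> (\<exists>m r idx w u1 u2 t. 
      idx \<in> measurable borel (count_space UNIV) \<and> (\<forall>x. idx x < (m::nat)) \<and> (\<forall>x. dist x ((r::nat \<Rightarrow> 'a) (idx x)) < 1 / real (Suc n)) \<and>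
      (\<forall>i<m. (\<Sum>j<m. w (i, j)) = measure \<mu>1 {x. idx x = i}) \<and>
      (\<forall>j<m. (\<Sum>i<m. w (i, j)) = measure \<mu>2 {x. idx x = j}) \<and>
      (\<forall>i<m. \<forall>j<m. u2 j - u1 i \<le> c (r i, r j)) \<and>
      (\<Sum>i<m. \<Sum>j<m. w (i, j) * c (r i, r j)) = (\<Sum>j<m. measure \<mu>2 {x. idx x = j} * u2 j) - (\<Sum>i<m. measure \<mu>1 {x. idx x = i} * u1 i) \<and>
      (\<forall>i j. h (t i j) = (r i, r j)) \<and> real_distribution \<nu> \<and> measure \<nu> {- 1<..1} = 1 \<and>
      (\<forall>g :: real \<Rightarrow> real. continuous_on UNIV g \<longrightarrow> (\<integral>x. g x \<partial>\<nu>) = (\<Sum>i<m. \<Sum>j<m. w (i, j) * g (t i j))))" for n and \<nu> :: "real measure"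
  have "\<exists>\<nu>. good n \<nu>" for n
  proof -
    obtain m :: nat and r :: "nat \<Rightarrow> 'a" and idx :: "'a \<Rightarrow> nat"
      where idx: "idx \<in> measurable borel (count_space UNIV)" "\<And>x. idx x < m" "\<And>x. dist x (r (idx x)) < 1 / real (Suc n)"
      by (rule fine_partition[OF X, of "1 / real (Suc n)"], simp, rule that)
    define \<alpha> where "\<alpha> i = measure \<mu>1 {x. idx x = i}" for i
    define \<beta> where "\<beta> i = measure \<mu>2 {x. idx x = i}" for i
    have \<alpha>: "\<And>i. i \<in> {..<m} \<Longrightarrow> 0 \<le> \<alpha> i" "sum \<alpha> {..<m} = 1" and \<beta>: "\<And>i. i \<in> {..<m} \<Longrightarrow> 0 \<le> \<beta> i" "sum \<beta> {..<m} = 1"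
      using integral_finite_range(2)[OF \<mu>1 idx(1,2)] integral_finite_range(2)[OF \<mu>2 idx(1,2)] by (auto simp: \<alpha>_def \<beta>_def)
    obtain w u1 u2 where w: "\<And>i j. i \<in> {..<m} \<Longrightarrow> j \<in> {..<m} \<Longrightarrow> 0 \<le> w (i, j)"
      "\<And>i. i \<in> {..<m} \<Longrightarrow> (\<Sum>j<m. w (i, j)) = \<alpha> i" "\<And>j. j \<in> {..<m} \<Longrightarrow> (\<Sum>i<m. w (i, j)) = \<beta> j"
      "\<And>i j. i \<in> {..<m} \<Longrightarrow> j \<in> {..<m} \<Longrightarrow> u2 j - u1 i \<le> c (r i, r j)"
      "(\<Sum>i<m. \<Sum>j<m. w (i, j) * c (r i, r j)) = (\<Sum>j<m. \<beta> j * u2 j) - (\<Sum>i<m. \<alpha> i * u1 i)"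
      by (rule finite_kantorovich_duality[OF finite_lessThan \<alpha> \<beta>, of "\<lambda>i j. c (r i, r j)"], simp, simp, rule that)
    have "\<exists>t. t \<in> {0..1} \<and> h t = p" for p using h(2) by (metis UNIV_I imageE)
    then obtain e where e: "\<And>p. e p \<in> {0..1} \<and> h (e p) = p" by metis
    define t where "t i j = e (r i, r j)" for i j
    have t: "t i j \<in> {0..1}" "h (t i j) = (r i, r j)" for i j using e by (auto simp: t_def)
    have w1: "(\<Sum>i<m. \<Sum>j<m. w (i, j)) = 1" using w(2) \<alpha>(2) by simp
    obtain \<nu> where \<nu>: "real_distribution \<nu>" "measure \<nu> {- 1<..1} = 1"
      "\<And>g :: real \<Rightarrow> real. continuous_on UNIV g \<Longrightarrow> (\<integral>x. g x \<partial>\<nu>) = (\<Sum>i<m. \<Sum>j<m. w (i, j) * g (t i j))"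
      by (rule finite_plan_distribution[of m w t, OF _ w1 t(1)]) (use w(1) in auto)
    have "good n \<nu>" unfolding good_def
      by (intro exI[of _ m] exI[of _ r] exI[of _ idx] exI[of _ w] exI[of _ u1] exI[of _ u2] exI[of _ t])
        (use idx w \<nu> t(2) in \<open>simp add: \<alpha>_def \<beta>_def\<close>)
    then show ?thesis ..
  qed
  then obtain \<nu> where \<nu>: "\<And>n. good n (\<nu> n)" by metis
  have "tight \<nu>" unfolding tight_def
  proof (intro conjI allI impI)
    show "real_distribution (\<nu> n)" for n using \<nu>[of n] unfolding good_def by auto
    have "measure (\<nu> n) {- 1<..1} = 1" for n using \<nu>[of n] unfolding good_def by auto
    then show "\<exists>a b. a < b \<and> (\<forall>n. 1 - \<epsilon> < measure (\<nu> n) {a<..b})" if "\<epsilon> > 0" for \<epsilon> :: real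
      using that by (intro exI[of _ "- 1"] exI[of _ 1]) auto
  qed
  then obtain k M where k: "strict_mono k" "real_distribution M" "weak_conv_m (\<nu> \<circ> id \<circ> k) M"
    using tight_imp_convergent_subsubsequence[of \<nu> id] by (auto simp: strict_mono_def)
  interpret M: real_distribution M by fact
  have hm: "h \<in> measurable M borel" using borel_measurable_continuous_onI[OF h(1)] by simp
  define \<sigma> where "\<sigma> = distr M borel h"
  have \<sigma>: "prob_space \<sigma>" "sets \<sigma> = sets borel" using M.prob_space_distr[OF hm] by (auto simp: \<sigma>_def)
  have lim: "(\<lambda>n. \<integral>x. f (h x) \<partial>\<nu> (k n)) \<longlonglongrightarrow> (\<integral>p. f p \<partial>\<sigma>)" if f: "continuous_on UNIV f" for f :: "'a \<times> 'a \<Rightarrow> real"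
  proof -
    have fh: "continuous_on UNIV (\<lambda>x. f (h x))" by (rule continuous_on_compose2[OF f h(1)]) auto
    have "bounded (range f)" using compact_continuous_image[OF f XX] by (rule compact_imp_bounded)
    then obtain B where B: "\<And>p. norm (f p) \<le> B" by (auto simp: bounded_iff)
    have "(\<lambda>n. \<integral>x. f (h x) \<partial>(\<nu> \<circ> id \<circ> k) n) \<longlonglongrightarrow> (\<integral>x. f (h x) \<partial>M)"
    proof (rule weak_conv_imp_integral_bdd_continuous_conv[OF _ k(2,3)])
      show "real_distribution ((\<nu> \<circ> id \<circ> k) n)" for n using \<nu>[of "k n"] unfolding good_def by auto
      show "isCont (\<lambda>x. f (h x)) x" for x using fh by (simp add: continuous_on_eq_continuous_at)
      show "norm (f (h x)) \<le> B" for x by (rule B)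
    qed
    moreover have "(\<integral>p. f p \<partial>\<sigma>) = (\<integral>x. f (h x) \<partial>M)"
      unfolding \<sigma>_def by (rule integral_distr[OF hm]) (simp add: borel_measurable_continuous_onI[OF f])
    ultimately show ?thesis by simp
  qed
  have ev: "\<exists>N. \<forall>n\<ge>N. 1 / real (Suc (k n)) < d" if d: "d > 0" for d :: real
  proof -
    obtain N where N: "1 / real (Suc N) < d" using reals_Archimedean[OF d] by (auto simp: inverse_eq_divide)
    have "1 / real (Suc (k n)) < d" if "n \<ge> N" for n
    proof -
      have "N \<le> k n" using that seq_suble[OF k(1), of n] by simp
      then have "1 / real (Suc (k n)) \<le> 1 / real (Suc N)" by (intro divide_left_mono) auto
      then show ?thesis using N by simp
    qed
    then show ?thesis by blast
  qed
  \<comment> \<open>Stated for a general \<pi> in order to treat both marginals at once. The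
    discrete marginal arises from \<mu> by moving points less than 1 / (n + 1), which a uniformly
    continuous f does not notice in the limit.\<close>
  have marg: "(\<integral>p. f (\<pi> p) \<partial>\<sigma>) = (\<integral>x. f x \<partial>\<mu>)"
    if \<mu>: "prob_space \<mu>" "sets \<mu> = sets borel" and \<pi>: "continuous_on UNIV \<pi>" and f: "continuous_on UNIV f"
      and G: "\<And>n. \<exists>m r idx. idx \<in> measurable borel (count_space UNIV) \<and> (\<forall>x. idx x < (m::nat)) \<and>
        (\<forall>x. dist x (r (idx x)) < 1 / real (Suc n)) \<and> (\<integral>x. f (\<pi> (h x)) \<partial>\<nu> n) = (\<Sum>i<m. measure \<mu> {x. idx x = i} * f (r i))"
    for \<mu> and \<pi> :: "'a \<times> 'a \<Rightarrow> 'a" and f :: "'a \<Rightarrow> real"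
  proof -
    have "(\<lambda>n. \<integral>x. f (\<pi> (h x)) \<partial>\<nu> (k n)) \<longlonglongrightarrow> (\<integral>x. f x \<partial>\<mu>)"
    proof (rule LIMSEQ_I)
      fix e :: real assume e: "e > 0"
      obtain d where d: "d > 0" "\<And>x y. dist x y < d \<Longrightarrow> \<bar>f x - f y\<bar> < e / 2"
        using compact_uniformly_continuous[OF f X] half_gt_zero[OF e] unfolding uniformly_continuous_on_def by (metis UNIV_I dist_real_def)
      obtain N where N: "\<forall>n\<ge>N. 1 / real (Suc (k n)) < d" using ev[OF d(1)] by blast
      show "\<exists>N. \<forall>n\<ge>N. norm ((\<integral>x. f (\<pi> (h x)) \<partial>\<nu> (k n)) - (\<integral>x. f x \<partial>\<mu>)) < e"
      proof (intro exI[of _ N] allI impI)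
        fix n assume n: "n \<ge> N"
        obtain m r idx where g: "idx \<in> measurable borel (count_space UNIV)" "\<And>x. idx x < (m::nat)"
          "\<And>x. dist x (r (idx x)) < 1 / real (Suc (k n))" "(\<integral>x. f (\<pi> (h x)) \<partial>\<nu> (k n)) = (\<Sum>i<m. measure \<mu> {x. idx x = i} * f (r i))"
          using G[of "k n"] by blast
        have "(\<integral>x. f (\<pi> (h x)) \<partial>\<nu> (k n)) = (\<integral>x. f (r (idx x)) \<partial>\<mu>)"
          using g(4) integral_finite_range(1)[OF \<mu> g(1,2), of "\<lambda>i. f (r i)"] by simp
        moreover have "\<bar>(\<integral>x. f (r (idx x)) \<partial>\<mu>) - (\<integral>x. f x \<partial>\<mu>)\<bar> \<le> e / 2"
        proof (rule abs_integral_diff_le[OF \<mu>(1)])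
          show "integrable \<mu> (\<lambda>x. f (r (idx x)))" by (rule integral_finite_range(3)[OF \<mu> g(1,2), of "\<lambda>i. f (r i)"])
          show "integrable \<mu> f" by (rule compact_continuous_integrable[OF X f \<mu>])
          fix x
          have "dist (r (idx x)) x < d" using g(3)[of x] N n by (metis dist_commute order.strict_trans)
          then show "\<bar>f (r (idx x)) - f x\<bar> \<le> e / 2" using d(2) less_imp_le by blast
        qed
        ultimately show "norm ((\<integral>x. f (\<pi> (h x)) \<partial>\<nu> (k n)) - (\<integral>x. f x \<partial>\<mu>)) < e" using e by simp
      qed
    qed
    moreover have "(\<lambda>n. \<integral>x. f (\<pi> (h x)) \<partial>\<nu> (k n)) \<longlonglongrightarrow> (\<integral>p. f (\<pi> p) \<partial>\<sigma>)"
      using \<pi> f by (intro lim continuous_on_compose2[OF f \<pi>]) auto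
    ultimately show ?thesis using LIMSEQ_unique by blast
  qed
  have marg_eq: "distr \<sigma> borel \<pi> = \<mu>"
    if \<mu>: "prob_space \<mu>" "sets \<mu> = sets borel" and \<pi>: "continuous_on UNIV \<pi>"
      and G: "\<And>n f :: 'a \<Rightarrow> real. continuous_on UNIV f \<Longrightarrow> \<exists>m r idx. idx \<in> measurable borel (count_space UNIV) \<and> (\<forall>x. idx x < (m::nat)) \<and>
        (\<forall>x. dist x (r (idx x)) < 1 / real (Suc n)) \<and> (\<integral>x. f (\<pi> (h x)) \<partial>\<nu> n) = (\<Sum>i<m. measure \<mu> {x. idx x = i} * f (r i))"
    for \<mu> and \<pi> :: "'a \<times> 'a \<Rightarrow> 'a"
  proof (rule finite_borel_measure_eqI)
    have m: "\<pi> \<in> measurable \<sigma> borel" using borel_measurable_continuous_onI[OF \<pi>] \<sigma>(2) by (simp cong: measurable_cong_sets)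
    show "finite_measure (distr \<sigma> borel \<pi>)" using prob_space.prob_space_distr[OF \<sigma>(1) m] prob_space.finite_measure by blast
    show "finite_measure \<mu>" using \<mu>(1) prob_space.finite_measure by blast
    fix f :: "'a \<Rightarrow> real" assume f: "continuous_on UNIV f"
    have "(\<integral>x. f x \<partial>distr \<sigma> borel \<pi>) = (\<integral>p. f (\<pi> p) \<partial>\<sigma>)"
      by (rule integral_distr[OF m]) (simp add: borel_measurable_continuous_onI[OF f])
    also have "\<dots> = (\<integral>x. f x \<partial>\<mu>)" by (rule marg[OF \<mu> \<pi> f G[OF f]])
    finally show "(\<integral>x. f x \<partial>distr \<sigma> borel \<pi>) = (\<integral>x. f x \<partial>\<mu>)" .
  qed (use \<mu> in auto)
  show thesis
  proof (rule that[OF \<sigma>])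
    show "distr \<sigma> borel fst = \<mu>1"
    proof (rule marg_eq[OF \<mu>1])
      fix n and f :: "'a \<Rightarrow> real" assume f: "continuous_on UNIV f"
      obtain m r idx w t where g: "idx \<in> measurable borel (count_space UNIV)" "\<forall>x. idx x < (m::nat)" "\<forall>x. dist x (r (idx x)) < 1 / real (Suc n)"
        "\<forall>i<m. (\<Sum>j<m. w (i, j)) = measure \<mu>1 {x. idx x = i}" "\<forall>i j. h (t i j) = (r i, r j)"
        "\<forall>g :: real \<Rightarrow> real. continuous_on UNIV g \<longrightarrow> (\<integral>x. g x \<partial>\<nu> n) = (\<Sum>i<m. \<Sum>j<m. w (i, j) * g (t i j))"
        using \<nu>[of n] unfolding good_def by - (elim exE conjE, rule that)
      have "continuous_on UNIV (\<lambda>x. f (fst (h x)))"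
        by (intro continuous_on_compose2[OF f] continuous_intros h(1)) auto
      then have "(\<integral>x. f (fst (h x)) \<partial>\<nu> n) = (\<Sum>i<m. \<Sum>j<m. w (i, j) * f (r i))" using g(5,6) by simp
      also have "\<dots> = (\<Sum>i<m. measure \<mu>1 {x. idx x = i} * f (r i))" using g(4) by (simp flip: sum_distrib_right)
      finally show "\<exists>m r idx. idx \<in> measurable borel (count_space UNIV) \<and> (\<forall>x. idx x < (m::nat)) \<and>
        (\<forall>x. dist x (r (idx x)) < 1 / real (Suc n)) \<and> (\<integral>x. f (fst (h x)) \<partial>\<nu> n) = (\<Sum>i<m. measure \<mu>1 {x. idx x = i} * f (r i))"
        using g(1-3) by blast
    qed (intro continuous_intros)
    show "distr \<sigma> borel snd = \<mu>2"
    proof (rule marg_eq[OF \<mu>2])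
      fix n and f :: "'a \<Rightarrow> real" assume f: "continuous_on UNIV f"
      obtain m r idx w t where g: "idx \<in> measurable borel (count_space UNIV)" "\<forall>x. idx x < (m::nat)" "\<forall>x. dist x (r (idx x)) < 1 / real (Suc n)"
        "\<forall>j<m. (\<Sum>i<m. w (i, j)) = measure \<mu>2 {x. idx x = j}" "\<forall>i j. h (t i j) = (r i, r j)"
        "\<forall>g :: real \<Rightarrow> real. continuous_on UNIV g \<longrightarrow> (\<integral>x. g x \<partial>\<nu> n) = (\<Sum>i<m. \<Sum>j<m. w (i, j) * g (t i j))"
        using \<nu>[of n] unfolding good_def by - (elim exE conjE, rule that)
      have "continuous_on UNIV (\<lambda>x. f (snd (h x)))"
        by (intro continuous_on_compose2[OF f] continuous_intros h(1)) auto
      then have "(\<integral>x. f (snd (h x)) \<partial>\<nu> n) = (\<Sum>i<m. \<Sum>j<m. w (i, j) * f (r j))" using g(5,6) by simp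
      also have "\<dots> = (\<Sum>j<m. \<Sum>i<m. w (i, j) * f (r j))" by (rule sum.swap)
      also have "\<dots> = (\<Sum>j<m. measure \<mu>2 {x. idx x = j} * f (r j))" using g(4) by (simp flip: sum_distrib_right)
      finally show "\<exists>m r idx. idx \<in> measurable borel (count_space UNIV) \<and> (\<forall>x. idx x < (m::nat)) \<and>
        (\<forall>x. dist x (r (idx x)) < 1 / real (Suc n)) \<and> (\<integral>x. f (snd (h x)) \<partial>\<nu> n) = (\<Sum>i<m. measure \<mu>2 {x. idx x = i} * f (r i))"
        using g(1-3) by blast
    qed (intro continuous_intros)
    fix e :: real assume e: "e > 0"
    \<comment> \<open>Three errors of e / 3: replacing points by sample points in the integrals of
      U1 and of U2, and passing from the discrete plan to \<sigma>.\<close>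
    obtain d where d: "d > 0" "\<And>p q. dist p q < d \<Longrightarrow> \<bar>c p - c q\<bar> < e / 3"
      using compact_uniformly_continuous[OF c XX] e unfolding uniformly_continuous_on_def by (metis UNIV_I dist_real_def divide_pos_pos zero_less_numeral)
    obtain N1 where N1: "\<forall>n\<ge>N1. 1 / real (Suc (k n)) < d" using ev[OF d(1)] by blast
    obtain N2 where N2: "\<forall>n\<ge>N2. norm ((\<integral>x. c (h x) \<partial>\<nu> (k n)) - (\<integral>p. c p \<partial>\<sigma>)) < e / 3"
      using LIMSEQ_D[OF lim[OF c], of "e / 3"] e by auto
    define n where "n = max N1 N2"
    have kn: "1 / real (Suc (k n)) < d" "\<bar>(\<integral>x. c (h x) \<partial>\<nu> (k n)) - (\<integral>p. c p \<partial>\<sigma>)\<bar> < e / 3"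
      using N1 N2 by (auto simp: n_def)
    obtain m r idx w u1 u2 t where g: "idx \<in> measurable borel (count_space UNIV)" "\<forall>x. idx x < (m::nat)" "\<forall>x. dist x (r (idx x)) < 1 / real (Suc (k n))"
        "\<forall>i<m. \<forall>j<m. u2 j - u1 i \<le> c (r i, r j)"
        "(\<Sum>i<m. \<Sum>j<m. w (i, j) * c (r i, r j)) = (\<Sum>j<m. measure \<mu>2 {x. idx x = j} * u2 j) - (\<Sum>i<m. measure \<mu>1 {x. idx x = i} * u1 i)"
        "\<forall>i j. h (t i j) = (r i, r j)"
        "\<forall>g :: real \<Rightarrow> real. continuous_on UNIV g \<longrightarrow> (\<integral>x. g x \<partial>\<nu> (k n)) = (\<Sum>i<m. \<Sum>j<m. w (i, j) * g (t i j))"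
        using \<nu>[of "k n"] unfolding good_def by - (elim exE conjE, rule that)
    have m: "0 < m" using g(2) by (metis gr_implies_not0 neq0_conv)
    obtain U1 U2 where U: "\<And>x y. U2 y - U1 x \<le> c (x, y)" "continuous_on UNIV U1" "continuous_on UNIV U2"
      "\<And>i. i < m \<Longrightarrow> U1 (r i) \<le> u1 i"
      "\<forall>j a. (\<forall>i<m. a \<le> u1 i + c (r i, r j)) \<longrightarrow> a \<le> U2 (r j)"
      "\<forall>x x' e. (\<forall>y. \<bar>c (x, y) - c (x', y)\<bar> \<le> e) \<longrightarrow> \<bar>U1 x - U1 x'\<bar> \<le> e"
      "\<forall>y y' e. (\<forall>x. \<bar>c (x, y) - c (x, y')\<bar> \<le> e) \<longrightarrow> \<bar>U2 y - U2 y'\<bar> \<le> e"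
      by (rule c_transform[OF X c m, of r u1], rule that)
    have close: "\<bar>c (x, y) - c (x', y)\<bar> \<le> e / 3" "\<bar>c (y, x) - c (y, x')\<bar> \<le> e / 3" if "dist x x' < d" for x x' y
      using d(2)[of "(x, y)" "(x', y)"] d(2)[of "(y, x)" "(y, x')"] that by (auto simp: dist_Pair_Pair less_imp_le)
    have near: "dist x (r (idx x)) < d" for x using g(3) kn(1) by (meson order.strict_trans)
    have i1: "\<bar>(\<integral>x. U1 x \<partial>\<mu>1) - (\<integral>x. U1 (r (idx x)) \<partial>\<mu>1)\<bar> \<le> e / 3"
    proof (rule abs_integral_diff_le[OF \<mu>1(1)])
      show "integrable \<mu>1 (\<lambda>x. U1 (r (idx x)))" by (rule integral_finite_range(3)[OF \<mu>1 g(1) g(2)[rule_format], of "\<lambda>i. U1 (r i)"])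
      show "\<bar>U1 x - U1 (r (idx x))\<bar> \<le> e / 3" for x using U(6) close(1)[OF near] by blast
    qed (rule compact_continuous_integrable[OF X U(2) \<mu>1])
    have i2: "\<bar>(\<integral>x. U2 x \<partial>\<mu>2) - (\<integral>x. U2 (r (idx x)) \<partial>\<mu>2)\<bar> \<le> e / 3"
    proof (rule abs_integral_diff_le[OF \<mu>2(1)])
      show "integrable \<mu>2 (\<lambda>x. U2 (r (idx x)))" by (rule integral_finite_range(3)[OF \<mu>2 g(1) g(2)[rule_format], of "\<lambda>i. U2 (r i)"])
      show "\<bar>U2 x - U2 (r (idx x))\<bar> \<le> e / 3" for x using U(7) close(2)[OF near] by blast
    qed (rule compact_continuous_integrable[OF X U(3) \<mu>2])
    have j1: "(\<integral>x. U1 (r (idx x)) \<partial>\<mu>1) \<le> (\<Sum>i<m. measure \<mu>1 {x. idx x = i} * u1 i)"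
      unfolding integral_finite_range(1)[OF \<mu>1 g(1) g(2)[rule_format], of "\<lambda>i. U1 (r i)"]
      using U(4) by (intro sum_mono mult_left_mono) auto
    have "u2 j \<le> U2 (r j)" if "j < m" for j
    proof -
      have "\<forall>i<m. u2 j \<le> u1 i + c (r i, r j)" using g(4) that by (auto simp: algebra_simps)
      then show ?thesis using U(5) by blast
    qed
    then have j2: "(\<Sum>i<m. measure \<mu>2 {x. idx x = i} * u2 i) \<le> (\<integral>x. U2 (r (idx x)) \<partial>\<mu>2)"
      unfolding integral_finite_range(1)[OF \<mu>2 g(1) g(2)[rule_format], of "\<lambda>i. U2 (r i)"]
      by (intro sum_mono mult_left_mono) auto
    have "continuous_on UNIV (\<lambda>x. c (h x))" by (rule continuous_on_compose2[OF c h(1)]) auto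
    then have "(\<integral>x. c (h x) \<partial>\<nu> (k n)) = (\<Sum>i<m. \<Sum>j<m. w (i, j) * c (r i, r j))" using g(6,7) by simp
    then have "(\<integral>p. c p \<partial>\<sigma>) - e \<le> (\<integral>y. U2 y \<partial>\<mu>2) - (\<integral>x. U1 x \<partial>\<mu>1)"
      using i1 i2 j1 j2 kn(2) g(5) by linarith
    then show "\<exists>U1 U2. continuous_on UNIV U1 \<and> continuous_on UNIV U2 \<and> (\<forall>x y. U2 y - U1 x \<le> c (x, y)) \<and>
       (\<integral>p. c p \<partial>\<sigma>) - e \<le> (\<integral>y. U2 y \<partial>\<mu>2) - (\<integral>x. U1 x \<partial>\<mu>1)"
      using U(1-3) by blast
  qed
qed

section \<open>Test functions and weak-* curves\<close>

lemma torus_continuous_on_iff_lift: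
  fixes f :: "'n::finite torus \<Rightarrow> 'b::topological_space"
  assumes "continuous_on UNIV (\<lambda>x. f (proj_torus x))"
  shows "continuous_on UNIV f"
  unfolding continuous_on_open_vimage[OF open_UNIV]
proof (intro allI impI)
  fix B :: "'b set" assume "open B"
  then have "open ((\<lambda>x. f (proj_torus x)) -` B)"
    using assms unfolding continuous_on_open_vimage[OF open_UNIV] by auto
  moreover have "proj_torus -` (f -` B) = (\<lambda>x. f (proj_torus x)) -` B" by auto
  ultimately show "open (f -` B \<inter> UNIV)" by (simp add: open_torus_iff)
qed

lemma weak_star_topspace: "topspace weak_star = torus_probs"
proof -
  have "\<Union>{{\<mu> \<in> torus_probs. (\<integral>q. f q \<partial>\<mu>) \<in> U} | (f :: 'a torus \<Rightarrow> real) U. continuous_on UNIV f \<and> open U} = torus_probs"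
  proof (intro equalityI subsetI)
    fix \<mu> :: "'a torus measure" assume \<mu>: "\<mu> \<in> torus_probs"
    have "torus_probs \<in> {{\<mu> \<in> torus_probs. (\<integral>q. f q \<partial>\<mu>) \<in> U} | (f :: 'a torus \<Rightarrow> real) U. continuous_on UNIV f \<and> open U}"
      by (intro CollectI exI[of _ "\<lambda>_. 0"] exI[of _ UNIV]) auto
    then show "\<mu> \<in> \<Union>{{\<mu> \<in> torus_probs. (\<integral>q. f q \<partial>\<mu>) \<in> U} | (f :: 'a torus \<Rightarrow> real) U. continuous_on UNIV f \<and> open U}"
      using \<mu> by blast
  qed auto
  then show ?thesis unfolding weak_star_def topology_generated_by_topspace .
qed

lemma weak_star_curveI:
  fixes \<mu> :: "real \<Rightarrow> 'n::finite torus measure"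
  assumes \<mu>: "\<And>t. t \<in> {0..T} \<Longrightarrow> \<mu> t \<in> torus_probs"
    and c: "\<And>f :: 'n torus \<Rightarrow> real. continuous_on UNIV f \<Longrightarrow> continuous_on {0..T} (\<lambda>t. \<integral>q. f q \<partial>\<mu> t)"
  shows "continuous_map (top_of_set {0..T}) weak_star \<mu>"
  unfolding weak_star_def
proof (rule continuous_on_generated_topo)
  fix W assume "W \<in> {{\<mu> \<in> torus_probs. (\<integral>q. f q \<partial>\<mu>) \<in> U} | (f :: 'n torus \<Rightarrow> real) U. continuous_on UNIV f \<and> open U}"
  then obtain f :: "'n torus \<Rightarrow> real" and U where W: "W = {\<mu> \<in> torus_probs. (\<integral>q. f q \<partial>\<mu>) \<in> U}" "continuous_on UNIV f" "open U" by auto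
  have "\<mu> -` W \<inter> topspace (top_of_set {0..T}) = {0..T} \<inter> (\<lambda>t. \<integral>q. f q \<partial>\<mu> t) -` U" using \<mu> by (auto simp: W)
  moreover have "openin (top_of_set {0..T}) ({0..T} \<inter> (\<lambda>t. \<integral>q. f q \<partial>\<mu> t) -` U)"
    using c[OF W(2)] W(3) by (rule continuous_openin_preimage_gen)
  ultimately show "openin (top_of_set {0..T}) (\<mu> -` W \<inter> topspace (top_of_set {0..T}))" by simp
next
  show "\<mu> ` topspace (top_of_set {0..T}) \<subseteq> \<Union>{{\<mu> \<in> torus_probs. (\<integral>q. f q \<partial>\<mu>) \<in> U} | (f :: 'n torus \<Rightarrow> real) U. continuous_on UNIV f \<and> open U}"
  proof -
    have "\<Union>{{\<mu> \<in> torus_probs. (\<integral>q. f q \<partial>\<mu>) \<in> U} | (f :: 'n torus \<Rightarrow> real) U. continuous_on UNIV f \<and> open U} = torus_probs"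
      using weak_star_topspace unfolding weak_star_def topology_generated_by_topspace .
    then show ?thesis using \<mu> by (simp only:) auto
  qed
qed

lemma weak_star_curveD:
  fixes \<mu> :: "real \<Rightarrow> 'n::finite torus measure"
  assumes c: "continuous_map (top_of_set {0..T}) weak_star \<mu>"
  shows "t \<in> {0..T} \<Longrightarrow> \<mu> t \<in> torus_probs"
    "continuous_on UNIV f \<Longrightarrow> continuous_on {0..T} (\<lambda>t. \<integral>q. (f q :: real) \<partial>\<mu> t)"
proof -
  show p: "\<mu> t \<in> torus_probs" if "t \<in> {0..T}" for t
    using continuous_map_image_subset_topspace[OF c] that by (auto simp: weak_star_topspace)
  show "continuous_on {0..T} (\<lambda>t. \<integral>q. f q \<partial>\<mu> t)" if f: "continuous_on UNIV f"
    unfolding continuous_on_open_invariant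
  proof (intro allI impI)
    fix U :: "real set" assume U: "open U"
    have "openin weak_star {\<mu> \<in> torus_probs. (\<integral>q. f q \<partial>\<mu>) \<in> U}"
      unfolding weak_star_def using f U by (intro topology_generated_by_Basis) auto
    from openin_continuous_map_preimage[OF c this]
    obtain A where A: "open A" "{t \<in> {0..T}. \<mu> t \<in> {\<mu> \<in> torus_probs. (\<integral>q. f q \<partial>\<mu>) \<in> U}} = {0..T} \<inter> A"
      by (auto simp: openin_open)
    then show "\<exists>A. open A \<and> A \<inter> {0..T} = (\<lambda>t. \<integral>q. f q \<partial>\<mu> t) -` U \<inter> {0..T}"
      using p by (intro exI[of _ A]) auto
  qed
qed

section \<open>Derivatives on the torus and the inequality along a path\<close>

lemma blinfun_prod_vec:
  fixes D :: "((real ^ 'n::finite) \<times> real) \<Rightarrow>\<^sub>L real"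
  shows "blinfun_apply D (v, s) = (\<chi> i. blinfun_apply D (axis i 1, 0)) \<bullet> v + s * blinfun_apply D (0, 1)"
proof -
  have "(v, s) = (\<Sum>i\<in>UNIV. v $ i *\<^sub>R (axis i 1, 0)) + s *\<^sub>R (0, 1)"
  proof (rule prod_eqI)
    show "fst (v, s) = fst ((\<Sum>i\<in>UNIV. v $ i *\<^sub>R (axis i 1, 0)) + s *\<^sub>R (0, 1))"
      using basis_expansion[of v] by (simp add: fst_sum scalar_mult_eq_scaleR)
  qed (simp add: snd_sum)
  from arg_cong[OF this, of "blinfun_apply D"]
  have "blinfun_apply D (v, s) = (\<Sum>i\<in>UNIV. v $ i * blinfun_apply D (axis i 1, 0)) + s * blinfun_apply D (0, 1)"
    by (simp only: blinfun.add_right blinfun.sum_right blinfun.scaleR_right real_scaleR_def)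
  then show ?thesis by (simp add: inner_vec_def mult.commute)
qed

text \<open>The derivatives occurring in \<open>F_functional\<close> are taken on the torus, in time
  or along coordinate circles; the chain rule computes them from the total derivative on the
  cover.\<close>

lemma lift_derivatives:
  fixes \<phi> :: "'n::finite torus \<times> real \<Rightarrow> real"
  assumes D: "((\<lambda>(x, t). \<phi> (proj_torus x, t)) has_derivative blinfun_apply D) (at (x, t))"
  shows "time_deriv \<phi> (proj_torus x) t = blinfun_apply D (0, 1)"
    "space_grad \<phi> (proj_torus x) t = (\<chi> i. blinfun_apply D (axis i 1, 0))"
proof -
  have "((\<lambda>\<tau>. (x, \<tau>)) has_derivative (\<lambda>h. (0, h))) (at t)" by (auto intro!: derivative_eq_intros)
  from has_derivative_compose[OF this, of "\<lambda>(x, t). \<phi> (proj_torus x, t)" "blinfun_apply D"] D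
  have "((\<lambda>\<tau>. \<phi> (proj_torus x, \<tau>)) has_derivative (\<lambda>h. blinfun_apply D (0, h))) (at t)" by simp
  moreover have "(\<lambda>h. blinfun_apply D (0, h)) = (\<lambda>h. blinfun_apply D (0, 1) * h)"
  proof
    fix h :: real
    have "blinfun_apply D (h *\<^sub>R (0, 1)) = h * blinfun_apply D (0, 1)" by (simp only: blinfun.scaleR_right real_scaleR_def)
    then show "blinfun_apply D (0, h) = blinfun_apply D (0, 1) * h" by (simp add: mult.commute)
  qed
  ultimately have "((\<lambda>\<tau>. \<phi> (proj_torus x, \<tau>)) has_field_derivative blinfun_apply D (0, 1)) (at t)"
    by (simp add: has_field_derivative_def)
  then show "time_deriv \<phi> (proj_torus x) t = blinfun_apply D (0, 1)"
    unfolding time_deriv_def by (rule DERIV_imp_deriv)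
  have "deriv (\<lambda>h. \<phi> (proj_torus x + proj_torus (h *\<^sub>R axis i 1), t)) 0 = blinfun_apply D (axis i 1, 0)" for i
  proof (rule DERIV_imp_deriv)
    have "((\<lambda>h. (x + h *\<^sub>R axis i 1, t)) has_derivative (\<lambda>h. (h *\<^sub>R axis i 1, 0))) (at (0::real))"
      by (auto intro!: derivative_eq_intros)
    from has_derivative_compose[OF this, of "\<lambda>(x, t). \<phi> (proj_torus x, t)" "blinfun_apply D"] D
    have "((\<lambda>h. \<phi> (proj_torus (x + h *\<^sub>R axis i 1), t)) has_derivative (\<lambda>h. blinfun_apply D (h *\<^sub>R axis i 1, 0))) (at 0)" by simp
    moreover have "(\<lambda>h. blinfun_apply D (h *\<^sub>R axis i 1, 0)) = (\<lambda>h. blinfun_apply D (axis i 1, 0) * h)"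
    proof
      fix h :: real
      have "blinfun_apply D (h *\<^sub>R (axis i 1, 0)) = h * blinfun_apply D (axis i 1, 0)" by (simp only: blinfun.scaleR_right real_scaleR_def)
      then show "blinfun_apply D (h *\<^sub>R axis i 1, 0) = blinfun_apply D (axis i 1, 0) * h" by (simp add: mult.commute)
    qed
    ultimately show "((\<lambda>h. \<phi> (proj_torus x + proj_torus (h *\<^sub>R axis i 1), t)) has_field_derivative blinfun_apply D (axis i 1, 0)) (at 0)"
      by (simp add: has_field_derivative_def proj_torus_add)
  qed
  then show "space_grad \<phi> (proj_torus x) t = (\<chi> i. blinfun_apply D (axis i 1, 0))"
    unfolding space_grad_def by simp
qed

definition HJ :: "('n::finite torus \<times> real \<Rightarrow> real) \<Rightarrow> real ^ 'n \<Rightarrow> 'n torus \<Rightarrow> real \<Rightarrow> real" where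
  "HJ \<phi> P q t = time_deriv \<phi> q t + (norm (space_grad \<phi> q t + P))\<^sup>2 / 2"

lemma test_functionE:
  fixes \<phi> :: "'n::finite torus \<times> real \<Rightarrow> real"
  assumes "\<phi> \<in> test_functions T"
  obtains D where "\<And>x t. ((\<lambda>(x, t). \<phi> (proj_torus x, t)) has_derivative blinfun_apply (D (x, t))) (at (x, t))"
    "continuous_on UNIV D" "\<And>q t. t \<le> 0 \<or> T \<le> t \<Longrightarrow> \<phi> (q, t) = 0"
proof -
  obtain D :: "(real ^ 'n) \<times> real \<Rightarrow> ((real ^ 'n) \<times> real) \<Rightarrow>\<^sub>L real"
    where D: "\<forall>z. ((\<lambda>(x, t). \<phi> (proj_torus x, t)) has_derivative blinfun_apply (D z)) (at z)" "continuous_on UNIV D"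
    using assms unfolding test_functions_def by blast
  obtain K where K: "K \<subseteq> UNIV \<times> {0<..<T}" "\<And>z. z \<notin> K \<Longrightarrow> \<phi> z = 0"
    using assms unfolding test_functions_def by blast
  show thesis
  proof (rule that[of D])
    show "\<phi> (q, t) = 0" if "t \<le> 0 \<or> T \<le> t" for q t
      by (rule K(2)) (use K(1) that in auto)
  qed (use D in auto)
qed

lemma HJ_lift:
  fixes \<phi> :: "'n::finite torus \<times> real \<Rightarrow> real"
  assumes D: "\<And>x t. ((\<lambda>(x, t). \<phi> (proj_torus x, t)) has_derivative blinfun_apply (D (x, t))) (at (x, t))"
  shows "HJ \<phi> P (proj_torus x) t = blinfun_apply (D (x, t)) (0, 1) + (norm ((\<chi> i. blinfun_apply (D (x, t)) (axis i 1, 0)) + P))\<^sup>2 / 2"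
  unfolding HJ_def lift_derivatives[OF D] ..

lemma HJ_continuous:
  fixes \<phi> :: "'n::finite torus \<times> real \<Rightarrow> real"
  assumes "\<phi> \<in> test_functions T"
  shows "continuous_on UNIV (\<lambda>(x, t). HJ \<phi> P (proj_torus x) t)"
proof -
  obtain D where D: "\<And>x t. ((\<lambda>(x, t). \<phi> (proj_torus x, t)) has_derivative blinfun_apply (D (x, t))) (at (x, t))"
    "continuous_on UNIV D"
    by (rule test_functionE[OF assms], rule that)
  have "(\<lambda>(x, t). HJ \<phi> P (proj_torus x) t) = (\<lambda>z. blinfun_apply (D z) (0, 1) + (norm ((\<chi> i. blinfun_apply (D z) (axis i 1, 0)) + P))\<^sup>2 / 2)"
    using HJ_lift[of \<phi> D P, OF D(1)] by (auto simp: fun_eq_iff)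
  moreover have "continuous_on UNIV \<dots>"
    by (intro continuous_intros continuous_on_vec_lambda D(2)) auto
  ultimately show ?thesis by simp
qed

text \<open>Since \<phi> vanishes at both ends, its total derivative along \<gamma> integrates to
  zero and may be subtracted from the integrand. With a the gradient plus P, what remains is |a|^2 /
  2 - v . (a - P), and the tangent inequality bounds it below by v . P - |v|^2 / 2 = |P|^2 / 2 - |v
  - P|^2 / 2.\<close>

lemma HJ_action_inequality:
  fixes \<phi> :: "'n::finite torus \<times> real \<Rightarrow> real"
  assumes \<phi>: "\<phi> \<in> test_functions T" and n: "nice_curve R T \<gamma> v" and T: "T > 0"
  shows "(\<lambda>t. HJ \<phi> P (proj_torus (\<gamma> t)) t) integrable_on {0..T}"
    "T * (norm P)\<^sup>2 / 2 - integral {0..T} (\<lambda>t. (norm (v t - P))\<^sup>2 / 2) \<le> integral {0..T} (\<lambda>t. HJ \<phi> P (proj_torus (\<gamma> t)) t)"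
proof -
  obtain D where D: "\<And>x t. ((\<lambda>(x, t). \<phi> (proj_torus x, t)) has_derivative blinfun_apply (D (x, t))) (at (x, t))"
    "continuous_on UNIV D" "\<And>q t. t \<le> 0 \<or> T \<le> t \<Longrightarrow> \<phi> (q, t) = 0"
    by (rule test_functionE[OF \<phi>], rule that)
  have cg: "continuous_on {0..T} (\<lambda>t. (\<gamma> t, t))" by (intro continuous_intros nice_curveD(3)[OF n])
  show int: "(\<lambda>t. HJ \<phi> P (proj_torus (\<gamma> t)) t) integrable_on {0..T}"
    using continuous_on_compose2[OF HJ_continuous[OF \<phi>, of P] cg] by (intro integrable_continuous_real) auto
  obtain S where S: "finite S" "\<And>s. s\<in>{0<..<T} - S \<Longrightarrow> (\<gamma> has_vector_derivative v s) (at s)"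
    using n by (auto simp: nice_curve_def)
  have "((\<lambda>t. blinfun_apply (D (\<gamma> t, t)) (v t, 1)) has_integral (\<lambda>t. \<phi> (proj_torus (\<gamma> t), t)) T - (\<lambda>t. \<phi> (proj_torus (\<gamma> t), t)) 0) {0..T}"
  proof (rule fundamental_theorem_of_calculus_interior_strong[OF S(1)])
    have "continuous_on UNIV (\<lambda>(x, t). \<phi> (proj_torus x, t))"
      using D(1) by (intro continuous_at_imp_continuous_on) (auto intro: has_derivative_continuous)
    from continuous_on_compose2[OF this cg] show "continuous_on {0..T} (\<lambda>t. \<phi> (proj_torus (\<gamma> t), t))" by simp
    fix t assume t: "t \<in> {0<..<T} - S"
    have "((\<lambda>t. (\<gamma> t, t)) has_derivative (\<lambda>h. (h *\<^sub>R v t, h))) (at t)"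
      using S(2)[OF t] unfolding has_vector_derivative_def by (rule has_derivative_Pair[OF _ has_derivative_ident])
    from has_derivative_compose[OF this, of "\<lambda>(x, t). \<phi> (proj_torus x, t)" "blinfun_apply (D (\<gamma> t, t))"] D(1)
    have "((\<lambda>t. \<phi> (proj_torus (\<gamma> t), t)) has_derivative (\<lambda>h. blinfun_apply (D (\<gamma> t, t)) (h *\<^sub>R v t, h))) (at t)" by simp
    moreover have "(\<lambda>h. blinfun_apply (D (\<gamma> t, t)) (h *\<^sub>R v t, h)) = (\<lambda>h. h *\<^sub>R blinfun_apply (D (\<gamma> t, t)) (v t, 1))"
    proof
      fix h :: real
      have "blinfun_apply (D (\<gamma> t, t)) (h *\<^sub>R (v t, 1)) = h *\<^sub>R blinfun_apply (D (\<gamma> t, t)) (v t, 1)" by (rule blinfun.scaleR_right)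
      then show "blinfun_apply (D (\<gamma> t, t)) (h *\<^sub>R v t, h) = h *\<^sub>R blinfun_apply (D (\<gamma> t, t)) (v t, 1)" by simp
    qed
    ultimately show "((\<lambda>t. \<phi> (proj_torus (\<gamma> t), t)) has_vector_derivative blinfun_apply (D (\<gamma> t, t)) (v t, 1)) (at t)"
      by (simp add: has_vector_derivative_def)
  qed (use T in auto)
  then have z: "((\<lambda>t. blinfun_apply (D (\<gamma> t, t)) (v t, 1)) has_integral 0) {0..T}" using D(3) by simp
  note k = action_integrable(1)[OF n continuous_on_const order_refl order_refl, of P]
  have "((\<lambda>t. blinfun_apply (D (\<gamma> t, t)) (v t, 1) + ((norm P)\<^sup>2 / 2 - (norm (v t - P))\<^sup>2 / 2)) has_integral
      0 + ((norm P)\<^sup>2 / 2 * T - integral {0..T} (\<lambda>t. (norm (v t - P))\<^sup>2 / 2))) {0..T}"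
    using has_integral_const_real[of "(norm P)\<^sup>2 / 2" 0 T] T
    by (intro has_integral_add z has_integral_diff integrable_integral k) (simp add: mult.commute)
  then have "0 + ((norm P)\<^sup>2 / 2 * T - integral {0..T} (\<lambda>t. (norm (v t - P))\<^sup>2 / 2)) \<le> integral {0..T} (\<lambda>t. HJ \<phi> P (proj_torus (\<gamma> t)) t)"
  proof (rule has_integral_le[OF _ integrable_integral[OF int]])
    fix t assume "t \<in> {0..T}"
    let ?g = "(\<chi> i. blinfun_apply (D (\<gamma> t, t)) (axis i 1, 0)) :: real ^ 'n"
    have "blinfun_apply (D (\<gamma> t, t)) (v t, 1) = ?g \<bullet> v t + blinfun_apply (D (\<gamma> t, t)) (0, 1)"
      by (subst blinfun_prod_vec) simp
    moreover have "(norm (v t))\<^sup>2 / 2 + v t \<bullet> (?g + P - v t) \<le> (norm (?g + P))\<^sup>2 / 2" by (rule inner_tangent_le)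
    moreover have "(norm (v t - P))\<^sup>2 = (norm (v t))\<^sup>2 + (norm P)\<^sup>2 - 2 * (v t \<bullet> P)"
      by (simp add: power2_norm_eq_inner algebra_simps inner_commute)
    moreover have "v t \<bullet> (?g + P - v t) = ?g \<bullet> v t + v t \<bullet> P - (norm (v t))\<^sup>2"
      by (simp add: inner_add_right inner_diff_right inner_commute power2_norm_eq_inner)
    ultimately show "blinfun_apply (D (\<gamma> t, t)) (v t, 1) + ((norm P)\<^sup>2 / 2 - (norm (v t - P))\<^sup>2 / 2) \<le> HJ \<phi> P (proj_torus (\<gamma> t)) t"
      unfolding HJ_lift[of \<phi> D P, OF D(1)] by argo
  qed
  then show "T * (norm P)\<^sup>2 / 2 - integral {0..T} (\<lambda>t. (norm (v t - P))\<^sup>2 / 2) \<le> integral {0..T} (\<lambda>t. HJ \<phi> P (proj_torus (\<gamma> t)) t)"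
    by (simp add: mult.commute)
qed

section \<open>Rounding to a finite grid\<close>

definition torus_round :: "nat \<Rightarrow> 'n::finite torus \<Rightarrow> real ^ 'n" where
  "torus_round M q = (\<chi> i. real_of_int \<lfloor>real M * torus_sec q $ i\<rfloor> / real M)"

lemma torus_round_near:
  fixes q :: "'n::finite torus"
  assumes "M > 0"
  shows "norm (torus_sec q - torus_round M q) \<le> CARD('n) / M"
proof -
  have "norm (torus_sec q - torus_round M q) \<le> (\<Sum>i\<in>UNIV. \<bar>(torus_sec q - torus_round M q) $ i\<bar>)" by (rule norm_le_l1_cart)
  also have "\<dots> \<le> (\<Sum>i\<in>(UNIV :: 'n set). 1 / M)"
  proof (rule sum_mono)
    fix i
    let ?x = "real M * torus_sec q $ i"
    have "(torus_sec q - torus_round M q) $ i = (?x - \<lfloor>?x\<rfloor>) / M" using assms by (simp add: torus_round_def diff_divide_distrib)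
    moreover have "0 \<le> ?x - \<lfloor>?x\<rfloor>" "?x - \<lfloor>?x\<rfloor> \<le> 1" by linarith+
    ultimately show "\<bar>(torus_sec q - torus_round M q) $ i\<bar> \<le> 1 / M" using assms by (simp add: divide_right_mono)
  qed
  finally show ?thesis by simp
qed

lemma torus_round_finite:
  assumes "M > 0"
  shows "finite (range (torus_round M :: 'n::finite torus \<Rightarrow> real ^ 'n))"
proof (rule finite_subset)
  show "range (torus_round M) \<subseteq> (\<lambda>f. \<chi> i. real (f i) / real M) ` (PiE UNIV (\<lambda>_ :: 'n. {..<M}))"
  proof (rule image_subsetI)
    fix q :: "'n torus"
    let ?f = "\<lambda>i. nat \<lfloor>real M * torus_sec q $ i\<rfloor>"
    have "real (?f i) = real_of_int \<lfloor>real M * torus_sec q $ i\<rfloor>" for i using torus_sec_bounds(1)[of q i] by simp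
    moreover have "?f i < M" for i
    proof -
      have "real M * torus_sec q $ i < real M * 1" using torus_sec_bounds(2)[of q i] assms by (intro mult_strict_left_mono) auto
      then show ?thesis using torus_sec_bounds(1)[of q i] assms by (simp add: nat_less_iff floor_less_iff)
    qed
    ultimately show "torus_round M q \<in> (\<lambda>f. \<chi> i. real (f i) / real M) ` (PiE UNIV (\<lambda>_ :: 'n. {..<M}))"
      by (intro image_eqI[of _ _ ?f]) (auto simp: torus_round_def)
  qed
  show "finite ((\<lambda>f. \<chi> i. real (f i) / real M) ` (PiE UNIV (\<lambda>_ :: 'n. {..<M})))"
    by (intro finite_imageI finite_PiE) auto
qed

lemma torus_round_measurable: "torus_round M \<in> borel_measurable borel"
proof (rule borel_measurable_euclidean_space[THEN iffD2, rule_format])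
  fix b :: "real ^ 'a" assume "b \<in> Basis"
  then obtain i where b: "b = axis i 1" by (auto simp: Basis_vec_def)
  have "(\<lambda>q. torus_sec q \<bullet> b) \<in> borel_measurable borel" by measurable
  then have "(\<lambda>q. torus_sec q $ i) \<in> borel_measurable borel" by (simp add: b inner_axis)
  then have "(\<lambda>q. real_of_int \<lfloor>real M * torus_sec q $ i\<rfloor> / real M) \<in> borel_measurable borel" by measurable
  then show "(\<lambda>q. torus_round M q \<bullet> b) \<in> borel_measurable borel" by (simp add: b inner_axis torus_round_def)
qed

section \<open>The lower bound\<close>

text \<open>Measurable dependence on the endpoints is achieved without measurable selection: a
  near-optimal path is chosen for each pair of grid points, of which only finitely many occur, and
  is then bent affinely to the actual endpoints. The error e is shared equally by the choice, the
  bending, and the change of the cost under rounding.\<close>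

lemma near_optimal_paths:
  fixes \<Xi> :: "'n::finite torus \<Rightarrow> real"
  assumes T: "T > 0" and \<Xi>: "continuous_on UNIV \<Xi>" and e: "e > 0"
  obtains R and path vel :: "'n torus \<times> 'n torus \<Rightarrow> real \<Rightarrow> real ^ 'n"
  where "\<And>p. nice_curve R T (path p) (vel p)" "\<And>p. proj_torus (path p 0) = fst p" "\<And>p. proj_torus (path p T) = snd p"
    "\<And>p. action (\<lambda>x. \<Xi> (proj_torus x)) P T (path p) (vel p) \<le> T * (A_real \<Xi> P T (fst p) (snd p) + e)"
    "(\<lambda>z. path (fst z) (snd z)) \<in> borel_measurable (borel \<Otimes>\<^sub>M borel)"
    "\<And>p. continuous_on UNIV (path p)"
proof -
  let ?X = "\<lambda>x. \<Xi> (proj_torus x)"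
  obtain K where K: "K > 0" "\<And>y z. A_cost \<Xi> P y z T \<le> ereal K"
    using A_cost_bounds[OF T \<Xi>, of P] by metis
  have AK: "A_real \<Xi> P T y z \<le> K" for y z using K(2)[of y z] by (simp add: A_cost_eq_A_real[OF T \<Xi>])
  have e3: "e / 3 > 0" "e / 3 * T > 0" using e T by auto
  obtain d1 where d1: "d1 > 0" "\<And>R (\<gamma> :: real \<Rightarrow> real ^ 'n) v a b. nice_curve R T \<gamma> v \<Longrightarrow> action ?X P T \<gamma> v \<le> (K + e) * T \<Longrightarrow>
      norm a < d1 \<Longrightarrow> norm b < d1 \<Longrightarrow>
      action ?X P T (\<lambda>s. \<gamma> s + a + s *\<^sub>R ((b - a) /\<^sub>R T)) (\<lambda>s. v s + (b - a) /\<^sub>R T) \<le> action ?X P T \<gamma> v + e / 3 * T"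
    using nice_curve_perturb[OF T \<Xi> e3(2), of P "(K + e) * T"] by blast
  have XX: "compact (UNIV :: ('n torus \<times> 'n torus) set)" using compact_Times[OF compact_torus compact_torus] by simp
  obtain d2 where d2: "d2 > 0" "\<And>p q. dist p q < d2 \<Longrightarrow> \<bar>(case p of (y, z) \<Rightarrow> A_real \<Xi> P T y z) - (case q of (y, z) \<Rightarrow> A_real \<Xi> P T y z)\<bar> < e / 3"
    using compact_uniformly_continuous[OF A_real_continuous[OF T \<Xi>, of P] XX] e3(1)
    unfolding uniformly_continuous_on_def by (metis UNIV_I dist_real_def)
  \<comment> \<open>The projection is Lipschitz with constant 2 * pi, so rounding moves each of the
    two endpoints by less than 2 * pi * d \<le> d2 / 2.\<close>
  define d where "d = min d1 (d2 / (4 * pi))"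
  have d: "d > 0" "d \<le> d1" "4 * pi * d \<le> d2" using d1 d2 by (auto simp: d_def min_def field_simps)
  obtain M0 :: nat where "max 1 (CARD('n) / d) < M0" using reals_Archimedean2 by blast
  then have M0: "M0 > 0" "CARD('n) / M0 < d" using d(1) by (auto simp: field_simps)
  define k :: "'n torus \<Rightarrow> real ^ 'n" where "k = torus_round M0"
  have kn: "norm (torus_sec q - k q) < d" for q using torus_round_near[OF M0(1), of q] M0(2) by (simp add: k_def)
  define I where "I = range k \<times> range k"
  have I: "finite I" unfolding I_def k_def by (intro finite_cartesian_product torus_round_finite[OF M0(1)])
  have "\<exists>R \<gamma> v. nice_curve R T \<gamma> v \<and> \<gamma> 0 = fst \<kappa> \<and> proj_torus (\<gamma> T) = proj_torus (snd \<kappa>) \<and>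
      action ?X P T \<gamma> v / T \<le> A_real \<Xi> P T (proj_torus (fst \<kappa>)) (proj_torus (snd \<kappa>)) + e / 3" for \<kappa> :: "(real ^ 'n) \<times> (real ^ 'n)"
    using A_cost_approx[OF T \<Xi> e3(1), of "fst \<kappa>" "proj_torus (snd \<kappa>)" P] unfolding A_real_def by metis
  then obtain R \<gamma> v where gv: "\<And>\<kappa>. nice_curve (R \<kappa>) T (\<gamma> \<kappa>) (v \<kappa>)" "\<And>\<kappa>. \<gamma> \<kappa> 0 = fst \<kappa>" "\<And>\<kappa>. proj_torus (\<gamma> \<kappa> T) = proj_torus (snd \<kappa>)"
    "\<And>\<kappa>. action ?X P T (\<gamma> \<kappa>) (v \<kappa>) / T \<le> A_real \<Xi> P T (proj_torus (fst \<kappa>)) (proj_torus (snd \<kappa>)) + e / 3" by metis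
  define \<kappa> where "\<kappa> p = (k (fst p), k (snd p))" for p
  define \<alpha> where "\<alpha> p = torus_sec (fst p) - k (fst p)" for p :: "'n torus \<times> 'n torus"
  define \<beta> where "\<beta> p = torus_sec (snd p) - k (snd p)" for p :: "'n torus \<times> 'n torus"
  \<comment> \<open>Clamping the time extends every path continuously to the whole line, as joint
    measurability in the pair and the time requires.\<close>
  define cl where "cl t = max 0 (min T t)" for t
  have clc: "continuous_on S cl" for S unfolding cl_def by (intro continuous_intros)
  have cl01: "cl t \<in> {0..T}" for t using T by (auto simp: cl_def)
  have clid: "cl t = t" if "t \<in> {0..T}" for t using that by (auto simp: cl_def)
  define path where "path p t = \<gamma> (\<kappa> p) (cl t) + \<alpha> p + cl t *\<^sub>R ((\<beta> p - \<alpha> p) /\<^sub>R T)" for p t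
  define vel where "vel p t = v (\<kappa> p) t + (\<beta> p - \<alpha> p) /\<^sub>R T" for p t
  \<comment> \<open>The largest of the finitely many chosen speeds, increased by the speed of the
    affine correction.\<close>
  define R' where "R' = Max (R ` I) + (2 * d) / T"
  have ab: "norm (\<alpha> p) < d" "norm (\<beta> p) < d" for p using kn by (auto simp: \<alpha>_def \<beta>_def)
  have \<kappa>I: "\<kappa> p \<in> I" for p by (simp add: \<kappa>_def I_def)
  have n0: "nice_curve R' T (\<lambda>s. \<gamma> (\<kappa> p) s + \<alpha> p + s *\<^sub>R ((\<beta> p - \<alpha> p) /\<^sub>R T)) (vel p)" for p
  proof -
    have "R (\<kappa> p) \<le> Max (R ` I)" using I \<kappa>I by simp
    moreover have "norm ((\<beta> p - \<alpha> p) /\<^sub>R T) \<le> 2 * d / T"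
      using ab[of p] norm_triangle_ineq4[of "\<beta> p" "\<alpha> p"] T by (simp add: divide_inverse mult.commute)
    ultimately show ?thesis unfolding vel_def[abs_def] R'_def
      by (intro nice_curve_mono[OF nice_curve_add_linear[OF gv(1)]]) simp
  qed
  have path_eq: "path p s = \<gamma> (\<kappa> p) s + \<alpha> p + s *\<^sub>R ((\<beta> p - \<alpha> p) /\<^sub>R T)" if "s \<in> {0..T}" for p s
    using that by (simp add: path_def clid)
  have pc: "continuous_on UNIV (path p)" for p
    unfolding path_def
    by (intro continuous_intros clc continuous_on_compose2[OF nice_curveD(3)[OF gv(1)] clc]) (use cl01 in auto)
  have n: "nice_curve R' T (path p) (vel p)" for p
  proof -
    obtain S where S: "finite S" "\<forall>s\<in>{0<..<T} - S. ((\<lambda>s. \<gamma> (\<kappa> p) s + \<alpha> p + s *\<^sub>R ((\<beta> p - \<alpha> p) /\<^sub>R T)) has_vector_derivative vel p s) (at s)"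
      using n0[of p] by (auto simp: nice_curve_def)
    have "(path p has_vector_derivative vel p s) (at s)" if s: "s \<in> {0<..<T} - S" for s
      by (rule has_vector_derivative_transform_within_open[OF S(2)[rule_format, OF s], of "{0<..<T}"])
        (use s path_eq in auto)
    then show ?thesis
      using n0[of p] S(1) continuous_on_subset[OF pc] unfolding nice_curve_def by auto
  qed
  have act: "action ?X P T (path p) (vel p) \<le> T * (A_real \<Xi> P T (fst p) (snd p) + e)" for p
  proof -
    have eq: "action ?X P T (path p) (vel p) = action ?X P T (\<lambda>s. \<gamma> (\<kappa> p) s + \<alpha> p + s *\<^sub>R ((\<beta> p - \<alpha> p) /\<^sub>R T)) (vel p)"
      unfolding action_def by (rule integral_cong) (simp add: path_eq)
    have "action ?X P T (\<gamma> (\<kappa> p)) (v (\<kappa> p)) / T \<le> K + e"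
      using gv(4)[of "\<kappa> p"] AK[of "proj_torus (fst (\<kappa> p))" "proj_torus (snd (\<kappa> p))"] e by linarith
    then have le: "action ?X P T (\<gamma> (\<kappa> p)) (v (\<kappa> p)) \<le> (K + e) * T" using T by (simp add: pos_divide_le_eq)
    have "action ?X P T (path p) (vel p) \<le> action ?X P T (\<gamma> (\<kappa> p)) (v (\<kappa> p)) + e / 3 * T"
      unfolding eq unfolding vel_def[abs_def]
      by (rule d1(2)[OF gv(1) le]) (use ab[of p] d(2) in auto)
    also have "action ?X P T (\<gamma> (\<kappa> p)) (v (\<kappa> p)) \<le> T * (A_real \<Xi> P T (proj_torus (fst (\<kappa> p))) (proj_torus (snd (\<kappa> p))) + e / 3)"
      using gv(4)[of "\<kappa> p"] T by (simp add: pos_divide_le_eq mult.commute)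
    also have "A_real \<Xi> P T (proj_torus (fst (\<kappa> p))) (proj_torus (snd (\<kappa> p))) \<le> A_real \<Xi> P T (fst p) (snd p) + e / 3"
    proof -
      have near: "dist (proj_torus (k q)) q < d2 / 2" for q
      proof -
        have "dist (proj_torus (k q)) (proj_torus (torus_sec q)) \<le> 2 * pi * dist (k q) (torus_sec q)" by (rule dist_proj_torus_le)
        also have "\<dots> < 2 * pi * d" using kn[of q] by (simp add: dist_norm norm_minus_commute)
        finally show ?thesis using d(3) by simp
      qed
      have "dist (proj_torus (fst (\<kappa> p)), proj_torus (snd (\<kappa> p))) p \<le> dist (proj_torus (fst (\<kappa> p))) (fst p) + dist (proj_torus (snd (\<kappa> p))) (snd p)"
        by (cases p) (simp add: dist_Pair_Pair sqrt_sum_squares_le_sum)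
      also have "\<dots> < d2" using near[of "fst p"] near[of "snd p"] by (simp add: \<kappa>_def)
      finally have "\<bar>A_real \<Xi> P T (proj_torus (fst (\<kappa> p))) (proj_torus (snd (\<kappa> p))) - A_real \<Xi> P T (fst p) (snd p)\<bar> < e / 3"
        using d2(2)[of "(proj_torus (fst (\<kappa> p)), proj_torus (snd (\<kappa> p)))" p] by (simp add: case_prod_beta)
      then show ?thesis by linarith
    qed
    finally show ?thesis using T by (simp add: algebra_simps)
  qed
  have meas: "(\<lambda>z. path (fst z) (snd z)) \<in> borel_measurable (borel \<Otimes>\<^sub>M borel)"
  proof -
    have km[measurable]: "k \<in> borel_measurable borel" unfolding k_def by (rule torus_round_measurable)
    have f[measurable]: "fst \<in> borel_measurable (borel :: ('n torus \<times> 'n torus) measure)" "snd \<in> borel_measurable (borel :: ('n torus \<times> 'n torus) measure)"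
      by (intro borel_measurable_continuous_onI continuous_intros)+
    have am[measurable]: "\<alpha> \<in> borel_measurable borel" "\<beta> \<in> borel_measurable borel"
      unfolding \<alpha>_def[abs_def] \<beta>_def[abs_def] by measurable
    have clm[measurable]: "cl \<in> borel_measurable borel" by (intro borel_measurable_continuous_onI clc)
    have \<kappa>b: "\<kappa> \<in> measurable borel (count_space I)"
    proof (subst measurable_count_space_eq2[OF I], intro conjI ballI)
      show "\<kappa> \<in> space borel \<rightarrow> I" using \<kappa>I by auto
      fix a assume "a \<in> I"
      have "\<kappa> -` {a} \<inter> space borel = (\<lambda>p. k (fst p)) -` {fst a} \<inter> (\<lambda>p. k (snd p)) -` {snd a}"
        by (cases a) (auto simp: \<kappa>_def)
      moreover have "(\<lambda>p. k (fst p)) -` {fst a} \<inter> space borel \<in> sets (borel :: ('n torus \<times> 'n torus) measure)" by measurable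
      moreover have "(\<lambda>p. k (snd p)) -` {snd a} \<inter> space borel \<in> sets (borel :: ('n torus \<times> 'n torus) measure)" by measurable
      ultimately show "\<kappa> -` {a} \<inter> space borel \<in> sets borel" by auto
    qed
    have "(\<lambda>z. \<gamma> (\<kappa> (fst z)) (cl (snd z))) \<in> borel_measurable (borel \<Otimes>\<^sub>M borel)"
    proof (rule measurable_compose_countable'[of I "\<lambda>i z. \<gamma> i (cl (snd z))" _ _ "\<lambda>z. \<kappa> (fst z)"])
      fix i assume "i \<in> I"
      have "continuous_on UNIV (\<lambda>t. \<gamma> i (cl t))"
        by (intro continuous_on_compose2[OF nice_curveD(3)[OF gv(1)] clc]) (use cl01 in auto)
      then have "(\<lambda>t. \<gamma> i (cl t)) \<in> borel_measurable borel" by (rule borel_measurable_continuous_onI)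
      then show "(\<lambda>z. \<gamma> i (cl (snd z))) \<in> borel_measurable (borel \<Otimes>\<^sub>M borel)" by (rule measurable_compose[OF measurable_snd])
    next
      show "(\<lambda>z. \<kappa> (fst z)) \<in> measurable (borel \<Otimes>\<^sub>M borel) (count_space I)" by (rule measurable_compose[OF measurable_fst \<kappa>b])
    qed (use I in \<open>simp add: countable_finite\<close>)
    moreover have "(\<lambda>z. \<alpha> (fst z) + cl (snd z) *\<^sub>R ((\<beta> (fst z) - \<alpha> (fst z)) /\<^sub>R T)) \<in> borel_measurable (borel \<Otimes>\<^sub>M borel)"
      by measurable
    ultimately show ?thesis unfolding path_def add.assoc by (rule borel_measurable_add)
  qed
  show thesis
  proof (rule that[of R' path vel])
    show "proj_torus (path p 0) = fst p" for p
      using gv(2)[of "\<kappa> p"] T by (simp add: path_def clid \<kappa>_def \<alpha>_def)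
    show "proj_torus (path p T) = snd p" for p
    proof -
      have "path p T = \<gamma> (\<kappa> p) T + \<beta> p" using T by (simp add: path_def clid)
      then have "proj_torus (path p T) = proj_torus (snd (\<kappa> p) + \<beta> p)" by (simp add: proj_torus_add gv(3))
      then show ?thesis by (simp add: \<kappa>_def \<beta>_def)
    qed
  qed (use n act meas pc in auto)
qed

text \<open>Fubini in the mixed form in which it is applied: the Lebesgue time integral of
  \<open>F_functional\<close> outside, the gauge integral of the action inside.\<close>

lemma set_lebesgue_integral_swap:
  fixes F :: "'n::finite torus \<times> 'n torus \<Rightarrow> real \<Rightarrow> real"
  assumes \<sigma>: "prob_space \<sigma>" "sets \<sigma> = sets borel" and F: "(\<lambda>z. F (fst z) (snd z)) \<in> borel_measurable (borel \<Otimes>\<^sub>M borel)"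
    and B: "\<And>p t. t \<in> {0..T} \<Longrightarrow> \<bar>F p t\<bar> \<le> B" and T: "T > 0"
    and i: "\<And>p. set_integrable lborel {0..T} (F p)"
  shows "(LINT t:{0..T}|lborel. (\<integral>p. F p t \<partial>\<sigma>)) = (\<integral>p. integral {0..T} (F p) \<partial>\<sigma>)"
    "integrable \<sigma> (\<lambda>p. integral {0..T} (F p))"
proof -
  let ?L = "restrict_space lborel {0..T}"
  interpret \<sigma>: prob_space \<sigma> by fact
  interpret L: finite_measure ?L using T by (intro finite_measureI) (simp add: emeasure_restrict_space)
  interpret pair_sigma_finite \<sigma> ?L ..
  interpret P: finite_measure "\<sigma> \<Otimes>\<^sub>M ?L" by (rule finite_measure_pair_measure) unfold_locales
  have "(\<lambda>z. (fst z, snd z)) \<in> measurable (\<sigma> \<Otimes>\<^sub>M ?L) (borel \<Otimes>\<^sub>M borel)"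
  proof (rule measurable_Pair)
    show "fst \<in> measurable (\<sigma> \<Otimes>\<^sub>M ?L) borel" using measurable_fst[of \<sigma> ?L] by (simp cong: measurable_cong_sets add: \<sigma>(2))
    have "(\<lambda>t. t) \<in> measurable ?L borel" by (rule measurable_restrict_space1) simp
    from measurable_compose[OF measurable_snd[of \<sigma> ?L] this] show "snd \<in> measurable (\<sigma> \<Otimes>\<^sub>M ?L) borel" by simp
  qed
  from measurable_compose[OF this F] have m: "(\<lambda>z. F (fst z) (snd z)) \<in> borel_measurable (\<sigma> \<Otimes>\<^sub>M ?L)" by simp
  have int: "integrable (\<sigma> \<Otimes>\<^sub>M ?L) (\<lambda>z. F (fst z) (snd z))"
  proof (rule P.integrable_const_bound[OF _ m])
    show "AE z in \<sigma> \<Otimes>\<^sub>M ?L. norm (F (fst z) (snd z)) \<le> B"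
      using B by (intro AE_I2) (auto simp: space_pair_measure)
  qed
  then have int': "integrable (\<sigma> \<Otimes>\<^sub>M ?L) (case_prod F)" by (simp add: case_prod_beta')
  have eq: "(\<integral>t. F p t \<partial>?L) = integral {0..T} (F p)" for p by (rule integral_restrict_eq[OF i])
  have "(LINT t:{0..T}|lborel. (\<integral>p. F p t \<partial>\<sigma>)) = (\<integral>t. (\<integral>p. F p t \<partial>\<sigma>) \<partial>?L)"
    unfolding set_lebesgue_integral_def by (rule integral_restrict_space[symmetric]) simp
  also have "\<dots> = (\<integral>p. (\<integral>t. F p t \<partial>?L) \<partial>\<sigma>)" by (rule Fubini_integral[OF int'])
  finally show "(LINT t:{0..T}|lborel. (\<integral>p. F p t \<partial>\<sigma>)) = (\<integral>p. integral {0..T} (F p) \<partial>\<sigma>)" by (simp add: eq)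
  show "integrable \<sigma> (\<lambda>p. integral {0..T} (F p))" using integrable_fst'[OF int] by (simp add: eq)
qed

text \<open>Valid for every coupling \<sigma>. The measure at time t is the law of the position at
  time t when the pair of endpoints is drawn according to \<sigma>; its weak-* continuity follows by
  dominated convergence from the continuity of each single path.\<close>

theorem H_functional_ge:
  fixes \<Xi> :: "'n::finite torus \<Rightarrow> real"
  assumes \<sigma>: "\<sigma> \<in> couplings \<mu>1 \<mu>2" and \<Xi>: "continuous_on UNIV \<Xi>" and T: "T > 0"
  shows "ereal ((norm P)\<^sup>2 / 2 - (\<integral>p. A_real \<Xi> P T (fst p) (snd p) \<partial>\<sigma>)) \<le> H_functional \<Xi> T \<mu>1 \<mu>2 P"
proof (rule ereal_le_epsilon2)
  fix e :: real assume e: "e > 0"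
  let ?X = "\<lambda>x. \<Xi> (proj_torus x)"
  have \<sigma>p: "prob_space \<sigma>" "sets \<sigma> = sets borel" "distr \<sigma> borel fst = \<mu>1" "distr \<sigma> borel snd = \<mu>2"
    using \<sigma> by (auto simp: couplings_def)
  interpret \<sigma>: prob_space \<sigma> by fact
  obtain R and path vel :: "'n torus \<times> 'n torus \<Rightarrow> real \<Rightarrow> real ^ 'n"
  where n: "\<And>p. nice_curve R T (path p) (vel p)" and path0: "\<And>p. proj_torus (path p 0) = fst p" and pathT: "\<And>p. proj_torus (path p T) = snd p"
    and act: "\<And>p. action ?X P T (path p) (vel p) \<le> T * (A_real \<Xi> P T (fst p) (snd p) + e)"
    and pm: "(\<lambda>z. path (fst z) (snd z)) \<in> borel_measurable (borel \<Otimes>\<^sub>M borel)"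
    and pc: "\<And>p. continuous_on UNIV (path p)"
    by (rule near_optimal_paths[OF T \<Xi> e, of P], rule that)
  have pmt: "(\<lambda>p. path p t) \<in> borel_measurable borel" for t
    using measurable_compose[OF measurable_Pair2'[of t borel borel] pm] by simp
  have projm: "proj_torus \<in> borel_measurable borel" by (intro borel_measurable_continuous_onI continuous_on_proj_torus)
  have ppm: "(\<lambda>p. proj_torus (path p t)) \<in> measurable \<sigma> borel" for t
    using measurable_compose[OF pmt projm] by (simp cong: measurable_cong_sets add: \<sigma>p(2))
  define \<mu> where "\<mu> t = distr \<sigma> borel (\<lambda>p. proj_torus (path p t))" for t
  have \<mu>int: "(\<integral>q. f q \<partial>\<mu> t) = (\<integral>p. f (proj_torus (path p t)) \<partial>\<sigma>)" if "continuous_on UNIV f" for f :: "'n torus \<Rightarrow> real" and t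
    unfolding \<mu>_def by (rule integral_distr[OF ppm]) (simp add: borel_measurable_continuous_onI[OF that])
  have curve: "\<mu> \<in> measure_curves T \<mu>1 \<mu>2"
    unfolding measure_curves_def
  proof (intro CollectI conjI)
    show "continuous_map (top_of_set {0..T}) weak_star \<mu>"
    proof (rule weak_star_curveI)
      show "\<mu> t \<in> torus_probs" for t unfolding \<mu>_def torus_probs_def using \<sigma>.prob_space_distr[OF ppm] by simp
      fix f :: "'n torus \<Rightarrow> real" assume f: "continuous_on UNIV f"
      obtain B where B: "\<And>x. \<bar>f x\<bar> \<le> B" using torus_continuous_bounded[OF f] by metis
      have "continuous_on {0..T} (\<lambda>t. \<integral>p. f (proj_torus (path p t)) \<partial>\<sigma>)"
        unfolding continuous_on_sequentially
      proof (intro allI ballI impI, unfold o_def)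
        fix s and a assume s: "a \<in> {0..T}" "(\<forall>n. s n \<in> {0..T}) \<and> s \<longlonglongrightarrow> a"
        show "(\<lambda>n. \<integral>p. f (proj_torus (path p (s n))) \<partial>\<sigma>) \<longlonglongrightarrow> (\<integral>p. f (proj_torus (path p a)) \<partial>\<sigma>)"
        proof (rule integral_dominated_convergence[where w = "\<lambda>_. B"])
          show "AE p in \<sigma>. (\<lambda>n. f (proj_torus (path p (s n)))) \<longlonglongrightarrow> f (proj_torus (path p a))"
          proof (rule AE_I2)
            fix p
            have "continuous_on UNIV (\<lambda>t. f (proj_torus (path p t)))"
              by (rule continuous_on_compose2[OF torus_lift_continuous[OF f] pc]) auto
            then show "(\<lambda>n. f (proj_torus (path p (s n)))) \<longlonglongrightarrow> f (proj_torus (path p a))"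
              using s(2) by (auto simp: continuous_on_eq_continuous_at isCont_def intro: isCont_tendsto_compose[of a "\<lambda>t. f (proj_torus (path p t))"])
          qed
          show "(\<lambda>p. f (proj_torus (path p t))) \<in> borel_measurable \<sigma>" for t
            using measurable_compose[OF ppm borel_measurable_continuous_onI[OF f]] .
        qed (use B measurable_compose[OF ppm borel_measurable_continuous_onI[OF f]] in auto)
      qed
      then show "continuous_on {0..T} (\<lambda>t. \<integral>q. f q \<partial>\<mu> t)" by (simp add: \<mu>int[OF f])
    qed
    show "\<mu> 0 = \<mu>1" using \<sigma>p(3) by (simp add: \<mu>_def path0)
    show "\<mu> T = \<mu>2" using \<sigma>p(4) by (simp add: \<mu>_def pathT)
  qed
  have Xi_eq: "(LINT t:{0..T}|lborel. (\<integral>q. \<Xi> q \<partial>\<mu> t)) = (\<integral>p. integral {0..T} (\<lambda>t. ?X (path p t)) \<partial>\<sigma>)"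
    "integrable \<sigma> (\<lambda>p. integral {0..T} (\<lambda>t. ?X (path p t)))"
  proof -
    obtain B where B: "\<And>x. \<bar>\<Xi> x\<bar> \<le> B" using torus_continuous_bounded[OF \<Xi>] by metis
    have m: "(\<lambda>z. ?X (path (fst z) (snd z))) \<in> borel_measurable (borel \<Otimes>\<^sub>M borel)"
      by (rule measurable_compose[OF pm borel_measurable_continuous_onI[OF torus_lift_continuous[OF \<Xi>]]])
    have si: "set_integrable lborel {0..T} (\<lambda>t. ?X (path p t))" for p
      by (intro borel_integrable_atLeastAtMost' continuous_on_compose2[OF torus_lift_continuous[OF \<Xi>] continuous_on_subset[OF pc]]) auto
    note swap = set_lebesgue_integral_swap[of \<sigma> "\<lambda>p t. ?X (path p t)" T B, OF \<sigma>p(1,2) m B T si]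
    show "(LINT t:{0..T}|lborel. (\<integral>q. \<Xi> q \<partial>\<mu> t)) = (\<integral>p. integral {0..T} (\<lambda>t. ?X (path p t)) \<partial>\<sigma>)"
      using swap(1) by (simp add: \<mu>int[OF \<Xi>])
    show "integrable \<sigma> (\<lambda>p. integral {0..T} (\<lambda>t. ?X (path p t)))" by (rule swap(2))
  qed
  have Ai: "integrable \<sigma> (\<lambda>p. A_real \<Xi> P T (fst p) (snd p))"
  proof -
    have XX: "compact (UNIV :: ('n torus \<times> 'n torus) set)" using compact_Times[OF compact_torus compact_torus] by simp
    show ?thesis
      using compact_continuous_integrable[OF XX _ \<sigma>p(1,2), of "\<lambda>(y, z). A_real \<Xi> P T y z"] A_real_continuous[OF T \<Xi>, of P]
      by (simp add: case_prod_beta')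
  qed
  define a where "a = (\<integral>p. A_real \<Xi> P T (fst p) (snd p) \<partial>\<sigma>)"
  define xi where "xi = (LINT t:{0..T}|lborel. (\<integral>q. \<Xi> q \<partial>\<mu> t))"
  have each: "T * ((norm P)\<^sup>2 / 2 - a - e) - xi \<le> (LINT t:{0..T}|lborel. (\<integral>q. HJ \<phi> P q t \<partial>\<mu> t))"
    if \<phi>: "\<phi> \<in> test_functions T" for \<phi>
  proof -
    note Hc = HJ_continuous[OF \<phi>, of P]
    have Hqc: "continuous_on UNIV (\<lambda>q. HJ \<phi> P q t)" for t
    proof -
      have "continuous_on UNIV (\<lambda>x :: real ^ 'n. (x, t))" by (intro continuous_intros)
      from continuous_on_compose2[OF Hc this] show ?thesis by (intro torus_continuous_on_iff_lift) simp
    qed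
    have "compact ((\<lambda>(x, t). HJ \<phi> P (proj_torus x) t) ` (cbox 0 1 \<times> {0..T}))"
      by (intro compact_continuous_image continuous_on_subset[OF Hc] compact_Times compact_cbox) auto
    then have "bounded ((\<lambda>(x, t). HJ \<phi> P (proj_torus x) t) ` (cbox 0 1 \<times> {0..T}))" by (rule compact_imp_bounded)
    then obtain B where B1: "\<forall>y\<in>(\<lambda>(x, t). HJ \<phi> P (proj_torus x) t) ` (cbox 0 1 \<times> {0..T}). norm y \<le> B"
      unfolding bounded_iff by blast
    have B0: "\<bar>(\<lambda>(x, t). HJ \<phi> P (proj_torus x) t) z\<bar> \<le> B" if "z \<in> cbox 0 1 \<times> {0..T}" for z
      using bspec[OF B1 imageI[OF that]] by simp
    have B: "\<bar>HJ \<phi> P q t\<bar> \<le> B" if "t \<in> {0..T}" for q t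
    proof -
      obtain x where "x \<in> cbox 0 1" "q = proj_torus x" using proj_torus_unit_cube by blast
      then show ?thesis using B0[of "(x, t)"] that by auto
    qed
    have m: "(\<lambda>z. HJ \<phi> P (proj_torus (path (fst z) (snd z))) (snd z)) \<in> borel_measurable (borel \<Otimes>\<^sub>M borel)"
    proof -
      have "(\<lambda>z. (path (fst z) (snd z), snd z)) \<in> measurable (borel \<Otimes>\<^sub>M borel) (borel \<Otimes>\<^sub>M borel)" using pm by measurable
      then have "(\<lambda>z. (path (fst z) (snd z), snd z)) \<in> measurable (borel \<Otimes>\<^sub>M borel) borel" by (simp add: borel_prod)
      from measurable_compose[OF this borel_measurable_continuous_onI[OF Hc]] show ?thesis by simp
    qed
    have si: "set_integrable lborel {0..T} (\<lambda>t. HJ \<phi> P (proj_torus (path p t)) t)" for p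
    proof (rule borel_integrable_atLeastAtMost')
      have "continuous_on {0..T} (\<lambda>t. (path p t, t))" by (intro continuous_intros continuous_on_subset[OF pc]) auto
      from continuous_on_compose2[OF Hc this] show "continuous_on {0..T} (\<lambda>t. HJ \<phi> P (proj_torus (path p t)) t)" by simp
    qed
    note swap = set_lebesgue_integral_swap[of \<sigma> "\<lambda>p t. HJ \<phi> P (proj_torus (path p t)) t" T B, OF \<sigma>p(1,2) m B T si]
    have "T * ((norm P)\<^sup>2 / 2 - a - e) = (\<integral>p. T * ((norm P)\<^sup>2 / 2) - T * (A_real \<Xi> P T (fst p) (snd p) + e) \<partial>\<sigma>)"
      using Ai by (simp add: a_def \<sigma>.prob_space algebra_simps)
    also have "\<dots> \<le> (\<integral>p. integral {0..T} (\<lambda>t. ?X (path p t)) + integral {0..T} (\<lambda>t. HJ \<phi> P (proj_torus (path p t)) t) \<partial>\<sigma>)"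
    proof (rule integral_mono)
      show "integrable \<sigma> (\<lambda>p. T * ((norm P)\<^sup>2 / 2) - T * (A_real \<Xi> P T (fst p) (snd p) + e))" using Ai by simp
      show "integrable \<sigma> (\<lambda>p. integral {0..T} (\<lambda>t. ?X (path p t)) + integral {0..T} (\<lambda>t. HJ \<phi> P (proj_torus (path p t)) t))"
        using Xi_eq(2) swap(2) by simp
      fix p
      note ki = action_integrable(1)[OF n[of p] torus_lift_continuous[OF \<Xi>] order_refl order_refl, of P]
        action_integrable(2)[OF n[of p] torus_lift_continuous[OF \<Xi>] order_refl order_refl]
      have "action ?X P T (path p) (vel p) = integral {0..T} (\<lambda>t. (norm (vel p t - P))\<^sup>2 / 2) - integral {0..T} (\<lambda>t. ?X (path p t))"
        unfolding action_def by (rule integral_diff[OF ki])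
      then show "T * ((norm P)\<^sup>2 / 2) - T * (A_real \<Xi> P T (fst p) (snd p) + e) \<le> integral {0..T} (\<lambda>t. ?X (path p t)) + integral {0..T} (\<lambda>t. HJ \<phi> P (proj_torus (path p t)) t)"
        using act[of p] HJ_action_inequality(2)[OF \<phi> n[of p] T, of P] by simp
    qed
    also have "\<dots> = xi + (\<integral>p. integral {0..T} (\<lambda>t. HJ \<phi> P (proj_torus (path p t)) t) \<partial>\<sigma>)"
      using Xi_eq swap(2) by (simp add: xi_def)
    also have "(\<integral>p. integral {0..T} (\<lambda>t. HJ \<phi> P (proj_torus (path p t)) t) \<partial>\<sigma>) = (LINT t:{0..T}|lborel. (\<integral>q. HJ \<phi> P q t \<partial>\<mu> t))"
      using swap(1) by (simp add: \<mu>int[OF Hqc])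
    finally show ?thesis by simp
  qed
  have "ereal (T * ((norm P)\<^sup>2 / 2 - a - e) - xi) \<le> (INF \<phi> \<in> test_functions T. ereal (LINT t:{0..T}|lborel. (\<integral>q. HJ \<phi> P q t \<partial>\<mu> t)))"
    using each by (intro INF_greatest) simp
  then have "ereal (1 / T) * ereal (T * ((norm P)\<^sup>2 / 2 - a - e) - xi) \<le> F_functional \<mu> P T"
    unfolding F_functional_def HJ_def using T by (intro ereal_mult_left_mono) auto
  then have "ereal (1 / T * xi) + ereal (1 / T) * ereal (T * ((norm P)\<^sup>2 / 2 - a - e) - xi) \<le> ereal (1 / T * xi) + F_functional \<mu> P T"
    by (rule add_left_mono)
  also have "\<dots> \<le> H_functional \<Xi> T \<mu>1 \<mu>2 P"
    unfolding H_functional_def xi_def by (rule SUP_upper[OF curve])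
  finally have "ereal (1 / T * xi + 1 / T * (T * ((norm P)\<^sup>2 / 2 - a - e) - xi)) \<le> H_functional \<Xi> T \<mu>1 \<mu>2 P" by simp
  moreover have "1 / T * xi + 1 / T * (T * ((norm P)\<^sup>2 / 2 - a - e) - xi) = (norm P)\<^sup>2 / 2 - a - e"
    using T by (simp add: field_simps)
  ultimately have "ereal ((norm P)\<^sup>2 / 2 - a - e) + ereal e \<le> H_functional \<Xi> T \<mu>1 \<mu>2 P + ereal e"
    by (intro add_right_mono) simp
  then show "ereal ((norm P)\<^sup>2 / 2 - (\<integral>p. A_real \<Xi> P T (fst p) (snd p) \<partial>\<sigma>)) \<le> H_functional \<Xi> T \<mu>1 \<mu>2 P + ereal e"
    by (simp add: a_def)
qed

section \<open>Mollification\<close>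

text \<open>The square of the positive part is C^1 with a Lipschitz derivative. It replaces smooth
  bump functions here, as test functions only have to be C^1.\<close>

definition sqp :: "real \<Rightarrow> real" where "sqp s = (max 0 s)\<^sup>2"

lemma sqp_taylor: "\<bar>sqp (s + t) - sqp s - 2 * max 0 s * t\<bar> \<le> t\<^sup>2"
proof -
  consider "s \<ge> 0" "s + t \<ge> 0" | "s \<ge> 0" "s + t < 0" | "s < 0" "s + t \<ge> 0" | "s < 0" "s + t < 0" by linarith
  then show ?thesis
  proof cases
    case 1
    then have "sqp (s + t) - sqp s - 2 * max 0 s * t = t\<^sup>2" by (simp add: sqp_def power2_eq_square algebra_simps)
    then show ?thesis by simp
  next
    case 2
    then have "sqp (s + t) - sqp s - 2 * max 0 s * t = t\<^sup>2 - (s + t)\<^sup>2" by (simp add: sqp_def power2_eq_square algebra_simps)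
    moreover have "(s + t)\<^sup>2 \<le> t\<^sup>2" using 2 by (simp add: abs_le_square_iff[symmetric])
    ultimately show ?thesis by simp
  next
    case 3
    then have "sqp (s + t) - sqp s - 2 * max 0 s * t = (s + t)\<^sup>2" by (simp add: sqp_def)
    moreover have "(s + t)\<^sup>2 \<le> t\<^sup>2" using 3 by (simp add: abs_le_square_iff[symmetric])
    ultimately show ?thesis by simp
  next
    case 4
    then show ?thesis by (simp add: sqp_def)
  qed
qed

lemma sqp_deriv: "(sqp has_real_derivative 2 * max 0 s) (at s)"
  unfolding has_field_derivative_def has_derivative_at
proof (intro conjI)
  show "bounded_linear ((*) (2 * max 0 s))" by (rule bounded_linear_mult_right)
  show "(\<lambda>t. norm (sqp (s + t) - sqp s - 2 * max 0 s * t) / norm t) \<midarrow>0\<rightarrow> 0"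
  proof (rule tendsto_sandwich[where f = "\<lambda>_. 0" and h = "\<lambda>t. \<bar>t\<bar>"])
    show "\<forall>\<^sub>F t in at 0. norm (sqp (s + t) - sqp s - 2 * max 0 s * t) / norm t \<le> \<bar>t\<bar>"
      unfolding eventually_at
    proof (intro exI[of _ 1] conjI ballI impI)
      fix t :: real assume "t \<noteq> 0 \<and> dist t 0 < 1"
      then show "norm (sqp (s + t) - sqp s - 2 * max 0 s * t) / norm t \<le> \<bar>t\<bar>"
        using sqp_taylor[of s t] by (simp add: divide_le_eq power2_eq_square)
    qed simp
    show "(\<lambda>t. \<bar>t\<bar>) \<midarrow>0\<rightarrow> (0::real)" by (rule tendsto_rabs_zero) simp
  qed auto
qed

lemma lborel_integral_translation:
  fixes f :: "'a::euclidean_space \<Rightarrow> 'b::euclidean_space"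
  assumes "f \<in> borel_measurable borel"
  shows "(\<integral>w. f (z + w) \<partial>lborel) = (\<integral>w. f w \<partial>lborel)"
proof -
  have "(\<integral>w. f w \<partial>lborel) = (\<integral>w. f w \<partial>distr lborel borel ((+) z))" by (simp add: lborel_distr_plus)
  also have "\<dots> = (\<integral>w. f (z + w) \<partial>lborel)" by (rule integral_distr) (use assms in auto)
  finally show ?thesis ..
qed

lemma continuous_bounded_support_integrable:
  fixes f :: "'a::euclidean_space \<Rightarrow> 'b::euclidean_space"
  assumes f: "continuous_on UNIV f" and s: "\<And>w. norm w > r \<Longrightarrow> f w = 0"
  shows "integrable lborel f"
proof -
  have "integrable lborel (\<lambda>w. indicator (cball 0 r) w *\<^sub>R f w)"
    using f by (intro borel_integrable_compact continuous_on_subset[OF f]) auto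
  moreover have "(\<lambda>w. indicator (cball 0 r) w *\<^sub>R f w) = f" using s by (auto simp: indicator_def fun_eq_iff)
  ultimately show ?thesis by simp
qed

definition bump :: "real \<Rightarrow> 'a::euclidean_space \<Rightarrow> real" where
  "bump d w = sqp (d\<^sup>2 - (norm w)\<^sup>2)"

text \<open>The negative gradient of \<open>bump d\<close>: a shift of the averaged function by h is
  turned into a shift of the kernel by - h.\<close>

definition bump_grad :: "real \<Rightarrow> 'a::euclidean_space \<Rightarrow> 'a" where
  "bump_grad d w = (4 * max 0 (d\<^sup>2 - (norm w)\<^sup>2)) *\<^sub>R w"

lemma bump_continuous: "continuous_on S (bump d)" "continuous_on S (bump_grad d)"
  unfolding bump_def sqp_def bump_grad_def by (intro continuous_intros)+

lemma bump_support:
  assumes "d > 0" "norm w \<ge> d"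
  shows "bump d w = 0" "bump_grad d w = 0"
proof -
  have "d\<^sup>2 \<le> (norm w)\<^sup>2" using assms by (intro power_mono) auto
  then show "bump d w = 0" "bump_grad d w = 0" by (simp_all add: bump_def sqp_def bump_grad_def)
qed

text \<open>Put s = d^2 - |w|^2 and s + t for the same expression at w - h. For |w| \<le> d + 1 one
  has |t| \<le> (2 d + 3) |h|, whence the first constant; the second comes from the part |h|^2 of t
  multiplied by 2 max 0 s \<le> 2 d^2. For larger |w| both kernel values vanish because |h| \<le>
  1.\<close>

lemma bump_taylor:
  fixes w h :: "'a::euclidean_space"
  assumes d: "d > 0" and h: "norm h \<le> 1"
  shows "\<bar>bump d (w - h) - bump d w - bump_grad d w \<bullet> h\<bar> \<le> ((2 * d + 3)\<^sup>2 + 2 * d\<^sup>2) * (norm h)\<^sup>2 * indicator (cball 0 (d + 1)) w"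
proof (cases "norm w \<le> d + 1")
  case True
  define s where "s = d\<^sup>2 - (norm w)\<^sup>2"
  define t where "t = 2 * (w \<bullet> h) - (norm h)\<^sup>2"
  have st: "d\<^sup>2 - (norm (w - h))\<^sup>2 = s + t"
    by (simp add: s_def t_def power2_norm_eq_inner algebra_simps inner_commute)
  have "bump d (w - h) - bump d w - bump_grad d w \<bullet> h = (sqp (s + t) - sqp s - 2 * max 0 s * t) - 2 * max 0 s * (norm h)\<^sup>2"
    unfolding bump_def bump_grad_def st s_def[symmetric] by (simp add: t_def algebra_simps)
  then have "\<bar>bump d (w - h) - bump d w - bump_grad d w \<bullet> h\<bar> \<le> \<bar>sqp (s + t) - sqp s - 2 * max 0 s * t\<bar> + \<bar>2 * max 0 s * (norm h)\<^sup>2\<bar>"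
    by linarith
  also have "\<bar>sqp (s + t) - sqp s - 2 * max 0 s * t\<bar> \<le> t\<^sup>2" by (rule sqp_taylor)
  also have "t\<^sup>2 \<le> ((2 * d + 3) * norm h)\<^sup>2"
  proof -
    have "\<bar>w \<bullet> h\<bar> \<le> norm w * norm h" by (rule Cauchy_Schwarz_ineq2)
    also have "\<dots> \<le> (d + 1) * norm h" using True by (intro mult_right_mono) auto
    finally have "\<bar>w \<bullet> h\<bar> \<le> (d + 1) * norm h" .
    moreover have "(norm h)\<^sup>2 \<le> 1 * norm h" unfolding power2_eq_square using h by (intro mult_right_mono) auto
    moreover have "(2 * d + 3) * norm h = 2 * ((d + 1) * norm h) + norm h" by (simp add: algebra_simps)
    moreover have "0 \<le> (norm h)\<^sup>2" "0 \<le> norm h" by simp_all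
    ultimately have "\<bar>t\<bar> \<le> (2 * d + 3) * norm h" unfolding t_def abs_le_iff by linarith
    then show ?thesis using power_mono[of "\<bar>t\<bar>" "(2 * d + 3) * norm h" 2] by simp
  qed
  also have "\<bar>2 * max 0 s * (norm h)\<^sup>2\<bar> \<le> 2 * d\<^sup>2 * (norm h)\<^sup>2"
  proof -
    have "max 0 s \<le> d\<^sup>2" by (simp add: s_def)
    then show ?thesis by (simp add: abs_mult mult_right_mono)
  qed
  finally show ?thesis using True unfolding power_mult_distrib by (simp add: distrib_right)
next
  case False
  have "norm (w - h) \<ge> d" using False h norm_triangle_ineq2[of w h] by linarith
  then show ?thesis using False d by (simp add: bump_support)
qed

text \<open>Translation invariance moves the increment from f to the kernel, whose Taylor error is
  quadratic. The constant C is the L^1 norm of the gradient of k, so the gradient bound involves f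
  only through its supremum M, not through its modulus of continuity.\<close>

theorem mollifier:
  assumes d: "d > 0"
  obtains k :: "'a::euclidean_space \<Rightarrow> real" and C where "\<And>w. 0 \<le> k w" "\<And>w. d \<le> norm w \<Longrightarrow> k w = 0" "continuous_on UNIV k"
    "(\<integral>w. k w \<partial>lborel) = 1" "C \<ge> 0"
    "\<And>f M. continuous_on UNIV f \<Longrightarrow> (\<And>z. \<bar>f z\<bar> \<le> M) \<Longrightarrow> \<exists>g :: 'a \<Rightarrow> 'a. continuous_on UNIV g \<and>
       (\<forall>z. ((\<lambda>z. \<integral>w. k w * f (z + w) \<partial>lborel) has_derivative (\<lambda>h. g z \<bullet> h)) (at z) \<and> norm (g z) \<le> C * M)"
proof -
  define c where "c = (\<integral>w. bump d (w :: 'a) \<partial>lborel)"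
  have supp: "bump d w = 0" "bump_grad d w = 0" if "norm w > d" for w :: 'a using bump_support[OF d, of w] that by auto
  have bi: "integrable lborel (bump d :: 'a \<Rightarrow> real)"
    by (rule continuous_bounded_support_integrable[of _ d]) (use bump_continuous supp in auto)
  have b0: "0 \<le> bump d w" for w :: 'a by (simp add: bump_def sqp_def)
  have c: "c > 0"
  proof -
    have "c \<noteq> 0"
    proof
      assume "c = 0"
      then have "AE w in lborel. bump d (w :: 'a) = 0"
        unfolding c_def by (subst (asm) integral_nonneg_eq_0_iff_AE[OF bi]) (auto simp: b0)
      then have "AE w in lborel. w \<notin> ball (0 :: 'a) d"
      proof eventually_elim
        case (elim w)
        show ?case
        proof
          assume "w \<in> ball 0 d"
          then have "(norm w)\<^sup>2 < d\<^sup>2" by (simp add: power_strict_mono)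
          then show False using elim by (simp add: bump_def sqp_def)
        qed
      qed
      then have "emeasure lborel (ball (0 :: 'a) d) = 0"
        by (subst (asm) AE_iff_measurable[of "ball 0 d"]) auto
      moreover have "measure lborel (ball (0 :: 'a) d) > 0" using d by (rule content_ball_pos)
      ultimately show False by (simp add: Sigma_Algebra.measure_def)
    qed
    moreover have "c \<ge> 0" unfolding c_def by (intro integral_nonneg_AE) (auto simp: b0)
    ultimately show ?thesis by simp
  qed
  define k where "k w = bump d w / c" for w :: 'a
  define G where "G = (\<integral>w. norm (bump_grad d (w :: 'a)) \<partial>lborel)"
  have kc: "continuous_on UNIV k" unfolding k_def by (intro continuous_intros bump_continuous) (use c in auto)
  show thesis
  proof (rule that[of k "G / c"])
    show "0 \<le> k w" for w using b0 c by (simp add: k_def)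
    show "k w = 0" if "d \<le> norm w" for w using that d by (simp add: k_def bump_support)
    show "continuous_on UNIV k" by (rule kc)
    show "(\<integral>w. k w \<partial>lborel) = 1" using c by (simp add: k_def c_def)
    show "G / c \<ge> 0" using c by (simp add: G_def)
    fix f :: "'a \<Rightarrow> real" and M assume f: "continuous_on UNIV f" and M: "\<And>z. \<bar>f z\<bar> \<le> M"
    have M0: "M \<ge> 0" using M[of 0] by linarith
    have fz: "continuous_on UNIV (\<lambda>w. f (z + w))" for z by (intro continuous_on_compose2[OF f] continuous_intros) auto
    define g where "g z = (1 / c) *\<^sub>R (\<integral>w. f (z + w) *\<^sub>R bump_grad d w \<partial>lborel)" for z
    have gi: "integrable lborel (\<lambda>w. f (z + w) *\<^sub>R bump_grad d w)" for z
      by (rule continuous_bounded_support_integrable[of _ d]) (use supp in \<open>auto intro!: continuous_intros fz bump_continuous\<close>)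
    have ngi: "integrable lborel (\<lambda>w. norm (bump_grad d w :: 'a))"
      by (rule continuous_bounded_support_integrable[of _ d]) (use supp in \<open>auto intro!: continuous_intros bump_continuous\<close>)
    have gM: "norm (g z) \<le> G / c * M" for z
    proof -
      have "norm (\<integral>w. f (z + w) *\<^sub>R bump_grad d w \<partial>lborel) \<le> (\<integral>w. M * norm (bump_grad d w :: 'a) \<partial>lborel)"
        by (rule Bochner_Integration.integral_norm_bound_integral[OF gi]) (use ngi M in \<open>auto intro!: mult_right_mono\<close>)
      also have "\<dots> = M * G" by (simp add: G_def)
      finally show ?thesis using c by (simp add: g_def divide_right_mono mult.commute)
    qed
    have gc: "continuous_on UNIV g"
      unfolding continuous_on_sequentially
    proof (intro allI ballI impI, unfold o_def)
      fix x :: "nat \<Rightarrow> 'a" and a assume x: "(\<forall>n. x n \<in> UNIV) \<and> x \<longlonglongrightarrow> a"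
      have "(\<lambda>n. \<integral>w. f (x n + w) *\<^sub>R bump_grad d w \<partial>lborel) \<longlonglongrightarrow> (\<integral>w. f (a + w) *\<^sub>R bump_grad d w \<partial>lborel)"
      proof (rule integral_dominated_convergence[where w = "\<lambda>w. M * norm (bump_grad d w :: 'a)"])
        show "AE w in lborel. (\<lambda>n. f (x n + w) *\<^sub>R bump_grad d w) \<longlonglongrightarrow> f (a + w) *\<^sub>R bump_grad d w"
        proof (intro AE_I2 tendsto_scaleR tendsto_const)
          fix w
          have "isCont f (a + w)" using f by (simp add: continuous_on_eq_continuous_at)
          then show "(\<lambda>n. f (x n + w)) \<longlonglongrightarrow> f (a + w)"
            by (rule isCont_tendsto_compose) (use x in \<open>auto intro!: tendsto_intros\<close>)
        qed
        show "AE w in lborel. norm (f (x n + w) *\<^sub>R bump_grad d w) \<le> M * norm (bump_grad d w)" for n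
          using M by (intro AE_I2) (auto intro!: mult_right_mono)
      qed (use gi ngi in \<open>auto intro: borel_measurable_integrable\<close>)
      then show "(\<lambda>n. g (x n)) \<longlonglongrightarrow> g a" unfolding g_def by (intro tendsto_intros)
    qed
    have der: "((\<lambda>z. \<integral>w. k w * f (z + w) \<partial>lborel) has_derivative (\<lambda>h. g z \<bullet> h)) (at z)" for z
    proof -
      define Cd where "Cd = ((2 * d + 3)\<^sup>2 + 2 * d\<^sup>2)"
      define N where "N = M * Cd * measure lborel (cball (0 :: 'a) (d + 1)) / c"
      have Cd: "Cd \<ge> 0" by (simp add: Cd_def)
      have bound: "\<bar>(\<integral>w. k w * f (z + h + w) \<partial>lborel) - (\<integral>w. k w * f (z + w) \<partial>lborel) - g z \<bullet> h\<bar> \<le> N * (norm h)\<^sup>2"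
        if h: "norm h \<le> 1" for h
      proof -
        have i1: "integrable lborel (\<lambda>w. bump d (w - h) * f (z + w))"
        proof (rule continuous_bounded_support_integrable[of _ "d + 1"])
          show "continuous_on UNIV (\<lambda>w. bump d (w - h) * f (z + w))"
            by (intro continuous_intros fz continuous_on_compose2[OF bump_continuous(1)[of UNIV]]) auto
          fix w :: 'a assume "norm w > d + 1"
          then have "norm (w - h) > d" using h norm_triangle_ineq2[of w h] by linarith
          then show "bump d (w - h) * f (z + w) = 0" using supp by simp
        qed
        have i2: "integrable lborel (\<lambda>w. bump d w * f (z + w))"
          by (rule continuous_bounded_support_integrable[of _ d]) (use supp in \<open>auto intro!: continuous_intros fz bump_continuous\<close>)
        have i3: "integrable lborel (\<lambda>w. (bump_grad d w \<bullet> h) * f (z + w))"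
          by (rule continuous_bounded_support_integrable[of _ d]) (use supp in \<open>auto intro!: continuous_intros fz bump_continuous\<close>)
        have "(\<integral>w. bump d w * f (z + h + w) \<partial>lborel) = (\<integral>w. bump d ((h + w) - h) * f (z + (h + w)) \<partial>lborel)" by (simp add: add.assoc)
        also have "\<dots> = (\<integral>w. bump d (w - h) * f (z + w) \<partial>lborel)"
          by (rule lborel_integral_translation[where f = "\<lambda>w. bump d (w - h) * f (z + w)"]) (use borel_measurable_integrable[OF i1] in simp)
        finally have t: "(\<integral>w. bump d w * f (z + h + w) \<partial>lborel) = (\<integral>w. bump d (w - h) * f (z + w) \<partial>lborel)" .
        have gz: "g z \<bullet> h = (\<integral>w. (bump_grad d w \<bullet> h) * f (z + w) \<partial>lborel) / c"
          unfolding g_def using gi by (simp add: inner_commute[of _ h] flip: integral_inner_right) (simp add: inner_commute mult.commute)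
        have "(\<integral>w. k w * f (z + h + w) \<partial>lborel) - (\<integral>w. k w * f (z + w) \<partial>lborel) - g z \<bullet> h
          = (\<integral>w. (bump d (w - h) - bump d w - bump_grad d w \<bullet> h) * f (z + w) \<partial>lborel) / c"
          using i1 i2 i3 t by (simp add: k_def gz left_diff_distrib diff_divide_distrib)
        moreover have "\<bar>\<integral>w. (bump d (w - h) - bump d w - bump_grad d w \<bullet> h) * f (z + w) \<partial>lborel\<bar>
           \<le> (\<integral>w. (Cd * (norm h)\<^sup>2 * M) * indicator (cball (0 :: 'a) (d + 1)) w \<partial>lborel)"
          unfolding real_norm_def[symmetric]
        proof (rule Bochner_Integration.integral_norm_bound_integral)
          show "integrable lborel (\<lambda>w. (bump d (w - h) - bump d w - bump_grad d w \<bullet> h) * f (z + w))"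
            using i1 i2 i3 by (simp add: left_diff_distrib)
          show "integrable lborel (\<lambda>w. (Cd * (norm h)\<^sup>2 * M) * indicator (cball (0 :: 'a) (d + 1)) w)"
            by (intro integrable_mult_right integrable_real_indicator) (use emeasure_bounded_finite[OF bounded_cball] in auto)
          fix w
          have "norm ((bump d (w - h) - bump d w - bump_grad d w \<bullet> h) * f (z + w)) \<le> (Cd * (norm h)\<^sup>2 * indicator (cball 0 (d + 1)) w) * M"
            unfolding norm_mult using bump_taylor[OF d h, of w] M Cd by (intro mult_mono) (auto simp: Cd_def)
          then show "norm ((bump d (w - h) - bump d w - bump_grad d w \<bullet> h) * f (z + w)) \<le> (Cd * (norm h)\<^sup>2 * M) * indicator (cball 0 (d + 1)) w"
            by (simp add: mult_ac)
        qed
        moreover have "(\<integral>w. (Cd * (norm h)\<^sup>2 * M) * indicator (cball (0 :: 'a) (d + 1)) w \<partial>lborel) = Cd * (norm h)\<^sup>2 * M * measure lborel (cball (0 :: 'a) (d + 1))"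
          by simp
        ultimately show ?thesis using c by (simp add: N_def divide_right_mono mult_ac)
      qed
      have N: "N \<ge> 0" using M0 Cd c by (simp add: N_def)
      show ?thesis unfolding has_derivative_at
      proof (intro conjI)
        show "bounded_linear (\<lambda>h. g z \<bullet> h)" by (rule bounded_linear_inner_right)
        show "(\<lambda>h. norm ((\<integral>w. k w * f (z + h + w) \<partial>lborel) - (\<integral>w. k w * f (z + w) \<partial>lborel) - g z \<bullet> h) / norm h) \<midarrow>0\<rightarrow> 0"
        proof (rule tendsto_sandwich[where f = "\<lambda>_. 0" and h = "\<lambda>h. N * norm h"])
          show "\<forall>\<^sub>F h in at 0. norm ((\<integral>w. k w * f (z + h + w) \<partial>lborel) - (\<integral>w. k w * f (z + w) \<partial>lborel) - g z \<bullet> h) / norm h \<le> N * norm h"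
            unfolding eventually_at
          proof (intro exI[of _ 1] conjI ballI impI)
            fix h :: 'a assume "h \<noteq> 0 \<and> dist h 0 < 1"
            then show "norm ((\<integral>w. k w * f (z + h + w) \<partial>lborel) - (\<integral>w. k w * f (z + w) \<partial>lborel) - g z \<bullet> h) / norm h \<le> N * norm h"
              using bound[of h] by (simp add: divide_le_eq power2_eq_square mult.assoc)
          qed simp
          show "(\<lambda>h. N * norm h) \<midarrow>0\<rightarrow> 0" by (intro tendsto_mult_right_zero tendsto_norm_zero) simp
        qed auto
      qed
    qed
    show "\<exists>g :: 'a \<Rightarrow> 'a. continuous_on UNIV g \<and>
       (\<forall>z. ((\<lambda>z. \<integral>w. k w * f (z + w) \<partial>lborel) has_derivative (\<lambda>h. g z \<bullet> h)) (at z) \<and> norm (g z) \<le> G / c * M)"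
      using gc gM der by blast
  qed
qed

lemma kernel_average_mono:
  fixes k :: "'a::euclidean_space \<Rightarrow> real"
  assumes k: "\<And>w. 0 \<le> k w" "\<And>w. d \<le> norm w \<Longrightarrow> k w = 0" "continuous_on UNIV k" "(\<integral>w. k w \<partial>lborel) = 1"
    and f: "continuous_on UNIV f" "continuous_on UNIV g" and le: "\<And>w. norm w < d \<Longrightarrow> f w \<le> g w + C"
  shows "(\<integral>w. k w * f w \<partial>lborel) \<le> (\<integral>w. k w * g w \<partial>lborel) + C"
proof -
  have i: "integrable lborel (\<lambda>w. k w * h w)" if "continuous_on UNIV h" for h
    by (rule continuous_bounded_support_integrable[of _ d]) (use k(2) in \<open>auto intro!: continuous_intros k(3) that\<close>)
  have "(\<integral>w. k w * f w \<partial>lborel) \<le> (\<integral>w. k w * (g w + C) \<partial>lborel)"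
  proof (rule integral_mono)
    show "k w * f w \<le> k w * (g w + C)" for w
      using k(1)[of w] k(2)[of w] le[of w] by (cases "norm w < d") (auto intro: mult_left_mono)
  qed (auto intro!: i f continuous_intros)
  also have "\<dots> = (\<integral>w. k w * g w \<partial>lborel) + C"
    using i[OF f(2)] i[of "\<lambda>_. C"] k(4) by (simp add: distrib_left)
  finally show ?thesis .
qed

section \<open>A C^1 transition from 0 to 1\<close>

definition smoothstep :: "real \<Rightarrow> real" where
  "smoothstep s = sqp s / (sqp s + sqp (1 - s))"

definition smoothstep' :: "real \<Rightarrow> real" where
  "smoothstep' s = (2 * max 0 s * sqp (1 - s) + sqp s * (2 * max 0 (1 - s))) / (sqp s + sqp (1 - s))\<^sup>2"

lemma sqp_pos: "sqp s + sqp (1 - s) > 0"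
proof (cases "s > 0")
  case True
  then show ?thesis by (simp add: sqp_def add_pos_nonneg)
next
  case False
  then show ?thesis by (simp add: sqp_def)
qed

lemma smoothstep_deriv: "(smoothstep has_real_derivative smoothstep' s) (at s)"
proof -
  have d2: "((\<lambda>s. sqp (1 - s)) has_real_derivative 2 * max 0 (1 - s) * (- 1)) (at s)"
    by (rule DERIV_chain2[OF sqp_deriv]) (auto intro!: derivative_eq_intros)
  have "((\<lambda>s. sqp s / (sqp s + sqp (1 - s))) has_real_derivative
    ((2 * max 0 s) * (sqp s + sqp (1 - s)) - sqp s * (2 * max 0 s + 2 * max 0 (1 - s) * (- 1))) / ((sqp s + sqp (1 - s)) * (sqp s + sqp (1 - s)))) (at s)"
    by (rule DERIV_divide[OF sqp_deriv DERIV_add[OF sqp_deriv d2]]) (use sqp_pos[of s] in simp)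
  moreover have "(2 * max 0 s) * (sqp s + sqp (1 - s)) - sqp s * (2 * max 0 s + 2 * max 0 (1 - s) * (- 1)) = 2 * max 0 s * sqp (1 - s) + sqp s * (2 * max 0 (1 - s))"
    by (simp add: algebra_simps)
  ultimately show ?thesis unfolding smoothstep_def[abs_def] smoothstep'_def power2_eq_square by simp
qed

lemma smoothstep_facts:
  "0 \<le> smoothstep s" "smoothstep s \<le> 1" "s \<le> 0 \<Longrightarrow> smoothstep s = 0" "1 \<le> s \<Longrightarrow> smoothstep s = 1"
  "0 \<le> smoothstep' s" "s \<le> 0 \<or> 1 \<le> s \<Longrightarrow> smoothstep' s = 0" "continuous_on S smoothstep'"
proof -
  have p: "0 \<le> sqp x" for x by (simp add: sqp_def)
  show "0 \<le> smoothstep s" using p by (simp add: smoothstep_def)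
  show "smoothstep s \<le> 1" using sqp_pos[of s] p[of "1 - s"] by (simp add: smoothstep_def divide_le_eq)
  show "s \<le> 0 \<Longrightarrow> smoothstep s = 0" by (simp add: smoothstep_def sqp_def)
  show "1 \<le> s \<Longrightarrow> smoothstep s = 1" by (simp add: smoothstep_def sqp_def)
  show "0 \<le> smoothstep' s" using p by (simp add: smoothstep'_def)
  show "s \<le> 0 \<or> 1 \<le> s \<Longrightarrow> smoothstep' s = 0" by (auto simp: smoothstep'_def sqp_def)
  have "(sqp x + sqp (1 - x))\<^sup>2 \<noteq> 0" for x using sqp_pos[of x] by simp
  then show "continuous_on S smoothstep'"
    unfolding smoothstep'_def[abs_def] sqp_def by (intro continuous_intros) auto
qed

section \<open>The value function\<close>

text \<open>Speeds are bounded by \<open>R\<close> to make the infimum continuous. The gradient of the mollified value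
  function has a bound independent of \<open>R\<close>, so \<open>R\<close> can afterwards be chosen large enough for the
  bounded-speed dynamic programming inequality to imply the full Hamilton--Jacobi inequality.\<close>

definition value_fn :: "('a::euclidean_space \<Rightarrow> real) \<Rightarrow> 'a \<Rightarrow> ('a \<Rightarrow> real) \<Rightarrow> real \<Rightarrow> 'a \<Rightarrow> real \<Rightarrow> real" where
  "value_fn X P u R x t = Inf {u (\<gamma> 0) + action X P t \<gamma> v | \<gamma> v. nice_curve R t \<gamma> v \<and> \<gamma> t = x}"

text \<open>The value function is studied on the covering space, where segments and convolutions
  make sense; \<open>V_periodic\<close> later allows the descent to the torus.\<close>

locale value_function =
  fixes X u :: "'a::euclidean_space \<Rightarrow> real" and P :: 'a and B Mu R :: real
  assumes X: "continuous_on UNIV X" "\<And>x. \<bar>X x\<bar> \<le> B" and u: "\<And>x. \<bar>u x\<bar> \<le> Mu" and R: "0 \<le> R"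
begin

abbreviation "V \<equiv> value_fn X P u R"
text \<open>An upper bound for the cost per unit time of a curve at rest.\<close>

abbreviation "C' \<equiv> (norm P)\<^sup>2 / 2 + B"

lemma B0: "0 \<le> B" using X(2)[of 0] by linarith

lemma action_ge: "0 \<le> t \<Longrightarrow> nice_curve R t \<gamma> v \<Longrightarrow> - B * t \<le> action X P t \<gamma> v"
  using action_lower_bound(2)[of R t \<gamma> v X B P] X by (cases "t = 0") (auto simp: action_def)

lemma bdd: "0 \<le> t \<Longrightarrow> bdd_below {u (\<gamma> 0) + action X P t \<gamma> v | \<gamma> v. nice_curve R t \<gamma> v \<and> \<gamma> t = x}"
proof (rule bdd_belowI)
  fix a assume t: "0 \<le> t" and "a \<in> {u (\<gamma> 0) + action X P t \<gamma> v | \<gamma> v. nice_curve R t \<gamma> v \<and> \<gamma> t = x}"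
  then obtain \<gamma> v where g: "a = u (\<gamma> 0) + action X P t \<gamma> v" "nice_curve R t \<gamma> v" by auto
  show "- Mu - B * t \<le> a" using action_ge[OF t g(2)] u[of "\<gamma> 0"] g(1) by (simp add: abs_le_iff)
qed

lemma V_le: "0 \<le> t \<Longrightarrow> nice_curve R t \<gamma> v \<Longrightarrow> V (\<gamma> t) t \<le> u (\<gamma> 0) + action X P t \<gamma> v"
  unfolding value_fn_def by (rule cInf_lower[OF _ bdd]) auto

lemma const_nice: "nice_curve R t (\<lambda>_. x) (\<lambda>_. 0)"
  by (rule nice_curve_mono[OF nice_curve_const R])

lemma V_greatest:
  assumes "\<And>\<gamma> v. nice_curve R t \<gamma> v \<Longrightarrow> \<gamma> t = x \<Longrightarrow> c \<le> u (\<gamma> 0) + action X P t \<gamma> v"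
  shows "c \<le> V x t"
  unfolding value_fn_def
proof (rule cInf_greatest)
  show "{u (\<gamma> 0) + action X P t \<gamma> v | \<gamma> v. nice_curve R t \<gamma> v \<and> \<gamma> t = x} \<noteq> {}"
    using const_nice[of t x] by blast
qed (use assms in auto)

text \<open>The half of the dynamic programming principle that makes V a subsolution: every
  competitor for x at time t is prolonged by a straight segment with velocity w.\<close>

lemma V_step:
  assumes "0 \<le> t" "0 \<le> h" "norm w \<le> R"
  shows "V (x + h *\<^sub>R w) (t + h) \<le> V x t + integral {0..h} (\<lambda>s. (norm (w - P))\<^sup>2 / 2 - X (x + s *\<^sub>R w))"
proof -
  let ?I = "integral {0..h} (\<lambda>s. (norm (w - P))\<^sup>2 / 2 - X (x + s *\<^sub>R w))"
  have "V (x + h *\<^sub>R w) (t + h) - ?I \<le> V x t"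
  proof (rule V_greatest)
    fix \<gamma> v :: "real \<Rightarrow> 'a" assume n: "nice_curve R t \<gamma> v" and x: "\<gamma> t = x"
    note c = nice_curve_concat(1)[OF n assms(3,1,2) X(1)] nice_curve_concat(2)[OF n assms(3,1,2) X(1)]
      nice_curve_concat(3)[OF n assms(3,1,2) X(1), of P]
    have "0 \<le> t + h" using assms by simp
    from V_le[OF this c(1)] show "V (x + h *\<^sub>R w) (t + h) - ?I \<le> u (\<gamma> 0) + action X P t \<gamma> v"
      unfolding c(2,3) using assms(1) x by simp
  qed
  then show ?thesis by simp
qed

lemma integral_step_le:
  assumes "0 \<le> h" and "\<And>s. s \<in> {0..h} \<Longrightarrow> c \<le> X (x + s *\<^sub>R w)"
  shows "integral {0..h} (\<lambda>s. (norm (w - P))\<^sup>2 / 2 - X (x + s *\<^sub>R w)) \<le> h * ((norm (w - P))\<^sup>2 / 2 - c)"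
proof -
  have "integral {0..h} (\<lambda>s. (norm (w - P))\<^sup>2 / 2 - X (x + s *\<^sub>R w)) \<le> integral {0..h} (\<lambda>s. (norm (w - P))\<^sup>2 / 2 - c)"
  proof (rule integral_le)
    show "(\<lambda>s. (norm (w - P))\<^sup>2 / 2 - X (x + s *\<^sub>R w)) integrable_on {0..h}"
      by (intro integrable_continuous_real continuous_intros continuous_on_compose2[OF X(1)]) auto
  qed (use assms in auto)
  then show ?thesis using assms(1) by (simp add: mult.commute)
qed

lemma V_wait: "0 \<le> t \<Longrightarrow> 0 \<le> h \<Longrightarrow> V x (t + h) \<le> V x t + C' * h"
  using V_step[of t h 0 x] integral_step_le[of h "- B" x 0] X(2)[of x] R
  by (simp add: mult.commute abs_le_iff)

lemma V_zero: "V x 0 = u x"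
proof (rule antisym)
  show "V x 0 \<le> u x" using V_le[OF order_refl const_nice[of 0 x]] by (simp add: action_def)
  show "u x \<le> V x 0" by (rule V_greatest) (auto simp: action_def)
qed

lemma V_upper: "0 \<le> t \<Longrightarrow> V x t \<le> u x + C' * t"
  using V_wait[of 0 t x] by (simp add: V_zero)

lemma V_lower:
  assumes "0 \<le> t"
  shows "- Mu - B * t \<le> V x t"
proof (rule V_greatest)
  fix \<gamma> v :: "real \<Rightarrow> 'a" assume "nice_curve R t \<gamma> v"
  then show "- Mu - B * t \<le> u (\<gamma> 0) + action X P t \<gamma> v"
    using action_ge[OF assms, of \<gamma> v] u[of "\<gamma> 0"] by (simp add: abs_le_iff)
qed

lemma V_bound:
  assumes "0 \<le> t" "t \<le> T"
  shows "\<bar>V x t\<bar> \<le> Mu + C' * T"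
proof -
  have "C' * t \<le> C' * T" "B * t \<le> B * T" using assms B0 by (intro mult_left_mono; simp)+
  moreover have "B * T \<le> C' * T" using assms B0 by (intro mult_right_mono) auto
  ultimately show ?thesis using V_upper[OF assms(1), of x] V_lower[OF assms(1), of x] u[of x] by (simp only: abs_le_iff) linarith
qed

text \<open>Translating all competitors by a compares the two infima directly. The resulting modulus
  in space involves neither R nor any regularity of the curves.\<close>

lemma V_shift:
  assumes t: "0 \<le> t" and e1: "\<And>y. \<bar>u (y + a) - u y\<bar> \<le> e1" and e2: "\<And>y. \<bar>X (y + a) - X y\<bar> \<le> e2"
  shows "V (x + a) t \<le> V x t + e1 + t * e2"
proof -
  have "V (x + a) t - e1 - t * e2 \<le> V x t"
  proof (rule V_greatest)
    fix \<gamma> v :: "real \<Rightarrow> 'a" assume n: "nice_curve R t \<gamma> v" and x: "\<gamma> t = x"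
    note n' = nice_curve_shift[OF n, of a]
    have "action X P t (\<lambda>s. \<gamma> s + a) v \<le> integral {0..t} (\<lambda>s. ((norm (v s - P))\<^sup>2 / 2 - X (\<gamma> s)) + e2)"
      unfolding action_def
    proof (rule integral_le)
      show "(\<lambda>s. (norm (v s - P))\<^sup>2 / 2 - X (\<gamma> s + a)) integrable_on {0..t}" by (rule action_integrable(3)[OF n' X(1)]) auto
      show "(\<lambda>s. ((norm (v s - P))\<^sup>2 / 2 - X (\<gamma> s)) + e2) integrable_on {0..t}"
        by (intro integrable_add action_integrable(3)[OF n X(1)]) auto
      show "(norm (v s - P))\<^sup>2 / 2 - X (\<gamma> s + a) \<le> ((norm (v s - P))\<^sup>2 / 2 - X (\<gamma> s)) + e2" for s
        using e2[of "\<gamma> s"] by (simp add: abs_le_iff)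
    qed
    also have "\<dots> = action X P t \<gamma> v + t * e2"
      unfolding action_def using t by (subst integral_add[OF action_integrable(3)[OF n X(1)]]) auto
    finally show "V (x + a) t - e1 - t * e2 \<le> u (\<gamma> 0) + action X P t \<gamma> v"
      using V_le[OF t n'] e1[of "\<gamma> 0"] x by (simp add: abs_le_iff)
  qed
  then show ?thesis by simp
qed

text \<open>The bound of V at an earlier time by V at a later one: a competitor is stopped at time
  t, where the speed limit keeps it within R * h of its end. This is where the bound on speeds
  produces continuity.\<close>

lemma V_cut:
  assumes t: "0 \<le> t" "0 \<le> h" and c: "\<And>y. norm (x - y) \<le> R * h \<Longrightarrow> V x t \<le> V y t + e"
  shows "V x t \<le> V x (t + h) + e + B * h"
proof -
  have "V x t - e - B * h \<le> V x (t + h)"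
  proof (rule V_greatest)
    fix \<gamma> v :: "real \<Rightarrow> 'a" assume n: "nice_curve R (t + h) \<gamma> v" and x: "\<gamma> (t + h) = x"
    have n': "nice_curve R t \<gamma> v" by (rule nice_curve_subinterval[OF n]) (use t in simp)
    have "norm (x - \<gamma> t) \<le> R * h" using nice_curve_lipschitz[OF n, of t "t + h"] t x by simp
    then have "V x t \<le> V (\<gamma> t) t + e" by (rule c)
    also have "V (\<gamma> t) t \<le> u (\<gamma> 0) + action X P t \<gamma> v" by (rule V_le[OF t(1) n'])
    also have "action X P t \<gamma> v \<le> action X P (t + h) \<gamma> v + B * h"
    proof -
      have i: "(\<lambda>s. (norm (v s - P))\<^sup>2 / 2 - X (\<gamma> s)) integrable_on {0..t + h}" by (rule action_integrable(3)[OF n X(1)]) auto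
      have i': "(\<lambda>s. (norm (v s - P))\<^sup>2 / 2 - X (\<gamma> s)) integrable_on {t..t + h}" by (rule integrable_on_subinterval[OF i]) (use t in auto)
      have "integral {t..t + h} (\<lambda>s. - B) \<le> integral {t..t + h} (\<lambda>s. (norm (v s - P))\<^sup>2 / 2 - X (\<gamma> s))"
      proof (rule integral_le[OF _ i'])
        show "- B \<le> (norm (v s - P))\<^sup>2 / 2 - X (\<gamma> s)" for s
        proof -
          have "0 \<le> (norm (v s - P))\<^sup>2 / 2" by simp
          then show ?thesis using X(2)[of "\<gamma> s"] by (simp only: abs_le_iff) linarith
        qed
      qed auto
      moreover have "integral {0..t} (\<lambda>s. (norm (v s - P))\<^sup>2 / 2 - X (\<gamma> s)) + integral {t..t + h} (\<lambda>s. (norm (v s - P))\<^sup>2 / 2 - X (\<gamma> s))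
        = integral {0..t + h} (\<lambda>s. (norm (v s - P))\<^sup>2 / 2 - X (\<gamma> s))"
        using t by (intro Henstock_Kurzweil_Integration.integral_combine i) auto
      moreover have "integral {t..t + h} (\<lambda>s. - B) = - (B * h)" using t by simp
      ultimately show ?thesis unfolding action_def by linarith
    qed
    finally show "V x t - e - B * h \<le> u (\<gamma> 0) + action X P (t + h) \<gamma> v" by simp
  qed
  then show ?thesis by simp
qed

text \<open>Translation gives a modulus in space that is uniform in time; waiting and cutting give
  the two directions in time. Time is clamped to [0, T] because the mollifier averages over the
  whole line.\<close>

lemma V_continuous:
  assumes T: "0 < T" and uc: "\<And>e. e > 0 \<Longrightarrow> \<exists>d>0. \<forall>x y. dist x y < d \<longrightarrow> \<bar>u x - u y\<bar> < e"
    and Xc: "\<And>e. e > 0 \<Longrightarrow> \<exists>d>0. \<forall>x y. dist x y < d \<longrightarrow> \<bar>X x - X y\<bar> < e"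
  shows "continuous_on UNIV (\<lambda>(x, t). V x (max 0 (min T t)))"
proof -
  have space: "\<exists>d>0. \<forall>x y t. dist x y < d \<longrightarrow> 0 \<le> t \<longrightarrow> t \<le> T \<longrightarrow> V x t \<le> V y t + e" if e: "e > 0" for e
  proof -
    obtain d1 where d1: "d1 > 0" "\<forall>x y. dist x y < d1 \<longrightarrow> \<bar>u x - u y\<bar> < e / 2" using uc[of "e / 2"] e by auto
    obtain d2 where d2: "d2 > 0" "\<forall>x y. dist x y < d2 \<longrightarrow> \<bar>X x - X y\<bar> < e / (2 * T)" using Xc[of "e / (2 * T)"] e T by auto
    show ?thesis
    proof (intro exI[of _ "min d1 d2"] conjI allI impI)
      fix x y :: 'a and t assume xy: "dist x y < min d1 d2" and t: "0 \<le> t" "t \<le> T"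
      have "dist (z + (x - y)) z = dist x y" for z by (simp add: dist_norm)
      then have "V (y + (x - y)) t \<le> V y t + e / 2 + t * (e / (2 * T))"
        using d1(2) d2(2) xy by (intro V_shift t) (simp_all add: less_imp_le)
      moreover have "t * (e / (2 * T)) \<le> T * (e / (2 * T))" using t e T by (intro mult_right_mono) auto
      moreover have "T * (e / (2 * T)) = e / 2" using T by simp
      ultimately have "V (y + (x - y)) t \<le> V y t + e" by linarith
      then show "V x t \<le> V y t + e" by simp
    qed (use d1 d2 in simp)
  qed
  have main: "\<exists>d>0. \<forall>x y s t. dist x y < d \<longrightarrow> \<bar>s - t\<bar> < d \<longrightarrow> 0 \<le> s \<longrightarrow> s \<le> T \<longrightarrow> 0 \<le> t \<longrightarrow> t \<le> T \<longrightarrow> \<bar>V x s - V y t\<bar> < e" if e: "e > 0" for e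
  proof -
    have e4: "e / 4 > 0" using e by simp
    obtain d1 where d1: "d1 > 0" "\<forall>x y t. dist x y < d1 \<longrightarrow> 0 \<le> t \<longrightarrow> t \<le> T \<longrightarrow> V x t \<le> V y t + e / 4" using space[OF e4] by blast
    \<comment> \<open>The second entry keeps a curve of speed R within the modulus d1 during a time
      below d; the third makes waiting for a time d cost at most e / 4.\<close>
    define d where "d = min d1 (min (d1 / (R + 1)) (e / (4 * (C' + 1))))"
    have C0: "0 \<le> C'" using B0 by simp
    have d: "d > 0" "d \<le> d1" "R * d < d1" "C' * d \<le> e / 4"
    proof -
      show "d > 0" using d1 R e C0 by (simp add: d_def add_nonneg_pos)
      show "d \<le> d1" by (simp add: d_def)
      have "d \<le> d1 / (R + 1)" by (simp add: d_def)
      then have "(R + 1) * d \<le> d1" using R by (subst (asm) pos_le_divide_eq) (auto simp: mult.commute)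
      then show "R * d < d1" using \<open>d > 0\<close> by (simp add: algebra_simps)
      have "d \<le> e / (4 * (C' + 1))" by (simp add: d_def)
      then have "d * (4 * (C' + 1)) \<le> e" using C0 by (subst (asm) pos_le_divide_eq) auto
      then show "C' * d \<le> e / 4" using \<open>d > 0\<close> by (simp add: algebra_simps)
    qed
    have time: "\<bar>V x s - V x (s + h)\<bar> \<le> e / 2" if h: "0 \<le> h" "h < d" "0 \<le> s" "s + h \<le> T" for x s h
    proof -
      have Ch: "C' * h \<le> e / 4" "B * h \<le> e / 4"
      proof -
        have "C' * h \<le> C' * d" using h C0 by (intro mult_left_mono) auto
        then show "C' * h \<le> e / 4" using d by simp
        have "B * h \<le> C' * h" using h by (intro mult_right_mono) auto
        then show "B * h \<le> e / 4" using \<open>C' * h \<le> e / 4\<close> by simp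
      qed
      have "V x s \<le> V x (s + h) + e / 4 + B * h"
      proof (rule V_cut[OF h(3,1)])
        fix y assume y: "norm (x - y) \<le> R * h"
        have "R * h \<le> R * d" using R h by (intro mult_left_mono) auto
        then have "dist x y < d1" using y d(3) by (simp add: dist_norm)
        then show "V x s \<le> V y s + e / 4" using d1(2) h by simp
      qed
      then show ?thesis using V_wait[OF h(3,1), of x] Ch by (simp only: abs_le_iff) linarith
    qed
    have "\<bar>V x s - V y t\<bar> < e" if h: "dist x y < d" "\<bar>s - t\<bar> < d" "0 \<le> s" "s \<le> T" "0 \<le> t" "t \<le> T" for x y s t
    proof -
      have "\<bar>V x s - V x t\<bar> \<le> e / 2"
      proof (cases "s \<le> t")
        case True
        then show ?thesis using time[of "t - s" s x] h by simp
      next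
        case False
        then show ?thesis using time[of "s - t" t x] h by (simp add: abs_minus_commute)
      qed
      moreover have "V x t \<le> V y t + e / 4" "V y t \<le> V x t + e / 4" using d1(2) h d(2) by (auto simp: dist_commute)
      ultimately show ?thesis using e by (simp only: abs_le_iff abs_less_iff) linarith
    qed
    then show ?thesis using d(1) by blast
  qed
  show ?thesis
    unfolding continuous_on_iff
  proof (intro ballI allI impI)
    fix z :: "'a \<times> real" and e :: real assume "e > 0"
    then obtain d where d: "d > 0" "\<forall>x y s t. dist x y < d \<longrightarrow> \<bar>s - t\<bar> < d \<longrightarrow> 0 \<le> s \<longrightarrow> s \<le> T \<longrightarrow> 0 \<le> t \<longrightarrow> t \<le> T \<longrightarrow> \<bar>V x s - V y t\<bar> < e"
      using main by blast
    show "\<exists>d>0. \<forall>z'\<in>UNIV. dist z' z < d \<longrightarrow> dist ((\<lambda>(x, t). V x (max 0 (min T t))) z') ((\<lambda>(x, t). V x (max 0 (min T t))) z) < e"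
    proof (intro exI[of _ d] conjI ballI impI d(1))
      fix z' assume z': "dist z' z < d"
      have "dist (fst z') (fst z) < d" "dist (snd z') (snd z) < d"
        using z' dist_fst_le[of z' z] dist_snd_le[of z' z] by linarith+
      moreover have "\<bar>max 0 (min T (snd z')) - max 0 (min T (snd z))\<bar> \<le> dist (snd z') (snd z)" by (auto simp: dist_real_def)
      ultimately have "\<bar>V (fst z') (max 0 (min T (snd z'))) - V (fst z) (max 0 (min T (snd z)))\<bar> < e"
        using d(2) T by simp
      then show "dist ((\<lambda>(x, t). V x (max 0 (min T t))) z') ((\<lambda>(x, t). V x (max 0 (min T t))) z) < e"
        by (simp add: case_prod_beta dist_real_def)
    qed
  qed
qed

end

section \<open>The mollified value function\<close>

context value_function
begin

definition clamped :: "real \<Rightarrow> 'a \<times> real \<Rightarrow> real" where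
  "clamped T = (\<lambda>(x, t). V x (max 0 (min T t)))"

lemma V_periodic:
  assumes "0 \<le> t" and per: "\<And>y. u (y + a) = u y" "\<And>y. X (y + a) = X y"
  shows "V (x + a) t = V x t"
proof (rule antisym)
  show "V (x + a) t \<le> V x t" using V_shift[OF assms(1), of a 0 0 x] per by simp
  have "u (y - a) = u y" "X (y - a) = X y" for y using per[of "y - a"] by simp_all
  then show "V x t \<le> V (x + a) t" using V_shift[OF assms(1), of "- a" 0 0 "x + a"] by simp
qed

lemma clamped_periodic:
  assumes "\<And>y. u (y + a) = u y" "\<And>y. X (y + a) = X y"
  shows "clamped T ((x + a, t) + w) = clamped T ((x, t) + w)"
proof -
  have "V (x + fst w + a) (max 0 (min T (t + snd w))) = V (x + fst w) (max 0 (min T (t + snd w)))"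
    by (rule V_periodic) (use assms in auto)
  then show ?thesis by (cases w) (simp add: clamped_def add_ac)
qed

lemma clamped_bound: "0 < T \<Longrightarrow> \<bar>clamped T z\<bar> \<le> Mu + C' * T"
  by (cases z) (auto simp: clamped_def intro!: V_bound)

lemma continuous_on_translate:
  fixes f :: "'b::real_normed_vector \<Rightarrow> real"
  shows "continuous_on UNIV f \<Longrightarrow> continuous_on UNIV (\<lambda>w. f (z + w))"
  by (rule continuous_on_compose2[of UNIV f]) (auto intro!: continuous_intros)

lemma average_le:
  fixes k :: "'a \<times> real \<Rightarrow> real"
  assumes k: "\<And>w. 0 \<le> k w" "\<And>w. \<delta> \<le> norm w \<Longrightarrow> k w = 0" "continuous_on UNIV k" "(\<integral>w. k w \<partial>lborel) = 1"
    and f: "continuous_on UNIV f" and le: "\<And>w. norm w < \<delta> \<Longrightarrow> f (z + w) \<le> c"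
  shows "(\<integral>w. k w * f (z + w) \<partial>lborel) \<le> c"
proof -
  have "(\<integral>w. k w * f (z + w) \<partial>lborel) \<le> (\<integral>w. k w * 0 \<partial>lborel) + c"
    by (rule kernel_average_mono[where d = \<delta>]) (use k continuous_on_translate[OF f] le in auto)
  then show ?thesis by simp
qed

lemma average_ge:
  fixes k :: "'a \<times> real \<Rightarrow> real"
  assumes k: "\<And>w. 0 \<le> k w" "\<And>w. \<delta> \<le> norm w \<Longrightarrow> k w = 0" "continuous_on UNIV k" "(\<integral>w. k w \<partial>lborel) = 1"
    and f: "continuous_on UNIV f" and le: "\<And>w. norm w < \<delta> \<Longrightarrow> c \<le> f (z + w)"
  shows "c \<le> (\<integral>w. k w * f (z + w) \<partial>lborel)"
proof -
  have "(\<integral>w. k w * 0 \<partial>lborel) \<le> (\<integral>w. k w * f (z + w) \<partial>lborel) + - c"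
  proof (rule kernel_average_mono[where d = \<delta>])
    show "0 \<le> f (z + w) + - c" if "norm w < \<delta>" for w using le[OF that] by simp
  qed (use k continuous_on_translate[OF f] in auto)
  then show ?thesis by simp
qed

lemma norm_components: "norm (w :: 'a \<times> real) < \<delta> \<Longrightarrow> norm (fst w) < \<delta> \<and> \<bar>snd w\<bar> < \<delta>"
  using norm_fst_le[of "fst w" "snd w"] norm_snd_le[of "snd w" "fst w"] by simp

text \<open>One e is the oscillation of u over the kernel, the other the cost of resting up to time
  m, which exceeds all times the kernel can reach from t.\<close>

lemma average_initial:
  assumes k: "\<And>w. 0 \<le> k w" "\<And>w. \<delta> \<le> norm w \<Longrightarrow> k w = 0" "continuous_on UNIV k" "(\<integral>w. k w \<partial>lborel) = 1"
    and c: "continuous_on UNIV (clamped T)" and T: "0 < T"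
    and uc: "\<And>x y. dist x y < \<delta> \<Longrightarrow> \<bar>u x - u y\<bar> < e" and t: "t + \<delta> \<le> m" "0 \<le> m" "C' * m \<le> e"
  shows "(\<integral>w. k w * clamped T ((x, t) + w) \<partial>lborel) \<le> u x + 2 * e"
proof (rule average_le[where \<delta> = \<delta>])
  fix w :: "'a \<times> real" assume w: "norm w < \<delta>"
  note nc = norm_components[OF w]
  let ?t = "max 0 (min T (t + snd w))"
  have "V (x + fst w) ?t \<le> u (x + fst w) + C' * ?t" by (rule V_upper) simp
  moreover have "C' * ?t \<le> C' * m" using nc t B0 by (intro mult_left_mono) auto
  moreover have "\<bar>u (x + fst w) - u x\<bar> < e" using nc by (intro uc) (simp add: dist_norm)
  ultimately show "clamped T ((x, t) + w) \<le> u x + 2 * e" using t by (cases w) (simp add: clamped_def)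
qed (use k c in auto)

text \<open>The mirror image at time T: from any time reached by the kernel a curve can rest until T
  at cost at most e, so V there is at least its terminal value minus e.\<close>

lemma average_terminal:
  assumes k: "\<And>w. 0 \<le> k w" "\<And>w. \<delta> \<le> norm w \<Longrightarrow> k w = 0" "continuous_on UNIV k" "(\<integral>w. k w \<partial>lborel) = 1"
    and c: "continuous_on UNIV (clamped T)" and T: "0 < T"
    and W: "\<And>x. W x \<le> V x T"
    and uc: "\<And>x y. dist x y < \<delta> \<Longrightarrow> \<bar>W x - W y\<bar> < e" and t: "T - t + \<delta> \<le> m" "0 \<le> m" "C' * m \<le> e"
  shows "W x - 2 * e \<le> (\<integral>w. k w * clamped T ((x, t) + w) \<partial>lborel)"
proof (rule average_ge[where \<delta> = \<delta>])
  fix w :: "'a \<times> real" assume w: "norm w < \<delta>"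
  note nc = norm_components[OF w]
  let ?t = "max 0 (min T (t + snd w))"
  have "V (x + fst w) (?t + (T - ?t)) \<le> V (x + fst w) ?t + C' * (T - ?t)" by (rule V_wait) (use T in auto)
  moreover have "C' * (T - ?t) \<le> C' * m" using nc t B0 by (intro mult_left_mono) auto
  moreover have "\<bar>W (x + fst w) - W x\<bar> < e" using nc by (intro uc) (simp add: dist_norm)
  ultimately show "W x - 2 * e \<le> clamped T ((x, t) + w)" using t W[of "x + fst w"] by (cases w) (simp add: clamped_def)
qed (use k c in auto)

text \<open>The velocity v = p + P attains the Legendre transform and is admissible since its norm
  is at most R. Averaging the step inequality in direction (v, 1) over the kernel and dividing by h
  gives p . v + \<tau> \<le> |p|^2 / 2 - X x + e, which is the claim after expanding |p +
  P|^2.\<close>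

lemma average_subsolution:
  assumes k: "\<And>w. 0 \<le> k w" "\<And>w. \<delta> \<le> norm w \<Longrightarrow> k w = 0" "continuous_on UNIV k" "(\<integral>w. k w \<partial>lborel) = 1"
    and c: "continuous_on UNIV (clamped T)"
    and Xc: "\<And>x y. dist x y < d \<Longrightarrow> \<bar>X x - X y\<bar> < e" and d: "0 < \<delta>" "\<delta> < d" and t: "\<delta> < t" "t < T - \<delta>"
    and D: "((\<lambda>z. \<integral>w. k w * clamped T (z + w) \<partial>lborel) has_derivative (\<lambda>h. (p, \<tau>) \<bullet> h)) (at (x, t))"
    and p: "norm (p + P) \<le> R"
  shows "\<tau> + (norm (p + P))\<^sup>2 / 2 \<le> (norm P)\<^sup>2 / 2 - X x + e"
proof -
  let ?\<Phi> = "\<lambda>z. \<integral>w. k w * clamped T (z + w) \<partial>lborel"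
  define v where "v = p + P"
  define b where "b = (norm (v - P))\<^sup>2 / 2 - (X x - e)"
  \<comment> \<open>The first entry keeps all sampled times below T, where the clamping is inactive;
    the second keeps the moving point within distance d of x.\<close>
  define h0 where "h0 = min (T - \<delta> - t) ((d - \<delta>) / (R + 1))"
  have h0: "h0 > 0" using t d R by (simp add: h0_def add_nonneg_pos)
  have step: "?\<Phi> ((x, t) + h *\<^sub>R (v, 1)) \<le> ?\<Phi> (x, t) + h * b" if h: "0 < h" "h < h0" for h
  proof (rule kernel_average_mono[where d = \<delta>])
    fix w :: "'a \<times> real" assume w: "norm w < \<delta>"
    note nc = norm_components[OF w]
    have s: "0 < t + snd w" "t + snd w + h < T" using nc t h by (auto simp: h0_def)
    have "V (x + fst w + h *\<^sub>R v) (t + snd w + h) \<le> V (x + fst w) (t + snd w) + integral {0..h} (\<lambda>s. (norm (v - P))\<^sup>2 / 2 - X (x + fst w + s *\<^sub>R v))"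
      by (rule V_step) (use s h p in \<open>auto simp: v_def\<close>)
    also have "integral {0..h} (\<lambda>s. (norm (v - P))\<^sup>2 / 2 - X (x + fst w + s *\<^sub>R v)) \<le> h * ((norm (v - P))\<^sup>2 / 2 - (X x - e))"
    proof (rule integral_step_le)
      fix s assume s: "s \<in> {0..h}"
      have "norm (s *\<^sub>R v) \<le> h * R" using s p unfolding norm_scaleR v_def by (intro mult_mono) auto
      also have "h * R \<le> h * (R + 1)" using h by simp
      also have "\<dots> < d - \<delta>" using h R by (simp add: h0_def less_divide_eq)
      finally have "norm (fst w + s *\<^sub>R v) < d" using nc norm_triangle_ineq[of "fst w" "s *\<^sub>R v"] by linarith
      then have "\<bar>X (x + fst w + s *\<^sub>R v) - X x\<bar> < e" by (intro Xc) (simp add: dist_norm add.assoc)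
      then show "X x - e \<le> X (x + fst w + s *\<^sub>R v)" by linarith
    qed (use h in simp)
    finally have "V (x + fst w + h *\<^sub>R v) (t + snd w + h) \<le> V (x + fst w) (t + snd w) + h * b" by (simp add: b_def)
    then show "clamped T ((x, t) + h *\<^sub>R (v, 1) + w) \<le> clamped T ((x, t) + w) + h * b"
      using s h by (cases w) (simp add: clamped_def algebra_simps)
  qed (use k continuous_on_translate[OF c] in auto)
  have "((\<lambda>h. (x, t) + h *\<^sub>R (v, 1)) has_derivative (\<lambda>h. h *\<^sub>R (v, 1))) (at (0::real))"
    by (auto intro!: derivative_eq_intros)
  from has_derivative_compose[OF this, of ?\<Phi> "\<lambda>h. (p, \<tau>) \<bullet> h"] D
  have "((\<lambda>h. ?\<Phi> ((x, t) + h *\<^sub>R (v, 1))) has_derivative (\<lambda>h. (p, \<tau>) \<bullet> (h *\<^sub>R (v, 1)))) (at 0)" by simp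
  then have "((\<lambda>h. ?\<Phi> ((x, t) + h *\<^sub>R (v, 1))) has_field_derivative (p, \<tau>) \<bullet> (v, 1)) (at 0)"
  proof -
    have "(\<lambda>h. (p, \<tau>) \<bullet> (h *\<^sub>R (v, 1))) = (*) ((p, \<tau>) \<bullet> (v, 1))" by (auto simp: algebra_simps)
    then show ?thesis if "((\<lambda>h. ?\<Phi> ((x, t) + h *\<^sub>R (v, 1))) has_derivative (\<lambda>h. (p, \<tau>) \<bullet> (h *\<^sub>R (v, 1)))) (at 0)"
      using that unfolding has_field_derivative_def by (simp only:)
  qed
  then have "((\<lambda>h. (?\<Phi> ((x, t) + h *\<^sub>R (v, 1)) - ?\<Phi> (x, t)) / h) \<longlongrightarrow> (p, \<tau>) \<bullet> (v, 1)) (at 0)"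
    unfolding has_field_derivative_iff by simp
  \<comment> \<open>The step inequality is available for h > 0 only, so the derivative is read as a
    limit from the right.\<close>
  then have "((\<lambda>h. (?\<Phi> ((x, t) + h *\<^sub>R (v, 1)) - ?\<Phi> (x, t)) / h) \<longlongrightarrow> (p, \<tau>) \<bullet> (v, 1)) (at_right 0)"
    by (rule filterlim_mono[OF _ order_refl]) (simp add: at_le)
  then have "(p, \<tau>) \<bullet> (v, 1) \<le> b"
  proof (rule tendsto_upperbound)
    show "\<forall>\<^sub>F h in at_right 0. (?\<Phi> ((x, t) + h *\<^sub>R (v, 1)) - ?\<Phi> (x, t)) / h \<le> b"
      unfolding eventually_at_right_field
    proof (intro exI[of _ h0] conjI allI impI h0)
      fix h assume h: "0 < h" "h < h0"
      show "(?\<Phi> ((x, t) + h *\<^sub>R (v, 1)) - ?\<Phi> (x, t)) / h \<le> b"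
        using step[OF h] h by (subst pos_divide_le_eq) (auto simp: mult.commute)
    qed
  qed simp
  then have "p \<bullet> v + \<tau> \<le> (norm p)\<^sup>2 / 2 - X x + e" by (simp add: b_def v_def)
  moreover have "p \<bullet> v = (norm p)\<^sup>2 + p \<bullet> P" by (simp add: v_def inner_add_right power2_norm_eq_inner)
  moreover have "(norm (p + P))\<^sup>2 = (norm p)\<^sup>2 + 2 * (p \<bullet> P) + (norm P)\<^sup>2"
    by (simp add: power2_norm_eq_inner inner_add_left inner_add_right inner_commute)
  ultimately show ?thesis by argo
qed

end

section \<open>The upper bound\<close>

text \<open>Uniform continuity on the compact cylinder controls the change of the integrand,
  uniformly in the measure; weak-* continuity controls the change of the measure with the integrand
  frozen.\<close>

lemma weak_star_curve_integral_continuous: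
  fixes G :: "'n::finite torus \<Rightarrow> real \<Rightarrow> real"
  assumes \<mu>: "continuous_map (top_of_set {0..T}) weak_star \<mu>" and G: "continuous_on UNIV (\<lambda>(x, t). G (proj_torus x) t)"
  shows "continuous_on {0..T} (\<lambda>t. \<integral>q. G q t \<partial>\<mu> t)"
proof -
  have Gt: "continuous_on UNIV (\<lambda>q. G q t)" for t
  proof (rule torus_continuous_on_iff_lift)
    have "continuous_on UNIV (\<lambda>x :: real ^ 'n. (x, t))" by (intro continuous_intros)
    from continuous_on_compose2[OF G this] show "continuous_on UNIV (\<lambda>x. G (proj_torus x) t)" by simp
  qed
  have "compact (cbox (0 :: real ^ 'n) 1 \<times> {0..T})" by (intro compact_Times) auto
  then have uc: "uniformly_continuous_on (cbox (0 :: real ^ 'n) 1 \<times> {0..T}) (\<lambda>(x, t). G (proj_torus x) t)"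
    by (intro compact_uniformly_continuous continuous_on_subset[OF G]) auto
  have near: "\<exists>d>0. \<forall>s\<in>{0..T}. \<forall>t\<in>{0..T}. dist s t < d \<longrightarrow> (\<forall>q. \<bar>G q s - G q t\<bar> \<le> e)" if e: "e > 0" for e
  proof -
    obtain d where d: "d > 0" "\<And>z z'. z \<in> cbox (0 :: real ^ 'n) 1 \<times> {0..T} \<Longrightarrow> z' \<in> cbox 0 1 \<times> {0..T} \<Longrightarrow> dist z' z < d \<Longrightarrow>
        dist ((\<lambda>(x, t). G (proj_torus x) t) z') ((\<lambda>(x, t). G (proj_torus x) t) z) < e"
      by (rule exE[OF uc[unfolded uniformly_continuous_on_def, rule_format, OF e]]) (rule that; blast)
    have "\<bar>G q s - G q t\<bar> \<le> e" if st: "s \<in> {0..T}" "t \<in> {0..T}" "dist s t < d" for q s t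
    proof -
      obtain x :: "real ^ 'n" where x: "x \<in> cbox 0 1" "q = proj_torus x" using proj_torus_unit_cube by (metis UNIV_I imageE)
      show ?thesis using d(2)[of "(x, t)" "(x, s)"] st x by (simp add: dist_Pair_Pair dist_real_def)
    qed
    then show ?thesis using d(1) by blast
  qed
  show ?thesis
    unfolding continuous_on_iff
  proof (intro ballI allI impI)
    fix t e :: real assume t: "t \<in> {0..T}" and e: "e > 0"
    obtain d1 where d1: "d1 > 0" "\<forall>s\<in>{0..T}. \<forall>t\<in>{0..T}. dist s t < d1 \<longrightarrow> (\<forall>q. \<bar>G q s - G q t\<bar> \<le> e / 2)" using near[of "e / 2"] e by auto
    obtain d2 where d2: "d2 > 0" "\<forall>s\<in>{0..T}. dist s t < d2 \<longrightarrow> dist (\<integral>q. G q t \<partial>\<mu> s) (\<integral>q. G q t \<partial>\<mu> t) < e / 2"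
      using weak_star_curveD(2)[OF \<mu> Gt[of t]] t e unfolding continuous_on_iff by (meson half_gt_zero)
    show "\<exists>d>0. \<forall>s\<in>{0..T}. dist s t < d \<longrightarrow> dist (\<integral>q. G q s \<partial>\<mu> s) (\<integral>q. G q t \<partial>\<mu> t) < e"
    proof (intro exI[of _ "min d1 d2"] conjI ballI impI)
      fix s assume s: "s \<in> {0..T}" "dist s t < min d1 d2"
      have p: "prob_space (\<mu> s)" "sets (\<mu> s) = sets borel" using weak_star_curveD(1)[OF \<mu> s(1)] by (auto simp: torus_probs_def)
      have "\<bar>(\<integral>q. G q s \<partial>\<mu> s) - (\<integral>q. G q t \<partial>\<mu> s)\<bar> \<le> e / 2"
        using d1(2) s t by (intro abs_integral_diff_le p compact_continuous_integrable compact_torus Gt) auto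
      moreover have "\<bar>(\<integral>q. G q t \<partial>\<mu> s) - (\<integral>q. G q t \<partial>\<mu> t)\<bar> < e / 2" using d2(2) s by (simp add: dist_real_def)
      ultimately show "dist (\<integral>q. G q s \<partial>\<mu> s) (\<integral>q. G q t \<partial>\<mu> t) < e" unfolding dist_real_def by linarith
    qed (use d1 d2 in simp)
  qed
qed

text \<open>For 4 * \<kappa> < T at least one of the two transitions equals 1 at every time, so the
  expression agrees with their product. As a sum its derivative splits into two ramps, each of unit
  integral.\<close>

definition cutoff :: "real \<Rightarrow> real \<Rightarrow> real \<Rightarrow> real" where
  "cutoff T \<kappa> t = smoothstep ((t - \<kappa>) / \<kappa>) + smoothstep ((T - \<kappa> - t) / \<kappa>) - 1"

definition ramp_up :: "real \<Rightarrow> real \<Rightarrow> real" where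
  "ramp_up \<kappa> t = smoothstep' ((t - \<kappa>) / \<kappa>) / \<kappa>"

definition ramp_down :: "real \<Rightarrow> real \<Rightarrow> real \<Rightarrow> real" where
  "ramp_down T \<kappa> t = smoothstep' ((T - \<kappa> - t) / \<kappa>) / \<kappa>"

lemma ramp_derivs:
  assumes "\<kappa> > 0"
  shows "((\<lambda>t. smoothstep ((t - \<kappa>) / \<kappa>)) has_real_derivative ramp_up \<kappa> t) (at t within S)"
    "((\<lambda>t. smoothstep ((T - \<kappa> - t) / \<kappa>)) has_real_derivative - ramp_down T \<kappa> t) (at t within S)"
proof -
  have "((\<lambda>t. (t - \<kappa>) / \<kappa>) has_real_derivative 1 / \<kappa>) (at t within S)"
    using assms by (auto intro!: derivative_eq_intros)
  from DERIV_chain2[OF smoothstep_deriv this] show "((\<lambda>t. smoothstep ((t - \<kappa>) / \<kappa>)) has_real_derivative ramp_up \<kappa> t) (at t within S)"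
    by (simp add: ramp_up_def)
  have "((\<lambda>t. (T - \<kappa> - t) / \<kappa>) has_real_derivative - (1 / \<kappa>)) (at t within S)"
    using assms by (auto intro!: derivative_eq_intros)
  from DERIV_chain2[OF smoothstep_deriv this] show "((\<lambda>t. smoothstep ((T - \<kappa> - t) / \<kappa>)) has_real_derivative - ramp_down T \<kappa> t) (at t within S)"
    by (simp add: ramp_down_def)
qed

lemma cutoff_deriv:
  assumes "\<kappa> > 0"
  shows "(cutoff T \<kappa> has_real_derivative ramp_up \<kappa> t - ramp_down T \<kappa> t) (at t)"
  unfolding cutoff_def[abs_def]
  by (rule derivative_eq_intros ramp_derivs[OF assms] refl)+ simp

lemma ramp_continuous: "\<kappa> > 0 \<Longrightarrow> continuous_on S (ramp_up \<kappa>)" "\<kappa> > 0 \<Longrightarrow> continuous_on S (ramp_down T \<kappa>)"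
  unfolding ramp_up_def[abs_def] ramp_down_def[abs_def]
  by (intro continuous_intros continuous_on_compose2[OF smoothstep_facts(7)[of UNIV]]; simp)+

lemma ramp_facts:
  assumes \<kappa>: "\<kappa> > 0"
  shows "0 \<le> ramp_up \<kappa> t" "0 \<le> ramp_down T \<kappa> t" "ramp_up \<kappa> t \<noteq> 0 \<Longrightarrow> \<kappa> \<le> t \<and> t \<le> 2 * \<kappa>"
    "ramp_down T \<kappa> t \<noteq> 0 \<Longrightarrow> T - 2 * \<kappa> \<le> t \<and> t \<le> T - \<kappa>"
proof -
  show "0 \<le> ramp_up \<kappa> t" "0 \<le> ramp_down T \<kappa> t" using \<kappa> smoothstep_facts(5) by (simp_all add: ramp_up_def ramp_down_def)
  show "\<kappa> \<le> t \<and> t \<le> 2 * \<kappa>" if "ramp_up \<kappa> t \<noteq> 0"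
  proof -
    have "\<not> ((t - \<kappa>) / \<kappa> \<le> 0 \<or> 1 \<le> (t - \<kappa>) / \<kappa>)" using that smoothstep_facts(6)[of "(t - \<kappa>) / \<kappa>"] by (auto simp: ramp_up_def)
    then show ?thesis using \<kappa> by (auto simp: field_simps)
  qed
  show "T - 2 * \<kappa> \<le> t \<and> t \<le> T - \<kappa>" if "ramp_down T \<kappa> t \<noteq> 0"
  proof -
    have "\<not> ((T - \<kappa> - t) / \<kappa> \<le> 0 \<or> 1 \<le> (T - \<kappa> - t) / \<kappa>)" using that smoothstep_facts(6)[of "(T - \<kappa> - t) / \<kappa>"] by (auto simp: ramp_down_def)
    then show ?thesis using \<kappa> by (auto simp: field_simps)
  qed
qed

lemma cutoff_facts:
  assumes \<kappa>: "\<kappa> > 0" "4 * \<kappa> < T"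
  shows "0 \<le> cutoff T \<kappa> t" "cutoff T \<kappa> t \<le> 1" "t \<le> \<kappa> \<or> T - \<kappa> \<le> t \<Longrightarrow> cutoff T \<kappa> t = 0"
    "2 * \<kappa> \<le> t \<Longrightarrow> t \<le> T - 2 * \<kappa> \<Longrightarrow> cutoff T \<kappa> t = 1"
proof -
  have up: "t \<le> \<kappa> \<Longrightarrow> smoothstep ((t - \<kappa>) / \<kappa>) = 0" "2 * \<kappa> \<le> t \<Longrightarrow> smoothstep ((t - \<kappa>) / \<kappa>) = 1"
    using \<kappa> by (auto intro!: smoothstep_facts simp: field_simps)
  have down: "T - \<kappa> \<le> t \<Longrightarrow> smoothstep ((T - \<kappa> - t) / \<kappa>) = 0" "t \<le> T - 2 * \<kappa> \<Longrightarrow> smoothstep ((T - \<kappa> - t) / \<kappa>) = 1"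
    using \<kappa> by (auto intro!: smoothstep_facts simp: field_simps)
  note s = smoothstep_facts(1,2)[of "(t - \<kappa>) / \<kappa>"] smoothstep_facts(1,2)[of "(T - \<kappa> - t) / \<kappa>"]
  show "cutoff T \<kappa> t \<le> 1" using s by (simp add: cutoff_def)
  show "0 \<le> cutoff T \<kappa> t" 
  proof (cases "2 * \<kappa> \<le> t")
    case True then show ?thesis using up s by (simp add: cutoff_def)
  next
    case False then show ?thesis using down s \<kappa> by (simp add: cutoff_def)
  qed
  show "cutoff T \<kappa> t = 0" if "t \<le> \<kappa> \<or> T - \<kappa> \<le> t" using that up down \<kappa> by (auto simp: cutoff_def)
  show "cutoff T \<kappa> t = 1" if "2 * \<kappa> \<le> t" "t \<le> T - 2 * \<kappa>" using that up down by (simp add: cutoff_def)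
qed

lemma ramp_integrals:
  assumes \<kappa>: "\<kappa> > 0" "4 * \<kappa> < T"
  shows "(ramp_up \<kappa> has_integral 1) {0..T}" "(ramp_down T \<kappa> has_integral 1) {0..T}"
proof -
  have T: "0 \<le> T" using \<kappa> by simp
  have e: "smoothstep ((T - \<kappa>) / \<kappa>) = 1" "smoothstep ((0 - \<kappa>) / \<kappa>) = 0"
    using \<kappa> by (auto intro!: smoothstep_facts simp: field_simps)
  have "(ramp_up \<kappa> has_integral smoothstep ((T - \<kappa>) / \<kappa>) - smoothstep ((0 - \<kappa>) / \<kappa>)) {0..T}"
    using ramp_derivs(1)[OF \<kappa>(1)] by (intro fundamental_theorem_of_calculus T) (simp add: has_real_derivative_iff_has_vector_derivative)
  then show "(ramp_up \<kappa> has_integral 1) {0..T}" unfolding e by simp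
  have "((\<lambda>t. - ramp_down T \<kappa> t) has_integral smoothstep ((T - \<kappa> - T) / \<kappa>) - smoothstep ((T - \<kappa> - 0) / \<kappa>)) {0..T}"
    using ramp_derivs(2)[OF \<kappa>(1)] by (intro fundamental_theorem_of_calculus T) (simp add: has_real_derivative_iff_has_vector_derivative)
  from has_integral_neg[OF this] show "(ramp_down T \<kappa> has_integral 1) {0..T}" using e by simp
qed

lemma cutoff_test_function:
  fixes \<Phi> :: "(real ^ 'n::finite) \<times> real \<Rightarrow> real"
  assumes \<kappa>: "\<kappa> > 0" "4 * \<kappa> < T" and D: "\<And>z. (\<Phi> has_derivative (\<lambda>h. g z \<bullet> h)) (at z)" and g: "continuous_on UNIV g"
    and per: "\<And>x a t. proj_torus a = 0 \<Longrightarrow> \<Phi> (x + a, t) = \<Phi> (x, t)"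
  obtains \<psi> where "\<psi> \<in> test_functions T"
    "\<And>x t. HJ \<psi> P (proj_torus x) t = (ramp_up \<kappa> t - ramp_down T \<kappa> t) * \<Phi> (x, t) + cutoff T \<kappa> t * snd (g (x, t))
       + (norm (cutoff T \<kappa> t *\<^sub>R fst (g (x, t)) + P))\<^sup>2 / 2"
proof -
  \<comment> \<open>Periodicity of \<Phi> makes the value independent of the representative, see
    \<open>rp\<close>.\<close>
  define \<psi> where "\<psi> = (\<lambda>(q, t). cutoff T \<kappa> t * \<Phi> (rep_torus q, t))"
  define G where "G z = (cutoff T \<kappa> (snd z) *\<^sub>R fst (g z), (ramp_up \<kappa> (snd z) - ramp_down T \<kappa> (snd z)) * \<Phi> z + cutoff T \<kappa> (snd z) * snd (g z))" for z
  have rp: "\<Phi> (rep_torus (proj_torus x), t) = \<Phi> (x, t)" for x t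
  proof -
    have "proj_torus (rep_torus (proj_torus x) - x) = (0 :: 'n torus)"
      using proj_rep_torus[of "proj_torus x"] unfolding proj_torus_eq_iff zero_torus_def by simp
    from per[OF this, of x t] show ?thesis by simp
  qed
  have lift: "(\<lambda>(x, t). \<psi> (proj_torus x, t)) = (\<lambda>z. cutoff T \<kappa> (snd z) * \<Phi> z)"
    by (auto simp: \<psi>_def rp)
  have der: "((\<lambda>(x, t). \<psi> (proj_torus x, t)) has_derivative blinfun_apply (blinfun_inner_right (G z))) (at z)" for z
  proof -
    have "(cutoff T \<kappa> has_derivative (\<lambda>h. h * (ramp_up \<kappa> (snd z) - ramp_down T \<kappa> (snd z)))) (at (snd z))"
      using cutoff_deriv[OF \<kappa>(1)] by (simp add: has_field_derivative_def mult_commute_abs)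
    moreover have "(snd has_derivative snd) (at z)" by (rule has_derivative_snd[OF has_derivative_ident])
    ultimately have "((\<lambda>z. cutoff T \<kappa> (snd z)) has_derivative (\<lambda>h. snd h * (ramp_up \<kappa> (snd z) - ramp_down T \<kappa> (snd z)))) (at z)"
      using has_derivative_compose[of snd snd z UNIV] by blast
    from has_derivative_mult[OF this D]
    have d: "((\<lambda>z. cutoff T \<kappa> (snd z) * \<Phi> z) has_derivative (\<lambda>h. cutoff T \<kappa> (snd z) * (g z \<bullet> h) + snd h * (ramp_up \<kappa> (snd z) - ramp_down T \<kappa> (snd z)) * \<Phi> z)) (at z)" .
    have "(\<lambda>h. cutoff T \<kappa> (snd z) * (g z \<bullet> h) + snd h * (ramp_up \<kappa> (snd z) - ramp_down T \<kappa> (snd z)) * \<Phi> z) = blinfun_apply (blinfun_inner_right (G z))"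
      by (rule ext) (simp add: G_def blinfun_inner_right.rep_eq inner_prod_def algebra_simps)
    with d show ?thesis unfolding lift by simp
  qed
  have c\<Phi>: "continuous_on UNIV \<Phi>"
    by (intro continuous_at_imp_continuous_on ballI has_derivative_continuous[OF D])
  have c\<eta>: "continuous_on UNIV (cutoff T \<kappa>)"
    by (intro continuous_at_imp_continuous_on ballI DERIV_isCont[OF cutoff_deriv] \<kappa>)
  have cG: "continuous_on UNIV G"
    unfolding G_def[abs_def]
    by (intro continuous_intros g c\<Phi> continuous_on_compose2[OF c\<eta>] continuous_on_compose2[OF ramp_continuous(1)[OF \<kappa>(1), of UNIV]]
        continuous_on_compose2[OF ramp_continuous(2)[OF \<kappa>(1), of UNIV]]) auto
  show thesis
  proof (rule that[of \<psi>])
    have "continuous_on UNIV (\<lambda>z. blinfun_inner_right (G z))"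
      by (rule bounded_linear.continuous_on[OF bounded_linear_blinfun_inner_right cG])
    moreover have "compact ((UNIV :: 'n torus set) \<times> {\<kappa>..T - \<kappa>})" by (intro compact_Times compact_torus) auto
    moreover have "(UNIV :: 'n torus set) \<times> {\<kappa>..T - \<kappa>} \<subseteq> UNIV \<times> {0<..<T}" using \<kappa> by auto
    moreover have "\<forall>z. z \<notin> (UNIV :: 'n torus set) \<times> {\<kappa>..T - \<kappa>} \<longrightarrow> \<psi> z = 0"
      using cutoff_facts(3)[OF \<kappa>] by (auto simp: \<psi>_def)
    ultimately show "\<psi> \<in> test_functions T"
      unfolding test_functions_def
      by (intro CollectI conjI exI[of _ "\<lambda>z. blinfun_inner_right (G z)"] exI[of _ "(UNIV :: 'n torus set) \<times> {\<kappa>..T - \<kappa>}"] allI[OF der])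
    fix x t
    have "(\<chi> i. G (x, t) \<bullet> (axis i 1, 0)) = fst (G (x, t))" by (simp add: vec_eq_iff inner_prod_def inner_axis)
    then show "HJ \<psi> P (proj_torus x) t = (ramp_up \<kappa> t - ramp_down T \<kappa> t) * \<Phi> (x, t) + cutoff T \<kappa> t * snd (g (x, t))
       + (norm (cutoff T \<kappa> t *\<^sub>R fst (g (x, t)) + P))\<^sup>2 / 2"
      unfolding HJ_lift[of \<psi> "\<lambda>z. blinfun_inner_right (G z)", OF der]
      by (simp add: blinfun_inner_right.rep_eq) (simp add: G_def)
  qed
qed

text \<open>Convexity between p and 0: damping the gradient by the cutoff costs only the matching
  fraction of |P|^2, which is the constant on the right of the Hamilton--Jacobi inequality
  anyway.\<close>

lemma scaled_norm_convex:
  fixes p P :: "'a::real_inner"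
  assumes "0 \<le> \<eta>" "\<eta> \<le> 1"
  shows "(norm (\<eta> *\<^sub>R p + P))\<^sup>2 \<le> \<eta> * (norm (p + P))\<^sup>2 + (1 - \<eta>) * (norm P)\<^sup>2"
proof -
  have "\<eta>\<^sup>2 * (norm p)\<^sup>2 \<le> \<eta> * (norm p)\<^sup>2" using assms by (intro mult_right_mono) (auto simp: power2_eq_square mult_left_le)
  moreover have "(norm (c *\<^sub>R p + P))\<^sup>2 = c\<^sup>2 * (norm p)\<^sup>2 + 2 * c * (p \<bullet> P) + (norm P)\<^sup>2" for c
    unfolding power2_norm_eq_inner by (simp add: inner_add_left inner_add_right inner_commute power2_eq_square)
  from this[of \<eta>] this[of 1] have "(norm (\<eta> *\<^sub>R p + P))\<^sup>2 = \<eta>\<^sup>2 * (norm p)\<^sup>2 + 2 * \<eta> * (p \<bullet> P) + (norm P)\<^sup>2"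
    "(norm (p + P))\<^sup>2 = (norm p)\<^sup>2 + 2 * (p \<bullet> P) + (norm P)\<^sup>2" by simp_all
  ultimately show ?thesis by (simp add: algebra_simps)
qed

text \<open>For each competitor the action divided by T is at least the cost between its endpoints,
  and dual feasibility does the rest. The speed limit can only raise the infimum.\<close>

lemma value_ge_terminal:
  fixes \<Xi> :: "'n::finite torus \<Rightarrow> real"
  assumes T: "T > 0" and \<Xi>: "continuous_on UNIV \<Xi>" and dual: "\<And>y z. U2 z - U1 y \<le> A_real \<Xi> P T y z"
    and R: "0 \<le> R"
  shows "T * U2 (proj_torus x) \<le> value_fn (\<lambda>x. \<Xi> (proj_torus x)) P (\<lambda>x. T * U1 (proj_torus x)) R x T"
  unfolding value_fn_def
proof (rule cInf_greatest)
  have "nice_curve R T (\<lambda>_. x) (\<lambda>_. 0)" by (rule nice_curve_mono[OF nice_curve_const R])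
  then show "{T * U1 (proj_torus (\<gamma> 0)) + action (\<lambda>x. \<Xi> (proj_torus x)) P T \<gamma> v | \<gamma> v. nice_curve R T \<gamma> v \<and> \<gamma> T = x} \<noteq> {}" by blast
  fix a assume "a \<in> {T * U1 (proj_torus (\<gamma> 0)) + action (\<lambda>x. \<Xi> (proj_torus x)) P T \<gamma> v | \<gamma> v. nice_curve R T \<gamma> v \<and> \<gamma> T = x}"
  then obtain \<gamma> v where n: "nice_curve R T \<gamma> v" "\<gamma> T = x" and a: "a = T * U1 (proj_torus (\<gamma> 0)) + action (\<lambda>x. \<Xi> (proj_torus x)) P T \<gamma> v"
    by blast
  have "ereal (A_real \<Xi> P T (proj_torus (\<gamma> 0)) (proj_torus (\<gamma> T))) \<le> ereal (action (\<lambda>x. \<Xi> (proj_torus x)) P T \<gamma> v / T)"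
    using A_cost_le_action[OF n(1) T \<Xi>, of P] unfolding A_cost_eq_A_real[OF T \<Xi>] .
  then have "U2 (proj_torus x) - U1 (proj_torus (\<gamma> 0)) \<le> action (\<lambda>x. \<Xi> (proj_torus x)) P T \<gamma> v / T"
    using dual[of "proj_torus x" "proj_torus (\<gamma> 0)"] n(2) by simp
  then have "T * (U2 (proj_torus x) - U1 (proj_torus (\<gamma> 0))) \<le> action (\<lambda>x. \<Xi> (proj_torus x)) P T \<gamma> v"
    using T by (simp add: pos_le_divide_eq mult.commute)
  then show "T * U2 (proj_torus x) \<le> a" unfolding a by (simp add: algebra_simps)
qed

text \<open>The ramps meet the boundary values of the mollified value function, each up to 2 * e.
  Elsewhere the subsolution inequality is weighted by the cutoff \<eta>, and convexity restores the
  full |P|^2 / 2. Only \<eta> * \<Xi> is subtracted then, and (1 - \<eta>) * B makes up for the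
  missing part.\<close>

lemma near_subsolution:
  fixes \<Xi> U1 U2 :: "'n::finite torus \<Rightarrow> real"
  assumes T: "T > 0" and \<Xi>: "continuous_on UNIV \<Xi>" and U1: "continuous_on UNIV U1" and U2: "continuous_on UNIV U2"
    and dual: "\<And>y z. U2 z - U1 y \<le> A_real \<Xi> P T y z" and B: "\<And>q. \<bar>\<Xi> q\<bar> \<le> B"
    and \<kappa>: "\<kappa> > 0" "4 * \<kappa> < T" "((norm P)\<^sup>2 / 2 + B) * (3 * \<kappa>) \<le> e" and e: "e > 0"
  obtains \<psi> where "\<psi> \<in> test_functions T"
    "\<And>q t. HJ \<psi> P q t \<le> (norm P)\<^sup>2 / 2 + e - \<Xi> q + ramp_up \<kappa> t * (T * U1 q + 2 * e) - ramp_down T \<kappa> t * (T * U2 q - 2 * e) + (1 - cutoff T \<kappa> t) * B"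
proof -
  define X where "X x = \<Xi> (proj_torus x)" for x
  define u where "u x = T * U1 (proj_torus x)" for x
  define W where "W x = T * U2 (proj_torus x)" for x
  have TU: "continuous_on UNIV (\<lambda>q. T * U1 q)" "continuous_on UNIV (\<lambda>q. T * U2 q)" by (intro continuous_intros U1 U2)+
  obtain Mu where Mu: "\<And>q. \<bar>T * U1 q\<bar> \<le> Mu" using torus_continuous_bounded[OF TU(1)] by blast
  obtain d1 where d1: "d1 > 0" "\<And>x y. dist x y < d1 \<Longrightarrow> \<bar>u x - u y\<bar> < e"
    using torus_lift_uniformly_continuous[OF TU(1) e] unfolding u_def by blast
  obtain d2 where d2: "d2 > 0" "\<And>x y. dist x y < d2 \<Longrightarrow> \<bar>W x - W y\<bar> < e"
    using torus_lift_uniformly_continuous[OF TU(2) e] unfolding W_def by blast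
  obtain d3 where d3: "d3 > 0" "\<And>x y. dist x y < d3 \<Longrightarrow> \<bar>X x - X y\<bar> < e"
    using torus_lift_uniformly_continuous[OF \<Xi> e] unfolding X_def by blast
  \<comment> \<open>Halving makes the comparisons strict; \<delta> < \<kappa> keeps the kernel
    inside (0, T) wherever the cutoff is nonzero.\<close>
  define \<delta> where "\<delta> = min \<kappa> (min d1 (min d2 d3)) / 2"
  have \<delta>: "0 < \<delta>" "\<delta> < \<kappa>" "\<delta> < d1" "\<delta> < d2" "\<delta> < d3" using \<kappa> d1 d2 d3 by (auto simp: \<delta>_def min_def)
  define M where "M = Mu + ((norm P)\<^sup>2 / 2 + B) * T"
  obtain k :: "(real ^ 'n) \<times> real \<Rightarrow> real" and C where k: "\<And>w. 0 \<le> k w" "\<And>w. \<delta> \<le> norm w \<Longrightarrow> k w = 0" "continuous_on UNIV k"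
    "(\<integral>w. k w \<partial>lborel) = 1" and C: "C \<ge> 0"
    and moll: "\<And>f M. continuous_on UNIV f \<Longrightarrow> (\<And>z. \<bar>f z\<bar> \<le> M) \<Longrightarrow> \<exists>g. continuous_on UNIV g \<and>
       (\<forall>z. ((\<lambda>z. \<integral>w. k w * f (z + w) \<partial>lborel) has_derivative (\<lambda>h. g z \<bullet> h)) (at z) \<and> norm (g z) \<le> C * M)"
    apply (rule mollifier[OF \<delta>(1), where 'a = "(real ^ 'n) \<times> real"])
    subgoal premises prems for k C by (rule that[of k C]) (fact prems)+
    done
  \<comment> \<open>M bounds the value function on [0, T] for every speed limit. Thus C * M bounds
    the mollified gradient before R is known, and there is no circularity.\<close>
  define R where "R = C * M + norm P"
  have B0: "0 \<le> B" using B[of 0] by linarith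
  have Mu0: "0 \<le> Mu" using Mu[of 0] by linarith
  have R: "0 \<le> R" using C B0 Mu0 T by (simp add: R_def M_def)
  interpret value_function X u P B Mu R
    by unfold_locales (auto simp: X_def u_def B Mu R intro: torus_lift_continuous \<Xi>)
  have cc: "continuous_on UNIV (clamped T)"
    unfolding clamped_def
  proof (rule V_continuous[OF T])
    show "\<exists>d>0. \<forall>x y. dist x y < d \<longrightarrow> \<bar>u x - u y\<bar> < e" if "e > 0" for e
      using torus_lift_uniformly_continuous[OF TU(1) that] unfolding u_def by metis
    show "\<exists>d>0. \<forall>x y. dist x y < d \<longrightarrow> \<bar>X x - X y\<bar> < e" if "e > 0" for e
      using torus_lift_uniformly_continuous[OF \<Xi> that] unfolding X_def by metis
  qed
  obtain g where g: "continuous_on UNIV g" "\<And>z. ((\<lambda>z. \<integral>w. k w * clamped T (z + w) \<partial>lborel) has_derivative (\<lambda>h. g z \<bullet> h)) (at z)"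
    "\<And>z. norm (g z) \<le> C * M"
    using moll[OF cc clamped_bound[OF T]] unfolding M_def by blast
  define \<Phi> where "\<Phi> z = (\<integral>w. k w * clamped T (z + w) \<partial>lborel)" for z
  have per: "\<Phi> (x + a, t) = \<Phi> (x, t)" if "proj_torus a = 0" for x a t
  proof -
    have "proj_torus (y + a) = proj_torus y" for y using that by (simp add: proj_torus_add)
    then have "clamped T ((x + a, t) + w) = clamped T ((x, t) + w)" for w
      by (intro clamped_periodic) (simp_all add: u_def X_def)
    then show ?thesis by (simp add: \<Phi>_def)
  qed
  obtain \<psi> where \<psi>: "\<psi> \<in> test_functions T"
    "\<And>x t. HJ \<psi> P (proj_torus x) t = (ramp_up \<kappa> t - ramp_down T \<kappa> t) * \<Phi> (x, t) + cutoff T \<kappa> t * snd (g (x, t))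
       + (norm (cutoff T \<kappa> t *\<^sub>R fst (g (x, t)) + P))\<^sup>2 / 2"
    by (rule cutoff_test_function[OF \<kappa>(1,2) g(2,1)[folded \<Phi>_def] per, of P]; (assumption | rule that))
  have bound: "HJ \<psi> P (proj_torus x) t \<le> (norm P)\<^sup>2 / 2 + e - X x + ramp_up \<kappa> t * (u x + 2 * e) - ramp_down T \<kappa> t * (W x - 2 * e) + (1 - cutoff T \<kappa> t) * B" for x t
  proof -
    let ?\<eta> = "cutoff T \<kappa> t" and ?p = "fst (g (x, t))" and ?\<tau> = "snd (g (x, t))"
    note \<eta> = cutoff_facts(1,2)[OF \<kappa>(1,2), of t]
    \<comment> \<open>The ramp vanishes after time 2 * \<kappa> and the kernel reaches less than
      \<kappa> further, hence the factor 3 * \<kappa> in the hypothesis.\<close>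
    have "ramp_up \<kappa> t * \<Phi> (x, t) \<le> ramp_up \<kappa> t * (u x + 2 * e)"
    proof (cases "ramp_up \<kappa> t = 0")
      case False
      then have "t \<le> 2 * \<kappa>" using ramp_facts(3)[OF \<kappa>(1)] by simp
      then have "\<Phi> (x, t) \<le> u x + 2 * e" unfolding \<Phi>_def
        using \<delta> \<kappa> d1 by (intro average_initial[where \<delta> = \<delta> and m = "3 * \<kappa>"] k cc T) auto
      then show ?thesis using ramp_facts(1)[OF \<kappa>(1)] by (intro mult_left_mono)
    qed simp
    moreover have "ramp_down T \<kappa> t * (W x - 2 * e) \<le> ramp_down T \<kappa> t * \<Phi> (x, t)"
    proof (cases "ramp_down T \<kappa> t = 0")
      case False
      then have "T - 2 * \<kappa> \<le> t" using ramp_facts(4)[OF \<kappa>(1)] by simp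
      moreover have "W x \<le> V x T" for x unfolding W_def u_def[abs_def] X_def[abs_def] by (rule value_ge_terminal[OF T \<Xi> dual R])
      ultimately have "W x - 2 * e \<le> \<Phi> (x, t)" unfolding \<Phi>_def
        using \<delta> \<kappa> d2 by (intro average_terminal[where \<delta> = \<delta> and m = "3 * \<kappa>"] k cc T) auto
      then show ?thesis using ramp_facts(2)[OF \<kappa>(1)] by (intro mult_left_mono)
    qed simp
    moreover have "?\<eta> * (?\<tau> + (norm (?p + P))\<^sup>2 / 2) \<le> ?\<eta> * ((norm P)\<^sup>2 / 2 - X x + e)"
    proof (cases "?\<eta> = 0")
      case False
      then have t: "\<kappa> < t" "t < T - \<kappa>" using cutoff_facts(3)[OF \<kappa>(1,2), of t] by force+
      have "norm ?p \<le> C * M" using g(3)[of "(x, t)"] norm_fst_le[of ?p ?\<tau>] by simp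
      then have "norm (?p + P) \<le> R" unfolding R_def using norm_triangle_ineq[of ?p P] by linarith
      moreover have "((\<lambda>z. \<integral>w. k w * clamped T (z + w) \<partial>lborel) has_derivative (\<lambda>h. (?p, ?\<tau>) \<bullet> h)) (at (x, t))" using g(2)[of "(x, t)"] by simp
      ultimately have "?\<tau> + (norm (?p + P))\<^sup>2 / 2 \<le> (norm P)\<^sup>2 / 2 - X x + e"
        using \<delta> t by (intro average_subsolution[where \<delta> = \<delta> and d = d3 and k = k and T = T and t = t] k cc d3) auto
      then show ?thesis using \<eta> by (intro mult_left_mono)
    qed simp
    moreover note scaled_norm_convex[OF \<eta>, of ?p P]
    moreover have "?\<eta> * e \<le> e" using \<eta> e by (simp add: mult_left_le_one_le)
    moreover have "(1 - ?\<eta>) * X x \<le> (1 - ?\<eta>) * B" using \<eta> X(2)[of x] by (intro mult_left_mono) auto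
    ultimately show ?thesis unfolding \<psi>(2) by (simp add: algebra_simps)
  qed
  show thesis
  proof (rule that[OF \<psi>(1)])
    fix q t show "HJ \<psi> P q t \<le> (norm P)\<^sup>2 / 2 + e - \<Xi> q + ramp_up \<kappa> t * (T * U1 q + 2 * e) - ramp_down T \<kappa> t * (T * U2 q - 2 * e) + (1 - cutoff T \<kappa> t) * B"
      using bound[of "rep_torus q" t] by (simp add: X_def u_def W_def)
  qed
qed

text \<open>The ramps act as approximate point masses at 0 and T. Of the error (3 T + 5) e, one T e
  stems from the subsolution inequality, twice T e from weak-* continuity at the endpoints, twice 2
  e from the mollified boundary values, and the last e from the times at which the cutoff is below
  1.\<close>

lemma curve_action_upper:
  fixes \<Xi> U1 U2 :: "'n::finite torus \<Rightarrow> real"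
  assumes T: "T > 0" and \<Xi>: "continuous_on UNIV \<Xi>" and U1: "continuous_on UNIV U1" and U2: "continuous_on UNIV U2"
    and dual: "\<And>y z. U2 z - U1 y \<le> A_real \<Xi> P T y z" and \<mu>: "\<mu> \<in> measure_curves T \<mu>1 \<mu>2" and e: "e > 0"
  shows "ereal (1 / T * (LINT t:{0..T}|lborel. (\<integral>q. \<Xi> q \<partial>\<mu> t))) + F_functional \<mu> P T
    \<le> ereal ((norm P)\<^sup>2 / 2 + (\<integral>q. U1 q \<partial>\<mu>1) - (\<integral>q. U2 q \<partial>\<mu>2) + (3 * T + 5) * e / T)"
proof -
  have wc: "continuous_map (top_of_set {0..T}) weak_star \<mu>" and ends: "\<mu> 0 = \<mu>1" "\<mu> T = \<mu>2"
    using \<mu> by (auto simp: measure_curves_def)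
  obtain B where B: "B > 0" "\<And>q. \<bar>\<Xi> q\<bar> \<le> B" using torus_continuous_bounded[OF \<Xi>] by blast
  define a1 where "a1 t = (\<integral>q. U1 q \<partial>\<mu> t)" for t
  define a2 where "a2 t = (\<integral>q. U2 q \<partial>\<mu> t)" for t
  define xi where "xi t = (\<integral>q. \<Xi> q \<partial>\<mu> t)" for t
  have ca: "continuous_on {0..T} a1" "continuous_on {0..T} a2" "continuous_on {0..T} xi"
    unfolding a1_def[abs_def] a2_def[abs_def] xi_def[abs_def] by (intro weak_star_curveD(2)[OF wc] U1 U2 \<Xi>)+
  obtain d1 where d1: "d1 > 0" "\<forall>t\<in>{0..T}. dist t 0 < d1 \<longrightarrow> dist (a1 t) (a1 0) < e"
    using ca(1)[unfolded continuous_on_iff, rule_format, of 0 e] T e by auto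
  obtain d2 where d2: "d2 > 0" "\<forall>t\<in>{0..T}. dist t T < d2 \<longrightarrow> dist (a2 t) (a2 T) < e"
    using ca(2)[unfolded continuous_on_iff, rule_format, of T e] T e by auto
  define C where "C = (norm P)\<^sup>2 / 2 + B"
  have C: "C > 0" using B by (simp add: C_def add_nonneg_pos)
  \<comment> \<open>T / 5 leaves room for both ramps, e / (4 * C) keeps waiting costs and the loss
    near the endpoints below e, and the last entry confines the ramps to times at which the endpoint
    integrals have changed by less than e.\<close>
  define \<kappa> where "\<kappa> = min (min (T / 5) (e / (4 * C))) (min d1 d2 / 3)"
  have \<kappa>: "\<kappa> > 0" "4 * \<kappa> < T" "2 * \<kappa> < d1" "2 * \<kappa> < d2" and \<kappa>C: "4 * \<kappa> * C \<le> e"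
  proof -
    show "\<kappa> > 0" using T e C d1 d2 by (simp add: \<kappa>_def)
    have "\<kappa> \<le> T / 5" "\<kappa> \<le> d1 / 3" "\<kappa> \<le> d2 / 3" by (auto simp: \<kappa>_def)
    then show "4 * \<kappa> < T" "2 * \<kappa> < d1" "2 * \<kappa> < d2" using T d1 d2 by linarith+
    have "\<kappa> \<le> e / (4 * C)" by (simp add: \<kappa>_def)
    then show "4 * \<kappa> * C \<le> e" using C by (simp add: pos_le_divide_eq mult_ac)
  qed
  have "C * (3 * \<kappa>) \<le> e" using \<kappa>C mult_pos_pos[OF \<kappa>(1) C] by (simp add: algebra_simps)
  then have \<kappa>3: "((norm P)\<^sup>2 / 2 + B) * (3 * \<kappa>) \<le> e" by (simp add: C_def)
  have "\<kappa> * B \<le> \<kappa> * C" using \<kappa> by (intro mult_left_mono) (auto simp: C_def)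
  then have \<kappa>B: "4 * \<kappa> * B \<le> e" using \<kappa>C by simp
  obtain \<psi> where \<psi>: "\<psi> \<in> test_functions T"
    "\<And>q t. HJ \<psi> P q t \<le> (norm P)\<^sup>2 / 2 + e - \<Xi> q + ramp_up \<kappa> t * (T * U1 q + 2 * e) - ramp_down T \<kappa> t * (T * U2 q - 2 * e) + (1 - cutoff T \<kappa> t) * B"
    by (rule near_subsolution[OF T \<Xi> U1 U2 dual B(2) \<kappa>(1,2) \<kappa>3 e], rule that)
  have cJ: "continuous_on {0..T} (\<lambda>t. \<integral>q. HJ \<psi> P q t \<partial>\<mu> t)"
    by (rule weak_star_curve_integral_continuous[OF wc HJ_continuous[OF \<psi>(1)]])
  define K1 where "K1 = T * a1 0 + T * e + 2 * e"
  define K2 where "K2 = T * a2 T - T * e - 2 * e"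
  \<comment> \<open>Dominates the loss (1 - cutoff) * B: at most B on two intervals of length 2 *
    \<kappa>, in total 4 * \<kappa> * B \<le> e.\<close>
  define b where "b t = (if t \<in> {0..2 * \<kappa>} then B else 0) + (if t \<in> {T - 2 * \<kappa>..T} then B else 0)" for t
  have J: "(\<integral>q. HJ \<psi> P q t \<partial>\<mu> t) \<le> ((norm P)\<^sup>2 / 2 + e) - xi t + ramp_up \<kappa> t * K1 - ramp_down T \<kappa> t * K2 + b t" if t: "t \<in> {0..T}" for t
  proof -
    interpret prob_space "\<mu> t" using weak_star_curveD(1)[OF wc t] by (simp add: torus_probs_def)
    have s: "sets (\<mu> t) = sets borel" using weak_star_curveD(1)[OF wc t] by (simp add: torus_probs_def)
    note i = compact_continuous_integrable[OF compact_torus _ prob_space_axioms s]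
    have cH: "continuous_on UNIV (\<lambda>q. HJ \<psi> P q t)"
    proof (rule torus_continuous_on_iff_lift)
      have "continuous_on UNIV (\<lambda>x :: real ^ 'n. (x, t))" by (intro continuous_intros)
      from continuous_on_compose2[OF HJ_continuous[OF \<psi>(1), of P] this] show "continuous_on UNIV (\<lambda>x. HJ \<psi> P (proj_torus x) t)" by simp
    qed
    have "(\<integral>q. HJ \<psi> P q t \<partial>\<mu> t) \<le> (\<integral>q. ((norm P)\<^sup>2 / 2 + e + ramp_up \<kappa> t * (2 * e) + ramp_down T \<kappa> t * (2 * e) + (1 - cutoff T \<kappa> t) * B)
        - \<Xi> q + (ramp_up \<kappa> t * T) * U1 q - (ramp_down T \<kappa> t * T) * U2 q \<partial>\<mu> t)"
    proof (rule integral_mono)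
      show "HJ \<psi> P q t \<le> ((norm P)\<^sup>2 / 2 + e + ramp_up \<kappa> t * (2 * e) + ramp_down T \<kappa> t * (2 * e) + (1 - cutoff T \<kappa> t) * B)
        - \<Xi> q + (ramp_up \<kappa> t * T) * U1 q - (ramp_down T \<kappa> t * T) * U2 q" for q
        using \<psi>(2)[of q t] by (simp add: algebra_simps)
    qed (intro i cH continuous_intros U1 U2 \<Xi>)+
    also have "\<dots> = ((norm P)\<^sup>2 / 2 + e + ramp_up \<kappa> t * (2 * e) + ramp_down T \<kappa> t * (2 * e) + (1 - cutoff T \<kappa> t) * B)
        - xi t + (ramp_up \<kappa> t * T) * a1 t - (ramp_down T \<kappa> t * T) * a2 t"
      using i[OF U1] i[OF U2] i[OF \<Xi>] by (simp add: prob_space a1_def a2_def xi_def)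
    finally have le: "(\<integral>q. HJ \<psi> P q t \<partial>\<mu> t) \<le> ((norm P)\<^sup>2 / 2 + e) - xi t + ramp_up \<kappa> t * (T * a1 t + 2 * e) - ramp_down T \<kappa> t * (T * a2 t - 2 * e) + (1 - cutoff T \<kappa> t) * B"
      by (simp add: algebra_simps)
    have "ramp_up \<kappa> t * (T * a1 t + 2 * e) \<le> ramp_up \<kappa> t * K1"
    proof (cases "ramp_up \<kappa> t = 0")
      case False
      then have "t \<le> 2 * \<kappa>" using ramp_facts(3)[OF \<kappa>(1)] by simp
      then have "dist (a1 t) (a1 0) < e" using d1 t \<kappa> by (simp add: dist_real_def)
      then have "T * a1 t \<le> T * (a1 0 + e)" using T by (intro mult_left_mono) (auto simp: dist_real_def abs_less_iff)
      then have "T * a1 t + 2 * e \<le> K1" by (simp add: K1_def distrib_left)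
      then show ?thesis using ramp_facts(1)[OF \<kappa>(1)] by (intro mult_left_mono)
    qed simp
    moreover have "ramp_down T \<kappa> t * K2 \<le> ramp_down T \<kappa> t * (T * a2 t - 2 * e)"
    proof (cases "ramp_down T \<kappa> t = 0")
      case False
      then have "T - 2 * \<kappa> \<le> t" using ramp_facts(4)[OF \<kappa>(1)] by simp
      then have "dist (a2 t) (a2 T) < e" using d2 t \<kappa> by (simp add: dist_real_def)
      then have "T * (a2 T - e) \<le> T * a2 t" using T by (intro mult_left_mono) (auto simp: dist_real_def abs_less_iff)
      then have "K2 \<le> T * a2 t - 2 * e" by (simp add: K2_def right_diff_distrib)
      then show ?thesis using ramp_facts(2)[OF \<kappa>(1)] by (intro mult_left_mono)
    qed simp
    moreover have "(1 - cutoff T \<kappa> t) * B \<le> b t"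
    proof (cases "2 * \<kappa> \<le> t \<and> t \<le> T - 2 * \<kappa>")
      case True
      then show ?thesis using cutoff_facts(4)[OF \<kappa>(1,2), of t] B by (simp add: b_def)
    next
      case False
      then have "B \<le> b t" using t B by (auto simp: b_def)
      moreover have "(1 - cutoff T \<kappa> t) * B \<le> 1 * B" using cutoff_facts(1)[OF \<kappa>(1,2), of t] B by (intro mult_right_mono) auto
      ultimately show ?thesis by simp
    qed
    ultimately show ?thesis using le by linarith
  qed
  have ib: "(b has_integral 4 * \<kappa> * B) {0..T}"
  proof -
    have "((\<lambda>t. if t \<in> {0..2 * \<kappa>} then B else 0) has_integral 2 * \<kappa> * B) {0..T}"
      using \<kappa> has_integral_const_real[of B 0 "2 * \<kappa>"] by (subst has_integral_restrict) auto
    moreover have "((\<lambda>t. if t \<in> {T - 2 * \<kappa>..T} then B else 0) has_integral 2 * \<kappa> * B) {0..T}"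
      using \<kappa> has_integral_const_real[of B "T - 2 * \<kappa>" T] by (subst has_integral_restrict) auto
    ultimately have "(b has_integral 2 * \<kappa> * B + 2 * \<kappa> * B) {0..T}" unfolding b_def[abs_def] by (rule has_integral_add)
    then show ?thesis by (simp add: mult_ac)
  qed
  have ixi: "(xi has_integral integral {0..T} xi) {0..T}" by (intro integrable_integral integrable_continuous_real ca)
  have ic: "((\<lambda>t. (norm P)\<^sup>2 / 2 + e) has_integral ((norm P)\<^sup>2 / 2 + e) * T) {0..T}"
    using has_integral_const_real[of "(norm P)\<^sup>2 / 2 + e" 0 T] T by (simp add: mult.commute)
  have "((\<lambda>t. ((norm P)\<^sup>2 / 2 + e) - xi t + ramp_up \<kappa> t * K1 - ramp_down T \<kappa> t * K2 + b t) has_integral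
      ((norm P)\<^sup>2 / 2 + e) * T - integral {0..T} xi + 1 * K1 - 1 * K2 + 4 * \<kappa> * B) {0..T}"
    by (intro has_integral_add has_integral_diff ic ixi ib has_integral_mult_left ramp_integrals \<kappa>)
  from has_integral_le[OF integrable_integral[OF integrable_continuous_real[OF cJ]] this J]
  have "integral {0..T} (\<lambda>t. \<integral>q. HJ \<psi> P q t \<partial>\<mu> t) \<le> ((norm P)\<^sup>2 / 2 + e) * T - integral {0..T} xi + K1 - K2 + 4 * \<kappa> * B" by simp
  also have "\<dots> \<le> T * ((norm P)\<^sup>2 / 2 + a1 0 - a2 T) + (3 * T + 5) * e - integral {0..T} xi"
    using \<kappa>B by (simp add: K1_def K2_def algebra_simps)
  finally have main: "integral {0..T} (\<lambda>t. \<integral>q. HJ \<psi> P q t \<partial>\<mu> t) \<le> T * ((norm P)\<^sup>2 / 2 + a1 0 - a2 T) + (3 * T + 5) * e - integral {0..T} xi" .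
  have LINT: "(LINT t:{0..T}|lborel. f t) = integral {0..T} f" if "continuous_on {0..T} f" for f :: "real \<Rightarrow> real"
    by (rule set_borel_integral_eq_integral(2)[OF borel_integrable_atLeastAtMost'[OF that]])
  have "F_functional \<mu> P T \<le> ereal (1 / T) * ereal (LINT t:{0..T}|lborel. (\<integral>q. HJ \<psi> P q t \<partial>\<mu> t))"
    unfolding F_functional_def HJ_def[symmetric] using T
    by (intro ereal_mult_left_mono INF_lower \<psi>(1)) auto
  also have "\<dots> \<le> ereal (1 / T * (T * ((norm P)\<^sup>2 / 2 + a1 0 - a2 T) + (3 * T + 5) * e - integral {0..T} xi))"
    unfolding LINT[OF cJ] using main T by (simp add: divide_right_mono)
  also have "\<dots> = ereal ((norm P)\<^sup>2 / 2 + a1 0 - a2 T + (3 * T + 5) * e / T - 1 / T * integral {0..T} xi)"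
    using T by (simp add: field_simps)
  finally have "ereal (1 / T * integral {0..T} xi) + F_functional \<mu> P T
     \<le> ereal (1 / T * integral {0..T} xi) + ereal ((norm P)\<^sup>2 / 2 + a1 0 - a2 T + (3 * T + 5) * e / T - 1 / T * integral {0..T} xi)"
    by (rule add_left_mono)
  also have "\<dots> = ereal ((norm P)\<^sup>2 / 2 + a1 0 - a2 T + (3 * T + 5) * e / T)" by simp
  finally show ?thesis unfolding xi_def[symmetric] LINT[OF ca(3)] unfolding a1_def a2_def ends .
qed

lemma H_functional_le:
  fixes \<Xi> U1 U2 :: "'n::finite torus \<Rightarrow> real"
  assumes T: "T > 0" and \<Xi>: "continuous_on UNIV \<Xi>" and U1: "continuous_on UNIV U1" and U2: "continuous_on UNIV U2"
    and dual: "\<And>y z. U2 z - U1 y \<le> A_real \<Xi> P T y z"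
  shows "H_functional \<Xi> T \<mu>1 \<mu>2 P \<le> ereal ((norm P)\<^sup>2 / 2 + (\<integral>q. U1 q \<partial>\<mu>1) - (\<integral>q. U2 q \<partial>\<mu>2))"
proof (rule ereal_le_epsilon2)
  fix e :: real assume e: "0 < e"
  define e' where "e' = T * e / (3 * T + 5)"
  have e': "e' > 0" "(3 * T + 5) * e' / T = e" using T e by (simp_all add: e'_def)
  have "H_functional \<Xi> T \<mu>1 \<mu>2 P \<le> ereal ((norm P)\<^sup>2 / 2 + (\<integral>q. U1 q \<partial>\<mu>1) - (\<integral>q. U2 q \<partial>\<mu>2) + (3 * T + 5) * e' / T)"
    unfolding H_functional_def by (intro SUP_least curve_action_upper T \<Xi> U1 U2 dual e')
  then show "H_functional \<Xi> T \<mu>1 \<mu>2 P \<le> ereal ((norm P)\<^sup>2 / 2 + (\<integral>q. U1 q \<partial>\<mu>1) - (\<integral>q. U2 q \<partial>\<mu>2)) + ereal e"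
    unfolding e'(2) by simp
qed

text \<open>The same potentials are used twice. Integrated against any competing coupling they show
  that \<sigma> is a minimiser, so the \<open>LEAST\<close> is attained; inserted into the upper
  bound for H they close the gap to the lower bound given by \<sigma>.\<close>

lemma H_functional_eq_D_cost:
  fixes \<Xi> :: "'n::finite torus \<Rightarrow> real"
  assumes \<mu>1: "\<mu>1 \<in> torus_probs" and \<mu>2: "\<mu>2 \<in> torus_probs" and \<Xi>: "continuous_on UNIV \<Xi>" and T: "T > 0"
  shows "H_functional \<Xi> T \<mu>1 \<mu>2 P = ereal ((norm P)\<^sup>2 / 2) - D_cost T P \<mu>1 \<mu>2 \<Xi>"
proof -
  let ?c = "\<lambda>(y, z). A_real \<Xi> P T y z"
  obtain h :: "real \<Rightarrow> 'n torus \<times> 'n torus" where h: "continuous_on UNIV h" "h ` {0..1} = UNIV"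
    by (rule torus_square_curve)
  have p: "prob_space \<mu>1" "sets \<mu>1 = sets borel" "prob_space \<mu>2" "sets \<mu>2 = sets borel"
    using \<mu>1 \<mu>2 by (auto simp: torus_probs_def)
  obtain \<sigma> where \<sigma>: "prob_space \<sigma>" "sets \<sigma> = sets borel" "distr \<sigma> borel fst = \<mu>1" "distr \<sigma> borel snd = \<mu>2"
    and opt: "\<And>e. e > 0 \<Longrightarrow> \<exists>U1 U2. continuous_on UNIV U1 \<and> continuous_on UNIV U2 \<and> (\<forall>x y. U2 y - U1 x \<le> ?c (x, y)) \<and>
       (\<integral>p. ?c p \<partial>\<sigma>) - e \<le> (\<integral>y. U2 y \<partial>\<mu>2) - (\<integral>x. U1 x \<partial>\<mu>1)"
    by (rule kantorovich_duality[OF compact_torus h A_real_continuous[OF T \<Xi>, of P] p], rule that)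
  have \<sigma>c: "\<sigma> \<in> couplings \<mu>1 \<mu>2" using \<sigma> by (simp add: couplings_def)
  have cU: "compact (UNIV :: ('n torus \<times> 'n torus) set)"
    using compact_Times[OF compact_torus compact_torus] by simp
  have int: "integrable \<sigma>' ?c" if "\<sigma>' \<in> couplings \<mu>1 \<mu>2" for \<sigma>'
    using that by (intro compact_continuous_integrable cU A_real_continuous T \<Xi>) (auto simp: couplings_def)
  have ext: "ext_integral \<sigma>' (\<lambda>(x, y). A_cost \<Xi> P x y T) = ereal (\<integral>p. ?c p \<partial>\<sigma>')" if "\<sigma>' \<in> couplings \<mu>1 \<mu>2" for \<sigma>'
  proof -
    have "(\<lambda>(x, y). A_cost \<Xi> P x y T) = (\<lambda>p. ereal (?c p))" by (auto simp: A_cost_eq_A_real[OF T \<Xi>])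
    then show ?thesis using ext_integral_real[OF int[OF that]] by simp
  qed
  have min: "(\<integral>p. ?c p \<partial>\<sigma>) \<le> (\<integral>p. ?c p \<partial>\<sigma>')" if s: "\<sigma>' \<in> couplings \<mu>1 \<mu>2" for \<sigma>'
  proof (rule field_le_epsilon)
    fix e :: real assume "e > 0"
    then obtain U1 U2 where U: "continuous_on UNIV U1" "continuous_on UNIV U2" "\<And>x y. U2 y - U1 x \<le> ?c (x, y)"
      "(\<integral>p. ?c p \<partial>\<sigma>) - e \<le> (\<integral>y. U2 y \<partial>\<mu>2) - (\<integral>x. U1 x \<partial>\<mu>1)" using opt by blast
    have s': "sets \<sigma>' = sets borel" "prob_space \<sigma>'" "\<mu>1 = distr \<sigma>' borel fst" "\<mu>2 = distr \<sigma>' borel snd"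
      using s by (auto simp: couplings_def)
    have m: "fst \<in> measurable \<sigma>' borel" "snd \<in> measurable \<sigma>' borel"
      unfolding measurable_cong_sets[OF s'(1) refl]
      by (intro borel_measurable_continuous_onI continuous_intros)+
    have "(\<integral>x. U1 x \<partial>\<mu>1) = (\<integral>p. U1 (fst p) \<partial>\<sigma>')" "(\<integral>y. U2 y \<partial>\<mu>2) = (\<integral>p. U2 (snd p) \<partial>\<sigma>')"
      unfolding s'(3,4) using m U(1,2) by (auto intro!: integral_distr borel_measurable_continuous_onI)
    moreover have i: "integrable \<sigma>' (\<lambda>p. U1 (fst p))" "integrable \<sigma>' (\<lambda>p. U2 (snd p))"
      by (intro compact_continuous_integrable cU s' continuous_on_compose2[OF U(1)] continuous_on_compose2[OF U(2)] continuous_intros; simp)+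
    moreover have "(\<integral>p. U2 (snd p) - U1 (fst p) \<partial>\<sigma>') \<le> (\<integral>p. ?c p \<partial>\<sigma>')"
      by (intro integral_mono Bochner_Integration.integrable_diff i int s) (use U(3) in \<open>auto split: prod.split\<close>)
    ultimately show "(\<integral>p. ?c p \<partial>\<sigma>) \<le> (\<integral>p. ?c p \<partial>\<sigma>') + e" using U(4) by simp
  qed
  have D: "D_cost T P \<mu>1 \<mu>2 \<Xi> = ereal (\<integral>p. ?c p \<partial>\<sigma>)"
    unfolding D_cost_def
  proof (rule Least_equality)
    show "\<exists>\<sigma>'\<in>couplings \<mu>1 \<mu>2. ereal (\<integral>p. ?c p \<partial>\<sigma>) = ext_integral \<sigma>' (\<lambda>(x, y). A_cost \<Xi> P x y T)"
      by (rule bexI[OF _ \<sigma>c]) (rule ext[OF \<sigma>c, symmetric])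
    fix y assume "\<exists>\<sigma>'\<in>couplings \<mu>1 \<mu>2. y = ext_integral \<sigma>' (\<lambda>(x, y). A_cost \<Xi> P x y T)"
    then obtain \<sigma>' where "\<sigma>' \<in> couplings \<mu>1 \<mu>2" "y = ereal (\<integral>p. ?c p \<partial>\<sigma>')" using ext by metis
    then show "ereal (\<integral>p. ?c p \<partial>\<sigma>) \<le> y" using min by simp
  qed
  have "H_functional \<Xi> T \<mu>1 \<mu>2 P \<le> ereal ((norm P)\<^sup>2 / 2 - (\<integral>p. ?c p \<partial>\<sigma>))"
  proof (rule ereal_le_epsilon2)
    fix e :: real assume "e > 0"
    then obtain U1 U2 where U: "continuous_on UNIV U1" "continuous_on UNIV U2" "\<And>x y. U2 y - U1 x \<le> ?c (x, y)"
      "(\<integral>p. ?c p \<partial>\<sigma>) - e \<le> (\<integral>y. U2 y \<partial>\<mu>2) - (\<integral>x. U1 x \<partial>\<mu>1)" using opt by blast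
    have "H_functional \<Xi> T \<mu>1 \<mu>2 P \<le> ereal ((norm P)\<^sup>2 / 2 + (\<integral>q. U1 q \<partial>\<mu>1) - (\<integral>q. U2 q \<partial>\<mu>2))"
      using U(3) by (intro H_functional_le T \<Xi> U(1,2)) simp
    also have "\<dots> \<le> ereal ((norm P)\<^sup>2 / 2 - (\<integral>p. ?c p \<partial>\<sigma>)) + ereal e" using U(4) by simp
    finally show "H_functional \<Xi> T \<mu>1 \<mu>2 P \<le> ereal ((norm P)\<^sup>2 / 2 - (\<integral>p. ?c p \<partial>\<sigma>)) + ereal e" .
  qed
  moreover have "ereal ((norm P)\<^sup>2 / 2 - (\<integral>p. ?c p \<partial>\<sigma>)) \<le> H_functional \<Xi> T \<mu>1 \<mu>2 P"
    using H_functional_ge[OF \<sigma>c \<Xi> T, of P] by (simp add: case_prod_beta)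
  ultimately show ?thesis unfolding D by (simp add: antisym)
qed

theorem proposition4p5:
  fixes \<mu>1 \<mu>2 :: "'n::finite torus measure"
    and \<Xi> :: "'n torus \<Rightarrow> real"
    and P :: "real ^ 'n"
    and T :: real
  assumes "\<mu>1 \<in> torus_probs" and "\<mu>2 \<in> torus_probs"
    and "continuous_on UNIV \<Xi>"
    and "T > 0"
  shows "H_functional \<Xi> T \<mu>1 \<mu>2 P = ereal ((norm P)\<^sup>2 / 2) - D_cost T P \<mu>1 \<mu>2 \<Xi> \<and>
         (\<forall>\<mu> \<in> torus_probs.
            H_functional \<Xi> T \<mu> \<mu> P = ereal ((norm P)\<^sup>2 / 2) - D_cost T P \<mu> \<mu> \<Xi>)"
  using assms by (intro conjI ballI H_functional_eq_D_cost)

end
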